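(* Consider the two-queue polling system ($\mu$-system) with a two-phase switching policy $\pi=(\alpha_i^m,\beta_i^m)_{i\in\{1,2\},\,m\in\{B,C\}}\in\mathcal T$ described in the context. Assume that, for each $i\in\{1,2\}$, the expectations $E[\mathcal H_{ik}^\mu]$ of the residual values $\mathcal H^\mu_{ik}$ are bounded uniformly in $k$. If $$\rho_1+\rho_2<1\quad\text{and}\quad \alpha_1^C\alpha_2^C<1,$$ then the discrete-time Markov chain $\{\mathbf X_k^\mu\}_{k\in\mathbb N}$ of normalized queue lengths at the server-visit epochs to $Q_1$ is stable, i.e. positive recurrent.
   Context: Polling system. There are two queues $Q_1,Q_2$ with infinite buffers and a single server alternating between them. Throughout $i\in\{1,2\}$ and $j:=3-i$. Customers arrive to $Q_i$ according to a Poisson process $\Lambda_i^\mu(\cdot)$ of rate $\lambda_i$ (independent for the two queues). Service times are i.i.d. with mean $1/\mu$ at both queues; $\rho_i:=\lambda_i/\mu$, $\rho:=\rho_1+\rho_2$. The service discipline is non-resume preemptive: if the server leaves a queue in the middle of a service, that service is restarted afresh at the next visit. Customers leave only after service completion. For the $k$-th visit of the server to $Q_i$, $\Gamma_{ik}^\mu(t)=\sup\{n:\sum_{v=1}^n J_{ik,v}\le t\}$ is the (uninterrupted service) renewal counting process of departures, with i.i.d. service times $J_{ik,n}$, $E[J_{ik,n}]=1/\mu$. The switching time from $Q_i$ to $Q_j$ in cycle $k$ is $S_{ik}^\mu$ (non-zero); for each $i$ these are i.i.d. in $k$ with mean $s_i^\mu$ and independent of previous events. $N_i^\mu(t)$ is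 the number of customers in $Q_i$ at time $t$. Policies. $\mathcal T$ is the set of $\pi=(\alpha_i^m,\beta_i^m)_{i\in\{1,2\},m\in\{B,C\}}$ with all $\alpha_i^m,\beta_i^m\le 0$ real. While visiting $Q_i$ the policy uses $$\Pi_{iB}(N_i,N_j)=\alpha_i^BN_i+N_j+\mu\beta_i^B,\qquad \Pi_{iC}(N_i,N_j)=N_i+\alpha_i^CN_j+\mu\beta_i^C.$$ If the server arrives at $Q_i$ at time $\Phi$, the beginning phase has length $B_i=\inf\{t\ge\Phi:\Pi_{iB}(N_i^\mu(t),N_j^\mu(t))\ge0\}-\Phi$, and the concluding phase, which starts immediately after, has length $C_i=\inf\{t\ge\Phi+B_i:\Pi_{iC}(N_i^\mu(t),N_j^\mu(t))\le0\}-(\Phi+B_i)$. The server serves $Q_i$ during both phases and then starts switching to $Q_j$. In cycle $k$ these lengths are $B_{ik}^\mu,C_{ik}^\mu$ and the visit time is $M_{ik}^\mu=B_{ik}^\mu+C_{ik}^\mu$. Cycles. A cycle is the time between successive server arrivals at $Q_1$; the $k$-th cycle has duration $\Psi_k^\mu=M_{1k}^\mu+S_{1k}^\mu+M_{2k}^\mu+S_{2k}^\mu$ and starts at $\Phi_k^\mu=\sum_{n<k}\Psi_n^\mu$. The server's departure epochs from $Q_1,Q_2$ in cycle $k$ are $D_{1k}^\mu=\Phi_k^\mu+M_{1k}^\mu$ and $D_{2k}^\mu=\Phi_k^\mu+M_{1k}^\mu+S_{1k}^\mu+M_{2k}^\mu$. During a visit to $Q_i$, $N_i^\mu$ increases by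 arrivals $\Lambda_i^\mu$ and decreases by departures $\Gamma_{ik}^\mu$ (time measured from the start of the visit); outside visits to $Q_i$, $N_i^\mu$ only increases by arrivals. Chain. $\Theta_i^\mu(t)=N_i^\mu(t)/\mu$, $\Theta_{ik}^\mu=\Theta_i^\mu(\Phi_k^\mu)$, and $\mathbf X_k^\mu=(\Theta_{1k}^\mu,\Theta_{2k}^\mu)$, a discrete-time Markov chain (the Palm Markov chain) on the countable state space $\{(z_1/\mu,z_2/\mu): z_1,z_2\in\{0,1,2,\dots\}\}$. Residual values: $\mathcal H_{ik}^\mu:=\Pi_{iC}(N_i^\mu(D_{ik}^\mu),N_j^\mu(D_{ik}^\mu))=N_i^\mu(D_{ik}^\mu)+\alpha_i^CN_j^\mu(D_{ik}^\mu)+\mu\beta_i^C$. *)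

theory Defs
  imports "HOL-Probability.Probability"
begin

datatype queue = Q1 | Q2

primrec other :: "queue \<Rightarrow> queue" where
  "other Q1 = Q2"
| "other Q2 = Q1"

datatype phase = Beginning | Concluding

record policy =
  alpha :: "queue \<Rightarrow> phase \<Rightarrow> real"
  beta :: "queue \<Rightarrow> phase \<Rightarrow> real"

definition two_phase_policies :: "policy set" where
  "two_phase_policies = {p. \<forall>i m. alpha p i m \<le> 0 \<and> beta p i m \<le> 0}"

type_synonym content = "queue \<Rightarrow> nat"

definition Pi_B :: "real \<Rightarrow> policy \<Rightarrow> queue \<Rightarrow> content \<Rightarrow> real" where
  "Pi_B \<mu> p i n =
     alpha p i Beginning * real (n i) + real (n (other i)) + \<mu> * beta p i Beginning"

definition Pi_C :: "real \<Rightarrow> policy \<Rightarrow> queue \<Rightarrow> content \<Rightarrow> real" where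
  "Pi_C \<mu> p i n =
     real (n i) + alpha p i Concluding * real (n (other i)) + \<mu> * beta p i Concluding"


subsection \<open>Sample-path dynamics\<close>

text \<open>
  In this part the randomness is frozen: \<open>A q t\<close> is the number of arrivals to queue \<open>q\<close>
  during the interval from 0 to \<open>t\<close>; \<open>J i k v\<close> is the service time of the customer number
  \<open>v + 1\<close> served in the \<open>k\<close>-th visit to queue \<open>i\<close>; \<open>S i k\<close> is the time of
  switching away from queue \<open>i\<close> in cycle \<open>k\<close>. Cycles are numbered from 0.

  Customer number \<open>v + 1\<close> of a visit (counting the \<open>n\<close> customers present at its start, time
  \<open>\<Phi>\<close>, first) is in the queue from the instant \<open>available a \<Phi> n v\<close> on, and
  \<open>completion a J \<Phi> n v\<close> is the epoch at which the first \<open>v\<close> services of the visit are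
  completed. The server idles when it is at an empty queue. As long as the queue does not
  become empty, \<open>completion a J \<Phi> n v\<close> is \<open>\<Phi> + (\<Sum>u<v. J u)\<close>, so that the number of
  departures up to time \<open>t\<close> is the renewal counting process evaluated at \<open>t - \<Phi>\<close>.
  Each visit has its own sequence of service times, so a service interrupted
  by the end of a visit is started afresh.
\<close>

definition available :: "(real \<Rightarrow> nat) \<Rightarrow> real \<Rightarrow> nat \<Rightarrow> nat \<Rightarrow> real" where
  "available a \<Phi> n v = Inf {t. \<Phi> \<le> t \<and> v < n + (a t - a \<Phi>)}"

primrec completion ::
  "(real \<Rightarrow> nat) \<Rightarrow> (nat \<Rightarrow> real) \<Rightarrow> real \<Rightarrow> nat \<Rightarrow> nat \<Rightarrow> real" where
  "completion a J \<Phi> n 0 = \<Phi>"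
| "completion a J \<Phi> n (Suc v) = max (completion a J \<Phi> n v) (available a \<Phi> n v) + J v"

definition departures ::
  "(real \<Rightarrow> nat) \<Rightarrow> (nat \<Rightarrow> real) \<Rightarrow> real \<Rightarrow> nat \<Rightarrow> real \<Rightarrow> nat" where
  "departures a J \<Phi> n t = Sup {v. completion a J \<Phi> n v \<le> t}"

text \<open>
  Queue contents at time \<open>t\<close> of a visit to queue \<open>i\<close> that starts at time \<open>\<Phi>\<close> with
  contents \<open>n\<close>. The subtraction never truncates, since only customers that have
  arrived can depart.
\<close>

definition visit_content ::
  "(queue \<Rightarrow> real \<Rightarrow> nat) \<Rightarrow> (nat \<Rightarrow> real) \<Rightarrow> queue \<Rightarrow> real \<Rightarrow> content \<Rightarrow> real \<Rightarrow> content" where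
  "visit_content A J i \<Phi> n t =
     (\<lambda>q. n q + (A q t - A q \<Phi>) - (if q = i then departures (A i) J \<Phi> (n i) t else 0))"

definition beginning_length ::
  "real \<Rightarrow> policy \<Rightarrow> (queue \<Rightarrow> real \<Rightarrow> nat) \<Rightarrow> (nat \<Rightarrow> real) \<Rightarrow> queue \<Rightarrow> real \<Rightarrow> content \<Rightarrow> real" where
  "beginning_length \<mu> p A J i \<Phi> n =
     Inf {t. \<Phi> \<le> t \<and> Pi_B \<mu> p i (visit_content A J i \<Phi> n t) \<ge> 0} - \<Phi>"

definition concluding_length ::
  "real \<Rightarrow> policy \<Rightarrow> (queue \<Rightarrow> real \<Rightarrow> nat) \<Rightarrow> (nat \<Rightarrow> real) \<Rightarrow> queue \<Rightarrow> real \<Rightarrow> content \<Rightarrow> real" where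
  "concluding_length \<mu> p A J i \<Phi> n =
     (let b = \<Phi> + beginning_length \<mu> p A J i \<Phi> n
      in Inf {t. b \<le> t \<and> Pi_C \<mu> p i (visit_content A J i \<Phi> n t) \<le> 0} - b)"

definition visit_length ::
  "real \<Rightarrow> policy \<Rightarrow> (queue \<Rightarrow> real \<Rightarrow> nat) \<Rightarrow> (nat \<Rightarrow> real) \<Rightarrow> queue \<Rightarrow> real \<Rightarrow> content \<Rightarrow> real" where
  "visit_length \<mu> p A J i \<Phi> n =
     beginning_length \<mu> p A J i \<Phi> n + concluding_length \<mu> p A J i \<Phi> n"

text \<open>
  The next two functions act on pairs of an epoch and the queue contents at that epoch:
  \<open>visit\<close> leads from the arrival of the server at queue \<open>i\<close> to its departure
  from there, and \<open>travel\<close> through the following switching time of length \<open>s\<close>.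
\<close>

definition visit ::
  "real \<Rightarrow> policy \<Rightarrow> (queue \<Rightarrow> real \<Rightarrow> nat) \<Rightarrow> (nat \<Rightarrow> real) \<Rightarrow> queue
     \<Rightarrow> real \<times> content \<Rightarrow> real \<times> content" where
  "visit \<mu> p A J i = (\<lambda>(\<Phi>, n).
     let D = \<Phi> + visit_length \<mu> p A J i \<Phi> n in (D, visit_content A J i \<Phi> n D))"

definition travel ::
  "(queue \<Rightarrow> real \<Rightarrow> nat) \<Rightarrow> real \<Rightarrow> real \<times> content \<Rightarrow> real \<times> content" where
  "travel A s = (\<lambda>(D, n). (D + s, \<lambda>q. n q + (A q (D + s) - A q D)))"

text \<open>
  Epoch and queue contents at the start of cycle \<open>k\<close>, when the server arrives at the first
  queue, and at the server's departure from queue \<open>i\<close> in cycle \<open>k\<close>. The system starts at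
  time 0 with the server arriving at the first queue and finding contents \<open>z\<close>.
\<close>

primrec cycle_start ::
  "real \<Rightarrow> policy \<Rightarrow> (queue \<Rightarrow> real \<Rightarrow> nat) \<Rightarrow> (queue \<Rightarrow> nat \<Rightarrow> nat \<Rightarrow> real)
     \<Rightarrow> (queue \<Rightarrow> nat \<Rightarrow> real) \<Rightarrow> content \<Rightarrow> nat \<Rightarrow> real \<times> content" where
  "cycle_start \<mu> p A J S z 0 = (0, z)"
| "cycle_start \<mu> p A J S z (Suc k) =
     travel A (S Q2 k) (visit \<mu> p A (J Q2 k) Q2
       (travel A (S Q1 k) (visit \<mu> p A (J Q1 k) Q1 (cycle_start \<mu> p A J S z k))))"

primrec departure_state ::
  "real \<Rightarrow> policy \<Rightarrow> (queue \<Rightarrow> real \<Rightarrow> nat) \<Rightarrow> (queue \<Rightarrow> nat \<Rightarrow> nat \<Rightarrow> real)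
     \<Rightarrow> (queue \<Rightarrow> nat \<Rightarrow> real) \<Rightarrow> content \<Rightarrow> nat \<Rightarrow> queue \<Rightarrow> real \<times> content" where
  "departure_state \<mu> p A J S z k Q1 = visit \<mu> p A (J Q1 k) Q1 (cycle_start \<mu> p A J S z k)"
| "departure_state \<mu> p A J S z k Q2 =
     visit \<mu> p A (J Q2 k) Q2 (travel A (S Q1 k)
       (visit \<mu> p A (J Q1 k) Q1 (cycle_start \<mu> p A J S z k)))"


subsection \<open>Stochastic primitives\<close>

definition poisson_process :: "'w measure \<Rightarrow> real \<Rightarrow> (real \<Rightarrow> 'w \<Rightarrow> nat) \<Rightarrow> bool" where
  "poisson_process M r N \<longleftrightarrow>
     (\<forall>t\<ge>0. N t \<in> measurable M (count_space UNIV)) \<and>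
     (AE \<omega> in M. N 0 \<omega> = 0 \<and> mono_on {0..} (\<lambda>t. N t \<omega>) \<and>
        (\<forall>t\<ge>0. continuous (at_right t) (\<lambda>u. N u \<omega>))) \<and>
     (\<forall>s t. 0 \<le> s \<and> s < t \<longrightarrow>
        distr M (count_space UNIV) (\<lambda>\<omega>. N t \<omega> - N s \<omega>)
          = measure_pmf (poisson_pmf (r * (t - s)))) \<and>
     (\<forall>(\<tau> :: nat \<Rightarrow> real) m. 0 \<le> \<tau> 0 \<and> mono \<tau> \<longrightarrow>
        prob_space.indep_vars M (\<lambda>_. count_space UNIV)
          (\<lambda>l \<omega>. N (\<tau> (Suc l)) \<omega> - N (\<tau> l) \<omega>) {..<m})"

datatype primitive = Arrivals queue | Service queue nat nat | Switching queue nat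

text \<open>The events determined by one of the primitives of the model.\<close>

primrec primitive_events ::
  "'w measure \<Rightarrow> (queue \<Rightarrow> real \<Rightarrow> 'w \<Rightarrow> nat) \<Rightarrow> (queue \<Rightarrow> nat \<Rightarrow> nat \<Rightarrow> 'w \<Rightarrow> real)
     \<Rightarrow> (queue \<Rightarrow> nat \<Rightarrow> 'w \<Rightarrow> real) \<Rightarrow> primitive \<Rightarrow> 'w set set" where
  "primitive_events M \<Lambda> J S (Arrivals i) =
     sigma_sets (space M) {\<Lambda> i t -` B \<inter> space M | t B. t \<ge> 0}"
| "primitive_events M \<Lambda> J S (Service i k v) =
     {J i k v -` B \<inter> space M | B. B \<in> sets borel}"
| "primitive_events M \<Lambda> J S (Switching i k) =
     {S i k -` B \<inter> space M | B. B \<in> sets borel}"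

locale polling_system = prob_space M
  for M :: "'w measure" +
  fixes lam :: "queue \<Rightarrow> real"
    and \<mu> :: real
    and s :: "queue \<Rightarrow> real"
    and \<Lambda> :: "queue \<Rightarrow> real \<Rightarrow> 'w \<Rightarrow> nat"
    and J :: "queue \<Rightarrow> nat \<Rightarrow> nat \<Rightarrow> 'w \<Rightarrow> real"
    and S :: "queue \<Rightarrow> nat \<Rightarrow> 'w \<Rightarrow> real"
  assumes lam_pos: "lam i > 0"
    and mu_pos: "\<mu> > 0"
    and arrivals: "poisson_process M (lam i) (\<Lambda> i)"
    and service_integrable: "integrable M (J i k v)"
    and service_pos: "AE \<omega> in M. J i k v \<omega> > 0"
    and service_ident: "distr M borel (J i k v) = distr M borel (J i 0 0)"
    and service_mean: "expectation (J i k v) = 1 / \<mu>"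
    and switching_integrable: "integrable M (S i k)"
    and switching_pos: "AE \<omega> in M. S i k \<omega> > 0"
    and switching_ident: "distr M borel (S i k) = distr M borel (S i 0)"
    and switching_mean: "expectation (S i k) = s i"
    and primitives_indep: "indep_sets (primitive_events M \<Lambda> J S) UNIV"


subsection \<open>The Palm chain and its residual values\<close>

definition normalized :: "real \<Rightarrow> content \<Rightarrow> real \<times> real" where
  "normalized \<mu> n = (real (n Q1) / \<mu>, real (n Q2) / \<mu>)"

definition state_space :: "real \<Rightarrow> (real \<times> real) set" where
  "state_space \<mu> = {(real z1 / \<mu>, real z2 / \<mu>) | z1 z2 :: nat. True}"

text \<open>
  \<open>palm_chain \<mu> p \<Lambda> J S x\<close> is the chain started in the state \<open>x\<close>. For \<open>\<mu> > 0\<close> the map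
  \<open>normalized \<mu>\<close> is a bijection from contents to states, so \<open>inv\<close> recovers the contents.
\<close>

definition palm_chain ::
  "real \<Rightarrow> policy \<Rightarrow> (queue \<Rightarrow> real \<Rightarrow> 'w \<Rightarrow> nat) \<Rightarrow> (queue \<Rightarrow> nat \<Rightarrow> nat \<Rightarrow> 'w \<Rightarrow> real)
     \<Rightarrow> (queue \<Rightarrow> nat \<Rightarrow> 'w \<Rightarrow> real) \<Rightarrow> real \<times> real \<Rightarrow> nat \<Rightarrow> 'w \<Rightarrow> real \<times> real" where
  "palm_chain \<mu> p \<Lambda> J S x k \<omega> = normalized \<mu> (snd (cycle_start \<mu> p
     (\<lambda>i t. \<Lambda> i t \<omega>) (\<lambda>i k v. J i k v \<omega>) (\<lambda>i k. S i k \<omega>) (inv (normalized \<mu>) x) k))"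

definition residual ::
  "real \<Rightarrow> policy \<Rightarrow> (queue \<Rightarrow> real \<Rightarrow> 'w \<Rightarrow> nat) \<Rightarrow> (queue \<Rightarrow> nat \<Rightarrow> nat \<Rightarrow> 'w \<Rightarrow> real)
     \<Rightarrow> (queue \<Rightarrow> nat \<Rightarrow> 'w \<Rightarrow> real) \<Rightarrow> real \<times> real \<Rightarrow> queue \<Rightarrow> nat \<Rightarrow> 'w \<Rightarrow> real" where
  "residual \<mu> p \<Lambda> J S x i k \<omega> = Pi_C \<mu> p i (snd (departure_state \<mu> p
     (\<lambda>i t. \<Lambda> i t \<omega>) (\<lambda>i k v. J i k v \<omega>) (\<lambda>i k. S i k \<omega>) (inv (normalized \<mu>) x) k i))"


subsection \<open>Positive recurrence\<close>

text \<open>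
  A Markov chain on a countable state space \<open>E\<close> is given as a family of processes,
  \<open>X x\<close> being the chain started in \<open>x\<close>. It is positive recurrent
  if it has a closed communicating class all of whose states have finite mean return time
  and which is entered almost surely from every state of \<open>E\<close> (positive Harris
  recurrence on a countable space); if the chain is irreducible on \<open>E\<close>, the
  class is \<open>E\<close> itself. The whole of \<open>E\<close> cannot be asked for in general: if, say,
  \<open>alpha\<close> vanishes and the thresholds \<open>beta p i Concluding\<close> are negative, states
  with few customers may be transient.

  The negated AE-condition says that \<open>X x k = y\<close> has positive probability. It is used since
  the processes defined above need not be measurable on the null set of irregular sample
  paths.
\<close>

definition return_time :: "('s \<Rightarrow> nat \<Rightarrow> 'w \<Rightarrow> 's) \<Rightarrow> 's \<Rightarrow> 'w \<Rightarrow> ennreal" where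
  "return_time X x \<omega> = (INF k\<in>{k. k \<ge> 1 \<and> X x k \<omega> = x}. of_nat k)"

definition positive_recurrent ::
  "'w measure \<Rightarrow> 's set \<Rightarrow> ('s \<Rightarrow> nat \<Rightarrow> 'w \<Rightarrow> 's) \<Rightarrow> bool" where
  "positive_recurrent M E X \<longleftrightarrow> (\<exists>R\<subseteq>E. R \<noteq> {} \<and>
     (\<forall>x\<in>R. \<forall>k. AE \<omega> in M. X x k \<omega> \<in> R) \<and>
     (\<forall>x\<in>R. \<forall>y\<in>R. \<exists>k. \<not> (AE \<omega> in M. X x k \<omega> \<noteq> y)) \<and>
     (\<forall>x\<in>R. (\<integral>\<^sup>+ \<omega>. return_time X x \<omega> \<partial>M) < \<infinity>) \<and>
     (\<forall>x\<in>E. AE \<omega> in M. \<exists>k. X x k \<omega> \<in> R))"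

end

theory Submission
  imports Defs
begin

text \<open>
  Each cycle consists of four steps (visit, switching, visit, switching), and by the strong Markov
  property of the arrivals every step depends on the past only through the current contents.
  Put \<open>r\<^sub>i = \<lambda>\<^sub>i / (\<mu> - \<lambda>\<^sub>j)\<close>. Optional stopping and Wald's identity show that a visit to
  \<open>Q\<^sub>i\<close> raises the mean of \<open>N\<^sub>j + r\<^sub>j N\<^sub>i\<close> at most by a constant, because the server can only idle while
  \<open>N\<^sub>j\<close> is below a threshold. At the end of the visit the bound on the mean residual turns this into an
  affine recursion for \<open>E[N\<^sub>j]\<close>, and over a cycle the recursion contracts by the factor
  \<open>(r\<^sub>1 - \<alpha>\<^sub>1) (r\<^sub>2 - \<alpha>\<^sub>2) / ((1 - \<alpha>\<^sub>1 r\<^sub>2) (1 - \<alpha>\<^sub>2 r\<^sub>1))\<close>, where \<open>\<alpha>\<^sub>i\<close> is the coefficient of the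
  concluding phase. It is less than 1 since \<open>(1 - \<alpha>\<^sub>1 \<alpha>\<^sub>2) (1 - r\<^sub>1 r\<^sub>2) > 0\<close>. Hence the mean contents stay
  bounded, the chain is tight, and a last-exit decomposition yields positive recurrence. There is
  a single recurrent class because any numbers of arrivals during the last switching time of a
  cycle have positive probability.
\<close>

subsection \<open>Tight Markov families\<close>

text \<open>The residual hypothesis bounds unconditional means along the chain and says nothing
  about single states. So there is no one-step drift inequality from a given state, and Foster's
  criterion does not apply. Only the means of the contents at the epochs of the cycles can be
  controlled, for each starting state separately; this is why the recurrence argument starts from
  tightness and works with expected occupation counts. Neither irreducibility nor aperiodicity is at
  hand, so occupation densities are taken along infinitely many horizons instead of as limits. The
  other obstacle is that one pair of arrival processes runs through all steps, whose ends are
  random: the Markov property has to be extracted from independent increments at these epochs,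
  jointly with the freshness of the service and switching times of the next step. Arguments on
  sample paths need well-behaved paths, which the model provides only almost surely. Everything is
  therefore first proved for a version in which every path is regular, and transferred at the
  end.\<close>

locale markov_family = prob_space M for M :: "'w measure" +
  fixes X :: "'s::countable \<Rightarrow> nat \<Rightarrow> 'w \<Rightarrow> 's"
  assumes X_measurable [measurable]: "X x k \<in> measurable M (count_space UNIV)"
    and X_0: "\<omega> \<in> space M \<Longrightarrow> X x 0 \<omega> = x"
    and markov: "prob {\<omega>\<in>space M. X x k \<omega> = z \<and> (\<forall>j\<in>{1..m}. X x (k + j) \<omega> \<in> D j)}
      = prob {\<omega>\<in>space M. X x k \<omega> = z} * prob {\<omega>\<in>space M. \<forall>j\<in>{1..m}. X z j \<omega> \<in> D j}"
begin

definition trans_prob :: "nat \<Rightarrow> 's \<Rightarrow> 's \<Rightarrow> real" where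
  "trans_prob k x y = prob {\<omega>\<in>space M. X x k \<omega> = y}"

text \<open>The tail of the return time to \<open>y\<close>. Its sum over \<open>m\<close> is the
  mean return time, which is how finiteness of that mean is reached.\<close>

definition avoid_prob :: "nat \<Rightarrow> 's \<Rightarrow> real" where
  "avoid_prob m y = prob {\<omega>\<in>space M. \<forall>j\<in>{1..m}. X y j \<omega> \<noteq> y}"

definition accessible :: "'s \<Rightarrow> 's \<Rightarrow> bool" where
  "accessible x y \<longleftrightarrow> (\<exists>k. trans_prob k x y > 0)"

text \<open>Positive upper density of the expected occupation. Asking for infinitely many horizons
  makes the notion survive a pigeonhole over finitely many states without any convergence.\<close>

definition frequent :: "'s \<Rightarrow> 's \<Rightarrow> bool" where
  "frequent x y \<longleftrightarrow> (\<exists>c>0. \<exists>\<^sub>\<infinity>N. c * real (Suc N) \<le> (\<Sum>k\<le>N. trans_prob k x y))"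

lemma trans_prob_nonneg: "trans_prob k x y \<ge> 0"
  by (simp add: trans_prob_def)

lemma avoid_prob_nonneg: "avoid_prob m y \<ge> 0"
  by (simp add: avoid_prob_def)

lemma trans_prob_0: "trans_prob 0 x y = (if x = y then 1 else 0)"
proof -
  have "{\<omega>\<in>space M. X x 0 \<omega> = y} = (if x = y then space M else {})"
    using X_0 by auto
  then show ?thesis
    by (auto simp: trans_prob_def prob_space)
qed

lemma accessible_refl: "accessible x x"
  unfolding accessible_def using trans_prob_0[of x x] by (metis less_numeral_extra(1))

text \<open>One summand of the Chapman-Kolmogorov sum, enough for accessibility. The case
  \<open>m = 0\<close> is separate because \<open>markov\<close> constrains only times after
  \<open>k\<close>.\<close>

lemma chapman_kolmogorov_le: "trans_prob k x y * trans_prob m y z \<le> trans_prob (k + m) x z"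
proof (cases "m = 0")
  case True
  then show ?thesis by (auto simp: trans_prob_0 trans_prob_nonneg)
next
  case False
  define D where "D = (\<lambda>j. if j = m then {z} else (UNIV :: 's set))"
  have *: "(\<forall>j\<in>{1..m}. f j \<in> D j) \<longleftrightarrow> f m = z" for f
    using False by (auto simp: D_def)
  have "trans_prob k x y * trans_prob m y z =
      prob {\<omega>\<in>space M. X x k \<omega> = y \<and> (\<forall>j\<in>{1..m}. X x (k + j) \<omega> \<in> D j)}"
    unfolding markov unfolding * trans_prob_def ..
  also have "\<dots> \<le> trans_prob (k + m) x z"
    unfolding * trans_prob_def by (intro finite_measure_mono) auto
  finally show ?thesis .
qed

lemma accessible_trans: "accessible x y \<Longrightarrow> accessible y z \<Longrightarrow> accessible x z"
  unfolding accessible_def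
  by (metis chapman_kolmogorov_le less_le_trans mult_pos_pos)

section \<open>Last-exit decomposition\<close>

definition last_visit :: "'s \<Rightarrow> 's \<Rightarrow> nat \<Rightarrow> nat \<Rightarrow> 'w set" where
  "last_visit x y n k = {\<omega>\<in>space M. X x k \<omega> = y \<and> (\<forall>j\<in>{1..n - k}. X x (k + j) \<omega> \<in> - {y})}"

lemma last_visit_measurable [measurable]: "last_visit x y n k \<in> sets M"
  unfolding last_visit_def by measurable

lemma prob_last_visit: "prob (last_visit x y n k) = trans_prob k x y * avoid_prob (n - k) y"
  unfolding last_visit_def markov trans_prob_def avoid_prob_def by simp

lemma disjoint_last_visit: "disjoint_family_on (last_visit x y n) {..n}"
proof -
  have *: False if "k < l" "l \<le> n" "\<omega> \<in> last_visit x y n k" "\<omega> \<in> last_visit x y n l" for k l \<omega>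
  proof -
    have "l - k \<in> {1..n - k}" "k + (l - k) = l"
      using that by auto
    then have "X x l \<omega> \<in> - {y}"
      using that(3) unfolding last_visit_def by (metis (mono_tags, lifting) mem_Collect_eq)
    then show False using that(4) by (auto simp: last_visit_def)
  qed
  show ?thesis
    unfolding disjoint_family_on_def
    by (metis "*" atMost_iff disjoint_iff linorder_neqE_nat)
qed

text \<open>The last visit to \<open>y\<close> up to time \<open>n\<close>, if there is one, happens
  at exactly one time. Splitting at the last instead of the first visit makes the second factor
  start in \<open>y\<close>, whatever \<open>x\<close> is.\<close>

lemma last_exit_le: "(\<Sum>k\<le>n. trans_prob k x y * avoid_prob (n - k) y) \<le> 1"
proof -
  have "(\<Sum>k\<le>n. trans_prob k x y * avoid_prob (n - k) y) = (\<Sum>k\<le>n. prob (last_visit x y n k))"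
    by (simp add: prob_last_visit)
  also have "\<dots> = prob (\<Union>k\<le>n. last_visit x y n k)"
    by (intro finite_measure_finite_Union[symmetric] disjoint_last_visit) auto
  finally show ?thesis by simp
qed

text \<open>The rectangle of pairs \<open>(k, j)\<close> lies in the triangle
  \<open>k + j \<le> N + J\<close>, whose diagonals are the sums of
  \<open>last_exit_le\<close>.\<close>

lemma occupation_avoid_le:
  "(\<Sum>k\<le>N. trans_prob k x y) * (\<Sum>j\<le>J. avoid_prob j y) \<le> real (N + J + 1)"
proof -
  have "(\<Sum>k\<le>N. trans_prob k x y) * (\<Sum>j\<le>J. avoid_prob j y)
      = (\<Sum>(k, j)\<in>{..N} \<times> {..J}. trans_prob k x y * avoid_prob j y)"
    by (simp add: sum_product sum.cartesian_product)
  also have "\<dots> \<le> (\<Sum>(k, j)\<in>{(k, j). k + j \<le> N + J}. trans_prob k x y * avoid_prob j y)"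
  proof (rule sum_mono2)
    have "{(k, j). k + j \<le> N + J} \<subseteq> {..N + J} \<times> {..N + J}" by auto
    then show "finite {(k, j). k + j \<le> N + J}" by (rule finite_subset) simp
  qed (auto simp: trans_prob_nonneg avoid_prob_nonneg)
  also have "\<dots> = (\<Sum>n\<le>N + J. \<Sum>k\<le>n. trans_prob k x y * avoid_prob (n - k) y)"
    by (rule sum.triangle_reindex_eq)
  also have "\<dots> \<le> (\<Sum>n\<le>N + J. 1)"
    by (intro sum_mono last_exit_le)
  finally show ?thesis by simp
qed

text \<open>With \<open>J\<close> fixed, dividing \<open>occupation_avoid_le\<close> by the horizon
  and letting it grow along the infinitely many good values bounds every partial sum by
  \<open>1 / c\<close>.\<close>

lemma frequent_summable:
  assumes "frequent x y"
  shows "summable (\<lambda>j. avoid_prob j y)"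
proof -
  obtain c where c: "c > 0" and inf: "\<exists>\<^sub>\<infinity>N. c * real (Suc N) \<le> (\<Sum>k\<le>N. trans_prob k x y)"
    using assms by (auto simp: frequent_def)
  have bound: "(\<Sum>j\<le>J. avoid_prob j y) \<le> 1 / c" for J :: nat
  proof (rule ccontr)
    let ?Q = "\<Sum>j\<le>J. avoid_prob j y"
    assume "\<not> ?Q \<le> 1 / c"
    then have gt: "c * ?Q > 1" using c by (simp add: field_simps)
    \<comment> \<open>Beyond this horizon the surplus \<open>c * ?Q - 1\<close> per step outweighs
      the boundary term \<open>J\<close>.\<close>
    obtain N0 :: nat where N0: "real N0 > real J / (c * ?Q - 1)"
      using reals_Archimedean2 by blast
    obtain N where N: "N \<ge> N0" "c * real (Suc N) \<le> (\<Sum>k\<le>N. trans_prob k x y)"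
      using inf unfolding INFM_nat_le by blast
    have "?Q \<ge> 0" by (intro sum_nonneg avoid_prob_nonneg)
    then have "c * real (Suc N) * ?Q \<le> real (N + J + 1)"
      using occupation_avoid_le[where N = N and x = x and y = y and J = J] N(2) by (meson mult_right_mono order_trans)
    then have "(c * ?Q - 1) * real (Suc N) \<le> real J"
      by (simp add: algebra_simps)
    moreover have "real J < (c * ?Q - 1) * real N0"
      using N0 gt by (simp add: field_simps)
    moreover have "(c * ?Q - 1) * real N0 \<le> (c * ?Q - 1) * real (Suc N)"
      using N(1) gt by (intro mult_left_mono) auto
    ultimately show False by linarith
  qed
  show ?thesis
  proof (rule summableI_nonneg_bounded)
    show "(\<Sum>j<n. avoid_prob j y) \<le> 1 / c" for n
      using bound[of n] avoid_prob_nonneg[of n y] by (simp add: lessThan_Suc_atMost[symmetric])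
  qed (rule avoid_prob_nonneg)
qed

text \<open>Each visit to \<open>y\<close> is followed \<open>m\<close> steps later by a visit to
  \<open>z\<close> with a fixed positive probability. The longer horizon is absorbed into the
  constant through \<open>Suc (N + m) \<le> Suc N * Suc m\<close>.\<close>

lemma frequent_accessible:
  assumes "frequent x y" "accessible y z"
  shows "frequent x z"
proof -
  obtain c where c: "c > 0" and inf: "\<exists>\<^sub>\<infinity>N. c * real (Suc N) \<le> (\<Sum>k\<le>N. trans_prob k x y)"
    using assms(1) by (auto simp: frequent_def)
  obtain m where m: "trans_prob m y z > 0"
    using assms(2) by (auto simp: accessible_def)
  define d where "d = c * trans_prob m y z / real (Suc m)"
  have d: "d > 0" using c m by (simp add: d_def)
  have *: "d * real (Suc (N + m)) \<le> (\<Sum>k\<le>N + m. trans_prob k x z)"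
    if "c * real (Suc N) \<le> (\<Sum>k\<le>N. trans_prob k x y)" for N
  proof -
    have "real (Suc (N + m)) \<le> real (Suc N) * real (Suc m)"
      by (simp add: algebra_simps)
    then have "d * real (Suc (N + m)) \<le> d * (real (Suc N) * real (Suc m))"
      using d by (intro mult_left_mono) auto
    also have "\<dots> = c * real (Suc N) * trans_prob m y z"
      by (simp add: d_def)
    also have "\<dots> \<le> (\<Sum>k\<le>N. trans_prob k x y) * trans_prob m y z"
      using that m by (intro mult_right_mono) auto
    also have "\<dots> \<le> (\<Sum>k\<le>N. trans_prob (k + m) x z)"
      unfolding sum_distrib_right by (intro sum_mono chapman_kolmogorov_le)
    also have "\<dots> = (\<Sum>k\<in>(\<lambda>k. k + m) ` {..N}. trans_prob k x z)"
      by (subst sum.reindex) (auto simp: inj_on_def)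
    also have "\<dots> \<le> (\<Sum>k\<le>N + m. trans_prob k x z)"
      by (intro sum_mono2) (auto simp: trans_prob_nonneg)
    finally show ?thesis .
  qed
  have "\<exists>n\<ge>N. d * real (Suc n) \<le> (\<Sum>k\<le>n. trans_prob k x z)" for N
  proof -
    obtain n where "n \<ge> N" "c * real (Suc n) \<le> (\<Sum>k\<le>n. trans_prob k x y)"
      using inf unfolding INFM_nat_le by blast
    then show ?thesis using * by (intro exI[of _ "n + m"]) auto
  qed
  then show ?thesis
    unfolding frequent_def INFM_nat_le using d by blast
qed

text \<open>Pigeonhole, twice: for every horizon some state of \<open>F\<close> carries at least the
  share \<open>d / card F\<close> of the average occupation, and one state of the finite set does so
  for infinitely many horizons.\<close>

lemma ex_frequent:
  assumes F: "finite F" and d: "d > 0"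
    and le: "\<And>k. d \<le> (\<Sum>y\<in>F. trans_prob k x y)"
  shows "\<exists>y\<in>F. frequent x y"
proof -
  have "F \<noteq> {}" using le[of 0] d by auto
  then have card: "real (card F) > 0" using F by (simp add: card_gt_0_iff)
  define c where "c = d / real (card F)"
  have "\<exists>y\<in>F. c * real (Suc N) \<le> (\<Sum>k\<le>N. trans_prob k x y)" for N
  proof (rule ccontr)
    assume "\<not> ?thesis"
    then have "(\<Sum>y\<in>F. \<Sum>k\<le>N. trans_prob k x y) < (\<Sum>y\<in>F. c * real (Suc N))"
      using F \<open>F \<noteq> {}\<close> by (intro sum_strict_mono) auto
    also have "\<dots> = d * real (Suc N)" using card by (simp add: c_def)
    also have "\<dots> = (\<Sum>k\<le>N. d)" by simp
    also have "\<dots> \<le> (\<Sum>k\<le>N. \<Sum>y\<in>F. trans_prob k x y)"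
      by (intro sum_mono le)
    also have "\<dots> = (\<Sum>y\<in>F. \<Sum>k\<le>N. trans_prob k x y)"
      by (rule sum.swap)
    finally show False by simp
  qed
  then have "\<exists>\<^sub>\<infinity>N. \<exists>y\<in>F. c * real (Suc N) \<le> (\<Sum>k\<le>N. trans_prob k x y)"
    unfolding INFM_nat_le by blast
  then have "\<exists>y\<in>F. \<exists>\<^sub>\<infinity>N. c * real (Suc N) \<le> (\<Sum>k\<le>N. trans_prob k x y)"
    by (rule frequently_bex_finite[OF F])
  moreover have "c > 0" using d card by (simp add: c_def)
  ultimately show ?thesis unfolding frequent_def by blast
qed

text \<open>Summable tails make \<open>y\<close> recurrent, and a recurrent state is reachable from
  everything that it reaches. Otherwise each passage from \<open>y\<close> to \<open>w\<close> would
  end the visits to \<open>y\<close>, which has probability zero.\<close>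

lemma accessible_back:
  assumes sm: "summable (\<lambda>j. avoid_prob j y)" and acc: "accessible y w"
  shows "accessible w y"
proof (rule ccontr)
  assume nacc: "\<not> accessible w y"
  obtain k where k: "trans_prob k y w > 0" using acc by (auto simp: accessible_def)
  have w0: "prob {\<omega>\<in>space M. \<forall>j\<in>{1..m}. X w j \<omega> \<in> - {y}} = 1" for m
  proof -
    have "AE \<omega> in M. X w j \<omega> \<noteq> y" for j
    proof -
      have "trans_prob j w y = 0"
        using nacc trans_prob_nonneg[of j w y] by (auto simp: accessible_def not_less intro: antisym)
      then have "AE \<omega> in M. \<not> (\<omega> \<in> space M \<and> X w j \<omega> = y)"
        unfolding trans_prob_def by (subst (asm) prob_eq_0) auto
      then show ?thesis by (auto elim: AE_mp)
    qed
    then have "AE \<omega> in M. \<forall>j. X w j \<omega> \<noteq> y"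
      by (simp add: AE_all_countable)
    then show ?thesis by (subst prob_Collect_eq_1) auto
  qed
  \<comment> \<open>If \<open>w\<close> does not lead to \<open>y\<close>, being in \<open>w\<close>
    at time \<open>k\<close> forces the last visit to \<open>y\<close> up to time
    \<open>n + k\<close> to occur by time \<open>k\<close>. Each of these finitely many last-visit
    probabilities is bounded by a tail of the return time, which vanishes as \<open>n\<close>
    grows.\<close>
  have le: "trans_prob k y w \<le> (\<Sum>m\<le>k. avoid_prob (n + k - m) y)" for n
  proof -
    let ?E = "{\<omega>\<in>space M. X y k \<omega> = w \<and> (\<forall>j\<in>{1..n}. X y (k + j) \<omega> \<in> - {y})}"
    have "?E \<subseteq> (\<Union>m\<le>k. last_visit y y (n + k) m)"
    proof
      fix \<omega> assume w: "\<omega> \<in> ?E"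
      \<comment> \<open>The last visit to \<open>y\<close> up to time \<open>k\<close>; time 0 is
        always a candidate.\<close>
      define m where "m = (GREATEST m. m \<le> k \<and> X y m \<omega> = y)"
      have m: "m \<le> k \<and> X y m \<omega> = y"
        unfolding m_def
        by (rule GreatestI_nat[where k = 0 and b = k]) (use w X_0 in auto)
      have "X y (m + j) \<omega> \<noteq> y" if j: "j \<in> {1..n + k - m}" for j
      proof (cases "m + j \<le> k")
        case True
        show ?thesis
        proof
          assume "X y (m + j) \<omega> = y"
          then have "m + j \<le> m"
            unfolding m_def using True m_def
            by (intro Greatest_le_nat[where b = k]) auto
          then show False using j by simp
        qed
      next
        case False
        then have "m + j - k \<in> {1..n}" "k + (m + j - k) = m + j"
          using j by auto
        then show ?thesis using w by (metis (mono_tags, lifting) ComplD mem_Collect_eq singletonI)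
      qed
      then have "\<omega> \<in> last_visit y y (n + k) m"
        using m w by (auto simp: last_visit_def)
      then show "\<omega> \<in> (\<Union>m\<le>k. last_visit y y (n + k) m)" using m by auto
    qed
    then have "prob ?E \<le> prob (\<Union>m\<le>k. last_visit y y (n + k) m)"
      by (intro finite_measure_mono) auto
    also have "\<dots> \<le> (\<Sum>m\<le>k. prob (last_visit y y (n + k) m))"
      by (intro finite_measure_subadditive_finite) auto
    also have "\<dots> \<le> (\<Sum>m\<le>k. avoid_prob (n + k - m) y)"
    proof (intro sum_mono)
      fix m
      have "trans_prob m y y \<le> 1" by (simp add: trans_prob_def)
      then show "prob (last_visit y y (n + k) m) \<le> avoid_prob (n + k - m) y"
        unfolding prob_last_visit
        by (intro mult_left_le_one_le avoid_prob_nonneg trans_prob_nonneg)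
    qed
    finally show ?thesis unfolding markov w0 by (simp add: trans_prob_def)
  qed
  have "(\<lambda>n. \<Sum>m\<le>k. avoid_prob (n + k - m) y) \<longlonglongrightarrow> (\<Sum>m\<le>k. 0)"
  proof (intro tendsto_sum)
    fix m assume "m \<in> {..k}"
    then have "(\<lambda>n. avoid_prob (n + k - m) y) = (\<lambda>n. avoid_prob (n + (k - m)) y)"
      by auto
    then show "(\<lambda>n. avoid_prob (n + k - m) y) \<longlonglongrightarrow> 0"
      using LIMSEQ_ignore_initial_segment[OF summable_LIMSEQ_zero[OF sm], of "k - m"] by simp
  qed
  then have "(\<lambda>n. \<Sum>m\<le>k. avoid_prob (n + k - m) y) \<longlonglongrightarrow> 0" by simp
  then have "trans_prob k y w \<le> 0"
    by (rule LIMSEQ_le_const) (use le in auto)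
  then show False using k by simp
qed

text \<open>The tail-sum formula on a single sample path. If there is no return, the infimum over
  the empty set is infinite, and so is the series of ones.\<close>

lemma return_time_le:
  "return_time X y \<omega> \<le> (\<Sum>j. indicator {\<omega>. \<forall>i\<in>{1..j}. X y i \<omega> \<noteq> y} \<omega>)"
proof (cases "\<exists>k\<ge>1. X y k \<omega> = y")
  case True
  define k where "k = (LEAST k. k \<ge> 1 \<and> X y k \<omega> = y)"
  have k: "k \<ge> 1 \<and> X y k \<omega> = y"
    unfolding k_def by (rule LeastI_ex) (use True in blast)
  have less: "X y i \<omega> \<noteq> y" if "i \<ge> 1" "i < k" for i
    using not_less_Least[of i "\<lambda>k. k \<ge> 1 \<and> X y k \<omega> = y"] that by (auto simp: k_def)
  have "return_time X y \<omega> \<le> of_nat k"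
    unfolding return_time_def using k by (intro INF_lower) auto
  also have "of_nat k = (\<Sum>j<k. indicator {\<omega>. \<forall>i\<in>{1..j}. X y i \<omega> \<noteq> y} \<omega> :: ennreal)"
    using less by (simp add: indicator_def)
  also have "\<dots> \<le> (\<Sum>j. indicator {\<omega>. \<forall>i\<in>{1..j}. X y i \<omega> \<noteq> y} \<omega>)"
    by (intro sum_le_suminf) auto
  finally show ?thesis .
next
  case False
  then have *: "(\<lambda>j. indicator {\<omega>. \<forall>i\<in>{1..j}. X y i \<omega> \<noteq> y} \<omega>) = (\<lambda>j. 1 :: ennreal)"
    by (auto simp: indicator_def)
  have "(\<Sum>j::nat. 1 :: ennreal) = \<infinity>"
  proof (rule ccontr)
    assume "(\<Sum>j::nat. 1 :: ennreal) \<noteq> \<infinity>"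
    then obtain n :: nat where "(\<Sum>j::nat. 1 :: ennreal) < of_nat n"
      using ennreal_Ex_less_of_nat by (auto simp: less_top)
    moreover have "of_nat n \<le> (\<Sum>j::nat. 1 :: ennreal)"
      using sum_le_suminf[of "\<lambda>_. 1 :: ennreal" "{..<n}"] by simp
    ultimately show False by simp
  qed
  then show ?thesis unfolding * by simp
qed

lemma return_time_finite_mean:
  assumes "frequent x y"
  shows "(\<integral>\<^sup>+ \<omega>. return_time X y \<omega> \<partial>M) < \<infinity>"
proof -
  let ?A = "\<lambda>j. {\<omega>\<in>space M. \<forall>i\<in>{1..j}. X y i \<omega> \<noteq> y}"
  have "(\<integral>\<^sup>+ \<omega>. return_time X y \<omega> \<partial>M) \<le> (\<integral>\<^sup>+ \<omega>. (\<Sum>j. indicator (?A j) \<omega>) \<partial>M)"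
  proof (intro nn_integral_mono)
    fix \<omega> assume "\<omega> \<in> space M"
    then have "(\<Sum>j. indicator {\<omega>. \<forall>i\<in>{1..j}. X y i \<omega> \<noteq> y} \<omega> :: ennreal) = (\<Sum>j. indicator (?A j) \<omega>)"
      by (intro suminf_cong) (auto simp: indicator_def)
    then show "return_time X y \<omega> \<le> (\<Sum>j. indicator (?A j) \<omega>)"
      using return_time_le[of y \<omega>] by simp
  qed
  also have "\<dots> = (\<Sum>j. emeasure M (?A j))"
    by (subst nn_integral_suminf) auto
  also have "\<dots> = (\<Sum>j. ennreal (avoid_prob j y))"
    by (simp add: emeasure_eq_measure avoid_prob_def)
  also have "\<dots> = ennreal (\<Sum>j. avoid_prob j y)"
    by (intro suminf_ennreal2 avoid_prob_nonneg frequent_summable[OF assms])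
  also have "\<dots> < \<infinity>" by simp
  finally show ?thesis .
qed

lemma prob_finite_set:
  assumes "finite F"
  shows "prob {\<omega>\<in>space M. X x k \<omega> \<in> F} = (\<Sum>y\<in>F. trans_prob k x y)"
proof -
  have "{\<omega>\<in>space M. X x k \<omega> \<in> F} = (\<Union>y\<in>F. {\<omega>\<in>space M. X x k \<omega> = y})" by auto
  also have "prob \<dots> = (\<Sum>y\<in>F. trans_prob k x y)"
    unfolding trans_prob_def
    by (intro finite_measure_finite_Union assms) (auto simp: disjoint_family_on_def)
  finally show ?thesis .
qed

text \<open>
  Tightness gives a state whose expected occupation density does not vanish; the last-exit
  decomposition bounds that density by the inverse of the mean return time.
\<close>

theorem tight_positive_recurrent:
  assumes tight: "\<And>x d. d > 0 \<Longrightarrow> \<exists>F. finite F \<and> (\<forall>k. prob {\<omega>\<in>space M. X x k \<omega> \<notin> F} \<le> d)"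
    and common: "\<And>x y. \<exists>w. accessible x w \<and> accessible y w"
  shows "positive_recurrent M UNIV X"
proof -
  fix x0 :: 's
  have compl: "prob {\<omega>\<in>space M. X x k \<omega> \<in> F} = 1 - prob {\<omega>\<in>space M. X x k \<omega> \<notin> F}" for x k F
    by (subst prob_neg) auto
  obtain F where F: "finite F" "\<And>k. prob {\<omega>\<in>space M. X x0 k \<omega> \<notin> F} \<le> 1/2"
    using tight[of "1/2" x0] by auto
  have "1/2 \<le> (\<Sum>y\<in>F. trans_prob k x0 y)" for k
    using F(2)[of k] compl[of x0 k F] by (simp add: prob_finite_set[OF F(1)])
  then obtain y0 where y0: "frequent x0 y0"
    using ex_frequent[OF F(1), of "1/2" x0] by auto
  \<comment> \<open>Closed by transitivity of \<open>accessible\<close>, communicating by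
    \<open>accessible_back\<close>, and with finite mean return times because
    \<open>frequent x0\<close> spreads along \<open>accessible\<close>.\<close>
  define R where "R = {y. accessible y0 y}"
  have freq: "frequent x0 y" if "y \<in> R" for y
    using that frequent_accessible[OF y0] by (simp add: R_def)
  have returns: "accessible y y0" if "y \<in> R" for y
    using accessible_back[OF frequent_summable[OF y0]] that by (simp add: R_def)
  have "AE \<omega> in M. X x k \<omega> \<in> R" if "x \<in> R" for x k
  proof -
    have "AE \<omega> in M. X x k \<omega> \<noteq> y" if "y \<notin> R" for y
    proof -
      have "\<not> accessible x y"
        using \<open>x \<in> R\<close> \<open>y \<notin> R\<close> accessible_trans by (auto simp: R_def)
      then have "trans_prob k x y = 0"
        using trans_prob_nonneg[of k x y] by (auto simp: accessible_def not_less intro: antisym)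
      then have "AE \<omega> in M. \<not> (\<omega> \<in> space M \<and> X x k \<omega> = y)"
        unfolding trans_prob_def by (subst (asm) prob_eq_0) auto
      then show ?thesis by (auto elim: AE_mp)
    qed
    then have "AE \<omega> in M. \<forall>y. y \<notin> R \<longrightarrow> X x k \<omega> \<noteq> y"
      by (subst AE_all_countable) auto
    then show ?thesis by (auto elim: AE_mp)
  qed
  moreover have "\<exists>k. \<not> (AE \<omega> in M. X x k \<omega> \<noteq> y)" if "x \<in> R" "y \<in> R" for x y
  proof -
    have "accessible x y"
      using returns[OF that(1)] that(2) accessible_trans by (auto simp: R_def)
    then obtain k where k: "trans_prob k x y > 0" by (auto simp: accessible_def)
    have "\<not> (AE \<omega> in M. X x k \<omega> \<noteq> y)"
    proof
      assume "AE \<omega> in M. X x k \<omega> \<noteq> y"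
      then have "prob {\<omega>\<in>space M. X x k \<omega> = y} = 0"
        by (subst prob_Collect_eq_0) auto
      then show False using k by (simp add: trans_prob_def)
    qed
    then show ?thesis ..
  qed
  \<comment> \<open>If the chain avoided \<open>R\<close> forever with probability
    \<open>?d\<close>, tightness would keep mass \<open>?d / 2\<close> in the finite set
    \<open>F - R\<close> at all times and produce a frequently visited \<open>y\<close> there. A
    common successor \<open>w\<close> of \<open>y0\<close> and \<open>y\<close> leads back to
    \<open>y\<close> by recurrence, so \<open>y\<close> would lie in \<open>R\<close> after
    all.\<close>
  moreover have "AE \<omega> in M. \<exists>k. X x k \<omega> \<in> R" for x
  proof (rule ccontr)
    assume "\<not> (AE \<omega> in M. \<exists>k. X x k \<omega> \<in> R)"
    then have pos: "prob {\<omega>\<in>space M. \<forall>k. X x k \<omega> \<notin> R} > 0" (is "?d > 0")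
    proof -
      have "{\<omega>\<in>space M. \<forall>k. X x k \<omega> \<notin> R} = {\<omega>\<in>space M. \<not> (\<exists>k. X x k \<omega> \<in> R)}" by auto
      then have "?d \<noteq> 0"
        using \<open>\<not> (AE \<omega> in M. \<exists>k. X x k \<omega> \<in> R)\<close>
        by (auto simp: prob_Collect_eq_0)
      then show ?thesis by (simp add: zero_less_measure_iff)
    qed
    obtain F where F: "finite F" "\<And>k. prob {\<omega>\<in>space M. X x k \<omega> \<notin> F} \<le> ?d / 2"
      using tight[of "?d / 2" x] pos by auto
    have "?d / 2 \<le> (\<Sum>y\<in>F - R. trans_prob k x y)" for k
    proof -
      have "?d \<le> prob ({\<omega>\<in>space M. X x k \<omega> \<in> F - R} \<union> {\<omega>\<in>space M. X x k \<omega> \<notin> F})"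
        by (intro finite_measure_mono) auto
      also have "\<dots> \<le> prob {\<omega>\<in>space M. X x k \<omega> \<in> F - R} + prob {\<omega>\<in>space M. X x k \<omega> \<notin> F}"
        by (intro measure_Un_le) auto
      finally show ?thesis using F(2)[of k] F(1) by (simp add: prob_finite_set[symmetric])
    qed
    then obtain y where y: "y \<in> F - R" "frequent x y"
      using ex_frequent[of "F - R" "?d / 2" x] F(1) pos by auto
    obtain w where w: "accessible y0 w" "accessible y w" using common by blast
    have "accessible w y"
      using accessible_back[OF frequent_summable[OF y(2)] w(2)] .
    then have "y \<in> R" using w(1) accessible_trans by (auto simp: R_def)
    then show False using y(1) by auto
  qed
  moreover have "R \<noteq> {}" using accessible_refl by (auto simp: R_def)
  moreover have "(\<integral>\<^sup>+ \<omega>. return_time X x \<omega> \<partial>M) < \<infinity>" if "x \<in> R" for x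
    using return_time_finite_mean[OF freq[OF that]] .
  ultimately show ?thesis
    unfolding positive_recurrent_def by (intro exI[of _ R]) auto
qed

end

subsection \<open>Regular sample paths\<close>

instance queue :: finite
proof
  have "(UNIV :: queue set) = {Q1, Q2}" using queue.exhaust by auto
  then show "finite (UNIV :: queue set)" by (metis finite.emptyI finite.insertI)
qed

instance queue :: countable
  by countable_datatype

lemma all_queue: "(\<forall>q. P q) \<longleftrightarrow> P Q1 \<and> P Q2"
  by (metis queue.exhaust)

lemma other_neq [simp]: "other i \<noteq> i" "i \<noteq> other i"
  by (cases i; simp)+

lemma queue_cases_other: "q = i \<or> q = other i"
  by (cases i; cases q) auto

text \<open>For integer values right-continuity means being constant on some interval to the right.
  In this form it yields that all infima of epochs below are attained.\<close>

definition regular_arrivals :: "(real \<Rightarrow> nat) \<Rightarrow> bool" where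
  "regular_arrivals a \<longleftrightarrow> a 0 = 0 \<and> mono_on {0..} a \<and>
     (\<forall>t\<ge>0. \<exists>e>0. \<forall>u\<in>{t..t + e}. a u = a t) \<and> (\<forall>m. \<exists>t\<ge>0. m \<le> a t)"

text \<open>Divergence of the partial sums rules out infinitely many completions in finite time, for
  which the supremum in \<open>departures\<close> would be meaningless.\<close>

definition regular_services :: "(nat \<Rightarrow> real) \<Rightarrow> bool" where
  "regular_services J \<longleftrightarrow> (\<forall>v. 0 < J v) \<and> (\<forall>x. \<exists>v. x < sum J {..<v})"

lemma Inf_plus_image:
  fixes X :: "real set"
  assumes "X \<noteq> {}" "bdd_below X"
  shows "Inf ((+) c ` X) = c + Inf X"
  using Inf_add_eq[of id X c] assms by simp

text \<open>Members approach the infimum from the right, and constancy to the right of it hands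
  membership back.\<close>

lemma right_constant_Inf_mem:
  fixes X :: "real set"
  assumes "X \<noteq> {}" "bdd_below X"
    and closed: "\<And>i. Inf X \<le> i \<Longrightarrow> i = Inf X \<Longrightarrow> \<exists>e>0. \<forall>u\<in>{i..i + e}. u \<in> X \<longrightarrow> i \<in> X"
  shows "Inf X \<in> X"
proof -
  obtain e where e: "e > 0" "\<forall>u\<in>{Inf X..Inf X + e}. u \<in> X \<longrightarrow> Inf X \<in> X"
    using closed[of "Inf X"] by auto
  obtain u where u: "u \<in> X" "u < Inf X + e"
    using cInf_lessD[of X "Inf X + e"] assms(1) e(1) by auto
  then have "Inf X \<le> u" using assms(2) by (intro cInf_lower)
  then show ?thesis using e(2) u by auto
qed

section \<open>Counting paths and the epochs inverse to them\<close>

lemma regular_arrivals_mono: "regular_arrivals a \<Longrightarrow> 0 \<le> s \<Longrightarrow> s \<le> t \<Longrightarrow> a s \<le> a t"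
  by (auto simp: regular_arrivals_def mono_on_def)

lemma regular_arrivals_right:
  "regular_arrivals a \<Longrightarrow> 0 \<le> t \<Longrightarrow> \<exists>e>0. \<forall>u\<in>{t..t + e}. a u = a t"
  by (simp add: regular_arrivals_def)

lemma regular_arrivals_unbounded: "regular_arrivals a \<Longrightarrow> \<exists>t\<ge>0. m \<le> a t"
  by (simp add: regular_arrivals_def)

context
  fixes a :: "real \<Rightarrow> nat" and n :: nat
  assumes a: "regular_arrivals a"
begin

text \<open>\<open>available\<close> is the generalized inverse of the counting path. Since the
  infimum is attained, the two form a Galois connection, and statements on epochs become statements
  on counts.\<close>

lemma available_le_iff:
  assumes "t \<ge> 0"
  shows "available a 0 n v \<le> t \<longleftrightarrow> v < n + a t"
proof -
  define S where "S = {t. 0 \<le> t \<and> v < n + a t}"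
  have S: "t \<in> S \<longleftrightarrow> 0 \<le> t \<and> v < n + a t" for t by (simp add: S_def)
  have av: "available a 0 n v = Inf S"
    using a by (simp add: available_def regular_arrivals_def S_def)
  have bdd: "bdd_below S" by (rule bdd_belowI[of _ 0]) (simp add: S)
  obtain s where "s \<ge> 0" "Suc v \<le> a s" using regular_arrivals_unbounded[OF a] by blast
  then have ne: "S \<noteq> {}" using S[of s] by auto
  have nonneg: "Inf S \<ge> 0" by (rule cInf_greatest[OF ne]) (simp add: S)
  have mem: "Inf S \<in> S"
  proof (rule right_constant_Inf_mem[OF ne bdd])
    fix i assume i: "i = Inf S"
    then obtain e where "e > 0" "\<forall>u\<in>{i..i + e}. a u = a i"
      using regular_arrivals_right[OF a] nonneg by blast
    moreover have "0 \<le> i" using nonneg i by simp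
    ultimately show "\<exists>e>0. \<forall>u\<in>{i..i + e}. u \<in> S \<longrightarrow> i \<in> S"
      unfolding S by metis
  qed
  show ?thesis
  proof
    assume "available a 0 n v \<le> t"
    then have "a (Inf S) \<le> a t"
      using nonneg regular_arrivals_mono[OF a] by (simp add: av)
    then show "v < n + a t" using mem unfolding S by simp
  next
    assume "v < n + a t"
    then have "t \<in> S" using assms by (simp add: S)
    then show "available a 0 n v \<le> t"
      unfolding av using bdd by (intro cInf_lower)
  qed
qed

lemma available_nonneg: "available a 0 n v \<ge> 0"
proof -
  obtain s where s: "s \<ge> 0" "Suc v \<le> a s" using regular_arrivals_unbounded[OF a] by blast
  have "a 0 = 0" using a by (simp add: regular_arrivals_def)
  then have "s \<in> {t. 0 \<le> t \<and> v < n + (a t - a 0)}" using s by simp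
  then have "{t. 0 \<le> t \<and> v < n + (a t - a 0)} \<noteq> {}" by blast
  then show ?thesis
    unfolding available_def by (rule cInf_greatest) simp
qed

end

context
  fixes a :: "real \<Rightarrow> nat" and J :: "nat \<Rightarrow> real" and n :: nat
  assumes a: "regular_arrivals a" and J: "regular_services J"
begin

lemma service_pos': "J v > 0"
  using J by (simp add: regular_services_def)

lemma completion_Suc_gt: "completion a J 0 n v < completion a J 0 n (Suc v)"
  using service_pos'[of v] by simp

lemma completion_strict_mono: "v < u \<Longrightarrow> completion a J 0 n v < completion a J 0 n u"
  by (rule lift_Suc_mono_less[of "completion a J 0 n"]) (rule completion_Suc_gt)

lemma completion_mono: "v \<le> u \<Longrightarrow> completion a J 0 n v \<le> completion a J 0 n u"
  using completion_strict_mono[of v u] by (cases "v = u") auto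

lemma available_le_completion: "available a 0 n v \<le> completion a J 0 n (Suc v)"
  using service_pos'[of v] by simp

lemma sum_le_completion: "sum J {..<v} \<le> completion a J 0 n v"
  by (induction v) auto

text \<open>Completion epochs increase strictly to infinity, so the supremum in
  \<open>departures\<close> is a maximum and time is cut into the intervals between successive
  completions.\<close>

lemma departures_eq_iff:
  assumes "t \<ge> 0"
  shows "departures a J 0 n t = d \<longleftrightarrow> completion a J 0 n d \<le> t \<and> t < completion a J 0 n (Suc d)"
proof -
  have eq: "departures a J 0 n t = d"
    if "completion a J 0 n d \<le> t" "t < completion a J 0 n (Suc d)" for d
  proof -
    have "v \<le> d" if "completion a J 0 n v \<le> t" for v
      using completion_mono[of "Suc d" v] that \<open>t < completion a J 0 n (Suc d)\<close>
      by (meson le_less_trans not_less not_less_eq_eq)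
    then show ?thesis
      unfolding departures_def using that(1) by (intro cSup_eq_maximum) auto
  qed
  obtain v where "t < sum J {..<v}" using J by (auto simp: regular_services_def)
  then have v: "t < completion a J 0 n v" using sum_le_completion[of v] by linarith
  define m where "m = (LEAST v. t < completion a J 0 n v)"
  have m: "t < completion a J 0 n m" unfolding m_def by (rule LeastI) (rule v)
  then obtain d' where d': "m = Suc d'" using assms by (cases m) auto
  then have "\<not> t < completion a J 0 n d'"
    using not_less_Least[of d' "\<lambda>v. t < completion a J 0 n v"] by (simp add: m_def)
  then have d'2: "completion a J 0 n d' \<le> t" "t < completion a J 0 n (Suc d')"
    using m d' by auto
  from eq[OF this] show ?thesis using eq[of d] d'2 by blast
qed

lemma less_departures_iff:
  assumes "t \<ge> 0"
  shows "v \<le> departures a J 0 n t \<longleftrightarrow> completion a J 0 n v \<le> t"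
proof -
  define d where "d = departures a J 0 n t"
  have d: "completion a J 0 n d \<le> t" "t < completion a J 0 n (Suc d)"
    using departures_eq_iff[OF assms, of d] by (auto simp: d_def)
  have "completion a J 0 n v \<le> t" if "v \<le> d"
    using completion_mono[OF that] d by linarith
  moreover have "v \<le> d" if "completion a J 0 n v \<le> t"
    using completion_mono[of "Suc d" v] d that by (meson le_less_trans not_less not_less_eq_eq)
  ultimately show ?thesis unfolding d_def by blast
qed

text \<open>A completed customer had arrived before; hence the natural subtraction in
  \<open>visit_content\<close> never truncates.\<close>

lemma departures_le:
  assumes "t \<ge> 0"
  shows "departures a J 0 n t \<le> n + a t"
proof (cases "departures a J 0 n t")
  case (Suc d)
  then have "completion a J 0 n (Suc d) \<le> t"
    using less_departures_iff[OF assms, of "Suc d"] by simp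
  then have "available a 0 n d \<le> t"
    using available_le_completion[of d] by linarith
  then show ?thesis using available_le_iff[OF a assms, of n d] Suc by simp
qed simp

lemma departures_right:
  assumes "t \<ge> 0"
  shows "\<exists>e>0. \<forall>u\<in>{t..t + e}. departures a J 0 n u = departures a J 0 n t"
proof -
  define d where "d = departures a J 0 n t"
  have d: "completion a J 0 n d \<le> t" "t < completion a J 0 n (Suc d)"
    using departures_eq_iff[OF assms, of d] by (auto simp: d_def)
  define e where "e = (completion a J 0 n (Suc d) - t) / 2"
  have e: "e > 0" "t + e < completion a J 0 n (Suc d)"
    using d(2) by (simp_all add: e_def field_simps)
  have "departures a J 0 n u = d" if "u \<in> {t..t + e}" for u
  proof -
    have "u \<ge> 0" "completion a J 0 n d \<le> u" "u < completion a J 0 n (Suc d)"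
      using that d(1) e(2) assms by (simp_all del: completion.simps)
    then show ?thesis using departures_eq_iff[of u d] by blast
  qed
  then show ?thesis using e(1) unfolding d_def by blast
qed

end

text \<open>
  The epochs of a cycle are reached in four steps (visit, travel, visit, travel), each driven by
  a sequence of positive numbers: the service times of the visit, or the switching time.
\<close>

datatype kind = Visit queue | Travel

type_synonym path = "(queue \<Rightarrow> real \<Rightarrow> nat) \<times> (nat \<Rightarrow> real)"

definition regular_paths :: "path set" where
  "regular_paths = {w. (\<forall>q. regular_arrivals (fst w q)) \<and> regular_services (snd w)}"

definition content_at :: "kind \<Rightarrow> content \<Rightarrow> path \<Rightarrow> real \<Rightarrow> content" where
  "content_at k n w t = (case k of
       Visit i \<Rightarrow> visit_content (fst w) (snd w) i 0 n t
     | Travel \<Rightarrow> (\<lambda>q. n q + (fst w q t - fst w q 0)))"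

text \<open>All epochs at which the step could end. For a visit the end of the beginning phase is
  replaced by the existence of some earlier \<open>b\<close>, so that the two successive infima of
  the model become a single one; \<open>stop_set_Visit\<close> shows that nothing changes. A travel
  step is driven by the first entry of the sequence.\<close>

definition stop_set :: "real \<Rightarrow> policy \<Rightarrow> kind \<Rightarrow> content \<Rightarrow> path \<Rightarrow> real set" where
  "stop_set \<mu> p k n w = {e. 0 \<le> e \<and> (case k of
       Visit i \<Rightarrow> (\<exists>b. 0 \<le> b \<and> b \<le> e \<and> Pi_B \<mu> p i (content_at k n w b) \<ge> 0) \<and>
         Pi_C \<mu> p i (content_at k n w e) \<le> 0
     | Travel \<Rightarrow> snd w 0 \<le> e)}"

definition duration :: "real \<Rightarrow> policy \<Rightarrow> kind \<Rightarrow> content \<Rightarrow> path \<Rightarrow> real" where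
  "duration \<mu> p k n w = (if stop_set \<mu> p k n w = {} then 0 else Inf (stop_set \<mu> p k n w))"

definition shift_arrivals :: "(queue \<Rightarrow> real \<Rightarrow> nat) \<Rightarrow> real \<Rightarrow> queue \<Rightarrow> real \<Rightarrow> nat" where
  "shift_arrivals A \<Phi> q t = A q (\<Phi> + t) - A q \<Phi>"

lemma regular_pathsD:
  assumes "w \<in> regular_paths"
  shows "regular_arrivals (fst w q)" "regular_services (snd w)" "fst w q 0 = 0"
  using assms by (auto simp: regular_paths_def regular_arrivals_def)

lemma content_at_Visit:
  assumes "w \<in> regular_paths"
  shows "content_at (Visit i) n w t q =
    n q + fst w q t - (if q = i then departures (fst w i) (snd w) 0 (n i) t else 0)"
  using regular_pathsD[OF assms] by (simp add: content_at_def visit_content_def)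

lemma content_at_Travel:
  assumes "w \<in> regular_paths"
  shows "content_at Travel n w t q = n q + fst w q t"
  using regular_pathsD[OF assms] by (simp add: content_at_def)

lemma content_at_right:
  assumes w: "w \<in> regular_paths" and t: "t \<ge> 0"
  shows "\<exists>e>0. \<forall>u\<in>{t..t + e}. content_at k n w u = content_at k n w t"
proof -
  have A: "\<exists>e>0. \<forall>u\<in>{t..t + e}. fst w q u = fst w q t" for q
    using regular_pathsD(1)[OF w, of q] t by (auto simp: regular_arrivals_def)
  obtain e1 where e1: "e1 > 0" "\<forall>u\<in>{t..t + e1}. fst w Q1 u = fst w Q1 t" using A by blast
  obtain e2 where e2: "e2 > 0" "\<forall>u\<in>{t..t + e2}. fst w Q2 u = fst w Q2 t" using A by blast
  define d where "d = min e1 e2"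
  have d: "d > 0" using e1 e2 by (simp add: d_def)
  have e: "fst w q u = fst w q t" if "u \<in> {t..t + d}" for u q
  proof (cases q)
    case Q1
    have "d \<le> e1" by (simp add: d_def)
    then have "u \<in> {t..t + e1}" using that by simp
    then show ?thesis using e1(2) Q1 by blast
  next
    case Q2
    have "d \<le> e2" by (simp add: d_def)
    then have "u \<in> {t..t + e2}" using that by simp
    then show ?thesis using e2(2) Q2 by blast
  qed
  show ?thesis
  proof (cases k)
    case (Visit i)
    obtain e3 where e3: "e3 > 0" "\<forall>u\<in>{t..t + e3}.
        departures (fst w i) (snd w) 0 (n i) u = departures (fst w i) (snd w) 0 (n i) t"
      using departures_right[OF regular_pathsD(1,2)[OF w] t] by blast
    have "content_at k n w u = content_at k n w t" if "u \<in> {t..t + min d e3}" for u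
    proof
      fix q
      have "u \<in> {t..t + d}" "u \<in> {t..t + e3}" using that by auto
      then show "content_at k n w u q = content_at k n w t q"
        using e e3(2) unfolding Visit content_at_Visit[OF w] by metis
    qed
    moreover have "min d e3 > 0" using d e3 by simp
    ultimately show ?thesis by blast
  next
    case Travel
    have "content_at k n w u = content_at k n w t" if "u \<in> {t..t + d}" for u
      unfolding Travel fun_eq_iff content_at_Travel[OF w] using e[OF that] by simp
    then show ?thesis using d by blast
  qed
qed

lemma mem_stop_set_Visit:
  "e \<in> stop_set \<mu> p (Visit i) n w \<longleftrightarrow> 0 \<le> e \<and>
     (\<exists>b. 0 \<le> b \<and> b \<le> e \<and> Pi_B \<mu> p i (content_at (Visit i) n w b) \<ge> 0) \<and>
     Pi_C \<mu> p i (content_at (Visit i) n w e) \<le> 0"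
  by (simp add: stop_set_def)

lemma mem_stop_set_Travel: "e \<in> stop_set \<mu> p Travel n w \<longleftrightarrow> 0 \<le> e \<and> snd w 0 \<le> e"
  by (simp add: stop_set_def)

lemma stop_set_nonneg: "e \<in> stop_set \<mu> p k n w \<Longrightarrow> 0 \<le> e"
  by (simp add: stop_set_def)

text \<open>Each member has an interval of members to its right, so rational epochs detect
  everything; the measurability of durations rests on this.\<close>

lemma stop_set_right:
  assumes w: "w \<in> regular_paths" and t: "t \<in> stop_set \<mu> p k n w"
  shows "\<exists>e>0. {t..t + e} \<subseteq> stop_set \<mu> p k n w"
proof -
  have t0: "t \<ge> 0" using stop_set_nonneg[OF t] .
  obtain e where e: "e > 0" "\<forall>u\<in>{t..t + e}. content_at k n w u = content_at k n w t"
    using content_at_right[OF w t0] by blast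
  have "u \<in> stop_set \<mu> p k n w" if u: "u \<in> {t..t + e}" for u
  proof -
    have tu: "t \<le> u" "0 \<le> u" using u t0 by auto
    have c: "content_at k n w u = content_at k n w t" using e u by blast
    show ?thesis
    proof (cases k)
      case (Visit i)
      show ?thesis
        using t c tu unfolding Visit mem_stop_set_Visit by (metis order_trans)
    next
      case Travel
      then show ?thesis using t tu by (simp add: mem_stop_set_Travel)
    qed
  qed
  then show ?thesis using e(1) by blast
qed

lemma bdd_below_stop_set [simp]: "bdd_below (stop_set \<mu> p k n w)"
  by (rule bdd_belowI[of _ 0]) (auto simp: stop_set_def)

lemma duration_nonneg: "duration \<mu> p k n w \<ge> 0"
proof (cases "stop_set \<mu> p k n w = {}")
  case False
  then have "0 \<le> Inf (stop_set \<mu> p k n w)"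
    by (rule cInf_greatest) (simp add: stop_set_def)
  then show ?thesis by (simp add: duration_def)
qed (simp add: duration_def)

lemma duration_le: "e \<in> stop_set \<mu> p k n w \<Longrightarrow> duration \<mu> p k n w \<le> e"
  using cInf_lower[OF _ bdd_below_stop_set] by (auto simp: duration_def)

lemma stop_Inf_mem:
  assumes w: "w \<in> regular_paths" and ne: "X \<noteq> {}" and X: "X = {t. c \<le> t \<and> P (content_at k n w t)}"
    and c: "c \<ge> 0"
  shows "Inf X \<in> X"
proof (rule right_constant_Inf_mem)
  have mem: "t \<in> X \<longleftrightarrow> c \<le> t \<and> P (content_at k n w t)" for t unfolding X by simp
  show "X \<noteq> {}" by (rule ne)
  show "bdd_below X" by (rule bdd_belowI[of _ c]) (simp add: mem)
  fix i assume i: "i = Inf X"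
  have ci: "c \<le> i" unfolding i using ne by (rule cInf_greatest) (simp add: mem)
  then have "0 \<le> i" using c by simp
  then obtain e where e: "e > 0" "\<forall>u\<in>{i..i + e}. content_at k n w u = content_at k n w i"
    using content_at_right[OF w] by blast
  then show "\<exists>e>0. \<forall>u\<in>{i..i + e}. u \<in> X \<longrightarrow> i \<in> X"
    using ci unfolding mem by metis
qed

text \<open>The infimum of the beginning epochs is attained and thus serves as the witness
  \<open>b\<close> for every later \<open>e\<close>. This recovers the concluding phase as defined
  in the model.\<close>

lemma stop_set_Visit:
  fixes \<mu> :: real and p :: policy and i :: queue and n :: content
  assumes w: "w \<in> regular_paths"
  defines "B \<equiv> {b. 0 \<le> b \<and> Pi_B \<mu> p i (content_at (Visit i) n w b) \<ge> 0}"
  assumes "B \<noteq> {}"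
  shows "stop_set \<mu> p (Visit i) n w = {e. Inf B \<le> e \<and> Pi_C \<mu> p i (content_at (Visit i) n w e) \<le> 0}"
    and "Inf B \<ge> 0"
proof -
  have mem: "Inf B \<in> B"
    by (rule stop_Inf_mem[OF w \<open>B \<noteq> {}\<close> meta_eq_to_obj_eq[OF B_def]]) simp
  then show nonneg: "Inf B \<ge> 0" by (simp add: B_def)
  have "bdd_below B" by (rule bdd_belowI[of _ 0]) (auto simp: B_def)
  then have lower: "Inf B \<le> b" if "b \<in> B" for b using that by (rule cInf_lower[rotated])
  show "stop_set \<mu> p (Visit i) n w = {e. Inf B \<le> e \<and> Pi_C \<mu> p i (content_at (Visit i) n w e) \<le> 0}"
  proof (intro set_eqI iffI)
    fix e assume "e \<in> stop_set \<mu> p (Visit i) n w"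
    then obtain b where "b \<in> B" "b \<le> e" "Pi_C \<mu> p i (content_at (Visit i) n w e) \<le> 0"
      unfolding mem_stop_set_Visit B_def by blast
    then show "e \<in> {e. Inf B \<le> e \<and> Pi_C \<mu> p i (content_at (Visit i) n w e) \<le> 0}"
      using lower by fastforce
  next
    fix e assume e: "e \<in> {e. Inf B \<le> e \<and> Pi_C \<mu> p i (content_at (Visit i) n w e) \<le> 0}"
    then have "0 \<le> e" using nonneg by simp
    then show "e \<in> stop_set \<mu> p (Visit i) n w"
      using mem e unfolding mem_stop_set_Visit B_def by blast
  qed
qed

lemma duration_mem:
  assumes w: "w \<in> regular_paths" and ne: "stop_set \<mu> p k n w \<noteq> {}"
  shows "duration \<mu> p k n w \<in> stop_set \<mu> p k n w"
proof (cases k)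
  case (Visit i)
  let ?B = "{b. 0 \<le> b \<and> Pi_B \<mu> p i (content_at (Visit i) n w b) \<ge> 0}"
  obtain e where "e \<in> stop_set \<mu> p (Visit i) n w" using ne unfolding Visit by blast
  then have B: "?B \<noteq> {}" unfolding mem_stop_set_Visit by blast
  have "Inf (stop_set \<mu> p (Visit i) n w) \<in> stop_set \<mu> p (Visit i) n w"
    using stop_Inf_mem[OF w ne[unfolded Visit] stop_set_Visit(1)[OF w B] stop_set_Visit(2)[OF w B]] .
  then show ?thesis using ne by (simp add: Visit duration_def)
next
  case Travel
  have "snd w 0 > 0" using regular_pathsD(2)[OF w] by (simp add: regular_services_def)
  then have "stop_set \<mu> p Travel n w = {snd w 0..}" by (auto simp: mem_stop_set_Travel)
  then show ?thesis by (simp add: Travel duration_def)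
qed

lemma duration_Travel:
  assumes w: "w \<in> regular_paths"
  shows "duration \<mu> p Travel n w = snd w 0" "stop_set \<mu> p Travel n w \<noteq> {}"
proof -
  have "snd w 0 > 0" using regular_pathsD(2)[OF w] by (simp add: regular_services_def)
  then have "stop_set \<mu> p Travel n w = {snd w 0..}" by (auto simp: mem_stop_set_Travel)
  then show "duration \<mu> p Travel n w = snd w 0" "stop_set \<mu> p Travel n w \<noteq> {}"
    by (auto simp: duration_def)
qed

subsection \<open>Dependence on the past only\<close>

text \<open>Epochs up to the horizon \<open>r\<close> depend only on arrivals up to
  \<open>r\<close>. Inside, equality is claimed as soon as one of the two epochs is within the
  horizon, since later ones may differ.\<close>

lemma completion_cong_arrivals:
  assumes a: "regular_arrivals a" "regular_arrivals a'" and J: "regular_services J"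
    and eq: "\<And>t. 0 \<le> t \<Longrightarrow> t \<le> r \<Longrightarrow> a t = a' t" and "0 \<le> t" "t \<le> r"
  shows "completion a J 0 n v \<le> t \<longleftrightarrow> completion a' J 0 n v \<le> t"
proof -
  have av: "available a 0 n v = available a' 0 n v"
    if "available a 0 n v \<le> r \<or> available a' 0 n v \<le> r" for v
  proof -
    have iff: "available a 0 n v \<le> t \<longleftrightarrow> available a' 0 n v \<le> t" if "0 \<le> t" "t \<le> r" for t
      using available_le_iff[OF a(1) that(1)] available_le_iff[OF a(2) that(1)] eq[OF that] by simp
    have "0 \<le> available a 0 n v" "0 \<le> available a' 0 n v"
      using available_nonneg[OF a(1)] available_nonneg[OF a(2)] by auto
    then show ?thesis using that iff by (meson order_antisym order_refl order_trans)
  qed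
  have comp: "completion a J 0 n v = completion a' J 0 n v"
    if "completion a J 0 n v \<le> r \<or> completion a' J 0 n v \<le> r" for v
    using that
  proof (induction v)
    case (Suc v)
    have "J v > 0" using J by (simp add: regular_services_def)
    then have 1: "completion a J 0 n v \<le> r \<and> available a 0 n v \<le> r \<or>
      completion a' J 0 n v \<le> r \<and> available a' 0 n v \<le> r"
      using Suc.prems by auto
    then have "completion a J 0 n v = completion a' J 0 n v" using Suc.IH by blast
    moreover have "available a 0 n v = available a' 0 n v" using 1 av by blast
    ultimately show ?case by simp
  qed simp
  show ?thesis
    using comp[of v] assms(6) by (metis order_trans)
qed

lemma departures_cong_arrivals:
  assumes a: "regular_arrivals a" "regular_arrivals a'" and J: "regular_services J"
    and eq: "\<And>t. 0 \<le> t \<Longrightarrow> t \<le> r \<Longrightarrow> a t = a' t" and t: "0 \<le> t" "t \<le> r"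
  shows "departures a J 0 n t = departures a' J 0 n t"
  using completion_cong_arrivals[OF a J eq t]
  by (simp add: departures_def)

lemma content_at_cong_arrivals:
  assumes w: "w \<in> regular_paths" "w' \<in> regular_paths"
    and eq: "snd w = snd w'" "\<And>q t. 0 \<le> t \<Longrightarrow> t \<le> r \<Longrightarrow> fst w q t = fst w' q t"
    and t: "0 \<le> t" "t \<le> r"
  shows "content_at k n w t = content_at k n w' t"
proof (cases k)
  case (Visit i)
  have "departures (fst w i) (snd w') 0 (n i) t = departures (fst w' i) (snd w') 0 (n i) t"
    using regular_pathsD[OF w(1)] regular_pathsD[OF w(2)] eq(2) t
    by (intro departures_cong_arrivals[where r = r]) auto
  moreover have "fst w q t = fst w' q t" for q using eq(2) t by blast
  ultimately show ?thesis
    unfolding Visit fun_eq_iff content_at_Visit[OF w(1)] content_at_Visit[OF w(2)] eq(1) by simp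
next
  case Travel
  then show ?thesis using eq t by (auto simp: fun_eq_iff content_at_Travel w)
qed

lemma stop_set_cong_content:
  assumes "snd w 0 = snd w' 0 \<or> k \<noteq> Travel"
    and "\<And>t. 0 \<le> t \<Longrightarrow> t \<le> e \<Longrightarrow> content_at k n w t = content_at k n w' t"
    and "e \<in> stop_set \<mu> p k n w"
  shows "e \<in> stop_set \<mu> p k n w'"
proof (cases k)
  case (Visit i)
  obtain b where "0 \<le> b" "b \<le> e" "0 \<le> Pi_B \<mu> p i (content_at k n w b)"
    "Pi_C \<mu> p i (content_at k n w e) \<le> 0" "0 \<le> e"
    using assms(3) unfolding Visit mem_stop_set_Visit by blast
  moreover from this have "content_at k n w e = content_at k n w' e"
    "content_at k n w b = content_at k n w' b"
    by (simp_all add: assms(2))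
  ultimately show ?thesis unfolding Visit mem_stop_set_Visit by auto
next
  case Travel
  then show ?thesis using assms(1,3) by (simp add: mem_stop_set_Travel)
qed

text \<open>Whether a step has ended by time \<open>r\<close>, when, and with which contents is
  decided by the arrivals up to \<open>r\<close>: the stopping time property on the level of single
  paths.\<close>

lemma duration_cong_arrivals:
  assumes w: "w \<in> regular_paths" "w' \<in> regular_paths"
    and eq: "snd w = snd w'" "\<And>q t. 0 \<le> t \<Longrightarrow> t \<le> r \<Longrightarrow> fst w q t = fst w' q t"
    and stop: "stop_set \<mu> p k n w \<noteq> {}" "duration \<mu> p k n w \<le> r"
  shows "stop_set \<mu> p k n w' \<noteq> {}" "duration \<mu> p k n w' = duration \<mu> p k n w"
    "content_at k n w' (duration \<mu> p k n w') = content_at k n w (duration \<mu> p k n w)"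
proof -
  have c: "content_at k n w t = content_at k n w' t" if "0 \<le> t" "t \<le> r" for t
    by (rule content_at_cong_arrivals[OF w eq that])
  have st: "e \<in> stop_set \<mu> p k n w \<longleftrightarrow> e \<in> stop_set \<mu> p k n w'" if "e \<le> r" for e
    by (rule iffI; rule stop_set_cong_content) (use eq c that in auto)
  have mem: "duration \<mu> p k n w \<in> stop_set \<mu> p k n w'"
    using duration_mem[OF w(1) stop(1)] st stop(2) by blast
  then show ne: "stop_set \<mu> p k n w' \<noteq> {}" by auto
  have le: "duration \<mu> p k n w' \<le> duration \<mu> p k n w" using duration_le[OF mem] .
  then have "duration \<mu> p k n w' \<in> stop_set \<mu> p k n w"
    using duration_mem[OF w(2) ne] st stop(2) by (meson order_trans)
  then show d: "duration \<mu> p k n w' = duration \<mu> p k n w"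
    using duration_le le by (metis order_antisym)
  show "content_at k n w' (duration \<mu> p k n w') = content_at k n w (duration \<mu> p k n w)"
    unfolding d using c stop(2) duration_nonneg by metis
qed

lemma completion_cong_services:
  assumes "\<And>u. u < v \<Longrightarrow> J u = J' u"
  shows "completion a J 0 n v = completion a J' 0 n v"
  using assms by (induction v) auto

text \<open>Before the completion of \<open>v\<close> services only the service times numbered below
  \<open>v\<close> have had any effect.\<close>

lemma departures_cong_services:
  assumes a: "regular_arrivals a" and J: "regular_services J" "regular_services J'"
    and eq: "\<And>u. u < v \<Longrightarrow> J u = J' u" and t: "0 \<le> t" "t < completion a J 0 n v"
  shows "departures a J 0 n t = departures a J' 0 n t"
proof -
  define d where "d = departures a J 0 n t"
  have d: "completion a J 0 n d \<le> t" "t < completion a J 0 n (Suc d)"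
    using departures_eq_iff[OF a J(1) t(1), of n d] by (auto simp: d_def)
  then have "completion a J 0 n d < completion a J 0 n v" using t by linarith
  then have "d < v" using completion_mono[OF a J(1), of v d n] by (meson not_less)
  then have "completion a J' 0 n d \<le> t" "t < completion a J' 0 n (Suc d)"
    using d eq completion_cong_services[of d J J' a n] completion_cong_services[of "Suc d" J J' a n]
    by auto
  then have "departures a J' 0 n t = d" using departures_eq_iff[OF a J(2) t(1), of n d] by simp
  then show ?thesis by (simp add: d_def)
qed

text \<open>
  This makes the number of services started a stopping time for the service times.
\<close>

lemma completion_stop_cong_services:
  assumes w: "w \<in> regular_paths" "w' \<in> regular_paths" and A: "fst w = fst w'"
    and eq: "\<And>u. u < v \<Longrightarrow> snd w u = snd w' u"
    and le: "\<And>e. e \<in> stop_set \<mu> p (Visit i) n w \<Longrightarrow> completion (fst w i) (snd w) 0 (n i) v \<le> e"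
    and e: "e \<in> stop_set \<mu> p (Visit i) n w'"
  shows "completion (fst w' i) (snd w') 0 (n i) v \<le> e"
proof (rule ccontr)
  have comp: "completion (fst w' i) (snd w') 0 (n i) v = completion (fst w i) (snd w) 0 (n i) v"
    using completion_cong_services[of v "snd w" "snd w'"] eq A by simp
  assume "\<not> ?thesis"
  then have less: "e < completion (fst w i) (snd w) 0 (n i) v" by (simp add: comp)
  have "content_at (Visit i) n w t = content_at (Visit i) n w' t" if "0 \<le> t" "t \<le> e" for t
  proof -
    have "departures (fst w i) (snd w) 0 (n i) t = departures (fst w i) (snd w') 0 (n i) t"
      using regular_pathsD[OF w(1)] regular_pathsD[OF w(2)] eq that less
      by (intro departures_cong_services[where v = v]) auto
    then show ?thesis by (auto simp: fun_eq_iff content_at_Visit w A)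
  qed
  then have "e \<in> stop_set \<mu> p (Visit i) n w"
    using e by (intro stop_set_cong_content[of w' w "Visit i" e n \<mu> p]) auto
  then show False using le less by force
qed


subsection \<open>Shifts in time\<close>

lemma regular_shift:
  assumes a: "\<And>q. regular_arrivals (A q)" and \<Phi>: "\<Phi> \<ge> 0"
  shows "regular_arrivals (shift_arrivals A \<Phi> q)"
  unfolding regular_arrivals_def
proof (intro conjI allI impI)
  show "mono_on {0..} (shift_arrivals A \<Phi> q)"
  proof (rule mono_onI)
    fix s t :: real assume "s \<in> {0..}" "s \<le> t"
    then have "A q (\<Phi> + s) \<le> A q (\<Phi> + t)"
      using \<Phi> by (intro regular_arrivals_mono[OF a]) auto
    then show "shift_arrivals A \<Phi> q s \<le> shift_arrivals A \<Phi> q t"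
      unfolding shift_arrivals_def by (rule diff_le_mono)
  qed
next
  fix t :: real assume "t \<ge> 0"
  then have "\<Phi> + t \<ge> 0" using \<Phi> by simp
  then obtain e where e: "e > 0" "\<forall>u\<in>{\<Phi> + t..\<Phi> + t + e}. A q u = A q (\<Phi> + t)"
    using regular_arrivals_right[OF a] by blast
  have "shift_arrivals A \<Phi> q u = shift_arrivals A \<Phi> q t" if "u \<in> {t..t + e}" for u
  proof -
    have "\<Phi> + u \<in> {\<Phi> + t..\<Phi> + t + e}" using that by simp
    then have "A q (\<Phi> + u) = A q (\<Phi> + t)" using e(2) by blast
    then show ?thesis by (simp add: shift_arrivals_def)
  qed
  then show "\<exists>e>0. \<forall>u\<in>{t..t + e}. shift_arrivals A \<Phi> q u = shift_arrivals A \<Phi> q t"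
    using e(1) by blast
next
  fix m
  obtain t where t: "t \<ge> 0" "A q \<Phi> + m \<le> A q t" using regular_arrivals_unbounded[OF a] by blast
  moreover have "A q t \<le> A q (\<Phi> + t)" using regular_arrivals_mono[OF a, of t "\<Phi> + t"] t \<Phi> by simp
  ultimately have "m \<le> shift_arrivals A \<Phi> q t" by (simp add: shift_arrivals_def)
  then show "\<exists>t\<ge>0. m \<le> shift_arrivals A \<Phi> q t" using t(1) by blast
qed (simp add: shift_arrivals_def)

lemma image_plus_Collect:
  fixes c :: real
  shows "{t. P t} = (+) c ` {t. P (c + t)}"
proof (intro set_eqI iffI)
  fix x assume "x \<in> {t. P t}"
  then have "x - c \<in> {t. P (c + t)}" by simp
  then have "c + (x - c) \<in> (+) c ` {t. P (c + t)}" by (rule imageI)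
  then show "x \<in> (+) c ` {t. P (c + t)}" by simp
qed auto

text \<open>All infima in the definition of a visit are translated by \<Phi>. The visit has to end,
  because the infimum of an empty set carries no meaning and would not translate.\<close>

lemma visit_shift:
  fixes \<mu> \<Phi> :: real and p :: policy and i :: queue and n :: content
  assumes a: "\<And>q. regular_arrivals (A q)" and J: "regular_services J" and \<Phi>: "\<Phi> \<ge> 0"
  defines "w \<equiv> (shift_arrivals A \<Phi>, J)"
  assumes ne: "stop_set \<mu> p (Visit i) n w \<noteq> {}"
  shows "visit \<mu> p A J i (\<Phi>, n) =
    (\<Phi> + duration \<mu> p (Visit i) n w, content_at (Visit i) n w (duration \<mu> p (Visit i) n w))"
proof -
  have w: "w \<in> regular_paths"
    using regular_shift[OF a \<Phi>] J by (simp add: regular_paths_def w_def)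
  note aw = regular_pathsD(1)[OF w, of i]
  have av: "available (A i) \<Phi> m v = \<Phi> + available (fst w i) 0 m v" for m v
  proof -
    let ?S = "{t. 0 \<le> t \<and> v < m + (fst w i t - fst w i 0)}"
    obtain s where "s \<ge> 0" "Suc v \<le> fst w i s" using regular_arrivals_unbounded[OF aw] by blast
    then have "s \<in> ?S" using regular_pathsD(3)[OF w, of i] by simp
    then have "?S \<noteq> {}" by blast
    moreover have "bdd_below ?S" by (rule bdd_belowI[of _ 0]) auto
    moreover have "{t. \<Phi> \<le> t \<and> v < m + (A i t - A i \<Phi>)} = (+) \<Phi> ` ?S"
      by (subst image_plus_Collect[of _ \<Phi>]) (simp add: w_def shift_arrivals_def)
    ultimately show ?thesis by (simp add: available_def Inf_plus_image)
  qed
  have comp: "completion (A i) J \<Phi> m v = \<Phi> + completion (fst w i) J 0 m v" for m v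
    by (induction v) (auto simp: av max_def)
  have dep: "departures (A i) J \<Phi> m (\<Phi> + t) = departures (fst w i) J 0 m t" for m t
    by (simp add: departures_def comp)
  have cont: "visit_content A J i \<Phi> n (\<Phi> + t) = content_at (Visit i) n w t" for t
    by (auto simp: fun_eq_iff visit_content_def content_at_def dep w_def shift_arrivals_def)
  let ?B = "{b. 0 \<le> b \<and> Pi_B \<mu> p i (content_at (Visit i) n w b) \<ge> 0}"
  obtain e where "e \<in> stop_set \<mu> p (Visit i) n w" using ne by blast
  then have B: "?B \<noteq> {}" unfolding mem_stop_set_Visit by blast
  have bl: "beginning_length \<mu> p A J i \<Phi> n = Inf ?B"
  proof -
    have "{t. \<Phi> \<le> t \<and> Pi_B \<mu> p i (visit_content A J i \<Phi> n t) \<ge> 0} = (+) \<Phi> ` ?B"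
      by (subst image_plus_Collect[of _ \<Phi>]) (simp add: cont)
    moreover have "bdd_below ?B" by (rule bdd_belowI[of _ 0]) auto
    ultimately show ?thesis using B by (simp add: beginning_length_def Inf_plus_image)
  qed
  have cl: "concluding_length \<mu> p A J i \<Phi> n = Inf (stop_set \<mu> p (Visit i) n w) - Inf ?B"
  proof -
    have "{t. \<Phi> + Inf ?B \<le> t \<and> Pi_C \<mu> p i (visit_content A J i \<Phi> n t) \<le> 0}
        = (+) \<Phi> ` stop_set \<mu> p (Visit i) n w"
      unfolding stop_set_Visit(1)[OF w B]
      by (subst image_plus_Collect[of _ \<Phi>]) (simp add: cont)
    then show ?thesis using ne by (simp add: concluding_length_def bl Let_def Inf_plus_image)
  qed
  have "visit_length \<mu> p A J i \<Phi> n = duration \<mu> p (Visit i) n w"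
    using ne by (simp add: visit_length_def bl cl duration_def)
  then show ?thesis by (simp add: visit_def Let_def cont)
qed

lemma travel_shift:
  fixes \<mu> \<Phi> :: real and p :: policy and n :: content
  assumes a: "\<And>q. regular_arrivals (A q)" and J: "regular_services U" and \<Phi>: "\<Phi> \<ge> 0"
  defines "w \<equiv> (shift_arrivals A \<Phi>, U)"
  shows "travel A (U 0) (\<Phi>, n) =
    (\<Phi> + duration \<mu> p Travel n w, content_at Travel n w (duration \<mu> p Travel n w))"
proof -
  have w: "w \<in> regular_paths"
    using regular_shift[OF a \<Phi>] J by (simp add: regular_paths_def w_def)
  show ?thesis
    by (simp add: travel_def duration_Travel[OF w] fun_eq_iff content_at_Travel[OF w])
      (simp add: w_def shift_arrivals_def)
qed


subsection \<open>Idling\<close>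

text \<open>
  The server can idle only while the other queue is below its threshold, since an empty queue
  ends the concluding phase; \<open>\<kappa>\<close> bounds the total idle time.
\<close>

lemma visit_time_le:
  assumes w: "w \<in> regular_paths" and p: "p \<in> two_phase_policies" and \<mu>: "\<mu> > 0"
    and \<kappa>: "\<kappa> \<ge> 0" "\<And>t. \<kappa> \<le> t \<Longrightarrow> - (\<mu> * beta p i Beginning) \<le> real (n (other i) + fst w (other i) t)"
    and \<tau>: "0 \<le> \<tau>" "\<And>e. e \<in> stop_set \<mu> p (Visit i) n w \<Longrightarrow> \<tau> \<le> e"
  shows "\<tau> \<le> \<kappa> + sum (snd w) {..departures (fst w i) (snd w) 0 (n i) \<tau>}"
proof -
  note a = regular_pathsD(1)[OF w, of i]
  note J = regular_pathsD(2)[OF w]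
  let ?c = "completion (fst w i) (snd w) 0 (n i)"
  let ?av = "available (fst w i) 0 (n i)"
  \<comment> \<open>After \<open>v\<close> services and with no further customer available the own
    queue is empty. From \<kappa> on this makes \<open>Pi_B\<close> nonnegative, while
    \<open>Pi_C\<close> has only nonpositive terms left, so such a \<open>t\<close> is a possible
    end of the visit.\<close>
  have empty: "\<tau> \<le> t" if t: "\<kappa> \<le> t" "?c v \<le> t" "t < ?av v" for t v
  proof -
    have t0: "t \<ge> 0" using \<kappa> t by linarith
    have "v \<le> departures (fst w i) (snd w) 0 (n i) t"
      using less_departures_iff[OF a J t0, of v] t by simp
    moreover have "\<not> v < n i + fst w i t" using available_le_iff[OF a t0, of "n i" v] t by simp
    ultimately have "content_at (Visit i) n w t i = 0" by (simp add: content_at_Visit[OF w])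
    moreover have "content_at (Visit i) n w t (other i) = n (other i) + fst w (other i) t"
      by (simp add: content_at_Visit[OF w])
    moreover have "alpha p i Concluding * real (n (other i) + fst w (other i) t) \<le> 0"
      "\<mu> * beta p i Concluding \<le> 0"
      using p \<mu> by (simp_all add: two_phase_policies_def mult_nonpos_nonneg mult_nonneg_nonpos)
    ultimately have "Pi_B \<mu> p i (content_at (Visit i) n w t) \<ge> 0"
      and "Pi_C \<mu> p i (content_at (Visit i) n w t) \<le> 0"
      using \<kappa>(2)[OF t(1)] by (simp_all add: Pi_B_def Pi_C_def)
    then have "t \<in> stop_set \<mu> p (Visit i) n w" using t0 unfolding mem_stop_set_Visit by blast
    then show ?thesis by (rule \<tau>(2))
  qed
  have Jpos: "snd w v > 0" for v using J by (simp add: regular_services_def)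
  \<comment> \<open>Before \<tau> the server can only idle up to time \<kappa>, so completions lag
    behind the accumulated service time by at most \<kappa>.\<close>
  have c: "?c v \<le> \<kappa> + sum (snd w) {..<v}" if "?c v \<le> \<tau>" for v
    using that
  proof (induction v)
    case (Suc v)
    have v: "?c v \<le> \<tau>" using Suc.prems completion_Suc_gt[OF a J, of "n i" v] by linarith
    note IH = Suc.IH[OF v]
    have "?av v \<le> max (?c v) \<kappa>"
    proof (rule ccontr)
      assume "\<not> ?thesis"
      then have "\<tau> \<le> max (?c v) \<kappa>" by (intro empty[of _ v]) auto
      moreover have "\<dots> < ?c (Suc v)" using Jpos[of v] \<open>\<not> ?av v \<le> max (?c v) \<kappa>\<close> by auto
      ultimately show False using Suc.prems by linarith
    qed
    moreover have "0 \<le> sum (snd w) {..<v}" using Jpos by (intro sum_nonneg) (auto intro: less_imp_le)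
    ultimately show ?case using IH by auto
  qed (use \<kappa> in simp)
  define d where "d = departures (fst w i) (snd w) 0 (n i) \<tau>"
  have d: "?c d \<le> \<tau>" "\<tau> < ?c (Suc d)"
    using departures_eq_iff[OF a J \<tau>(1), of "n i" d] by (auto simp: d_def)
  have sum0: "0 \<le> sum (snd w) {..<d}" using Jpos by (intro sum_nonneg) (auto intro: less_imp_le)
  \<comment> \<open>The service in progress at \<tau> is counted in full; hence one more service
    time than there are departures.\<close>
  have "\<tau> \<le> \<kappa> + sum (snd w) {..<Suc d}"
  proof (cases "?av d \<le> max (?c d) \<kappa>")
    case True
    then show ?thesis using c[OF d(1)] d(2) sum0 by auto
  next
    case False
    then have "\<tau> \<le> max (?c d) \<kappa>" by (intro empty[of _ d]) auto
    then show ?thesis using c[OF d(1)] sum0 Jpos[of d] by auto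
  qed
  then show ?thesis by (simp add: d_def lessThan_Suc_atMost)
qed

subsection \<open>Measurability on the space of regular paths\<close>

lemma measurable_countableI:
  fixes f :: "'a \<Rightarrow> 'b::countable"
  assumes "\<And>y. {x\<in>space F. f x = y} \<in> sets F"
  shows "f \<in> measurable F (count_space UNIV)"
proof (subst measurable_count_space_eq2_countable)
  have "f -` {y} \<inter> space F = {x\<in>space F. f x = y}" for y by auto
  then show "f \<in> space F \<rightarrow> UNIV \<and> (\<forall>a\<in>UNIV. f -` {a} \<inter> space F \<in> sets F)"
    using assms by simp
qed

text \<open>The least multiple of \<open>1 / (n + 1)\<close> strictly above a nonnegative
  \<open>x\<close>. Random times are approximated from the right by times with countably many
  values, as right-continuous paths require.\<close>

definition mesh :: "nat \<Rightarrow> real \<Rightarrow> real" where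
  "mesh n x = real (Suc (nat \<lfloor>real (Suc n) * x\<rfloor>)) / real (Suc n)"

lemma mesh_bounds:
  assumes "x \<ge> 0"
  shows "x < mesh n x" "mesh n x \<le> x + 1 / real (Suc n)"
proof -
  have *: "real (Suc (nat \<lfloor>real (Suc n) * x\<rfloor>)) = of_int \<lfloor>real (Suc n) * x\<rfloor> + 1"
    using assms by (simp add: add.commute)
  have "real (Suc n) * x < real (Suc (nat \<lfloor>real (Suc n) * x\<rfloor>))"
    unfolding * by linarith
  then show "x < mesh n x"
    unfolding mesh_def by (subst pos_less_divide_eq) (simp_all add: mult.commute)
  have "real (Suc (nat \<lfloor>real (Suc n) * x\<rfloor>)) \<le> real (Suc n) * x + 1"
    unfolding * by linarith
  also have "\<dots> = (x + 1 / real (Suc n)) * real (Suc n)"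
    by (simp add: field_simps)
  finally show "mesh n x \<le> x + 1 / real (Suc n)"
    unfolding mesh_def by (subst pos_divide_le_eq) auto
qed

lemma eventually_mesh:
  assumes "x \<ge> 0" "e > 0"
  shows "eventually (\<lambda>n. mesh n x \<in> {x..x + e}) sequentially"
proof -
  obtain N where N: "1 / real (Suc N) < e" using assms(2) nat_approx_posE by blast
  have "mesh n x \<in> {x..x + e}" if "n \<ge> N" for n
  proof -
    have "1 / real (Suc n) \<le> 1 / real (Suc N)" using that by (simp add: frac_le)
    then show ?thesis using mesh_bounds[OF assms(1), of n] N by auto
  qed
  then show ?thesis by (auto simp: eventually_sequentially)
qed

text \<open>At a time with countably many values the composition is measurable piece by piece.
  Constancy to the right makes the approximation by \<open>mesh\<close> exact from some
  \<open>n\<close> on, so no limit of values is involved.\<close>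

lemma measurable_right_constant_compose:
  fixes g :: "real \<Rightarrow> 'a \<Rightarrow> 'b::countable"
  assumes T [measurable]: "T \<in> borel_measurable F" and T0: "\<And>\<omega>. \<omega> \<in> space F \<Longrightarrow> 0 \<le> T \<omega>"
    and g: "\<And>t. 0 \<le> t \<Longrightarrow> g t \<in> measurable F (count_space UNIV)"
    and right: "\<And>\<omega> t. \<omega> \<in> space F \<Longrightarrow> 0 \<le> t \<Longrightarrow> \<exists>e>0. \<forall>u\<in>{t..t + e}. g u \<omega> = g t \<omega>"
  shows "(\<lambda>\<omega>. g (T \<omega>) \<omega>) \<in> measurable F (count_space UNIV)"
proof (rule measurable_countableI)
  fix y
  have [measurable]: "(\<lambda>\<omega>. g (mesh n (T \<omega>)) \<omega>) \<in> measurable F (count_space UNIV)" for n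
  proof -
    have [measurable]: "g (real (Suc i) / real (Suc n)) \<in> measurable F (count_space UNIV)" for i
      by (rule g) simp
    have "(\<lambda>\<omega>. (\<lambda>i \<omega>. g (real (Suc i) / real (Suc n)) \<omega>) (nat \<lfloor>real (Suc n) * T \<omega>\<rfloor>) \<omega>)
        \<in> measurable F (count_space UNIV)"
      by (rule measurable_compose_countable) measurable
    then show ?thesis by (simp add: mesh_def)
  qed
  have "g (T \<omega>) \<omega> = y \<longleftrightarrow> (\<exists>m. \<forall>n\<ge>m. g (mesh n (T \<omega>)) \<omega> = y)" if w: "\<omega> \<in> space F" for \<omega>
  proof -
    obtain e where e: "e > 0" "\<forall>u\<in>{T \<omega>..T \<omega> + e}. g u \<omega> = g (T \<omega>) \<omega>"
      using right[OF w T0[OF w]] by blast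
    obtain N where N: "\<And>n. n \<ge> N \<Longrightarrow> mesh n (T \<omega>) \<in> {T \<omega>..T \<omega> + e}"
      using eventually_mesh[OF T0[OF w] e(1)] unfolding eventually_sequentially by blast
    have *: "g (mesh n (T \<omega>)) \<omega> = g (T \<omega>) \<omega>" if "n \<ge> N" for n
      using e(2) N[OF that] by blast
    show ?thesis
    proof
      show "g (T \<omega>) \<omega> = y" if "\<exists>m. \<forall>n\<ge>m. g (mesh n (T \<omega>)) \<omega> = y"
        using that * by (metis nle_le)
    qed (use * in blast)
  qed
  then have "{\<omega>\<in>space F. g (T \<omega>) \<omega> = y} = {\<omega>\<in>space F. \<exists>m. \<forall>n\<ge>m. g (mesh n (T \<omega>)) \<omega> = y}"
    by blast
  also have "\<dots> \<in> sets F" by measurable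
  finally show "{\<omega>\<in>space F. g (T \<omega>) \<omega> = y} \<in> sets F" .
qed

section \<open>The sigma-algebra of regular paths\<close>

definition cylinder ::
  "real set \<Rightarrow> (queue \<Rightarrow> real \<Rightarrow> nat set) \<Rightarrow> nat set \<Rightarrow> (nat \<Rightarrow> real set) \<Rightarrow> path set" where
  "cylinder T G V B = {w\<in>regular_paths.
     (\<forall>q. \<forall>t\<in>T. fst w q t \<in> G q t) \<and> (\<forall>v\<in>V. snd w v \<in> B v)}"

definition cylinders :: "path set set" where
  "cylinders = {cylinder T G V B | T G V B.
     finite T \<and> T \<subseteq> {0..} \<and> finite V \<and> (\<forall>v. B v \<in> sets borel)}"

definition path_space :: "path measure" where
  "path_space = sigma regular_paths cylinders"

lemma cylindersI:
  "finite T \<Longrightarrow> T \<subseteq> {0..} \<Longrightarrow> finite V \<Longrightarrow> (\<And>v. B v \<in> sets borel) \<Longrightarrow> cylinder T G V B \<in> cylinders"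
  unfolding cylinders_def by blast

lemma cylinders_Pow: "cylinders \<subseteq> Pow regular_paths"
  by (auto simp: cylinders_def cylinder_def)

lemma space_path_space [simp]: "space path_space = regular_paths"
  using cylinders_Pow by (simp add: path_space_def space_measure_of)

lemma regular_paths_sets [measurable, simp]: "regular_paths \<in> sets path_space"
  by (metis sets.top space_path_space)

lemma sets_path_space: "sets path_space = sigma_sets regular_paths cylinders"
  using cylinders_Pow by (simp add: path_space_def sets_measure_of)

lemma cylinder_Int:
  "cylinder T1 G1 V1 B1 \<inter> cylinder T2 G2 V2 B2 = cylinder (T1 \<union> T2)
     (\<lambda>q t. (if t \<in> T1 then G1 q t else UNIV) \<inter> (if t \<in> T2 then G2 q t else UNIV)) (V1 \<union> V2)
     (\<lambda>v. (if v \<in> V1 then B1 v else UNIV) \<inter> (if v \<in> V2 then B2 v else UNIV))"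
  by (auto simp: cylinder_def)

lemma Int_stable_cylinders: "Int_stable cylinders"
proof (rule Int_stableI)
  fix a b assume "a \<in> cylinders" "b \<in> cylinders"
  then obtain T1 G1 V1 B1 T2 G2 V2 B2 where
    "a = cylinder T1 G1 V1 B1" "finite T1" "T1 \<subseteq> {0..}" "finite V1" "\<forall>v. B1 v \<in> sets borel"
    "b = cylinder T2 G2 V2 B2" "finite T2" "T2 \<subseteq> {0..}" "finite V2" "\<forall>v. B2 v \<in> sets borel"
    unfolding cylinders_def by blast
  then show "a \<inter> b \<in> cylinders"
    by (simp only: cylinder_Int) (rule cylindersI, auto)
qed

lemma measurable_arrivals_path [measurable]:
  assumes "0 \<le> t"
  shows "(\<lambda>w. fst w q t) \<in> measurable path_space (count_space UNIV)"
proof (rule measurable_countableI)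
  fix y
  have "cylinder {t} (\<lambda>q' _. if q' = q then {y} else UNIV) {} (\<lambda>_. UNIV) \<in> cylinders"
    using assms by (intro cylindersI) auto
  moreover have "cylinder {t} (\<lambda>q' _. if q' = q then {y} else UNIV) {} (\<lambda>_. UNIV) =
      {w\<in>space path_space. fst w q t = y}"
    by (auto simp: cylinder_def)
  ultimately show "{w\<in>space path_space. fst w q t = y} \<in> sets path_space"
    by (auto simp: sets_path_space)
qed

lemma measurable_services_path [measurable]: "(\<lambda>w. snd w v) \<in> borel_measurable path_space"
proof (rule measurableI)
  fix A :: "real set" assume "A \<in> sets borel"
  then have "cylinder {} (\<lambda>_ _. UNIV) {v} (\<lambda>_. A) \<in> cylinders"
    by (intro cylindersI) auto
  moreover have "cylinder {} (\<lambda>_ _. UNIV) {v} (\<lambda>_. A) = (\<lambda>w. snd w v) -` A \<inter> space path_space"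
    by (auto simp: cylinder_def)
  ultimately show "(\<lambda>w. snd w v) -` A \<inter> space path_space \<in> sets path_space"
    by (auto simp: sets_path_space)
qed simp

lemma measurable_path_space:
  assumes reg: "\<And>\<omega>. \<omega> \<in> space F \<Longrightarrow> f \<omega> \<in> regular_paths"
    and A: "\<And>q t. 0 \<le> t \<Longrightarrow> (\<lambda>\<omega>. fst (f \<omega>) q t) \<in> measurable F (count_space UNIV)"
    and U [measurable]: "\<And>v. (\<lambda>\<omega>. snd (f \<omega>) v) \<in> borel_measurable F"
  shows "f \<in> measurable F path_space"
  unfolding path_space_def
proof (rule measurable_measure_of[OF cylinders_Pow])
  fix a assume "a \<in> cylinders"
  then obtain T G V B where a: "a = cylinder T G V B" and fin: "finite T" "T \<subseteq> {0..}" "finite V"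
    and B [measurable]: "\<And>v. B v \<in> sets borel"
    unfolding cylinders_def by blast
  have 1: "{\<omega>\<in>space F. \<forall>q. \<forall>t\<in>T. fst (f \<omega>) q t \<in> G q t} \<in> sets F"
  proof -
    have "{\<omega>\<in>space F. fst (f \<omega>) q t \<in> G q t} \<in> sets F" if "t \<in> T" for q t
      using measurable_sets[OF A[of t q], of "G q t"] fin that by (auto simp: vimage_def Int_def conj_commute)
    then show ?thesis
      unfolding all_queue by (intro sets.sets_Collect_conj sets.sets_Collect_finite_All fin) auto
  qed
  have 2: "{\<omega>\<in>space F. \<forall>v\<in>V. snd (f \<omega>) v \<in> B v} \<in> sets F"
    using fin(3) by (intro sets.sets_Collect_finite_All) auto
  have "f -` a \<inter> space F = {\<omega>\<in>space F. \<forall>q. \<forall>t\<in>T. fst (f \<omega>) q t \<in> G q t} \<inter>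
      {\<omega>\<in>space F. \<forall>v\<in>V. snd (f \<omega>) v \<in> B v}"
    using reg by (auto simp: a cylinder_def)
  then show "f -` a \<inter> space F \<in> sets F" using 1 2 by auto
qed (use reg in auto)

section \<open>Measurability of epochs, contents and durations\<close>

lemma available_measurable [measurable]:
  "(\<lambda>w. available (fst w i) 0 m v) \<in> borel_measurable path_space"
  unfolding borel_measurable_iff_le
proof
  fix c :: real
  show "{w\<in>space path_space. available (fst w i) 0 m v \<le> c} \<in> sets path_space"
  proof (cases "0 \<le> c")
    case True
    note measurable_arrivals_path[OF True, measurable]
    have "available (fst w i) 0 m v \<le> c \<longleftrightarrow> v < m + fst w i c" if "w \<in> regular_paths" for w
      using available_le_iff[OF regular_pathsD(1)[OF that] True] .
    then have "{w\<in>space path_space. available (fst w i) 0 m v \<le> c} = {w\<in>space path_space. v < m + fst w i c}"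
      unfolding space_path_space by blast
    also have "\<dots> \<in> sets path_space" by measurable
    finally show ?thesis .
  next
    case False
    have "\<not> available (fst w i) 0 m v \<le> c" if "w \<in> regular_paths" for w
      using available_nonneg[OF regular_pathsD(1)[OF that], of i m v] False by linarith
    then have "{w\<in>space path_space. available (fst w i) 0 m v \<le> c} = {}" by simp
    then show ?thesis by (metis sets.empty_sets)
  qed
qed

lemma completion_measurable [measurable]:
  "(\<lambda>w. completion (fst w i) (snd w) 0 m v) \<in> borel_measurable path_space"
  by (induction v) simp_all

lemma departures_measurable:
  assumes "0 \<le> t"
  shows "(\<lambda>w. departures (fst w i) (snd w) 0 m t) \<in> measurable path_space (count_space UNIV)"
proof (rule measurable_countableI)
  fix d
  have "departures (fst w i) (snd w) 0 m t = d \<longleftrightarrow>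
      completion (fst w i) (snd w) 0 m d \<le> t \<and> t < completion (fst w i) (snd w) 0 m (Suc d)"
    if "w \<in> regular_paths" for w
    using departures_eq_iff[OF regular_pathsD(1)[OF that] regular_pathsD(2)[OF that] assms] .
  then have "{w\<in>space path_space. departures (fst w i) (snd w) 0 m t = d} = {w\<in>space path_space.
      completion (fst w i) (snd w) 0 m d \<le> t \<and> t < completion (fst w i) (snd w) 0 m (Suc d)}"
    unfolding space_path_space by blast
  also have "\<dots> \<in> sets path_space"
    by (simp del: completion.simps space_path_space)
  finally show "{w\<in>space path_space. departures (fst w i) (snd w) 0 m t = d} \<in> sets path_space" .
qed

lemma content_at_measurable:
  assumes "0 \<le> t"
  shows "(\<lambda>w. content_at k n w t) \<in> measurable path_space (count_space UNIV)"
proof (rule measurable_countableI)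
  fix y :: content
  note measurable_arrivals_path[OF assms, measurable] departures_measurable[OF assms, measurable]
  have [measurable]: "(\<lambda>w. content_at k n w t q) \<in> measurable path_space (count_space UNIV)" for q
  proof (cases k)
    case (Visit i)
    have "(\<lambda>w. n q + fst w q t - (if q = i then departures (fst w i) (snd w) 0 (n i) t else 0))
        \<in> measurable path_space (count_space UNIV)"
      by (cases "q = i") simp_all
    then show ?thesis
      unfolding Visit by (rule measurable_cong[THEN iffD2, rotated]) (simp add: content_at_Visit)
  next
    case Travel
    have "(\<lambda>w. n q + fst w q t) \<in> measurable path_space (count_space UNIV)" by simp
    then show ?thesis
      unfolding Travel by (rule measurable_cong[THEN iffD2, rotated]) (simp add: content_at_Travel)
  qed
  have "{w\<in>space path_space. content_at k n w t = y} =
      {w\<in>space path_space. content_at k n w t Q1 = y Q1 \<and> content_at k n w t Q2 = y Q2}"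
    by (auto simp: fun_eq_iff all_queue)
  also have "\<dots> \<in> sets path_space" by measurable
  finally show "{w\<in>space path_space. content_at k n w t = y} \<in> sets path_space" .
qed

lemma stop_set_measurable:
  assumes "0 \<le> e"
  shows "{w\<in>space path_space. e \<in> stop_set \<mu> p k n w} \<in> sets path_space"
proof (cases k)
  case (Visit i)
  have P: "{w\<in>space path_space. P (content_at k n w t)} \<in> sets path_space" if "0 \<le> t" for P t
  proof -
    have "{w\<in>space path_space. P (content_at k n w t)} =
        (\<lambda>w. content_at k n w t) -` Collect P \<inter> space path_space" by blast
    then show ?thesis using measurable_sets[OF content_at_measurable[OF that], of "Collect P"] by simp
  qed
  \<comment> \<open>The uncountable choice of \<open>b\<close> is reduced to a countable one:
    contents are constant just after \<open>b\<close>, so \<open>b < e\<close> can be moved to a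
    rational number below \<open>e\<close>, and \<open>b = e\<close> is kept as a case of its
    own.\<close>
  have ex: "(\<exists>b. 0 \<le> b \<and> b \<le> e \<and> Pi_B \<mu> p i (content_at (Visit i) n w b) \<ge> 0) \<longleftrightarrow>
      Pi_B \<mu> p i (content_at (Visit i) n w e) \<ge> 0 \<or>
      (\<exists>r::rat. (0 \<le> real_of_rat r \<and> real_of_rat r \<le> e) \<and>
         Pi_B \<mu> p i (content_at (Visit i) n w (real_of_rat r)) \<ge> 0)"
    (is "?L \<longleftrightarrow> ?R") if w: "w \<in> regular_paths" for w
  proof
    assume ?L
    then obtain b where b: "0 \<le> b" "b \<le> e" "Pi_B \<mu> p i (content_at (Visit i) n w b) \<ge> 0" by blast
    show ?R
    proof (cases "b = e")
      case False
      obtain d where d: "d > 0" "\<forall>u\<in>{b..b + d}. content_at (Visit i) n w u = content_at (Visit i) n w b"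
        using content_at_right[OF w b(1)] by blast
      obtain r where r: "b < real_of_rat r" "real_of_rat r < min e (b + d)"
        using of_rat_dense[of b "min e (b + d)"] False b(2) d(1) by fastforce
      then have "real_of_rat r \<in> {b..b + d}" by simp
      then have "content_at (Visit i) n w (real_of_rat r) = content_at (Visit i) n w b"
        using d(2) by blast
      then have "Pi_B \<mu> p i (content_at (Visit i) n w (real_of_rat r)) \<ge> 0" using b(3) by simp
      moreover have "0 \<le> real_of_rat r" "real_of_rat r \<le> e" using r b(1) by linarith+
      ultimately show ?thesis by blast
    qed (use b in blast)
  next
    assume ?R then show ?L using assms by blast
  qed
  have "{w\<in>space path_space. e \<in> stop_set \<mu> p k n w} =
      ({w\<in>space path_space. Pi_B \<mu> p i (content_at (Visit i) n w e) \<ge> 0} \<union>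
      (\<Union>r\<in>{r. 0 \<le> real_of_rat r \<and> real_of_rat r \<le> e}.
         {w\<in>space path_space. Pi_B \<mu> p i (content_at (Visit i) n w (real_of_rat r)) \<ge> 0})) \<inter>
      {w\<in>space path_space. Pi_C \<mu> p i (content_at (Visit i) n w e) \<le> 0}" (is "?L = ?R")
  proof (rule set_eqI)
    fix w
    show "w \<in> ?L \<longleftrightarrow> w \<in> ?R"
    proof (cases "w \<in> regular_paths")
      case True
      show ?thesis
        unfolding Visit mem_Collect_eq mem_stop_set_Visit ex[OF True] using True assms by auto
    qed simp
  qed
  also have "\<dots> \<in> sets path_space"
  proof (intro sets.Int sets.Un sets.countable_UN')
    show "{w\<in>space path_space. Pi_B \<mu> p i (content_at (Visit i) n w e) \<ge> 0} \<in> sets path_space"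
      using P[OF assms, of "\<lambda>c. Pi_B \<mu> p i c \<ge> 0"] unfolding Visit .
    show "{w\<in>space path_space. Pi_C \<mu> p i (content_at (Visit i) n w e) \<le> 0} \<in> sets path_space"
      using P[OF assms, of "\<lambda>c. Pi_C \<mu> p i c \<le> 0"] unfolding Visit .
    show "(\<lambda>r. {w\<in>space path_space. Pi_B \<mu> p i (content_at (Visit i) n w (real_of_rat r)) \<ge> 0}) `
        {r. 0 \<le> real_of_rat r \<and> real_of_rat r \<le> e} \<subseteq> sets path_space"
    proof (rule image_subsetI)
      fix r :: rat assume "r \<in> {r. 0 \<le> real_of_rat r \<and> real_of_rat r \<le> e}"
      then have "0 \<le> real_of_rat r" by blast
      from P[OF this, of "\<lambda>c. Pi_B \<mu> p i c \<ge> 0"]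
      show "{w\<in>space path_space. Pi_B \<mu> p i (content_at (Visit i) n w (real_of_rat r)) \<ge> 0}
          \<in> sets path_space" unfolding Visit .
    qed
    show "countable {r. 0 \<le> real_of_rat r \<and> real_of_rat r \<le> e}" by (rule countableI_type)
  qed
  finally show ?thesis .
next
  case Travel
  have "{w\<in>space path_space. e \<in> stop_set \<mu> p k n w} = {w\<in>space path_space. snd w 0 \<le> e}"
    using assms by (simp add: Travel mem_stop_set_Travel)
  also have "\<dots> \<in> sets path_space" by measurable
  finally show ?thesis .
qed

text \<open>The bound is an extended real, so that infinity covers the event that the step ends at
  all.\<close>

lemma stop_set_less_measurable:
  "{w\<in>space path_space. \<exists>e\<in>stop_set \<mu> p k n w. ereal e < a} \<in> sets path_space"
proof -
  have "(\<exists>e\<in>stop_set \<mu> p k n w. ereal e < a) \<longleftrightarrow>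
      (\<exists>r::rat. (0 \<le> real_of_rat r \<and> ereal (real_of_rat r) < a) \<and> real_of_rat r \<in> stop_set \<mu> p k n w)"
    (is "?L \<longleftrightarrow> ?R") if w: "w \<in> regular_paths" for w
  proof
    assume ?L
    then obtain e where e: "e \<in> stop_set \<mu> p k n w" "ereal e < a" by blast
    obtain d where d: "d > 0" "{e..e + d} \<subseteq> stop_set \<mu> p k n w" using stop_set_right[OF w e(1)] by blast
    obtain c where c: "ereal e < ereal c" "ereal c < a" using ereal_dense2[OF e(2)] by blast
    obtain r where r: "e < real_of_rat r" "real_of_rat r < min c (e + d)"
      using of_rat_dense[of e "min c (e + d)"] c(1) d(1) by fastforce
    have "real_of_rat r \<in> stop_set \<mu> p k n w" using d(2) r by auto
    moreover have "ereal (real_of_rat r) < a" using r(2) c(2) by (metis less_ereal.simps(1) less_trans min_less_iff_conj)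
    moreover have "0 \<le> real_of_rat r" using r stop_set_nonneg[OF e(1)] by linarith
    ultimately show ?R by blast
  qed blast
  then have "{w\<in>space path_space. \<exists>e\<in>stop_set \<mu> p k n w. ereal e < a} =
      (\<Union>r\<in>{r. 0 \<le> real_of_rat r \<and> ereal (real_of_rat r) < a}.
        {w\<in>space path_space. real_of_rat r \<in> stop_set \<mu> p k n w})"
    unfolding space_path_space by blast
  also have "\<dots> \<in> sets path_space"
  proof (intro sets.countable_UN' image_subsetI)
    fix r :: rat assume "r \<in> {r. 0 \<le> real_of_rat r \<and> ereal (real_of_rat r) < a}"
    then have "0 \<le> real_of_rat r" by blast
    then show "{w\<in>space path_space. real_of_rat r \<in> stop_set \<mu> p k n w} \<in> sets path_space"
      by (rule stop_set_measurable)
  qed (rule countableI_type)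
  finally show ?thesis .
qed

lemma stop_set_nonempty_measurable [measurable]:
  "{w\<in>space path_space. stop_set \<mu> p k n w \<noteq> {}} \<in> sets path_space"
proof -
  have "{w\<in>space path_space. stop_set \<mu> p k n w \<noteq> {}} =
      {w\<in>space path_space. \<exists>e\<in>stop_set \<mu> p k n w. ereal e < \<infinity>}" by auto
  then show ?thesis using stop_set_less_measurable[of \<mu> p k n \<infinity>] by simp
qed

lemma duration_less_iff:
  assumes "w \<in> regular_paths" "stop_set \<mu> p k n w \<noteq> {}"
  shows "duration \<mu> p k n w < a \<longleftrightarrow> (\<exists>e\<in>stop_set \<mu> p k n w. ereal e < ereal a)"
  using duration_mem[OF assms] duration_le by fastforce

lemma duration_measurable [measurable]: "duration \<mu> p k n \<in> borel_measurable path_space"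
  unfolding borel_measurable_iff_less
proof
  fix a :: real
  have "{w\<in>space path_space. duration \<mu> p k n w < a} =
     {w\<in>space path_space. stop_set \<mu> p k n w \<noteq> {}} \<inter>
        {w\<in>space path_space. \<exists>e\<in>stop_set \<mu> p k n w. ereal e < ereal a} \<union>
     (if 0 < a then space path_space - {w\<in>space path_space. stop_set \<mu> p k n w \<noteq> {}} else {})"
    (is "?L = ?R")
  proof (rule set_eqI)
    fix w
    show "w \<in> ?L \<longleftrightarrow> w \<in> ?R"
    proof (cases "w \<in> regular_paths \<and> stop_set \<mu> p k n w \<noteq> {}")
      case True
      then show ?thesis using duration_less_iff[of w \<mu> p k n a] by simp
    next
      case False
      then show ?thesis by (auto simp: duration_def)
    qed
  qed
  also have "\<dots> \<in> sets path_space"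
    using stop_set_less_measurable[of \<mu> p k n "ereal a"] stop_set_nonempty_measurable[of \<mu> p k n] by auto
  finally show "{w\<in>space path_space. duration \<mu> p k n w < a} \<in> sets path_space" .
qed

lemma content_at_compose_measurable:
  assumes "T \<in> borel_measurable path_space" "\<And>w. w \<in> regular_paths \<Longrightarrow> 0 \<le> T w"
  shows "(\<lambda>w. content_at k n w (T w)) \<in> measurable path_space (count_space UNIV)"
  by (rule measurable_right_constant_compose[where g = "\<lambda>t w. content_at k n w t"])
    (use assms content_at_measurable content_at_right in auto)

definition outcome :: "real \<Rightarrow> policy \<Rightarrow> kind \<Rightarrow> content \<Rightarrow> path \<Rightarrow> content" where
  "outcome \<mu> p k n w = content_at k n w (duration \<mu> p k n w)"

lemma outcome_measurable [measurable]:
  "outcome \<mu> p k n \<in> measurable path_space (count_space UNIV)"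
  unfolding outcome_def by (rule content_at_compose_measurable) (auto simp: duration_nonneg)

subsection \<open>Past and future of a Poisson process\<close>

text \<open>The sorted list of the given times, continued forever by \<open>b\<close>: independence
  of increments is available for infinite nondecreasing sequences, in which repetitions do no
  harm.\<close>

lemma ex_mono_grid:
  fixes F :: "real set"
  assumes F: "finite F" "F \<subseteq> {0..b}" and b: "0 \<le> b"
  obtains \<tau> :: "nat \<Rightarrow> real" and k where "k > 0" "mono \<tau>" "\<tau> 0 = 0" "\<tau> k = b"
    "\<And>s. s \<in> F \<Longrightarrow> \<exists>l\<le>k. \<tau> l = s"
proof -
  define xs where "xs = sorted_list_of_set (insert 0 F)"
  have set: "set xs = insert 0 F"
    using F by (simp add: xs_def del: sorted_list_of_set_insert_remove)
  have sorted: "sorted xs" by (simp add: xs_def)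
  have ne: "xs \<noteq> []" using set by auto
  define \<tau> where "\<tau> l = (if l < length xs then xs ! l else b)" for l
  have le_b: "x \<le> b" if "x \<in> set xs" for x using that F b set by auto
  show thesis
  proof
    show "length xs > 0" using ne by simp
    show "mono \<tau>"
    proof (rule monoI)
      fix i j :: nat assume "i \<le> j"
      then show "\<tau> i \<le> \<tau> j"
        using sorted le_b by (auto simp: \<tau>_def sorted_nth_mono)
    qed
    have "xs ! 0 = 0"
    proof -
      obtain i where i: "i < length xs" "xs ! i = 0" using set by (metis in_set_conv_nth insertI1)
      then have "xs ! 0 \<le> 0" using sorted_nth_mono[OF sorted, of 0 i] by simp
      moreover have "xs ! 0 \<in> set xs" using ne by simp
      ultimately show ?thesis using set F by auto
    qed
    then show "\<tau> 0 = 0" using ne by (simp add: \<tau>_def)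
    show "\<tau> (length xs) = b" by (simp add: \<tau>_def)
    fix s assume "s \<in> F"
    then obtain i where "i < length xs" "xs ! i = s" using set by (metis in_set_conv_nth insertI2)
    then show "\<exists>l\<le>length xs. \<tau> l = s" by (intro exI[of _ i]) (simp add: \<tau>_def)
  qed
qed

lemma telescope_nat:
  fixes f :: "nat \<Rightarrow> nat"
  assumes "\<And>l. f l \<le> f (Suc l)"
  shows "(\<Sum>j<l. f (Suc j) - f j) = f l - f 0"
proof (induction l)
  case (Suc l)
  have "f 0 \<le> f l" by (rule lift_Suc_mono_le[of f]) (use assms in auto)
  then show ?case using Suc assms[of l] by simp
qed simp

lemma measurable_sum_count_space:
  assumes "finite I" "\<And>i. i \<in> I \<Longrightarrow> f i \<in> measurable F (count_space (UNIV :: nat set))"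
  shows "(\<lambda>x. \<Sum>i\<in>I. f i x) \<in> measurable F (count_space UNIV)"
  using assms
proof (induction rule: finite_induct)
  case (insert i I)
  have [measurable]: "f i \<in> measurable F (count_space UNIV)"
    "(\<lambda>x. \<Sum>i\<in>I. f i x) \<in> measurable F (count_space UNIV)"
    using insert by auto
  have "(\<lambda>x. f i x + (\<Sum>i\<in>I. f i x)) \<in> measurable F (count_space UNIV)" by measurable
  then show ?case using insert by simp
qed simp

context prob_space
begin

lemma poisson_process_measurable:
  "poisson_process M r N \<Longrightarrow> 0 \<le> t \<Longrightarrow> N t \<in> measurable M (count_space UNIV)"
  by (simp add: poisson_process_def)

lemma poisson_process_indep:
  "poisson_process M r N \<Longrightarrow> 0 \<le> \<tau> 0 \<Longrightarrow> mono \<tau> \<Longrightarrow>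
     indep_vars (\<lambda>_. count_space UNIV) (\<lambda>l \<omega>. N (\<tau> (Suc l)) \<omega> - N (\<tau> l) \<omega>) {..<m}"
  by (simp add: poisson_process_def)

lemma poisson_process_increment:
  "poisson_process M r N \<Longrightarrow> 0 \<le> s \<Longrightarrow> s < t \<Longrightarrow>
     distr M (count_space UNIV) (\<lambda>\<omega>. N t \<omega> - N s \<omega>) = measure_pmf (poisson_pmf (r * (t - s)))"
  by (simp add: poisson_process_def)

context
  fixes N :: "real \<Rightarrow> 'a \<Rightarrow> nat" and r :: real
  assumes N: "poisson_process M r N"
    and reg: "\<And>\<omega>. \<omega> \<in> space M \<Longrightarrow> regular_arrivals (\<lambda>t. N t \<omega>)"
begin

lemma N_mono: "\<omega> \<in> space M \<Longrightarrow> 0 \<le> s \<Longrightarrow> s \<le> t \<Longrightarrow> N s \<omega> \<le> N t \<omega>"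
  using regular_arrivals_mono[OF reg] by blast

lemma N_0: "\<omega> \<in> space M \<Longrightarrow> N 0 \<omega> = 0"
  using reg by (simp add: regular_arrivals_def)

lemma grid_value:
  assumes "\<omega> \<in> space M" "mono \<tau>" "0 \<le> \<tau> 0"
  shows "N (\<tau> l) \<omega> - N (\<tau> 0) \<omega> = (\<Sum>j<l. N (\<tau> (Suc j)) \<omega> - N (\<tau> j) \<omega>)"
proof -
  have "N (\<tau> j) \<omega> \<le> N (\<tau> (Suc j)) \<omega>" for j
  proof (rule N_mono[OF assms(1)])
    show "0 \<le> \<tau> j" using assms(2,3) monoD[OF assms(2), of 0 j] by simp
    show "\<tau> j \<le> \<tau> (Suc j)" using monoD[OF assms(2), of j "Suc j"] by simp
  qed
  from telescope_nat[of "\<lambda>j. N (\<tau> j) \<omega>", OF this] show ?thesis by simp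
qed

lemma shifted_increments_distr:
  assumes \<tau>: "mono \<tau>" "\<tau> 0 = 0" and t: "0 \<le> t" and m: "m > 0"
  shows "distr M (\<Pi>\<^sub>M l\<in>{..<m}. count_space UNIV) (\<lambda>\<omega>. \<lambda>l\<in>{..<m}. N (t + \<tau> (Suc l)) \<omega> - N (t + \<tau> l) \<omega>)
    = distr M (\<Pi>\<^sub>M l\<in>{..<m}. count_space UNIV) (\<lambda>\<omega>. \<lambda>l\<in>{..<m}. N (\<tau> (Suc l)) \<omega> - N (\<tau> l) \<omega>)"
proof -
  have \<tau>0: "0 \<le> \<tau> l" for l using monoD[OF \<tau>(1), of 0 l] \<tau>(2) by simp
  have \<tau>S: "\<tau> l \<le> \<tau> (Suc l)" for l using monoD[OF \<tau>(1), of l "Suc l"] by simp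
  have [measurable]: "N t \<in> measurable M (count_space UNIV)" if "0 \<le> t" for t
    using poisson_process_measurable[OF N that] .
  have meas: "random_variable (count_space UNIV) (\<lambda>\<omega>. N (t + \<tau> (Suc l)) \<omega> - N (t + \<tau> l) \<omega>)"
    if "0 \<le> t" for l t
    using \<tau>0[of l] \<tau>0[of "Suc l"] that by simp
  have law: "distr M (\<Pi>\<^sub>M l\<in>{..<m}. count_space UNIV) (\<lambda>\<omega>. \<lambda>l\<in>{..<m}. N (t + \<tau> (Suc l)) \<omega> - N (t + \<tau> l) \<omega>)
    = (\<Pi>\<^sub>M l\<in>{..<m}. distr M (count_space UNIV) (\<lambda>\<omega>. N (t + \<tau> (Suc l)) \<omega> - N (t + \<tau> l) \<omega>))"
    if "0 \<le> t" for t
  proof (rule indep_vars_iff_distr_eq_PiM[THEN iffD1])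
    have "mono (\<lambda>l. t + \<tau> l)" using \<tau>(1) by (simp add: mono_def)
    then show "indep_vars (\<lambda>_. count_space UNIV) (\<lambda>l \<omega>. N (t + \<tau> (Suc l)) \<omega> - N (t + \<tau> l) \<omega>) {..<m}"
      using poisson_process_indep[OF N, of "\<lambda>l. t + \<tau> l" m] that \<tau>(2) by simp
  qed (use m meas that in auto)
  have marg: "distr M (count_space UNIV) (\<lambda>\<omega>. N (t + \<tau> (Suc l)) \<omega> - N (t + \<tau> l) \<omega>)
    = distr M (count_space UNIV) (\<lambda>\<omega>. N (0 + \<tau> (Suc l)) \<omega> - N (0 + \<tau> l) \<omega>)" for l
  \<comment> \<open>The Poisson law is given for intervals of positive length only; over an empty
    interval both increments vanish.\<close>
  proof (cases "\<tau> l = \<tau> (Suc l)")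
    case False
    then have "\<tau> l < \<tau> (Suc l)" using \<tau>S[of l] by simp
    then show ?thesis
      using poisson_process_increment[OF N, of "t + \<tau> l" "t + \<tau> (Suc l)"]
        poisson_process_increment[OF N, of "\<tau> l" "\<tau> (Suc l)"] \<tau>0[of l] t by simp
  qed simp
  show ?thesis using law[OF t] law[of 0] marg by simp
qed

text \<open>Past and future values are partial sums over two disjoint blocks of increments on a
  common grid, so they are independent; stationarity then moves the future back to time 0.\<close>

lemma poisson_finite_past_future:
  assumes S: "finite S" "S \<subseteq> {0..t}" and T: "finite T" "T \<subseteq> {0..}" and t: "0 \<le> t"
  shows "prob ({\<omega>\<in>space M. \<forall>s\<in>S. N s \<omega> \<in> G s} \<inter> {\<omega>\<in>space M. \<forall>s\<in>T. N (t + s) \<omega> - N t \<omega> \<in> H s}) =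
    prob {\<omega>\<in>space M. \<forall>s\<in>S. N s \<omega> \<in> G s} * prob {\<omega>\<in>space M. \<forall>s\<in>T. N s \<omega> \<in> H s}" (is ?prod)
proof -
  obtain \<tau>1 :: "nat \<Rightarrow> real" and k where \<tau>1: "k > 0" "mono \<tau>1" "\<tau>1 0 = 0" "\<tau>1 k = t"
    "\<And>s. s \<in> S \<Longrightarrow> \<exists>l\<le>k. \<tau>1 l = s"
    using ex_mono_grid[OF S t] by metis
  define b where "b = Max (insert 0 T)"
  have "0 \<le> b" "T \<subseteq> {0..b}" using T by (auto simp: b_def)
  then obtain \<tau>2 :: "nat \<Rightarrow> real" and m where \<tau>2: "m > 0" "mono \<tau>2" "\<tau>2 0 = 0"
    "\<And>s. s \<in> T \<Longrightarrow> \<exists>l\<le>m. \<tau>2 l = s"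
    using ex_mono_grid[OF T(1), of b] by metis
  obtain i1 where i1: "\<And>s. s \<in> S \<Longrightarrow> i1 s \<le> k \<and> \<tau>1 (i1 s) = s" using \<tau>1(5) by metis
  obtain i2 where i2: "\<And>s. s \<in> T \<Longrightarrow> i2 s \<le> m \<and> \<tau>2 (i2 s) = s" using \<tau>2(4) by metis
  \<comment> \<open>The grid of the past followed by the grid of the future shifted by
    \<open>t\<close>; they meet in the point \<open>t\<close>, which has index
    \<open>k\<close>.\<close>
  define \<tau> where "\<tau> l = (if l \<le> k then \<tau>1 l else t + \<tau>2 (l - k))" for l
  have \<tau>2_nonneg: "0 \<le> \<tau>2 l" for l using monoD[OF \<tau>2(2), of 0 l] \<tau>2(3) by simp
  have mono: "mono \<tau>"
  proof (rule monoI)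
    fix i j :: nat assume ij: "i \<le> j"
    consider "j \<le> k" | "i \<le> k" "k < j" | "k < i" by linarith
    then show "\<tau> i \<le> \<tau> j"
    proof cases
      case 1
      then show ?thesis using ij monoD[OF \<tau>1(2) ij] by (simp add: \<tau>_def)
    next
      case 2
      then have "\<tau>1 i \<le> t" using monoD[OF \<tau>1(2), of i k] \<tau>1(4) by simp
      then show ?thesis using 2 \<tau>2_nonneg[of "j - k"] by (simp add: \<tau>_def)
    next
      case 3
      then show ?thesis using ij monoD[OF \<tau>2(2), of "i - k" "j - k"] by (simp add: \<tau>_def)
    qed
  qed
  have \<tau>0: "\<tau> 0 = 0" using \<tau>1(3) by (simp add: \<tau>_def)
  have \<tau>k: "\<tau> (k + l) = t + \<tau>2 l" for l using \<tau>1(4) \<tau>2(3) by (cases l) (simp_all add: \<tau>_def)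
  let ?X = "\<lambda>l \<omega>. N (\<tau> (Suc l)) \<omega> - N (\<tau> l) \<omega>"
  let ?C = "\<lambda>_::nat. count_space (UNIV :: nat set)"
  have indep: "indep_vars ?C ?X {..<k + m}"
    using poisson_process_indep[OF N _ mono] \<tau>0 by simp
  have ind2: "indep_var (PiM {..<k} ?C) (\<lambda>\<omega>. restrict (\<lambda>l. ?X l \<omega>) {..<k})
      (PiM {k..<k+m} ?C) (\<lambda>\<omega>. restrict (\<lambda>l. ?X l \<omega>) {k..<k+m})"
    by (rule indep_var_restrict[OF indep]) auto
  define E1 where "E1 = {f\<in>space (PiM {..<k} ?C). \<forall>s\<in>S. (\<Sum>l<i1 s. f l) \<in> G s}"
  define E2 where "E2 = {f\<in>space (PiM {k..<k+m} ?C). \<forall>s\<in>T. (\<Sum>l\<in>{k..<k+i2 s}. f l) \<in> H s}"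
  define E3 where "E3 = {f\<in>space (PiM {..<m} ?C). \<forall>s\<in>T. (\<Sum>l<i2 s. f l) \<in> H s}"
  have pre: "{x\<in>space P. f x \<in> A} \<in> sets P" if "f \<in> measurable P (count_space UNIV)" for P f and A :: "nat set"
    using measurable_sets[OF that, of A] by (simp add: vimage_def Int_def conj_commute)
  have "E1 \<in> sets (PiM {..<k} ?C)"
    unfolding E1_def
    by (intro sets.sets_Collect_finite_All pre measurable_sum_count_space measurable_component_singleton S)
      (use i1 in fastforce)+
  moreover have "E2 \<in> sets (PiM {k..<k+m} ?C)"
    unfolding E2_def
    by (intro sets.sets_Collect_finite_All pre measurable_sum_count_space measurable_component_singleton T)
      (use i2 in fastforce)+
  ultimately have prod: "prob ((\<lambda>\<omega>. (restrict (\<lambda>l. ?X l \<omega>) {..<k}, restrict (\<lambda>l. ?X l \<omega>) {k..<k+m})) -` (E1 \<times> E2) \<inter> space M)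
      = prob ((\<lambda>\<omega>. restrict (\<lambda>l. ?X l \<omega>) {..<k}) -` E1 \<inter> space M) *
        prob ((\<lambda>\<omega>. restrict (\<lambda>l. ?X l \<omega>) {k..<k+m}) -` E2 \<inter> space M)"
    by (rule indep_varD[OF ind2])
  have ev1: "(\<lambda>\<omega>. restrict (\<lambda>l. ?X l \<omega>) {..<k}) -` E1 \<inter> space M = {\<omega>\<in>space M. \<forall>s\<in>S. N s \<omega> \<in> G s}"
  proof -
    have "(\<Sum>l<i1 s. restrict (\<lambda>l. ?X l \<omega>) {..<k} l) = N s \<omega>" if "s \<in> S" "\<omega> \<in> space M" for s \<omega>
    proof -
      have "(\<Sum>l<i1 s. restrict (\<lambda>l. ?X l \<omega>) {..<k} l) = (\<Sum>l<i1 s. ?X l \<omega>)"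
        using i1[OF that(1)] by (intro sum.cong) auto
      also have "\<dots> = N (\<tau> (i1 s)) \<omega>"
        using grid_value[OF that(2) mono, of "i1 s"] \<tau>0 N_0[OF that(2)] by simp
      finally show ?thesis using i1[OF that(1)] by (simp add: \<tau>_def)
    qed
    then show ?thesis by (auto simp: E1_def space_PiM)
  qed
  have ev2: "(\<lambda>\<omega>. restrict (\<lambda>l. ?X l \<omega>) {k..<k+m}) -` E2 \<inter> space M
      = {\<omega>\<in>space M. \<forall>s\<in>T. N (t + s) \<omega> - N t \<omega> \<in> H s}"
  proof -
    have "(\<Sum>l\<in>{k..<k+i2 s}. restrict (\<lambda>l. ?X l \<omega>) {k..<k+m} l) = N (t + s) \<omega> - N t \<omega>"
      if "s \<in> T" "\<omega> \<in> space M" for s \<omega>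
    proof -
      have "(\<Sum>l\<in>{k..<k+i2 s}. restrict (\<lambda>l. ?X l \<omega>) {k..<k+m} l) = (\<Sum>l\<in>{k..<k+i2 s}. ?X l \<omega>)"
        using i2[OF that(1)] by (intro sum.cong) auto
      also have "\<dots> = (\<Sum>l<i2 s. ?X (k + l) \<omega>)"
        using sum.shift_bounds_nat_ivl[of "\<lambda>l. ?X l \<omega>" 0 k "i2 s"]
        by (simp add: add.commute atLeast0LessThan)
      also have "\<dots> = (\<Sum>l<i2 s. N (t + \<tau>2 (Suc l)) \<omega> - N (t + \<tau>2 l) \<omega>)"
        using \<tau>k[of "Suc _"] by (simp add: \<tau>k)
      also have "\<dots> = N (t + \<tau>2 (i2 s)) \<omega> - N (t + \<tau>2 0) \<omega>"
        using grid_value[OF that(2), of "\<lambda>l. t + \<tau>2 l" "i2 s"] \<tau>2(2,3) t by (simp add: mono_def)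
      finally show ?thesis using i2[OF that(1)] \<tau>2(3) by simp
    qed
    then show ?thesis by (auto simp: E2_def space_PiM)
  qed
  have law: "prob {\<omega>\<in>space M. \<forall>s\<in>T. N (t + s) \<omega> - N t \<omega> \<in> H s} = prob {\<omega>\<in>space M. \<forall>s\<in>T. N s \<omega> \<in> H s}"
  proof -
    have E3: "E3 \<in> sets (PiM {..<m} ?C)"
      unfolding E3_def
      by (intro sets.sets_Collect_finite_All pre measurable_sum_count_space measurable_component_singleton T)
        (use i2 in fastforce)+
    have ev3: "(\<lambda>\<omega>. \<lambda>l\<in>{..<m}. N (u + \<tau>2 (Suc l)) \<omega> - N (u + \<tau>2 l) \<omega>) -` E3 \<inter> space M
        = {\<omega>\<in>space M. \<forall>s\<in>T. N (u + s) \<omega> - N u \<omega> \<in> H s}" if u: "0 \<le> u" for u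
    proof -
      have "(\<Sum>l<i2 s. (\<lambda>l\<in>{..<m}. N (u + \<tau>2 (Suc l)) \<omega> - N (u + \<tau>2 l) \<omega>) l) = N (u + s) \<omega> - N u \<omega>"
        if "s \<in> T" "\<omega> \<in> space M" for s \<omega>
      proof -
        have "(\<Sum>l<i2 s. (\<lambda>l\<in>{..<m}. N (u + \<tau>2 (Suc l)) \<omega> - N (u + \<tau>2 l) \<omega>) l)
            = (\<Sum>l<i2 s. N (u + \<tau>2 (Suc l)) \<omega> - N (u + \<tau>2 l) \<omega>)"
          using i2[OF that(1)] by (intro sum.cong) auto
        also have "\<dots> = N (u + \<tau>2 (i2 s)) \<omega> - N (u + \<tau>2 0) \<omega>"
          using grid_value[OF that(2), of "\<lambda>l. u + \<tau>2 l" "i2 s"] \<tau>2(2,3) u by (simp add: mono_def)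
        finally show ?thesis using i2[OF that(1)] \<tau>2(3) by simp
      qed
      then show ?thesis by (auto simp: E3_def space_PiM)
    qed
    have meas: "(\<lambda>\<omega>. \<lambda>l\<in>{..<m}. N (u + \<tau>2 (Suc l)) \<omega> - N (u + \<tau>2 l) \<omega>) \<in> measurable M (PiM {..<m} ?C)"
      if u: "0 \<le> u" for u
    proof (rule measurable_restrict)
      fix l
      have [measurable]: "N (u + \<tau>2 j) \<in> measurable M (count_space UNIV)" for j
        using \<tau>2_nonneg[of j] u by (intro poisson_process_measurable[OF N]) simp
      show "random_variable (count_space UNIV) (\<lambda>\<omega>. N (u + \<tau>2 (Suc l)) \<omega> - N (u + \<tau>2 l) \<omega>)"
        by measurable
    qed
    have "prob {\<omega>\<in>space M. \<forall>s\<in>T. N (t + s) \<omega> - N t \<omega> \<in> H s}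
        = measure (distr M (PiM {..<m} ?C) (\<lambda>\<omega>. \<lambda>l\<in>{..<m}. N (t + \<tau>2 (Suc l)) \<omega> - N (t + \<tau>2 l) \<omega>)) E3"
      by (simp add: measure_distr[OF meas[OF t] E3] ev3[OF t])
    also have "\<dots> = measure (distr M (PiM {..<m} ?C) (\<lambda>\<omega>. \<lambda>l\<in>{..<m}. N (0 + \<tau>2 (Suc l)) \<omega> - N (0 + \<tau>2 l) \<omega>)) E3"
      using shifted_increments_distr[OF \<tau>2(2,3) t \<tau>2(1)] by simp
    also have "\<dots> = prob {\<omega>\<in>space M. \<forall>s\<in>T. N (0 + s) \<omega> - N 0 \<omega> \<in> H s}"
      by (subst measure_distr[OF meas E3]) (simp_all only: ev3 order_refl)
    also have "{\<omega>\<in>space M. \<forall>s\<in>T. N (0 + s) \<omega> - N 0 \<omega> \<in> H s} = {\<omega>\<in>space M. \<forall>s\<in>T. N s \<omega> \<in> H s}"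
      using N_0 by auto
    finally show ?thesis .
  qed
  have pair: "(\<lambda>\<omega>. (f \<omega>, g \<omega>)) -` (A \<times> B) \<inter> C = (f -` A \<inter> C) \<inter> (g -` B \<inter> C)"
    for f :: "'a \<Rightarrow> nat \<Rightarrow> nat" and g :: "'a \<Rightarrow> nat \<Rightarrow> nat" and A B C by blast
  show ?prod using prod unfolding pair ev1 ev2 law .
qed

definition finite_past_events :: "real \<Rightarrow> 'a set set" where
  "finite_past_events t = {{\<omega>\<in>space M. \<forall>s\<in>S. N s \<omega> \<in> G s} | S G. finite S \<and> S \<subseteq> {0..t}}"

lemma Int_stable_finite_past: "Int_stable (finite_past_events t)"
proof (rule Int_stableI)
  fix a b assume "a \<in> finite_past_events t" "b \<in> finite_past_events t"
  then obtain S1 G1 S2 G2 where ab: "a = {\<omega>\<in>space M. \<forall>s\<in>S1. N s \<omega> \<in> G1 s}" "finite S1" "S1 \<subseteq> {0..t}"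
    "b = {\<omega>\<in>space M. \<forall>s\<in>S2. N s \<omega> \<in> G2 s}" "finite S2" "S2 \<subseteq> {0..t}"
    unfolding finite_past_events_def by blast
  have "a \<inter> b = {\<omega>\<in>space M. \<forall>s\<in>S1 \<union> S2.
      N s \<omega> \<in> (if s \<in> S1 then G1 s else UNIV) \<inter> (if s \<in> S2 then G2 s else UNIV)}"
    unfolding ab by auto
  moreover have "finite (S1 \<union> S2)" "S1 \<union> S2 \<subseteq> {0..t}" using ab by auto
  ultimately show "a \<inter> b \<in> finite_past_events t"
    unfolding finite_past_events_def mem_Collect_eq
    by (intro exI[of _ "S1 \<union> S2"]
        exI[of _ "\<lambda>s. (if s \<in> S1 then G1 s else UNIV) \<inter> (if s \<in> S2 then G2 s else UNIV)"] conjI)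
qed

lemma poisson_event: "finite S \<Longrightarrow> S \<subseteq> {0..} \<Longrightarrow> {\<omega>\<in>space M. \<forall>s\<in>S. N s \<omega> \<in> G s} \<in> events"
proof (rule sets.sets_Collect_finite_All)
  fix s assume "S \<subseteq> {0..}" "s \<in> S"
  then have "N s \<in> measurable M (count_space UNIV)" by (intro poisson_process_measurable[OF N]) auto
  from measurable_sets[OF this, of "G s"] show "{\<omega>\<in>space M. N s \<omega> \<in> G s} \<in> events"
    by (simp add: vimage_def Int_def conj_commute)
qed

text \<open>Events on finitely many past times form a pi-system generating the whole past, and
  independence extends to the generated sigma-algebra.\<close>

lemma poisson_past_future:
  assumes t: "0 \<le> t" and T: "finite T" "T \<subseteq> {0..}"
    and a: "a \<in> sigma_sets (space M) {N s -` B \<inter> space M | s B. 0 \<le> s \<and> s \<le> t}"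
  shows "prob (a \<inter> {\<omega>\<in>space M. \<forall>s\<in>T. N (t + s) \<omega> - N t \<omega> \<in> H s}) =
    prob a * prob {\<omega>\<in>space M. \<forall>s\<in>T. N s \<omega> \<in> H s}"
proof -
  let ?F = "{\<omega>\<in>space M. \<forall>s\<in>T. N (t + s) \<omega> - N t \<omega> \<in> H s}"
  have F: "?F \<in> events"
  proof (rule sets.sets_Collect_finite_All)
    fix s assume "s \<in> T"
    then have [measurable]: "N (t + s) \<in> measurable M (count_space UNIV)" "N t \<in> measurable M (count_space UNIV)"
      using T t by (auto intro!: poisson_process_measurable[OF N])
    have "(\<lambda>\<omega>. N (t + s) \<omega> - N t \<omega>) \<in> measurable M (count_space UNIV)" by measurable
    from measurable_sets[OF this, of "H s"] show "{\<omega>\<in>space M. N (t + s) \<omega> - N t \<omega> \<in> H s} \<in> events"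
      by (simp add: vimage_def Int_def conj_commute)
  qed (rule T)
  have le: "finite_past_events t \<subseteq> events"
  proof
    fix a assume "a \<in> finite_past_events t"
    then obtain S G where "a = {\<omega>\<in>space M. \<forall>s\<in>S. N s \<omega> \<in> G s}" "finite S" "S \<subseteq> {0..t}"
      unfolding finite_past_events_def by blast
    then show "a \<in> events" by (simp only:) (rule poisson_event, auto)
  qed
  have PF: "prob ?F = prob {\<omega>\<in>space M. \<forall>s\<in>T. N s \<omega> \<in> H s}"
    using poisson_finite_past_future[of "{}" t T "\<lambda>_. UNIV" H] T t prob_space by (simp add: Int_absorb1 subset_eq)
  have "indep_set (finite_past_events t) {?F}"
  proof (rule indep_setI)
    show "finite_past_events t \<subseteq> events" by (rule le)
    show "{?F} \<subseteq> events" using F by simp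
    fix a b assume "a \<in> finite_past_events t" "b \<in> {?F}"
    then obtain S G where a: "a = {\<omega>\<in>space M. \<forall>s\<in>S. N s \<omega> \<in> G s}" "finite S" "S \<subseteq> {0..t}" "b = ?F"
      unfolding finite_past_events_def by blast
    show "prob (a \<inter> b) = prob a * prob b"
      unfolding a(1,4) PF by (rule poisson_finite_past_future[OF a(2,3) T t])
  qed
  then have ind: "indep_set (sigma_sets (space M) (finite_past_events t)) (sigma_sets (space M) {?F})"
    by (rule indep_set_sigma_sets[OF _ Int_stable_finite_past]) (simp add: Int_stable_def)
  have "sigma_sets (space M) {N s -` B \<inter> space M | s B. 0 \<le> s \<and> s \<le> t} \<subseteq>
      sigma_sets (space M) (finite_past_events t)"
  proof (rule sigma_sets_subseteq, rule subsetI)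
    fix a assume "a \<in> {N s -` B \<inter> space M | s B. 0 \<le> s \<and> s \<le> t}"
    then obtain s B where "a = N s -` B \<inter> space M" "0 \<le> s" "s \<le> t" by blast
    moreover from this have "a = {\<omega>\<in>space M. \<forall>s'\<in>{s}. N s' \<omega> \<in> B}" by auto
    ultimately show "a \<in> finite_past_events t"
      unfolding finite_past_events_def mem_Collect_eq by (intro exI[of _ "{s}"] exI[of _ "\<lambda>_. B"]) auto
  qed
  then have "prob (a \<inter> ?F) = prob a * prob ?F"
    using a by (intro indep_setD[OF ind]) auto
  then show ?thesis by (simp only: PF)
qed

end

end

subsection \<open>The regular model and the strong Markov property\<close>

text \<open>Steps are numbered through all cycles: cycle \<open>k\<close> consists of the steps
  \<open>4 * k\<close> to \<open>4 * k + 3\<close>.\<close>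

definition kind_at :: "nat \<Rightarrow> kind" where
  "kind_at l = (if l mod 4 = 0 then Visit Q1 else if l mod 4 = 2 then Visit Q2 else Travel)"

text \<open>The name of the primitive behind the random variable \<open>U l v\<close> below, through
  which independence of the primitives is applied to steps. In a switching step it is the same for
  all \<open>v\<close>.\<close>

definition driver :: "nat \<Rightarrow> nat \<Rightarrow> primitive" where
  "driver l v = (if l mod 4 = 0 then Service Q1 (l div 4) v else if l mod 4 = 1 then Switching Q1 (l div 4)
     else if l mod 4 = 2 then Service Q2 (l div 4) v else Switching Q2 (l div 4))"

lemma mod4_cases:
  fixes l :: nat
  obtains "l mod 4 = 0" | "l mod 4 = 1" | "l mod 4 = 2" | "l mod 4 = 3"
proof -
  have "l mod 4 < 4" by simp
  then have "l mod 4 = 0 \<or> l mod 4 = 1 \<or> l mod 4 = 2 \<or> l mod 4 = 3" by presburger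
  then show thesis using that by auto
qed

lemma driver_inj: "driver l v = driver l' v' \<Longrightarrow> l = l'"
proof -
  assume eq: "driver l v = driver l' v'"
  have "l mod 4 = l' mod 4 \<and> l div 4 = l' div 4"
    by (rule mod4_cases[of l]; rule mod4_cases[of l']; insert eq; simp add: driver_def)
  then show "l = l'" by (metis div_mult_mod_eq)
qed

lemma driver_Arrivals: "driver l v \<noteq> Arrivals q"
  by (simp add: driver_def)

locale regular_polling = polling_system M lam \<mu> s \<Lambda> J S
  for M :: "'w measure" and lam \<mu> s \<Lambda> J S +
  assumes arrivals_regular: "\<omega> \<in> space M \<Longrightarrow> regular_arrivals (\<lambda>t. \<Lambda> i t \<omega>)"
    and services_regular: "\<omega> \<in> space M \<Longrightarrow> regular_services (\<lambda>v. J i k v \<omega>)"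
    and switching_regular: "\<omega> \<in> space M \<Longrightarrow> 0 < S i k \<omega>"
begin

text \<open>A switching time is repeated along the whole sequence, so that its partial sums diverge
  and both kinds of step are driven by regular sequences.\<close>

definition U :: "nat \<Rightarrow> nat \<Rightarrow> 'w \<Rightarrow> real" where
  "U l v \<omega> = (if l mod 4 = 0 then J Q1 (l div 4) v \<omega> else if l mod 4 = 1 then S Q1 (l div 4) \<omega>
     else if l mod 4 = 2 then J Q2 (l div 4) v \<omega> else S Q2 (l div 4) \<omega>)"

definition path_from :: "real \<Rightarrow> nat \<Rightarrow> 'w \<Rightarrow> path" where
  "path_from t l \<omega> = (shift_arrivals (\<lambda>q u. \<Lambda> q u \<omega>) t, \<lambda>v. U l v \<omega>)"

lemma J_measurable [measurable]: "J i k v \<in> borel_measurable M"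
  using service_integrable by blast

lemma S_measurable [measurable]: "S i k \<in> borel_measurable M"
  using switching_integrable by blast

lemma U_measurable [measurable]: "U l v \<in> borel_measurable M"
proof -
  have "U l v = J Q1 (l div 4) v \<or> U l v = S Q1 (l div 4) \<or> U l v = J Q2 (l div 4) v \<or> U l v = S Q2 (l div 4)"
    by (auto simp: U_def fun_eq_iff)
  then show ?thesis by auto
qed

lemma Lam_measurable: "0 \<le> t \<Longrightarrow> \<Lambda> q t \<in> measurable M (count_space UNIV)"
  using poisson_process_measurable[OF arrivals] .

lemma U_regular:
  assumes "\<omega> \<in> space M"
  shows "regular_services (\<lambda>v. U l v \<omega>)"
proof -
  have const: "regular_services (\<lambda>v. c)" if "0 < c" for c :: real
  proof -
    have "\<exists>v. x < real v * c" for x using reals_Archimedean3[OF that] by blast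
    then show ?thesis using that by (simp add: regular_services_def)
  qed
  show ?thesis
    by (rule mod4_cases[of l])
      (simp_all add: U_def services_regular[OF assms] const switching_regular[OF assms])
qed

lemma Lam_right:
  assumes "\<omega> \<in> space M" "0 \<le> t"
  shows "\<exists>e>0. \<forall>u\<in>{t..t + e}. \<Lambda> q u \<omega> = \<Lambda> q t \<omega>"
  using regular_arrivals_right[OF arrivals_regular[OF assms(1)] assms(2)] .

lemma path_regular: "\<omega> \<in> space M \<Longrightarrow> 0 \<le> t \<Longrightarrow> path_from t l \<omega> \<in> regular_paths"
  unfolding regular_paths_def path_from_def
  using regular_shift[of "\<lambda>q u. \<Lambda> q u \<omega>" t] arrivals_regular U_regular by simp

lemma fst_path: "fst (path_from t l \<omega>) q u = \<Lambda> q (t + u) \<omega> - \<Lambda> q t \<omega>"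
  by (simp add: path_from_def shift_arrivals_def)

lemma snd_path: "snd (path_from t l \<omega>) v = U l v \<omega>"
  by (simp add: path_from_def)

lemma Lam_compose_measurable:
  assumes "T \<in> borel_measurable M" "\<And>\<omega>. \<omega> \<in> space M \<Longrightarrow> 0 \<le> T \<omega>"
  shows "(\<lambda>\<omega>. \<Lambda> q (T \<omega>) \<omega>) \<in> measurable M (count_space UNIV)"
  by (rule measurable_right_constant_compose[OF assms Lam_measurable Lam_right])

lemma path_measurable:
  assumes [measurable]: "T \<in> borel_measurable M" and T: "\<And>\<omega>. \<omega> \<in> space M \<Longrightarrow> 0 \<le> T \<omega>"
  shows "(\<lambda>\<omega>. path_from (T \<omega>) l \<omega>) \<in> measurable M path_space"
proof (rule measurable_path_space)
  fix q and t :: real assume t: "0 \<le> t"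
  have [measurable]: "(\<lambda>\<omega>. \<Lambda> q (T \<omega>) \<omega>) \<in> measurable M (count_space UNIV)"
    "(\<lambda>\<omega>. \<Lambda> q (T \<omega> + t) \<omega>) \<in> measurable M (count_space UNIV)"
    using T t by (auto intro!: Lam_compose_measurable)
  show "(\<lambda>\<omega>. fst (path_from (T \<omega>) l \<omega>) q t) \<in> measurable M (count_space UNIV)"
    unfolding fst_path by measurable
qed (use T path_regular in \<open>simp_all add: snd_path\<close>)

text \<open>The filtration has two indices: arrivals are known up to time \<open>t\<close>, service
  and switching times of the steps before \<open>l\<close> are known entirely, even those of
  services that never began. The sequence driving step \<open>l\<close> is left out and hence
  fresh.\<close>

definition past_generator :: "nat \<Rightarrow> real \<Rightarrow> 'w set set" where
  "past_generator l t = {\<Lambda> q u -` B \<inter> space M | q u B. 0 \<le> u \<and> u \<le> t} \<union>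
     {U l' v -` B \<inter> space M | l' v B. l' < l \<and> B \<in> sets borel}"

definition past :: "nat \<Rightarrow> real \<Rightarrow> 'w measure" where
  "past l t = sigma (space M) (past_generator l t)"

lemma past_generator_Pow: "past_generator l t \<subseteq> Pow (space M)"
  by (auto simp: past_generator_def)

lemma space_past [simp]: "space (past l t) = space M"
  using past_generator_Pow by (simp add: past_def space_measure_of)

lemma sets_past: "sets (past l t) = sigma_sets (space M) (past_generator l t)"
  using past_generator_Pow by (simp add: past_def sets_measure_of)

lemma past_generator_mono: "l \<le> l' \<Longrightarrow> t \<le> t' \<Longrightarrow> past_generator l t \<subseteq> past_generator l' t'"
  unfolding past_generator_def by (intro Un_mono Collect_mono) (blast intro: order_trans less_le_trans)+

lemma past_mono: "l \<le> l' \<Longrightarrow> t \<le> t' \<Longrightarrow> sets (past l t) \<subseteq> sets (past l' t')"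
  unfolding sets_past by (rule sigma_sets_subseteq[OF past_generator_mono])

lemma Lam_past: "0 \<le> u \<Longrightarrow> u \<le> t \<Longrightarrow> \<Lambda> q u \<in> measurable (past l t) (count_space UNIV)"
  by (rule measurableI) (auto simp: sets_past past_generator_def intro!: sigma_sets.Basic)

lemma U_past: "l' < l \<Longrightarrow> U l' v \<in> borel_measurable (past l t)"
  by (rule measurableI) (auto simp: sets_past past_generator_def intro!: sigma_sets.Basic)

section \<open>Independence of the past and the next path\<close>

lemma primitive_events_driver:
  "primitive_events M \<Lambda> J S (driver l v) = {U l v -` B \<inter> space M | B. B \<in> sets borel}"
  by (rule mod4_cases[of l]) (simp_all add: driver_def U_def [abs_def])

lemma Int_stable_primitive_events: "Int_stable (primitive_events M \<Lambda> J S x)"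
proof -
  have vi: "Int_stable {f -` B \<inter> space M | B. B \<in> sets borel}" for f :: "'w \<Rightarrow> real"
  proof (rule Int_stableI)
    fix a b assume "a \<in> {f -` B \<inter> space M | B. B \<in> sets borel}" "b \<in> {f -` B \<inter> space M | B. B \<in> sets borel}"
    then obtain A B where "a = f -` A \<inter> space M" "b = f -` B \<inter> space M" "A \<in> sets borel" "B \<in> sets borel" by blast
    then have "a \<inter> b = f -` (A \<inter> B) \<inter> space M" "A \<inter> B \<in> sets borel" by auto
    then show "a \<inter> b \<in> {f -` B \<inter> space M | B. B \<in> sets borel}" by blast
  qed
  show ?thesis
  proof (cases x)
    case (Arrivals i)
    have "{\<Lambda> i t -` B \<inter> space M | t B. 0 \<le> t} \<subseteq> Pow (space M)" by auto
    then interpret sigma_algebra "space M" "sigma_sets (space M) {\<Lambda> i t -` B \<inter> space M | t B. 0 \<le> t}"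
      by (rule sigma_algebra_sigma_sets)
    show ?thesis unfolding Arrivals primitive_events.simps by (rule Int_stableI) (rule Int)
  qed (simp_all add: vi)
qed

lemma primitive_events_subset: "primitive_events M \<Lambda> J S x \<subseteq> events"
  using primitives_indep by (simp add: indep_sets_def)

lemma indep_blocks:
  assumes "disjoint_family_on I K"
  shows "indep_sets (\<lambda>j. sigma_sets (space M) (\<Union>x\<in>I j. primitive_events M \<Lambda> J S x)) K"
proof (rule indep_sets_collect_sigma[OF _ Int_stable_primitive_events assms])
  show "indep_sets (primitive_events M \<Lambda> J S) (\<Union>j\<in>K. I j)"
    by (rule indep_sets_mono_index[OF _ primitives_indep]) simp
qed

text \<open>Four independent groups of primitives: the arrivals to either queue, the sequences of
  earlier steps, and the sequence of the current step.\<close>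

definition block :: "nat \<Rightarrow> nat \<Rightarrow> primitive set" where
  "block l j = (if j = 0 then {Arrivals Q1} else if j = 1 then {Arrivals Q2}
     else if j = 2 then {driver l' v | l' v. l' < l} else range (driver l))"

lemma disjoint_block: "disjoint_family_on (block l) {0, 1, 2, 3}"
  by (auto simp: disjoint_family_on_def block_def driver_Arrivals driver_Arrivals[symmetric] dest: driver_inj)

lemma prob_block4:
  assumes "a1 \<in> sigma_sets (space M) (primitive_events M \<Lambda> J S (Arrivals Q1))"
    and "a2 \<in> sigma_sets (space M) (primitive_events M \<Lambda> J S (Arrivals Q2))"
    and "u \<in> sigma_sets (space M) (\<Union>x\<in>block l 2. primitive_events M \<Lambda> J S x)"
    and "u' \<in> sigma_sets (space M) (\<Union>x\<in>block l 3. primitive_events M \<Lambda> J S x)"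
  shows "prob (a1 \<inter> a2 \<inter> u \<inter> u') = prob a1 * prob a2 * prob u * prob u'"
proof -
  define A where "A j = (if j = 0 then a1 else if j = 1 then a2 else if j = 2 then u else u')" for j :: nat
  have "prob (\<Inter>j\<in>{0, 1, 2, 3}. A j) = (\<Prod>j\<in>{0, 1, 2, 3}. prob (A j))"
  proof (rule indep_setsD[OF indep_blocks[OF disjoint_block]])
    show "\<forall>j\<in>{0, 1, 2, 3}. A j \<in> sigma_sets (space M) (\<Union>x\<in>block l j. primitive_events M \<Lambda> J S x)"
      using assms by (simp add: A_def block_def)
  qed auto
  moreover have "(\<Inter>j\<in>{0, 1, 2, 3}. A j) = a1 \<inter> a2 \<inter> u \<inter> u'" by (auto simp: A_def)
  ultimately show ?thesis by (simp add: A_def)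
qed

definition arrival_past :: "queue \<Rightarrow> real \<Rightarrow> 'w set set" where
  "arrival_past q t = sigma_sets (space M) {\<Lambda> q u -` B \<inter> space M | u B. 0 \<le> u \<and> u \<le> t}"

definition driver_past :: "nat \<Rightarrow> 'w set set" where
  "driver_past l = sigma_sets (space M) (\<Union>x\<in>block l 2. primitive_events M \<Lambda> J S x)"

lemma sigma_algebra_arrival_past: "sigma_algebra (space M) (arrival_past q t)"
  unfolding arrival_past_def by (rule sigma_algebra_sigma_sets) auto

lemma sigma_algebra_driver_past: "sigma_algebra (space M) (driver_past l)"
  unfolding driver_past_def
  using primitive_events_subset sets.sets_into_space by (intro sigma_algebra_sigma_sets) blast

lemma arrival_past_subset: "arrival_past q t \<subseteq> sigma_sets (space M) (primitive_events M \<Lambda> J S (Arrivals q))"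
  unfolding arrival_past_def primitive_events.simps
  by (rule sigma_sets_mono) (auto intro!: sigma_sets.Basic)

lemma arrival_events_sets: "sigma_sets (space M) (primitive_events M \<Lambda> J S (Arrivals q)) \<subseteq> events"
  using primitive_events_subset by (rule sets.sigma_sets_subset)

lemma driver_past_events: "driver_past l \<subseteq> events"
  unfolding driver_past_def using primitive_events_subset by (intro sets.sigma_sets_subset) blast

text \<open>A pi-system of generators of the past in which the independent groups appear as separate
  factors.\<close>

definition past_product :: "nat \<Rightarrow> real \<Rightarrow> 'w set set" where
  "past_product l t = {a1 \<inter> a2 \<inter> u | a1 a2 u. a1 \<in> arrival_past Q1 t \<and> a2 \<in> arrival_past Q2 t \<and> u \<in> driver_past l}"

lemma past_productI:
  "a1 \<in> arrival_past Q1 t \<Longrightarrow> a2 \<in> arrival_past Q2 t \<Longrightarrow> u \<in> driver_past l \<Longrightarrow> a1 \<inter> a2 \<inter> u \<in> past_product l t"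
  unfolding past_product_def by blast

lemma Int_stable_past_product: "Int_stable (past_product l t)"
proof (rule Int_stableI)
  interpret A1: sigma_algebra "space M" "arrival_past Q1 t" by (rule sigma_algebra_arrival_past)
  interpret A2: sigma_algebra "space M" "arrival_past Q2 t" by (rule sigma_algebra_arrival_past)
  interpret D: sigma_algebra "space M" "driver_past l" by (rule sigma_algebra_driver_past)
  fix a b assume "a \<in> past_product l t" "b \<in> past_product l t"
  then obtain a1 a2 u b1 b2 u' where "a = a1 \<inter> a2 \<inter> u" "b = b1 \<inter> b2 \<inter> u'"
    "a1 \<in> arrival_past Q1 t" "a2 \<in> arrival_past Q2 t" "u \<in> driver_past l"
    "b1 \<in> arrival_past Q1 t" "b2 \<in> arrival_past Q2 t" "u' \<in> driver_past l"
    unfolding past_product_def by blast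
  moreover from this have "a \<inter> b = (a1 \<inter> b1) \<inter> (a2 \<inter> b2) \<inter> (u \<inter> u')" by blast
  ultimately show "a \<inter> b \<in> past_product l t" by (simp only:) (intro past_productI A1.Int A2.Int D.Int)
qed

lemma past_generator_subset: "past_generator l t \<subseteq> past_product l t"
proof
  interpret A1: sigma_algebra "space M" "arrival_past Q1 t" by (rule sigma_algebra_arrival_past)
  interpret A2: sigma_algebra "space M" "arrival_past Q2 t" by (rule sigma_algebra_arrival_past)
  interpret D: sigma_algebra "space M" "driver_past l" by (rule sigma_algebra_driver_past)
  fix a assume "a \<in> past_generator l t"
  then consider q u B where "a = \<Lambda> q u -` B \<inter> space M" "0 \<le> u" "u \<le> t"
    | l' v B where "a = U l' v -` B \<inter> space M" "l' < l" "B \<in> sets borel"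
    unfolding past_generator_def by blast
  then show "a \<in> past_product l t"
  proof cases
    case 1
    then have a: "a \<in> arrival_past q t" unfolding arrival_past_def by (intro sigma_sets.Basic) blast
    have sub: "a \<subseteq> space M" using 1 by blast
    show ?thesis
    proof (cases q)
      case Q1
      have "a \<inter> space M \<inter> space M \<in> past_product l t"
        by (intro past_productI A2.top D.top) (use a Q1 in simp)
      then show ?thesis using sub by (simp add: Int_absorb2)
    next
      case Q2
      have "space M \<inter> a \<inter> space M \<in> past_product l t"
        by (intro past_productI A1.top D.top) (use a Q2 in simp)
      then show ?thesis using sub by (simp add: Int_absorb1 Int_absorb2)
    qed
  next
    case 2
    have "a \<in> primitive_events M \<Lambda> J S (driver l' v)"
      unfolding primitive_events_driver using 2 by blast
    moreover have "driver l' v \<in> block l 2" using 2 by (auto simp: block_def)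
    ultimately have "a \<in> driver_past l" unfolding driver_past_def by (intro sigma_sets.Basic) blast
    then have "space M \<inter> space M \<inter> a \<in> past_product l t"
      by (intro past_productI A1.top A2.top)
    moreover have "a \<subseteq> space M" using 2 by blast
    ultimately show ?thesis by (simp add: Int_absorb1)
  qed
qed

lemma path_cylinder:
  assumes "0 \<le> t"
  shows "{\<omega>\<in>space M. path_from t l \<omega> \<in> cylinder T G V B} =
    {\<omega>\<in>space M. \<forall>u\<in>T. \<Lambda> Q1 (t + u) \<omega> - \<Lambda> Q1 t \<omega> \<in> G Q1 u} \<inter>
    {\<omega>\<in>space M. \<forall>u\<in>T. \<Lambda> Q2 (t + u) \<omega> - \<Lambda> Q2 t \<omega> \<in> G Q2 u} \<inter>
    {\<omega>\<in>space M. \<forall>v\<in>V. U l v \<omega> \<in> B v}"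
proof (rule set_eqI)
  fix \<omega>
  show "\<omega> \<in> {\<omega>\<in>space M. path_from t l \<omega> \<in> cylinder T G V B} \<longleftrightarrow> \<omega> \<in>
    {\<omega>\<in>space M. \<forall>u\<in>T. \<Lambda> Q1 (t + u) \<omega> - \<Lambda> Q1 t \<omega> \<in> G Q1 u} \<inter>
    {\<omega>\<in>space M. \<forall>u\<in>T. \<Lambda> Q2 (t + u) \<omega> - \<Lambda> Q2 t \<omega> \<in> G Q2 u} \<inter>
    {\<omega>\<in>space M. \<forall>v\<in>V. U l v \<omega> \<in> B v}"
  proof (cases "\<omega> \<in> space M")
    case True
    then show ?thesis
      using path_regular[OF True assms, of l]
      by (simp add: cylinder_def fst_path snd_path all_queue)
  qed simp
qed

lemma arrival_future_event:
  assumes t: "0 \<le> t" and T: "finite T" "T \<subseteq> {0..}"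
  shows "{\<omega>\<in>space M. \<forall>u\<in>T. \<Lambda> q (t + u) \<omega> - \<Lambda> q t \<omega> \<in> G q u}
    \<in> sigma_sets (space M) (primitive_events M \<Lambda> J S (Arrivals q))"
proof -
  define N where "N = sigma (space M) {\<Lambda> q u -` B \<inter> space M | u B. 0 \<le> u}"
  have N: "{\<Lambda> q u -` B \<inter> space M | u B. 0 \<le> u} \<subseteq> Pow (space M)" by auto
  have L: "\<Lambda> q u \<in> measurable N (count_space UNIV)" if "0 \<le> u" for u
    using N that by (intro measurableI) (auto simp: N_def space_measure_of sets_measure_of intro!: sigma_sets.Basic)
  have sp: "space N = space M" using N by (simp add: N_def space_measure_of)
  have "{\<omega>\<in>space M. \<forall>u\<in>T. \<Lambda> q (t + u) \<omega> - \<Lambda> q t \<omega> \<in> G q u} \<in> sets N"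
    unfolding sp[symmetric]
  proof (rule sets.sets_Collect_finite_All)
    fix u assume "u \<in> T"
    then have [measurable]: "\<Lambda> q (t + u) \<in> measurable N (count_space UNIV)" "\<Lambda> q t \<in> measurable N (count_space UNIV)"
      using T t by (auto intro!: L)
    have "(\<lambda>\<omega>. \<Lambda> q (t + u) \<omega> - \<Lambda> q t \<omega>) \<in> measurable N (count_space UNIV)" by measurable
    from measurable_sets[OF this, of "G q u"]
    show "{\<omega>\<in>space N. \<Lambda> q (t + u) \<omega> - \<Lambda> q t \<omega> \<in> G q u} \<in> sets N"
      by (simp add: vimage_def Int_def conj_commute)
  qed (rule T)
  moreover have "sets N = sigma_sets (space M) (primitive_events M \<Lambda> J S (Arrivals q))"
    using N by (simp add: N_def sets_measure_of sigma_sets_sigma_sets_eq)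
  ultimately show ?thesis by simp
qed

lemma driver_event:
  assumes V: "finite V" and B: "\<And>v. B v \<in> sets borel"
  shows "{\<omega>\<in>space M. \<forall>v\<in>V. U l v \<omega> \<in> B v} \<in>
    sigma_sets (space M) (\<Union>x\<in>block l 3. primitive_events M \<Lambda> J S x)" (is "_ \<in> sigma_sets _ ?G")
proof -
  have G: "?G \<subseteq> Pow (space M)"
    using subset_trans[OF primitive_events_subset sets.space_closed] by (rule UN_least)
  interpret sigma_algebra "space M" "sigma_sets (space M) ?G" by (rule sigma_algebra_sigma_sets[OF G])
  have "{\<omega>\<in>space M. U l v \<omega> \<in> B v} \<in> ?G" for v
  proof -
    have "{\<omega>\<in>space M. U l v \<omega> \<in> B v} = U l v -` B v \<inter> space M" by blast
    then have "{\<omega>\<in>space M. U l v \<omega> \<in> B v} \<in> primitive_events M \<Lambda> J S (driver l v)"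
      unfolding primitive_events_driver mem_Collect_eq using B by (intro exI[of _ "B v"]) simp
    moreover have "driver l v \<in> block l 3" by (simp add: block_def)
    ultimately show ?thesis by (rule UN_I[rotated])
  qed
  then show ?thesis by (intro sets_Collect_finite_All sigma_sets.Basic V)
qed

lemma prob_path_cylinder:
  assumes t: "0 \<le> t" and fin: "finite T" "T \<subseteq> {0..}" "finite V" and B: "\<And>v. B v \<in> sets borel"
  shows "prob {\<omega>\<in>space M. path_from t l \<omega> \<in> cylinder T G V B} =
    prob {\<omega>\<in>space M. \<forall>u\<in>T. \<Lambda> Q1 (t + u) \<omega> - \<Lambda> Q1 t \<omega> \<in> G Q1 u} *
    prob {\<omega>\<in>space M. \<forall>u\<in>T. \<Lambda> Q2 (t + u) \<omega> - \<Lambda> Q2 t \<omega> \<in> G Q2 u} *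
    prob {\<omega>\<in>space M. \<forall>v\<in>V. U l v \<omega> \<in> B v}"
proof -
  let ?f = "\<lambda>q. {\<omega>\<in>space M. \<forall>u\<in>T. \<Lambda> q (t + u) \<omega> - \<Lambda> q t \<omega> \<in> G q u}"
  let ?u = "{\<omega>\<in>space M. \<forall>v\<in>V. U l v \<omega> \<in> B v}"
  have "space M \<in> sigma_sets (space M) (\<Union>x\<in>block l 2. primitive_events M \<Lambda> J S x)"
    by (rule sigma_sets_top)
  from prob_block4[OF arrival_future_event[OF t fin(1,2)] arrival_future_event[OF t fin(1,2)] this
      driver_event[OF fin(3) B]]
  have "prob (?f Q1 \<inter> ?f Q2 \<inter> space M \<inter> ?u) = prob (?f Q1) * prob (?f Q2) * prob ?u"
    by (simp add: prob_space)
  moreover have "?f Q1 \<inter> ?f Q2 \<inter> space M \<inter> ?u = ?f Q1 \<inter> ?f Q2 \<inter> ?u" by blast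
  ultimately show ?thesis unfolding path_cylinder[OF t] by simp
qed

text \<open>The Markov property at a fixed time. On products of events the four blocks factorize,
  the Poisson property splits each arrival process at \<open>t\<close>, and the pi-system argument
  covers the whole past.\<close>

lemma past_future_cylinder:
  assumes t: "0 \<le> t" and H: "H \<in> sets (past l t)" and C: "C \<in> cylinders"
  shows "prob (H \<inter> {\<omega>\<in>space M. path_from t l \<omega> \<in> C}) = prob H * prob {\<omega>\<in>space M. path_from 0 l \<omega> \<in> C}"
proof -
  obtain T G V B where C: "C = cylinder T G V B" and fin: "finite T" "T \<subseteq> {0..}" "finite V"
    and B: "\<And>v. B v \<in> sets borel"
    using C unfolding cylinders_def by blast
  define f where "f t q = {\<omega>\<in>space M. \<forall>u\<in>T. \<Lambda> q (t + u) \<omega> - \<Lambda> q t \<omega> \<in> G q u}" for t q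
  define u' where "u' = {\<omega>\<in>space M. \<forall>v\<in>V. U l v \<omega> \<in> B v}"
  have F: "{\<omega>\<in>space M. path_from t l \<omega> \<in> C} = f t Q1 \<inter> f t Q2 \<inter> u'" if "0 \<le> t" for t
    unfolding C path_cylinder[OF that] f_def u'_def ..
  have f_meas: "f t q \<in> sigma_sets (space M) (primitive_events M \<Lambda> J S (Arrivals q))" if t: "0 \<le> t" for t q
    unfolding f_def by (rule arrival_future_event[OF t fin(1,2)])
  have u'_meas: "u' \<in> sigma_sets (space M) (\<Union>x\<in>block l 3. primitive_events M \<Lambda> J S x)"
    unfolding u'_def by (rule driver_event[OF fin(3) B])
  have pois: "prob (a \<inter> f t q) = prob a * prob (f 0 q)" if "a \<in> arrival_past q t" for a q
  proof -
    have "f 0 q = {\<omega>\<in>space M. \<forall>u\<in>T. \<Lambda> q u \<omega> \<in> G q u}"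
      using N_0[OF arrivals arrivals_regular] by (auto simp: f_def)
    then show ?thesis
      using poisson_past_future[OF arrivals arrivals_regular t fin(1,2) that[unfolded arrival_past_def]]
      by (simp add: f_def)
  qed
  have space_past: "space M \<in> arrival_past q t" for q unfolding arrival_past_def by (rule sigma_sets_top)
  have P0: "prob (f t q) = prob (f 0 q)" for q
  proof -
    have "space M \<inter> f t q = f t q" by (auto simp: f_def)
    then show ?thesis using pois[OF space_past[of q]] prob_space by simp
  qed
  have PF: "prob (f t Q1 \<inter> f t Q2 \<inter> u') = prob (f t Q1) * prob (f t Q2) * prob u'" if "0 \<le> t" for t
    using prob_path_cylinder[OF that fin B] unfolding path_cylinder[OF that] f_def u'_def .
  let ?F = "{\<omega>\<in>space M. path_from t l \<omega> \<in> C}"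
  have Feq: "prob ?F = prob {\<omega>\<in>space M. path_from 0 l \<omega> \<in> C}"
    unfolding F[OF t] F[OF order_refl] PF[OF t] PF[OF order_refl] P0 ..
  have ev_block: "sigma_sets (space M) (\<Union>x\<in>I. primitive_events M \<Lambda> J S x) \<subseteq> events" for I
    using primitive_events_subset by (intro sets.sigma_sets_subset UN_least)
  have "f t q \<in> events" for q using f_meas[OF t, of q] arrival_events_sets[of q] by (rule rev_subsetD)
  moreover have "u' \<in> events" using u'_meas ev_block by (rule rev_subsetD)
  ultimately have Fev: "?F \<in> events" unfolding F[OF t] by (intro sets.Int)
  have "indep_set (past_product l t) {?F}"
  proof (rule indep_setI)
    have past_ev: "a \<in> events" if "a \<in> arrival_past q t" for a q
      using subset_trans[OF arrival_past_subset arrival_events_sets] that by (rule subsetD)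
    show "past_product l t \<subseteq> events"
    proof
      fix a assume "a \<in> past_product l t"
      then obtain a1 a2 u where "a = a1 \<inter> a2 \<inter> u" "a1 \<in> arrival_past Q1 t" "a2 \<in> arrival_past Q2 t"
        "u \<in> driver_past l" unfolding past_product_def by blast
      then show "a \<in> events"
        using driver_past_events past_ev by (simp only:) (intro sets.Int, auto)
    qed
    show "{?F} \<subseteq> events" using Fev by simp
    fix a b assume "a \<in> past_product l t" and "b \<in> {?F}"
    then have b: "b = f t Q1 \<inter> f t Q2 \<inter> u'" using F[OF t] by simp
    obtain a1 a2 u where a: "a = a1 \<inter> a2 \<inter> u" "a1 \<in> arrival_past Q1 t" "a2 \<in> arrival_past Q2 t"
      "u \<in> driver_past l"
      using \<open>a \<in> past_product l t\<close> unfolding past_product_def by blast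
    have af: "a \<inter> f t q \<in> sigma_sets (space M) (primitive_events M \<Lambda> J S (Arrivals q))" if "a \<in> arrival_past q t" for a q
    proof -
      have "primitive_events M \<Lambda> J S (Arrivals q) \<subseteq> Pow (space M)"
        using primitive_events_subset sets.space_closed by (rule subset_trans)
      then interpret sigma_algebra "space M" "sigma_sets (space M) (primitive_events M \<Lambda> J S (Arrivals q))"
        by (rule sigma_algebra_sigma_sets)
      show ?thesis by (rule Int[OF subsetD[OF arrival_past_subset that] f_meas[OF t]])
    qed
    have ap: "a \<in> sigma_sets (space M) (primitive_events M \<Lambda> J S (Arrivals q))" if "a \<in> arrival_past q t" for a q
      by (rule subsetD[OF arrival_past_subset that])
    \<comment> \<open>Past and future of one arrival process are not separate primitives. They stay
      together while the blocks are split, and \<open>pois\<close> separates them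
      afterwards.\<close>
    have "a \<inter> b = (a1 \<inter> f t Q1) \<inter> (a2 \<inter> f t Q2) \<inter> u \<inter> u'" unfolding a(1) b by blast
    then have "prob (a \<inter> b) = prob (a1 \<inter> f t Q1) * prob (a2 \<inter> f t Q2) * prob u * prob u'"
      using prob_block4[OF af[OF a(2)] af[OF a(3)] a(4)[unfolded driver_past_def] u'_meas] by simp
    also have "\<dots> = (prob a1 * prob a2 * prob u) * (prob (f 0 Q1) * prob (f 0 Q2) * prob u')"
      by (simp add: pois[OF a(2)] pois[OF a(3)])
    also have "prob a1 * prob a2 * prob u = prob a"
    proof -
      have "space M \<in> sigma_sets (space M) (\<Union>x\<in>block l 3. primitive_events M \<Lambda> J S x)" by (rule sigma_sets_top)
      from prob_block4[OF ap[OF a(2)] ap[OF a(3)] a(4)[unfolded driver_past_def] this]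
      have "prob (a1 \<inter> a2 \<inter> u \<inter> space M) = prob a1 * prob a2 * prob u" by (simp add: prob_space)
      moreover have "u \<subseteq> space M"
        using subsetD[OF driver_past_events a(4)] by (rule sets.sets_into_space)
      then have "a1 \<inter> a2 \<inter> u \<inter> space M = a" unfolding a(1) by blast
      ultimately show ?thesis by simp
    qed
    also have "prob (f 0 Q1) * prob (f 0 Q2) * prob u' = prob b" using PF[OF t] P0 b by simp
    finally show "prob (a \<inter> b) = prob a * prob b" .
  qed
  then have ind: "indep_set (sigma_sets (space M) (past_product l t)) (sigma_sets (space M) {?F})"
    by (rule indep_set_sigma_sets[OF _ Int_stable_past_product]) (simp add: Int_stable_def)
  have "H \<in> sigma_sets (space M) (past_product l t)"
    using H unfolding sets_past by (rule subsetD[OF sigma_sets_subseteq[OF past_generator_subset]])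
  then have "prob (H \<inter> ?F) = prob H * prob ?F" by (intro indep_setD[OF ind]) auto
  then show ?thesis unfolding Feq .
qed

end

text \<open>Stated without regularity of the paths, because the almost sure regularity of the
  service times is itself derived from it.\<close>

lemma (in polling_system) prob_services:
  assumes "finite V" "\<And>v. B v \<in> sets borel"
  shows "prob {\<omega>\<in>space M. \<forall>v\<in>V. J q k v \<omega> \<in> B v} = (\<Prod>v\<in>V. measure (distr M borel (J q 0 0)) (B v))"
proof (cases "V = {}")
  case True
  then show ?thesis by (simp add: prob_space)
next
  case False
  have [measurable]: "J q k v \<in> borel_measurable M" for v using service_integrable by blast
  define A where "A x = (case x of Service _ _ v \<Rightarrow> J q k v -` B v \<inter> space M | _ \<Rightarrow> {})" for x
  have "prob (\<Inter>x\<in>Service q k ` V. A x) = (\<Prod>x\<in>Service q k ` V. prob (A x))"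
  proof (rule indep_setsD[OF primitives_indep])
    show "\<forall>x\<in>Service q k ` V. A x \<in> primitive_events M \<Lambda> J S x"
      using assms by (auto simp: A_def)
  qed (use assms False in auto)
  also have "(\<Inter>x\<in>Service q k ` V. A x) = {\<omega>\<in>space M. \<forall>v\<in>V. J q k v \<omega> \<in> B v}"
    using False by (auto simp: A_def)
  also have "(\<Prod>x\<in>Service q k ` V. prob (A x)) = (\<Prod>v\<in>V. prob (A (Service q k v)))"
    by (subst prod.reindex) (auto simp: inj_on_def)
  also have "\<dots> = (\<Prod>v\<in>V. measure (distr M borel (J q k v)) (B v))"
    using assms by (intro prod.cong) (auto simp: A_def measure_distr)
  also have "\<dots> = (\<Prod>v\<in>V. measure (distr M borel (J q 0 0)) (B v))"
    by (simp add: service_ident[of q k])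
  finally show ?thesis .
qed

context regular_polling
begin

section \<open>Periodicity of the laws and the strong Markov property\<close>

lemma prob_switching:
  assumes "finite V" "\<And>v. B v \<in> sets borel"
  shows "prob {\<omega>\<in>space M. \<forall>v\<in>V. S q k \<omega> \<in> B v} = measure (distr M borel (S q 0)) (\<Inter>v\<in>V. B v)"
proof -
  have "(\<Inter>v\<in>V. B v) \<in> sets borel"
    using sets.finite_INT[of V B borel] assms by (cases "V = {}") auto
  then have "prob (S q k -` (\<Inter>v\<in>V. B v) \<inter> space M) = measure (distr M borel (S q k)) (\<Inter>v\<in>V. B v)"
    by (simp add: measure_distr)
  moreover have "S q k -` (\<Inter>v\<in>V. B v) \<inter> space M = {\<omega>\<in>space M. \<forall>v\<in>V. S q k \<omega> \<in> B v}" by auto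
  ultimately show ?thesis by (simp add: switching_ident[of q k])
qed

lemma prob_driver:
  assumes "finite V" "\<And>v. B v \<in> sets borel"
  shows "prob {\<omega>\<in>space M. \<forall>v\<in>V. U l v \<omega> \<in> B v} = prob {\<omega>\<in>space M. \<forall>v\<in>V. U (l mod 4) v \<omega> \<in> B v}"
  by (rule mod4_cases[of l])
    (simp_all add: U_def prob_services[OF assms] prob_switching[OF assms])

text \<open>The law of the path that drives step \<open>l\<close>. Service and switching times are
  identically distributed over the cycles, so only \<open>l mod 4\<close> matters.\<close>

definition path_law :: "nat \<Rightarrow> path set \<Rightarrow> real" where
  "path_law l C = prob {\<omega>\<in>space M. path_from 0 (l mod 4) \<omega> \<in> C}"

lemma path_law_cylinder:
  assumes "C \<in> cylinders"
  shows "prob {\<omega>\<in>space M. path_from 0 l \<omega> \<in> C} = path_law l C"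
proof -
  obtain T G V B where C: "C = cylinder T G V B" and fin: "finite T" "T \<subseteq> {0..}" "finite V"
    and B: "\<And>v. B v \<in> sets borel"
    using assms unfolding cylinders_def by blast
  show ?thesis
    unfolding path_law_def C prob_path_cylinder[OF order_refl fin B] prob_driver[OF fin(3) B, of l] by simp
qed

text \<open>One condition for two classical ones: on \<open>E\<close> the time \<open>T\<close>
  behaves as a stopping time, and \<open>E\<close> belongs to the sigma-algebra of the past of
  \<open>T\<close>.\<close>

definition adapted_time :: "nat \<Rightarrow> ('w \<Rightarrow> real) \<Rightarrow> 'w set \<Rightarrow> bool" where
  "adapted_time l T E \<longleftrightarrow> E \<subseteq> space M \<and>
     (\<forall>t\<ge>0. E \<inter> {\<omega>\<in>space M. T \<omega> \<le> t} \<in> sets (past l t))"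

lemma past_events: "sets (past l t) \<subseteq> events" if "0 \<le> t"
  unfolding sets_past past_generator_def
  using Lam_measurable[THEN measurable_sets] U_measurable[THEN measurable_sets]
  by (intro sets.sigma_sets_subset) auto

lemma adapted_time_event:
  assumes "adapted_time l T E"
  shows "E \<in> events"
proof -
  have "E = (\<Union>k::nat. E \<inter> {\<omega>\<in>space M. T \<omega> \<le> real k})"
  proof (intro set_eqI iffI)
    fix \<omega> assume "\<omega> \<in> E"
    moreover obtain k where "T \<omega> \<le> real k" using real_arch_simple by blast
    moreover have "\<omega> \<in> space M" using assms \<open>\<omega> \<in> E\<close> by (auto simp: adapted_time_def)
    ultimately show "\<omega> \<in> (\<Union>k::nat. E \<inter> {\<omega>\<in>space M. T \<omega> \<le> real k})" by blast
  qed blast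
  moreover have "E \<inter> {\<omega>\<in>space M. T \<omega> \<le> real k} \<in> events" for k
    using assms past_events[of "real k" l] by (auto simp: adapted_time_def)
  then have "(\<Union>k::nat. E \<inter> {\<omega>\<in>space M. T \<omega> \<le> real k}) \<in> events"
    by (intro sets.countable_UN image_subsetI)
  ultimately show ?thesis by (rule ssubst)
qed

text \<open>\<open>mesh\<close> rounds strictly upwards, so its level sets are cut out by strict
  inequalities; these are countable unions over earlier pasts.\<close>

lemma adapted_time_less:
  assumes T: "adapted_time l T E" "\<And>\<omega>. \<omega> \<in> space M \<Longrightarrow> 0 \<le> T \<omega>" and t: "0 \<le> t"
  shows "E \<inter> {\<omega>\<in>space M. T \<omega> < t} \<in> sets (past l t)"
proof -
  have eq: "E \<inter> {\<omega>\<in>space M. T \<omega> < t} = (\<Union>k::nat. E \<inter> {\<omega>\<in>space M. T \<omega> \<le> t - 1 / real (Suc k)})"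
  proof (intro set_eqI iffI)
    fix \<omega> assume w: "\<omega> \<in> E \<inter> {\<omega>\<in>space M. T \<omega> < t}"
    then obtain k where "1 / real (Suc k) < t - T \<omega>" using nat_approx_posE[of "t - T \<omega>"] by auto
    then show "\<omega> \<in> (\<Union>k::nat. E \<inter> {\<omega>\<in>space M. T \<omega> \<le> t - 1 / real (Suc k)})"
      using w by (intro UN_I[of k]) auto
  next
    fix \<omega> assume "\<omega> \<in> (\<Union>k::nat. E \<inter> {\<omega>\<in>space M. T \<omega> \<le> t - 1 / real (Suc k)})"
    then obtain k where k: "\<omega> \<in> E" "\<omega> \<in> space M" "T \<omega> \<le> t - 1 / real (Suc k)" by blast
    have "0 < 1 / real (Suc k)" by simp
    then have "T \<omega> < t" using k(3) by linarith
    then show "\<omega> \<in> E \<inter> {\<omega>\<in>space M. T \<omega> < t}" using k by simp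
  qed
  have "E \<inter> {\<omega>\<in>space M. T \<omega> \<le> u} \<in> sets (past l t)" if "u \<le> t" for u
  proof (cases "0 \<le> u")
    case True
    then have "E \<inter> {\<omega>\<in>space M. T \<omega> \<le> u} \<in> sets (past l u)" using T by (simp add: adapted_time_def)
    then show ?thesis using past_mono[OF order_refl that] by blast
  next
    case False
    then have "E \<inter> {\<omega>\<in>space M. T \<omega> \<le> u} = {}" using T(2) by force
    then show ?thesis by (metis sets.empty_sets)
  qed
  then show ?thesis unfolding eq by (intro sets.countable_UN) auto
qed

text \<open>For the rounded time the property holds on every level set by the Markov property at
  fixed times. The common value does not depend on \<open>n\<close>, and right-continuity transfers
  it to \<open>T\<close> by dominated convergence.\<close>

lemma strong_markov_cylinder:
  assumes T: "adapted_time l T E" "\<And>\<omega>. \<omega> \<in> space M \<Longrightarrow> 0 \<le> T \<omega>"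
    and Tm [measurable]: "T \<in> borel_measurable M" and C: "C \<in> cylinders"
  shows "prob (E \<inter> {\<omega>\<in>space M. path_from (T \<omega>) l \<omega> \<in> C}) = prob E * path_law l C"
proof -
  note [measurable] = adapted_time_event[OF T(1)]
  have C_set: "C \<in> sets path_space" using C unfolding sets_path_space by (rule sigma_sets.Basic)
  have mesh0: "0 \<le> mesh n (T \<omega>)" if "\<omega> \<in> space M" for n \<omega>
    using mesh_bounds(1)[OF T(2)[OF that], of n] T(2)[OF that] by linarith
  have mesh_meas [measurable]: "(\<lambda>\<omega>. mesh n (T \<omega>)) \<in> borel_measurable M" for n
    unfolding mesh_def by measurable
  have ev: "E \<inter> {\<omega>\<in>space M. path_from (R \<omega>) l \<omega> \<in> C} \<in> events"
    if "R \<in> borel_measurable M" "\<And>\<omega>. \<omega> \<in> space M \<Longrightarrow> 0 \<le> R \<omega>" for R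
  proof -
    have "{\<omega>\<in>space M. path_from (R \<omega>) l \<omega> \<in> C} \<in> events"
      using measurable_sets[OF path_measurable[OF that] C_set] by (simp add: vimage_def Int_def conj_commute)
    then show ?thesis by (rule sets.Int[OF adapted_time_event[OF T(1)]])
  qed
  have mesh_prob: "prob (E \<inter> {\<omega>\<in>space M. path_from (mesh n (T \<omega>)) l \<omega> \<in> C}) = prob E * path_law l C" for n
  proof -
    let ?N = "\<lambda>\<omega>. nat \<lfloor>real (Suc n) * T \<omega>\<rfloor>"
    define t where "t k = real (Suc k) / real (Suc n)" for k
    define H where "H k = E \<inter> {\<omega>\<in>space M. ?N \<omega> = k}" for k
    have t0: "0 \<le> t k" for k by (simp add: t_def)
    have H: "H k \<in> sets (past l (t k))" for k
    proof -
      have iff: "?N \<omega> = k \<longleftrightarrow> T \<omega> < t k \<and> \<not> T \<omega> < real k / real (Suc n)" if "\<omega> \<in> space M" for \<omega>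
      proof -
        have "?N \<omega> = k \<longleftrightarrow> \<lfloor>real (Suc n) * T \<omega>\<rfloor> = int k" using T(2)[OF that] by auto
        also have "\<dots> \<longleftrightarrow> real k \<le> real (Suc n) * T \<omega> \<and> real (Suc n) * T \<omega> < real k + 1"
          by (simp add: floor_eq_iff)
        also have "\<dots> \<longleftrightarrow> \<not> T \<omega> < real k / real (Suc n) \<and> T \<omega> < t k"
          unfolding t_def by (subst pos_less_divide_eq, simp, subst pos_less_divide_eq, simp)
            (auto simp: mult.commute)
        finally show ?thesis by blast
      qed
      \<comment> \<open>The \<open>k\<close>-th level set says that \<open>T\<close> lies in the
        half-open interval between the grid points with indices \<open>k\<close> and
        \<open>k + 1\<close>, so it belongs to the past of its right end.\<close>
      have "H k = (E \<inter> {\<omega>\<in>space M. T \<omega> < t k}) - (E \<inter> {\<omega>\<in>space M. T \<omega> < real k / real (Suc n)})"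
        unfolding H_def using iff by blast
      moreover have "E \<inter> {\<omega>\<in>space M. T \<omega> < t k} \<in> sets (past l (t k))"
        by (rule adapted_time_less[OF T t0])
      moreover have le: "real k / real (Suc n) \<le> t k" unfolding t_def by (intro divide_right_mono) auto
      have "E \<inter> {\<omega>\<in>space M. T \<omega> < real k / real (Suc n)} \<in> sets (past l (real k / real (Suc n)))"
        by (rule adapted_time_less[OF T], assumption, rule divide_nonneg_nonneg) (rule of_nat_0_le_iff)+
      then have "E \<inter> {\<omega>\<in>space M. T \<omega> < real k / real (Suc n)} \<in> sets (past l (t k))"
        by (rule subsetD[OF past_mono[OF order_refl le]])
      ultimately show ?thesis by (simp only: sets.Diff)
    qed
    have Hev: "H k \<in> events" for k using H past_events[OF t0] by blast
    have disj: "disjoint_family H" by (auto simp: disjoint_family_on_def H_def)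
    have HE: "(\<Union>k. H k) = E" using sets.sets_into_space[OF adapted_time_event[OF T(1)]] by (auto simp: H_def)
    let ?P = "\<lambda>k. {\<omega>\<in>space M. path_from (t k) l \<omega> \<in> C}"
    have P: "?P k \<in> events" for k
    proof -
      have "(\<lambda>\<omega>. path_from (t k) l \<omega>) \<in> measurable M path_space"
        by (rule path_measurable) (simp_all add: t0)
      from measurable_sets[OF this C_set] show ?thesis by (simp add: vimage_def Int_def conj_commute)
    qed
    have "E \<inter> {\<omega>\<in>space M. path_from (mesh n (T \<omega>)) l \<omega> \<in> C} = (\<Union>k. H k \<inter> ?P k)"
      unfolding H_def mesh_def t_def by auto
    moreover have sums1: "(\<lambda>k. prob (H k \<inter> ?P k)) sums prob (\<Union>k. H k \<inter> ?P k)"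
    proof (rule finite_measure_UNION)
      show "range (\<lambda>k. H k \<inter> ?P k) \<subseteq> events" using Hev P by blast
      show "disjoint_family (\<lambda>k. H k \<inter> ?P k)" using disj by (auto simp: disjoint_family_on_def)
    qed
    moreover have "prob (H k \<inter> ?P k) = prob (H k) * path_law l C" for k
      using past_future_cylinder[OF t0 H C] path_law_cylinder[OF C] by simp
    moreover have sums2: "(\<lambda>k. prob (H k) * path_law l C) sums (prob (\<Union>k. H k) * path_law l C)"
      using Hev disj by (intro sums_mult2 finite_measure_UNION) auto
    ultimately show ?thesis using sums_unique2[OF sums1, of "prob E * path_law l C"] HE by simp
  qed
  have "(\<lambda>n. prob (E \<inter> {\<omega>\<in>space M. path_from (mesh n (T \<omega>)) l \<omega> \<in> C})) \<longlonglongrightarrow>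
      prob (E \<inter> {\<omega>\<in>space M. path_from (T \<omega>) l \<omega> \<in> C})"
  proof -
    let ?f = "\<lambda>n. indicat_real (E \<inter> {\<omega>\<in>space M. path_from (mesh n (T \<omega>)) l \<omega> \<in> C})"
    let ?g = "indicat_real (E \<inter> {\<omega>\<in>space M. path_from (T \<omega>) l \<omega> \<in> C})"
    obtain Ts G V B where C': "C = cylinder Ts G V B" and fin: "finite Ts" "Ts \<subseteq> {0..}"
      using C unfolding cylinders_def by blast
    have lim: "(\<lambda>n. ?f n \<omega>) \<longlonglongrightarrow> ?g \<omega>" if w: "\<omega> \<in> space M" for \<omega>
    proof (rule tendsto_eventually)
      have right: "eventually (\<lambda>n. \<Lambda> q (mesh n (T \<omega>) + u) \<omega> = \<Lambda> q (T \<omega> + u) \<omega>) sequentially"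
        if u: "0 \<le> u" for u q
      proof -
        obtain e where e: "e > 0" "\<forall>x\<in>{T \<omega> + u..T \<omega> + u + e}. \<Lambda> q x \<omega> = \<Lambda> q (T \<omega> + u) \<omega>"
          using Lam_right[OF w, of "T \<omega> + u"] T(2)[OF w] u by auto
        show ?thesis
          using eventually_mesh[OF T(2)[OF w] e(1)]
        proof (rule eventually_mono)
          fix n assume "mesh n (T \<omega>) \<in> {T \<omega>..T \<omega> + e}"
          then have "mesh n (T \<omega>) + u \<in> {T \<omega> + u..T \<omega> + u + e}" by simp
          then show "\<Lambda> q (mesh n (T \<omega>) + u) \<omega> = \<Lambda> q (T \<omega> + u) \<omega>" using e(2) by blast
        qed
      qed
      \<comment> \<open>A cylinder inspects finitely many times, and 0 is added because increments
        are taken from \<open>T\<close>. All these values are eventually exact, hence so is the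
        indicator.\<close>
      have "eventually (\<lambda>n. \<forall>u\<in>insert 0 Ts. \<forall>q. \<Lambda> q (mesh n (T \<omega>) + u) \<omega> = \<Lambda> q (T \<omega> + u) \<omega>) sequentially"
        unfolding all_queue using fin
        by (intro eventually_ball_finite ballI eventually_conj right) auto
      then show "eventually (\<lambda>n. ?f n \<omega> = ?g \<omega>) sequentially"
      proof (rule eventually_mono)
        fix n assume eq: "\<forall>u\<in>insert 0 Ts. \<forall>q. \<Lambda> q (mesh n (T \<omega>) + u) \<omega> = \<Lambda> q (T \<omega> + u) \<omega>"
        have "\<Lambda> q (mesh n (T \<omega>)) \<omega> = \<Lambda> q (T \<omega>) \<omega>" for q
          using bspec[OF eq, of 0] by simp
        moreover have "\<Lambda> q (mesh n (T \<omega>) + u) \<omega> = \<Lambda> q (T \<omega> + u) \<omega>" if "u \<in> Ts" for u q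
          using eq that by blast
        ultimately have "path_from (mesh n (T \<omega>)) l \<omega> \<in> C \<longleftrightarrow> path_from (T \<omega>) l \<omega> \<in> C"
          unfolding C' cylinder_def mem_Collect_eq fst_path snd_path
          using path_regular[OF w T(2)[OF w], of l] path_regular[OF w mesh0[OF w], of n l] by simp
        then show "?f n \<omega> = ?g \<omega>" by (simp add: indicator_def)
      qed
    qed
    have Int_space: "X \<inter> space M = X" if "X \<in> events" for X
      using sets.sets_into_space[OF that] by blast
    have "(\<lambda>n. integral\<^sup>L M (?f n)) \<longlonglongrightarrow> integral\<^sup>L M ?g"
    proof (rule integral_dominated_convergence)
      show "?g \<in> borel_measurable M" using ev[OF Tm T(2)] by (intro borel_measurable_indicator)
      show "?f n \<in> borel_measurable M" for n
        using ev[OF mesh_meas mesh0, of n] by (intro borel_measurable_indicator)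
      show "integrable M (\<lambda>_. 1 :: real)" by simp
      show "AE \<omega> in M. norm (?f n \<omega>) \<le> 1" for n by (simp add: indicator_def)
    qed (use lim in simp)
    moreover have "integral\<^sup>L M (?f n) = prob (E \<inter> {\<omega>\<in>space M. path_from (mesh n (T \<omega>)) l \<omega> \<in> C})" for n
      using Int_space[OF ev[OF mesh_meas mesh0, of n]] Bochner_Integration.integral_indicator by metis
    moreover have "integral\<^sup>L M ?g = prob (E \<inter> {\<omega>\<in>space M. path_from (T \<omega>) l \<omega> \<in> C})"
      using Int_space[OF ev[OF Tm T(2)]] Bochner_Integration.integral_indicator by metis
    ultimately show ?thesis by simp
  qed
  then show ?thesis unfolding mesh_prob by (simp add: LIMSEQ_const_iff)
qed

lemma path_event:
  assumes "T \<in> borel_measurable M" "\<And>\<omega>. \<omega> \<in> space M \<Longrightarrow> 0 \<le> T \<omega>" "C \<in> sets path_space"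
  shows "{\<omega>\<in>space M. path_from (T \<omega>) l \<omega> \<in> C} \<in> events"
  using measurable_sets[OF path_measurable[OF assms(1,2)] assms(3)]
  by (simp add: vimage_def Int_def conj_commute)

text \<open>Cylinders generate the path space and are stable under intersection, and both sides are
  additive in \<open>C\<close>.\<close>

theorem strong_markov:
  assumes T: "adapted_time l T E" "\<And>\<omega>. \<omega> \<in> space M \<Longrightarrow> 0 \<le> T \<omega>"
    and Tm: "T \<in> borel_measurable M" and C: "C \<in> sets path_space"
  shows "prob (E \<inter> {\<omega>\<in>space M. path_from (T \<omega>) l \<omega> \<in> C}) = prob E * path_law l C"
  using Int_stable_cylinders cylinders_Pow C[unfolded sets_path_space]
proof (induction rule: sigma_sets_induct_disjoint)
  case (basic C)
  show ?case using strong_markov_cylinder[OF T Tm basic] .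
next
  case empty
  then show ?case by (simp add: path_law_def)
next
  case (compl C)
  have Cs: "C \<in> sets path_space" using compl by (simp add: sets_path_space)
  note E = adapted_time_event[OF T(1)]
  have E_sub: "E \<subseteq> space M" using E by (rule sets.sets_into_space)
  have reg: "path_from (T \<omega>) l \<omega> \<in> regular_paths" if "\<omega> \<in> space M" for \<omega>
    using path_regular[OF that T(2)[OF that]] .
  have "E \<inter> {\<omega>\<in>space M. path_from (T \<omega>) l \<omega> \<in> regular_paths - C} =
      E - (E \<inter> {\<omega>\<in>space M. path_from (T \<omega>) l \<omega> \<in> C})"
    using reg E_sub by blast
  then have eq1: "prob (E \<inter> {\<omega>\<in>space M. path_from (T \<omega>) l \<omega> \<in> regular_paths - C}) =
      prob E - prob (E \<inter> {\<omega>\<in>space M. path_from (T \<omega>) l \<omega> \<in> C})"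
    using E path_event[OF Tm T(2) Cs, of l] by (simp add: finite_measure_Diff)
  have eq2: "path_law l (regular_paths - C) = 1 - path_law l C"
  proof -
    have "{\<omega>\<in>space M. path_from 0 (l mod 4) \<omega> \<in> regular_paths - C} =
        space M - {\<omega>\<in>space M. path_from 0 (l mod 4) \<omega> \<in> C}"
      using path_regular by auto
    then show ?thesis
      unfolding path_law_def using path_event[of "\<lambda>_. 0" C "l mod 4"] Cs by (simp add: prob_compl)
  qed
  show ?case unfolding eq1 eq2 compl(2) by (simp add: right_diff_distrib)
next
  case (union A)
  have A: "A i \<in> sets path_space" for i using union by (auto simp: sets_path_space)
  have sums: "(\<lambda>i. prob (F \<inter> {\<omega>\<in>space M. path_from (R \<omega>) l' \<omega> \<in> A i})) sums
      prob (F \<inter> {\<omega>\<in>space M. path_from (R \<omega>) l' \<omega> \<in> (\<Union>i. A i)})"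
    if R: "R \<in> borel_measurable M" "\<And>\<omega>. \<omega> \<in> space M \<Longrightarrow> 0 \<le> R \<omega>" and F: "F \<in> events" for F R l'
  proof -
    have "(\<lambda>i. prob (F \<inter> {\<omega>\<in>space M. path_from (R \<omega>) l' \<omega> \<in> A i})) sums
        prob (\<Union>i. F \<inter> {\<omega>\<in>space M. path_from (R \<omega>) l' \<omega> \<in> A i})"
    proof (rule finite_measure_UNION)
      show "range (\<lambda>i. F \<inter> {\<omega>\<in>space M. path_from (R \<omega>) l' \<omega> \<in> A i}) \<subseteq> events"
        using F path_event[OF R A, of l'] by blast
      show "disjoint_family (\<lambda>i. F \<inter> {\<omega>\<in>space M. path_from (R \<omega>) l' \<omega> \<in> A i})"
        using union(1) unfolding disjoint_family_on_def by blast
    qed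
    moreover have "(\<Union>i. F \<inter> {\<omega>\<in>space M. path_from (R \<omega>) l' \<omega> \<in> A i}) =
        F \<inter> {\<omega>\<in>space M. path_from (R \<omega>) l' \<omega> \<in> (\<Union>i. A i)}" by blast
    ultimately show ?thesis by simp
  qed
  have "(\<lambda>i. path_law l (A i)) sums path_law l (\<Union>i. A i)"
    using sums[of "\<lambda>_. 0" "space M" "l mod 4"] by (simp add: path_law_def Int_def)
  then have "(\<lambda>i. prob E * path_law l (A i)) sums (prob E * path_law l (\<Union>i. A i))"
    by (rule sums_mult)
  then have "(\<lambda>i. prob (E \<inter> {\<omega>\<in>space M. path_from (T \<omega>) l \<omega> \<in> A i})) sums
      (prob E * path_law l (\<Union>i. A i))"
    by (simp only: union(3))
  with sums[OF Tm T(2) adapted_time_event[OF T(1)], of l] show ?case by (rule sums_unique2)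
qed

end

subsection \<open>The embedded chain and its history\<close>

locale polling_policy = regular_polling M lam \<mu> s \<Lambda> J S
  for M :: "'w measure" and lam \<mu> s \<Lambda> J S +
  fixes p :: policy
begin

primrec state :: "content \<Rightarrow> nat \<Rightarrow> 'w \<Rightarrow> real \<times> content" where
  "state z 0 \<omega> = (0, z)"
| "state z (Suc l) \<omega> =
    (fst (state z l \<omega>) + duration \<mu> p (kind_at l) (snd (state z l \<omega>)) (path_from (fst (state z l \<omega>)) l \<omega>),
     outcome \<mu> p (kind_at l) (snd (state z l \<omega>)) (path_from (fst (state z l \<omega>)) l \<omega>))"

definition clock :: "content \<Rightarrow> nat \<Rightarrow> 'w \<Rightarrow> real" where
  "clock z l \<omega> = fst (state z l \<omega>)"

definition cust :: "content \<Rightarrow> nat \<Rightarrow> 'w \<Rightarrow> content" where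
  "cust z l \<omega> = snd (state z l \<omega>)"

definition stopping_paths :: "nat \<Rightarrow> content \<Rightarrow> path set" where
  "stopping_paths l n = {w\<in>regular_paths. stop_set \<mu> p (kind_at l) n w \<noteq> {}}"

text \<open>The chain \<open>state\<close> is defined even when a step never ends, but its value
  then means nothing; this event singles out the meaningful case.\<close>

definition step_ends :: "content \<Rightarrow> nat \<Rightarrow> 'w set" where
  "step_ends z l = {\<omega>\<in>space M. path_from (clock z l \<omega>) l \<omega> \<in> stopping_paths l (cust z l \<omega>)}"

definition next_paths :: "nat \<Rightarrow> content \<Rightarrow> content set \<Rightarrow> path set" where
  "next_paths l n D = {w\<in>stopping_paths l n. outcome \<mu> p (kind_at l) n w \<in> D}"

lemma clock_0 [simp]: "clock z 0 \<omega> = 0" and cust_0 [simp]: "cust z 0 \<omega> = z"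
  by (simp_all add: clock_def cust_def)

lemma clock_Suc: "clock z (Suc l) \<omega> =
    clock z l \<omega> + duration \<mu> p (kind_at l) (cust z l \<omega>) (path_from (clock z l \<omega>) l \<omega>)"
  and cust_Suc: "cust z (Suc l) \<omega> = outcome \<mu> p (kind_at l) (cust z l \<omega>) (path_from (clock z l \<omega>) l \<omega>)"
  by (simp_all add: clock_def cust_def)

lemma clock_nonneg: "0 \<le> clock z l \<omega>"
  by (induction l) (simp_all add: clock_Suc duration_nonneg)

lemma stopping_paths_sets: "stopping_paths l n \<in> sets path_space"
  using stop_set_nonempty_measurable[of \<mu> p "kind_at l" n] by (simp add: stopping_paths_def)

lemma next_paths_sets: "next_paths l n D \<in> sets path_space"
proof -
  have "next_paths l n D = stopping_paths l n \<inter> (outcome \<mu> p (kind_at l) n -` D \<inter> space path_space)"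
    by (auto simp: next_paths_def stopping_paths_def)
  then show ?thesis
    using stopping_paths_sets[of l n] measurable_sets[OF outcome_measurable[of \<mu> p "kind_at l" n], of D] by simp
qed

lemma state_measurable:
  "clock z l \<in> borel_measurable M \<and> cust z l \<in> measurable M (count_space UNIV)"
proof (induction l)
  case 0
  have "clock z 0 = (\<lambda>_. 0)" "cust z 0 = (\<lambda>_. z)" by auto
  then show ?case by simp
next
  case (Suc l)
  have c: "clock z l \<in> borel_measurable M" and n: "cust z l \<in> measurable M (count_space UNIV)"
    using Suc by auto
  have pm [measurable]: "(\<lambda>\<omega>. path_from (clock z l \<omega>) l \<omega>) \<in> measurable M path_space"
    by (rule path_measurable[OF c clock_nonneg])
  have "(\<lambda>\<omega>. duration \<mu> p (kind_at l) (cust z l \<omega>) (path_from (clock z l \<omega>) l \<omega>)) \<in> borel_measurable M"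
    by (rule measurable_compose_countable[OF _ n, where f = "\<lambda>n \<omega>. duration \<mu> p (kind_at l) n (path_from (clock z l \<omega>) l \<omega>)"])
      (rule measurable_compose[OF pm duration_measurable])
  moreover have "(\<lambda>\<omega>. outcome \<mu> p (kind_at l) (cust z l \<omega>) (path_from (clock z l \<omega>) l \<omega>)) \<in> measurable M (count_space UNIV)"
    by (rule measurable_compose_countable[OF _ n, where f = "\<lambda>n \<omega>. outcome \<mu> p (kind_at l) n (path_from (clock z l \<omega>) l \<omega>)"])
      (rule measurable_compose[OF pm outcome_measurable])
  ultimately show ?case using c by (simp add: clock_Suc [abs_def] cust_Suc [abs_def])
qed

lemma clock_measurable [measurable]: "clock z l \<in> borel_measurable M"
  and cust_measurable [measurable]: "cust z l \<in> measurable M (count_space UNIV)"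
  using state_measurable by auto

text \<open>What is known when step \<open>l\<close> begins. The condition is imposed on each value
  of the contents separately, since only for fixed contents is the next step a fixed functional of
  the path.\<close>

definition history :: "content \<Rightarrow> nat \<Rightarrow> 'w set set" where
  "history z l = {E. \<forall>n. adapted_time l (clock z l) (E \<inter> {\<omega>\<in>space M. cust z l \<omega> = n}) \<and> E \<subseteq> space M}"

lemma history_0: "space M \<in> history z 0"
proof -
  have "space M \<inter> {\<omega>\<in>space M. cust z 0 \<omega> = n} \<inter> {\<omega>\<in>space M. clock z 0 \<omega> \<le> t} \<in> sets (past 0 t)"
    if "0 \<le> t" for n t
  proof -
    have "space M \<inter> {\<omega>\<in>space M. cust z 0 \<omega> = n} \<inter> {\<omega>\<in>space M. clock z 0 \<omega> \<le> t}
        = (if z = n then space (past 0 t) else {})"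
      using that by auto
    moreover have "(if z = n then space (past 0 t) else {}) \<in> sets (past 0 t)"
      by (auto simp del: space_past)
    ultimately show ?thesis by (simp only:)
  qed
  then show ?thesis unfolding history_def adapted_time_def by blast
qed

lemma history_adapted: "E \<in> history z l \<Longrightarrow> adapted_time l (clock z l) (E \<inter> {\<omega>\<in>space M. cust z l \<omega> = n})"
  and history_subset: "E \<in> history z l \<Longrightarrow> E \<subseteq> space M"
  by (simp_all add: history_def)

lemma history_split:
  assumes "E \<in> history z l"
  shows "E = (\<Union>n. E \<inter> {\<omega>\<in>space M. cust z l \<omega> = n})"
  using history_subset[OF assms] by blast

lemma history_event:
  assumes E: "E \<in> history z l"
  shows "E \<in> events"
proof -
  have "E \<inter> {\<omega>\<in>space M. cust z l \<omega> = n} \<in> events" for n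
    by (rule adapted_time_event[OF history_adapted[OF E]])
  then have "(\<Union>n. E \<inter> {\<omega>\<in>space M. cust z l \<omega> = n}) \<in> events"
    by (intro sets.countable_UN' countableI_type image_subsetI)
  then show ?thesis using history_split[OF E] by simp
qed

lemma history_cust:
  assumes E: "E \<in> history z l"
  shows "E \<inter> {\<omega>\<in>space M. cust z l \<omega> \<in> D} \<in> history z l"
proof -
  have "adapted_time l (clock z l) (E \<inter> {\<omega>\<in>space M. cust z l \<omega> \<in> D} \<inter> {\<omega>\<in>space M. cust z l \<omega> = n})" for n
  proof (cases "n \<in> D")
    case True
    then have "E \<inter> {\<omega>\<in>space M. cust z l \<omega> \<in> D} \<inter> {\<omega>\<in>space M. cust z l \<omega> = n} = E \<inter> {\<omega>\<in>space M. cust z l \<omega> = n}"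
      by blast
    then show ?thesis using history_adapted[OF E, of n] by simp
  next
    case False
    then have "E \<inter> {\<omega>\<in>space M. cust z l \<omega> \<in> D} \<inter> {\<omega>\<in>space M. cust z l \<omega> = n} = {}" by blast
    then show ?thesis by (simp add: adapted_time_def)
  qed
  then show ?thesis using history_subset[OF E] by (auto simp: history_def)
qed

lemma history_markov:
  assumes "E \<in> history z l" "C \<in> sets path_space"
  shows "prob (E \<inter> {\<omega>\<in>space M. cust z l \<omega> = n} \<inter> {\<omega>\<in>space M. path_from (clock z l \<omega>) l \<omega> \<in> C}) =
    prob (E \<inter> {\<omega>\<in>space M. cust z l \<omega> = n}) * path_law l C"
  by (rule strong_markov[OF history_adapted[OF assms(1)] clock_nonneg clock_measurable assms(2)])

text \<open>
  A path that continues deterministically after time \<open>t\<close>. It is measurable with respect to the past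
  of \<open>t\<close> and agrees with the true path up to \<open>t\<close>, hence decides every event that occurs before \<open>t\<close>.
\<close>

definition frozen_arrivals :: "real \<Rightarrow> 'w \<Rightarrow> queue \<Rightarrow> real \<Rightarrow> nat" where
  "frozen_arrivals t \<omega> q u = \<Lambda> q (min u t) \<omega> + nat \<lfloor>max 0 (u - t)\<rfloor>"

lemma frozen_regular:
  assumes w: "\<omega> \<in> space M" and t: "0 \<le> t"
  shows "regular_arrivals (frozen_arrivals t \<omega> q)"
  unfolding regular_arrivals_def
proof (intro conjI allI impI)
  note reg = arrivals_regular[OF w, of q]
  show "frozen_arrivals t \<omega> q 0 = 0"
    using t N_0[OF arrivals arrivals_regular w, of q] by (simp add: frozen_arrivals_def)
  show "mono_on {0..} (frozen_arrivals t \<omega> q)"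
  proof (rule mono_onI)
    fix x y :: real assume "x \<in> {0..}" "x \<le> y"
    then have "\<Lambda> q (min x t) \<omega> \<le> \<Lambda> q (min y t) \<omega>"
      using t by (intro regular_arrivals_mono[OF reg]) auto
    moreover have "nat \<lfloor>max 0 (x - t)\<rfloor> \<le> nat \<lfloor>max 0 (y - t)\<rfloor>"
      using \<open>x \<le> y\<close> by (intro nat_mono floor_mono) simp
    ultimately show "frozen_arrivals t \<omega> q x \<le> frozen_arrivals t \<omega> q y"
      unfolding frozen_arrivals_def by (rule add_mono)
  qed
  fix m
  \<comment> \<open>After \<open>t\<close> the continuation gains one customer per unit of time, as
    regular arrivals have to be unbounded.\<close>
  have "max 0 (t + real m - t) = real m" by simp
  then have "nat \<lfloor>max 0 (t + real m - t)\<rfloor> = m" by simp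
  then have "m \<le> frozen_arrivals t \<omega> q (t + real m)" by (simp only: frozen_arrivals_def)
  then show "\<exists>u\<ge>0. m \<le> frozen_arrivals t \<omega> q u" using t by (intro exI[of _ "t + real m"]) simp
next
  fix u :: real assume u: "0 \<le> u"
  show "\<exists>e>0. \<forall>x\<in>{u..u + e}. frozen_arrivals t \<omega> q x = frozen_arrivals t \<omega> q u"
  proof (cases "u < t")
    case True
    obtain e where e: "e > 0" "\<forall>x\<in>{u..u + e}. \<Lambda> q x \<omega> = \<Lambda> q u \<omega>" using Lam_right[OF w u] by blast
    have "frozen_arrivals t \<omega> q x = frozen_arrivals t \<omega> q u" if "x \<in> {u..u + min e (t - u)}" for x
    proof -
      have "x \<in> {u..u + e}" "x \<le> t" using that by auto
      then have "\<Lambda> q x \<omega> = \<Lambda> q u \<omega>" using e(2) by blast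
      then show ?thesis using \<open>x \<le> t\<close> True by (simp add: frozen_arrivals_def)
    qed
    moreover have "0 < min e (t - u)" using e True by simp
    ultimately show ?thesis by blast
  next
    case False
    \<comment> \<open>Half the distance to the next jump of the deterministic continuation.\<close>
    define e where "e = (of_int \<lfloor>u - t\<rfloor> + 1 - (u - t)) / 2"
    have less: "u - t < of_int \<lfloor>u - t\<rfloor> + 1" by linarith
    have e: "e > 0" "u - t + e < of_int \<lfloor>u - t\<rfloor> + 1"
      using less by (simp_all add: e_def field_simps)
    have "frozen_arrivals t \<omega> q x = frozen_arrivals t \<omega> q u" if "x \<in> {u..u + e}" for x
    proof -
      have x: "u \<le> x" "x \<le> u + e" using that by auto
      have "of_int \<lfloor>u - t\<rfloor> \<le> u - t" by linarith
      then have "of_int \<lfloor>u - t\<rfloor> \<le> x - t" using x(1) by linarith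
      moreover have "x - t < of_int \<lfloor>u - t\<rfloor> + 1" using x(2) e(2) by linarith
      ultimately have "\<lfloor>x - t\<rfloor> = \<lfloor>u - t\<rfloor>" by (rule floor_unique)
      moreover have "max 0 (x - t) = x - t" "max 0 (u - t) = u - t" "min x t = t" "min u t = t"
        using that False by auto
      ultimately show ?thesis by (simp only: frozen_arrivals_def)
    qed
    then show ?thesis using e(1) by blast
  qed
qed

lemma frozen_measurable:
  assumes u: "0 \<le> u" and t: "0 \<le> t"
  shows "(\<lambda>\<omega>. frozen_arrivals t \<omega> q u) \<in> measurable (past l t) (count_space UNIV)"
proof -
  have [measurable]: "\<Lambda> q (min u t) \<in> measurable (past l t) (count_space UNIV)"
    using u t by (intro Lam_past) auto
  show ?thesis unfolding frozen_arrivals_def by measurable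
qed

lemma frozen_path_measurable:
  assumes t: "0 \<le> t" and R [measurable]: "R \<in> borel_measurable (past (Suc l) t)"
    and R0: "\<And>\<omega>. \<omega> \<in> space M \<Longrightarrow> 0 \<le> R \<omega>"
  shows "(\<lambda>\<omega>. (shift_arrivals (frozen_arrivals t \<omega>) (R \<omega>), \<lambda>v. U l v \<omega>)) \<in> measurable (past (Suc l) t) path_space"
proof (rule measurable_path_space)
  fix \<omega> assume "\<omega> \<in> space (past (Suc l) t)"
  then have w: "\<omega> \<in> space M" by simp
  have "regular_arrivals (shift_arrivals (frozen_arrivals t \<omega>) (R \<omega>) q)" for q
    by (rule regular_shift[OF frozen_regular[OF w t] R0[OF w]])
  then show "(shift_arrivals (frozen_arrivals t \<omega>) (R \<omega>), \<lambda>v. U l v \<omega>) \<in> regular_paths"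
    using U_regular[OF w] by (simp add: regular_paths_def)
next
  fix q and u :: real assume u: "0 \<le> u"
  have comp: "(\<lambda>\<omega>. frozen_arrivals t \<omega> q (T \<omega>)) \<in> measurable (past (Suc l) t) (count_space UNIV)"
    if "T \<in> borel_measurable (past (Suc l) t)" "\<And>\<omega>. \<omega> \<in> space M \<Longrightarrow> 0 \<le> T \<omega>" for T
  proof (rule measurable_right_constant_compose[where g = "\<lambda>u \<omega>. frozen_arrivals t \<omega> q u", OF that(1)])
    fix \<omega> and u :: real assume "\<omega> \<in> space (past (Suc l) t)" "0 \<le> u"
    then show "\<exists>e>0. \<forall>x\<in>{u..u + e}. frozen_arrivals t \<omega> q x = frozen_arrivals t \<omega> q u"
      using regular_arrivals_right[OF frozen_regular[OF _ t]] by simp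
  qed (use that frozen_measurable[OF _ t] in simp_all)
  have [measurable]: "(\<lambda>\<omega>. frozen_arrivals t \<omega> q (R \<omega>)) \<in> measurable (past (Suc l) t) (count_space UNIV)"
    "(\<lambda>\<omega>. frozen_arrivals t \<omega> q (R \<omega> + u)) \<in> measurable (past (Suc l) t) (count_space UNIV)"
    using R0 u by (auto intro!: comp)
  show "(\<lambda>\<omega>. fst (shift_arrivals (frozen_arrivals t \<omega>) (R \<omega>), \<lambda>v. U l v \<omega>) q u)
      \<in> measurable (past (Suc l) t) (count_space UNIV)"
    unfolding fst_conv shift_arrivals_def by measurable
qed (simp add: U_past)

lemma adapted_step:
  assumes T: "adapted_time l T E" "\<And>\<omega>. 0 \<le> T \<omega>" and t: "0 \<le> t"
  shows "E \<inter> {\<omega>\<in>space M. path_from (T \<omega>) l \<omega> \<in> next_paths l n D \<and>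
      T \<omega> + duration \<mu> p (kind_at l) n (path_from (T \<omega>) l \<omega>) \<le> t} \<in> sets (past (Suc l) t)"
proof -
  define F where "F = E \<inter> {\<omega>\<in>space M. T \<omega> \<le> t}"
  have past_le: "sets (past l x) \<subseteq> sets (past (Suc l) t)" if "x \<le> t" for x
    by (rule past_mono) (use that in auto)
  \<comment> \<open>\<open>T\<close> itself is not determined by time \<open>t\<close> where it
    exceeds \<open>t\<close> or where \<open>E\<close> fails; the value \<open>t\<close> replaces it
    there.\<close>
  define R where "R \<omega> = (if \<omega> \<in> F then T \<omega> else t)" for \<omega>
  define \<xi> where "\<xi> \<omega> = (shift_arrivals (frozen_arrivals t \<omega>) (R \<omega>), \<lambda>v. U l v \<omega>)" for \<omega>
  have F: "F \<in> sets (past (Suc l) t)"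
    using T(1) t past_le[OF order_refl] unfolding F_def adapted_time_def by blast
  have R_meas: "R \<in> borel_measurable (past (Suc l) t)"
    unfolding borel_measurable_iff_le
  proof
    fix x :: real
    show "{\<omega>\<in>space (past (Suc l) t). R \<omega> \<le> x} \<in> sets (past (Suc l) t)"
    proof (cases "t \<le> x")
      case True
      then have "{\<omega>\<in>space (past (Suc l) t). R \<omega> \<le> x} = space (past (Suc l) t)"
        by (auto simp: R_def F_def)
      then show ?thesis by (metis sets.top)
    next
      case False
      have "E \<subseteq> space M" using T(1) by (simp add: adapted_time_def)
      then have eq: "{\<omega>\<in>space (past (Suc l) t). R \<omega> \<le> x} = E \<inter> {\<omega>\<in>space M. T \<omega> \<le> x}"
        using False by (auto simp: R_def F_def)
      show ?thesis
      proof (cases "0 \<le> x")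
        case True
        then have "E \<inter> {\<omega>\<in>space M. T \<omega> \<le> x} \<in> sets (past l x)"
          using T(1) unfolding adapted_time_def by blast
        then show ?thesis unfolding eq by (rule subsetD[OF past_le, rotated]) (use False in simp)
      next
        case False
        then have "\<not> T \<omega> \<le> x" for \<omega> using T(2)[of \<omega>] by linarith
        then have "E \<inter> {\<omega>\<in>space M. T \<omega> \<le> x} = {}" by blast
        then show ?thesis unfolding eq by (simp only: sets.empty_sets)
      qed
    qed
  qed
  have R0: "0 \<le> R \<omega>" for \<omega> using t by (simp add: R_def T(2))
  have \<xi>: "\<xi> \<in> measurable (past (Suc l) t) path_space"
    unfolding \<xi>_def by (rule frozen_path_measurable[OF t R_meas R0])
  have sets: "F \<inter> {\<omega>\<in>space (past (Suc l) t). \<xi> \<omega> \<in> next_paths l n D \<and>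
      duration \<mu> p (kind_at l) n (\<xi> \<omega>) \<le> t - R \<omega>} \<in> sets (past (Suc l) t)"
  proof -
    note [measurable] = R_meas \<xi>
    have "{\<omega>\<in>space (past (Suc l) t). \<xi> \<omega> \<in> next_paths l n D} \<in> sets (past (Suc l) t)"
      using measurable_sets[OF \<xi> next_paths_sets[of l n D]] by (simp add: vimage_def Int_def conj_commute)
    moreover have "{\<omega>\<in>space (past (Suc l) t). duration \<mu> p (kind_at l) n (\<xi> \<omega>) \<le> t - R \<omega>} \<in> sets (past (Suc l) t)"
      by measurable
    ultimately show ?thesis using F by (intro sets.Int sets.sets_Collect_conj)
  qed
  have agree: "path_from (T \<omega>) l \<omega> \<in> next_paths l n D \<and>
      T \<omega> + duration \<mu> p (kind_at l) n (path_from (T \<omega>) l \<omega>) \<le> t \<longleftrightarrow>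
      \<xi> \<omega> \<in> next_paths l n D \<and> duration \<mu> p (kind_at l) n (\<xi> \<omega>) \<le> t - R \<omega>"
    if w: "\<omega> \<in> F" for \<omega>
  proof -
    have sp: "\<omega> \<in> space M" and R: "R \<omega> = T \<omega>" and ct: "T \<omega> \<le> t"
      using w by (auto simp: F_def R_def)
    let ?w = "path_from (T \<omega>) l \<omega>"
    let ?r = "t - T \<omega>"
    have reg: "?w \<in> regular_paths" by (rule path_regular[OF sp T(2)])
    have reg': "\<xi> \<omega> \<in> regular_paths" using measurable_space[OF \<xi>, of \<omega>] sp by simp
    have snd: "snd ?w = snd (\<xi> \<omega>)" by (simp add: \<xi>_def path_from_def)
    have fst: "fst ?w q u = fst (\<xi> \<omega>) q u" if "0 \<le> u" "u \<le> ?r" for q u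
      using that ct by (simp add: \<xi>_def fst_path shift_arrivals_def frozen_arrivals_def R)
    have to: "stop_set \<mu> p (kind_at l) n (\<xi> \<omega>) \<noteq> {}"
      "duration \<mu> p (kind_at l) n (\<xi> \<omega>) = duration \<mu> p (kind_at l) n ?w"
      "outcome \<mu> p (kind_at l) n (\<xi> \<omega>) = outcome \<mu> p (kind_at l) n ?w"
      if "stop_set \<mu> p (kind_at l) n ?w \<noteq> {}" "duration \<mu> p (kind_at l) n ?w \<le> ?r"
      unfolding outcome_def by (rule duration_cong_arrivals[OF reg reg' snd fst that]; assumption)+
    have from': "stop_set \<mu> p (kind_at l) n ?w \<noteq> {}"
      "duration \<mu> p (kind_at l) n ?w = duration \<mu> p (kind_at l) n (\<xi> \<omega>)"
      if "stop_set \<mu> p (kind_at l) n (\<xi> \<omega>) \<noteq> {}" "duration \<mu> p (kind_at l) n (\<xi> \<omega>) \<le> ?r"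
      by (rule duration_cong_arrivals[OF reg' reg snd[symmetric] fst[symmetric] that]; assumption)+
    have "stop_set \<mu> p (kind_at l) n ?w \<noteq> {} \<and> duration \<mu> p (kind_at l) n ?w \<le> ?r \<longleftrightarrow>
        stop_set \<mu> p (kind_at l) n (\<xi> \<omega>) \<noteq> {} \<and> duration \<mu> p (kind_at l) n (\<xi> \<omega>) \<le> ?r"
      using to(1,2) from' by metis
    moreover have "outcome \<mu> p (kind_at l) n ?w = outcome \<mu> p (kind_at l) n (\<xi> \<omega>)"
      if "stop_set \<mu> p (kind_at l) n ?w \<noteq> {} \<and> duration \<mu> p (kind_at l) n ?w \<le> ?r"
      using to(3) that by metis
    moreover have "T \<omega> + duration \<mu> p (kind_at l) n ?w \<le> t \<longleftrightarrow> duration \<mu> p (kind_at l) n ?w \<le> ?r"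
      by auto
    moreover have "w \<in> next_paths l n D \<longleftrightarrow>
        stop_set \<mu> p (kind_at l) n w \<noteq> {} \<and> outcome \<mu> p (kind_at l) n w \<in> D"
      if "w \<in> regular_paths" for w
      using that by (simp add: next_paths_def stopping_paths_def)
    ultimately show ?thesis unfolding R using reg reg' by metis
  qed
  have "E \<inter> {\<omega>\<in>space M. path_from (T \<omega>) l \<omega> \<in> next_paths l n D \<and>
      T \<omega> + duration \<mu> p (kind_at l) n (path_from (T \<omega>) l \<omega>) \<le> t} =
    F \<inter> {\<omega>\<in>space (past (Suc l) t). \<xi> \<omega> \<in> next_paths l n D \<and>
      duration \<mu> p (kind_at l) n (\<xi> \<omega>) \<le> t - R \<omega>}" (is "?L = ?Rs")
  proof (intro set_eqI iffI)
    fix \<omega> assume w: "\<omega> \<in> ?L"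
    then have "\<omega> \<in> E" "\<omega> \<in> space M" "T \<omega> + duration \<mu> p (kind_at l) n (path_from (T \<omega>) l \<omega>) \<le> t" by auto
    moreover have "T \<omega> \<le> T \<omega> + duration \<mu> p (kind_at l) n (path_from (T \<omega>) l \<omega>)"
      by (simp add: duration_nonneg)
    ultimately have "\<omega> \<in> F" unfolding F_def by (blast intro: order_trans)
    then show "\<omega> \<in> ?Rs" using agree w by simp
  next
    fix \<omega> assume w: "\<omega> \<in> ?Rs"
    then have "\<omega> \<in> F" by simp
    moreover from this have "\<omega> \<in> E" "\<omega> \<in> space M" by (simp_all add: F_def)
    ultimately show "\<omega> \<in> ?L" using agree w by simp
  qed
  then show ?thesis using sets by (simp only:)
qed

lemma history_step:
  assumes E: "E \<in> history z l"
  shows "E \<inter> step_ends z l \<in> history z (Suc l)"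
proof -
  have "E \<inter> step_ends z l \<inter> {\<omega>\<in>space M. cust z (Suc l) \<omega> = n'} \<inter> {\<omega>\<in>space M. clock z (Suc l) \<omega> \<le> t}
      \<in> sets (past (Suc l) t)" if t: "0 \<le> t" for n' t
  proof -
    let ?P = "\<lambda>n. (E \<inter> {\<omega>\<in>space M. cust z l \<omega> = n}) \<inter> {\<omega>\<in>space M. path_from (clock z l \<omega>) l \<omega> \<in> next_paths l n {n'} \<and>
      clock z l \<omega> + duration \<mu> p (kind_at l) n (path_from (clock z l \<omega>) l \<omega>) \<le> t}"
    have "?P n \<in> sets (past (Suc l) t)" for n
      by (rule adapted_step[OF history_adapted[OF E] clock_nonneg t])
    then have "(\<Union>n. ?P n) \<in> sets (past (Suc l) t)"
      by (intro sets.countable_UN' countableI_type image_subsetI)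
    moreover have "E \<inter> step_ends z l \<inter> {\<omega>\<in>space M. cust z (Suc l) \<omega> = n'} \<inter> {\<omega>\<in>space M. clock z (Suc l) \<omega> \<le> t}
        = (\<Union>n. ?P n)"
    proof (intro set_eqI)
      fix \<omega>
      show "\<omega> \<in> E \<inter> step_ends z l \<inter> {\<omega>\<in>space M. cust z (Suc l) \<omega> = n'} \<inter> {\<omega>\<in>space M. clock z (Suc l) \<omega> \<le> t}
        \<longleftrightarrow> \<omega> \<in> (\<Union>n. ?P n)"
        by (simp add: step_ends_def next_paths_def clock_Suc cust_Suc conj_ac)
    qed
    ultimately show ?thesis by (simp only:)
  qed
  then show ?thesis
    using history_subset[OF E] unfolding history_def adapted_time_def by blast
qed

end

subsection \<open>Poisson moments\<close>

lemma poisson_mean: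
  assumes r: "r > 0"
  shows "(\<integral>\<^sup>+k. of_nat k \<partial>measure_pmf (poisson_pmf r)) = ennreal r"
proof -
  let ?f = "\<lambda>k. pmf (poisson_pmf r) k * real k"
  have "(\<lambda>k. r * exp (- r) * (r ^ k /\<^sub>R fact k)) sums (r * exp (- r) * exp r)"
    by (rule sums_mult[OF exp_converges])
  moreover have "r * exp (- r) * (r ^ k /\<^sub>R fact k) = ?f (Suc k)" for k
    using r by (simp add: field_simps del: of_nat_Suc)
  moreover have "r * exp (- r) * exp r = r" by (simp add: exp_minus)
  ultimately have "(\<lambda>k. ?f (Suc k)) sums r" by (simp only:)
  then have sums: "?f sums r" using sums_Suc[of ?f r] by simp
  have "(\<integral>\<^sup>+k. of_nat k \<partial>measure_pmf (poisson_pmf r)) = (\<Sum>k. ennreal (pmf (poisson_pmf r) k) * of_nat k)"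
    by (simp add: nn_integral_measure_pmf nn_integral_count_space_nat)
  also have "\<dots> = (\<Sum>k. ennreal (?f k))"
    by (intro suminf_cong) (simp add: ennreal_mult ennreal_of_nat_eq_real_of_nat)
  also have "\<dots> = ennreal r"
    using sums by (intro suminf_ennreal_eq) (simp_all del: pmf_poisson)
  finally show ?thesis .
qed

text \<open>Comparison with the Poisson law of half the mean leaves the factor
  \<open>exp (- x / 2)\<close>. It decays geometrically in time, which makes the probabilities of
  few arrivals summable.\<close>

lemma poisson_pmf_bound:
  assumes x: "x > 0"
  shows "pmf (poisson_pmf x) l \<le> 2 ^ l * exp (- x / 2)"
proof -
  have "pmf (poisson_pmf x) l = 2 ^ l * exp (- x / 2) * pmf (poisson_pmf (x / 2)) l"
  proof -
    have "exp (- x) = exp (- x / 2) * exp (- (x / 2))" by (simp flip: exp_add)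
    moreover have "x ^ l = 2 ^ l * (x / 2) ^ l" by (simp add: power_divide)
    ultimately show ?thesis using x by simp
  qed
  also have "\<dots> \<le> 2 ^ l * exp (- x / 2) * 1"
    by (intro mult_left_mono pmf_le_1) simp
  finally show ?thesis by simp
qed

context prob_space
begin

lemma poisson_process_few:
  assumes N: "poisson_process M r N" and r: "r > 0" and k: "k > 0"
  shows "prob {\<omega>\<in>space M. N (real k) \<omega> - N 0 \<omega> < m} \<le> real m * 2 ^ m * exp (- r / 2) ^ k"
proof -
  let ?p = "poisson_pmf (r * real k)"
  have [measurable]: "N (real k) \<in> measurable M (count_space UNIV)" "N 0 \<in> measurable M (count_space UNIV)"
    using poisson_process_measurable[OF N] by auto
  have "{\<omega>\<in>space M. N (real k) \<omega> - N 0 \<omega> < m} = (\<lambda>\<omega>. N (real k) \<omega> - N 0 \<omega>) -` {..<m} \<inter> space M" by auto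
  then have "prob {\<omega>\<in>space M. N (real k) \<omega> - N 0 \<omega> < m} =
      measure (distr M (count_space UNIV) (\<lambda>\<omega>. N (real k) \<omega> - N 0 \<omega>)) {..<m}"
    by (simp add: measure_distr)
  also have "\<dots> = measure (measure_pmf ?p) {..<m}"
    using poisson_process_increment[OF N, of 0 "real k"] k by simp
  also have "\<dots> = (\<Sum>l<m. pmf ?p l)" by (rule measure_measure_pmf_finite) simp
  also have "\<dots> \<le> (\<Sum>l<m. 2 ^ m * exp (- r / 2) ^ k)"
  proof (rule sum_mono)
    fix l assume "l \<in> {..<m}"
    have "pmf ?p l \<le> 2 ^ l * exp (- (r * real k) / 2)"
      using r k by (intro poisson_pmf_bound) simp
    also have "\<dots> \<le> 2 ^ m * exp (- (r * real k) / 2)"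
      using \<open>l \<in> {..<m}\<close> by (intro mult_right_mono power_increasing) auto
    also have "exp (- (r * real k) / 2) = exp (- r / 2) ^ k"
      by (simp flip: exp_of_nat_mult)
    finally show "pmf ?p l \<le> 2 ^ m * exp (- r / 2) ^ k" .
  qed
  finally show ?thesis by (simp add: mult.assoc)
qed

lemma poisson_few_summable:
  assumes N: "poisson_process M r N" and r: "r > 0"
  shows "summable (\<lambda>k::nat. prob {\<omega>\<in>space M. N (real k) \<omega> - N 0 \<omega> < m})"
proof (rule summable_comparison_test_ev)
  show "eventually (\<lambda>k. norm (prob {\<omega>\<in>space M. N (real k) \<omega> - N 0 \<omega> < m}) \<le> real m * 2 ^ m * exp (- r / 2) ^ k) sequentially"
    using eventually_gt_at_top[of 0]
    by eventually_elim (use poisson_process_few[OF N r] in simp)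
  show "summable (\<lambda>k. real m * 2 ^ m * exp (- r / 2) ^ k)"
    using r by (intro summable_mult summable_geometric) simp
qed

end

subsection \<open>Optional stopping and Wald's inequality for one step\<close>

context polling_policy
begin

lemma Lam_0: "\<omega> \<in> space M \<Longrightarrow> \<Lambda> q 0 \<omega> = 0"
  using N_0[OF arrivals arrivals_regular] .

lemma Lam_mono: "\<omega> \<in> space M \<Longrightarrow> 0 \<le> u \<Longrightarrow> u \<le> t \<Longrightarrow> \<Lambda> q u \<omega> \<le> \<Lambda> q t \<omega>"
  using regular_arrivals_mono[OF arrivals_regular] .

lemma Lam_mean:
  assumes "0 < h"
  shows "(\<integral>\<^sup>+\<omega>. of_nat (\<Lambda> q h \<omega>) \<partial>M) = ennreal (lam q * h)"
proof -
  have [measurable]: "\<Lambda> q h \<in> measurable M (count_space UNIV)" "\<Lambda> q 0 \<in> measurable M (count_space UNIV)"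
    using Lam_measurable assms by auto
  have "(\<integral>\<^sup>+\<omega>. of_nat (\<Lambda> q h \<omega>) \<partial>M) = (\<integral>\<^sup>+\<omega>. of_nat (\<Lambda> q h \<omega> - \<Lambda> q 0 \<omega>) \<partial>M)"
    by (intro nn_integral_cong) (simp add: Lam_0)
  also have "\<dots> = (\<integral>\<^sup>+k. of_nat k \<partial>distr M (count_space UNIV) (\<lambda>\<omega>. \<Lambda> q h \<omega> - \<Lambda> q 0 \<omega>))"
    by (subst nn_integral_distr) auto
  also have "\<dots> = ennreal (lam q * h)"
    using poisson_process_increment[OF arrivals, of 0 h q] poisson_mean[of "lam q * h"] lam_pos[of q] assms by simp
  finally show ?thesis .
qed

text \<open>The mean of a count is the sum of its tail probabilities, and each tail event of the
  increment is a cylinder event independent of \<open>H\<close>.\<close>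

lemma increment_past_mean:
  assumes u: "0 \<le> u" and h: "0 < h" and H: "H \<in> sets (past l u)"
  shows "(\<integral>\<^sup>+\<omega>. indicator H \<omega> * of_nat (\<Lambda> q (u + h) \<omega> - \<Lambda> q u \<omega>) \<partial>M) = emeasure M H * ennreal (lam q * h)"
proof -
  have Hev: "H \<in> events" using past_events[OF u] H by blast
  note [measurable] = Hev
  have [measurable]: "\<Lambda> q (u + h) \<in> measurable M (count_space UNIV)" "\<Lambda> q u \<in> measurable M (count_space UNIV)"
    "\<Lambda> q h \<in> measurable M (count_space UNIV)"
    using Lam_measurable u h by auto
  let ?f = "\<lambda>\<omega>. if \<omega> \<in> H then \<Lambda> q (u + h) \<omega> - \<Lambda> q u \<omega> else 0"
  have ind: "emeasure M {\<omega>\<in>space M. t < ?f \<omega>} = emeasure M H * emeasure M {\<omega>\<in>space M. t < \<Lambda> q h \<omega>}" for t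
  proof -
    let ?C = "cylinder {h} (\<lambda>q' _. if q' = q then {t<..} else UNIV) {} (\<lambda>_. UNIV)"
    have C: "?C \<in> cylinders" using h by (intro cylindersI) auto
    have mem: "path_from x l \<omega> \<in> ?C \<longleftrightarrow> t < \<Lambda> q (x + h) \<omega> - \<Lambda> q x \<omega>" if "0 \<le> x" "\<omega> \<in> space M" for x \<omega>
      using path_regular[OF that(2,1), of l] by (auto simp: cylinder_def fst_path)
    have e1: "{\<omega>\<in>space M. t < ?f \<omega>} = H \<inter> {\<omega>\<in>space M. path_from u l \<omega> \<in> ?C}"
      using mem[OF u] by auto
    have e2: "{\<omega>\<in>space M. t < \<Lambda> q h \<omega>} = {\<omega>\<in>space M. path_from 0 l \<omega> \<in> ?C}"
      using mem[OF order_refl] Lam_0 by auto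
    show ?thesis
      unfolding e1 e2 emeasure_eq_measure past_future_cylinder[OF u H C]
      by (rule ennreal_mult) simp_all
  qed
  have "(\<integral>\<^sup>+\<omega>. indicator H \<omega> * of_nat (\<Lambda> q (u + h) \<omega> - \<Lambda> q u \<omega>) \<partial>M) = (\<integral>\<^sup>+\<omega>. of_nat (?f \<omega>) \<partial>M)"
    by (intro nn_integral_cong) (auto simp: indicator_def)
  also have "\<dots> = (\<Sum>t. emeasure M {\<omega>\<in>space M. t < ?f \<omega>})"
    by (rule nn_integral_nat_function) measurable
  also have "\<dots> = emeasure M H * (\<integral>\<^sup>+\<omega>. of_nat (\<Lambda> q h \<omega>) \<partial>M)"
    by (simp add: ind nn_integral_nat_function)
  finally show ?thesis using Lam_mean[OF h] by simp
qed

text \<open>Optional stopping for the compensated Poisson process, as an inequality.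
  \<open>T\<close> is rounded up to a grid of width \<open>h\<close>; whether the
  \<open>k\<close>-th interval is entered is known at its start, hence independent of the arrivals
  in it.\<close>

lemma Lam_stopped_le:
  assumes T [measurable]: "T \<in> borel_measurable M" and T0: "\<And>\<omega>. 0 \<le> T \<omega>"
    and stop: "\<And>u. 0 \<le> u \<Longrightarrow> {\<omega>\<in>space M. u < T \<omega>} \<in> sets (past l u)"
  shows "(\<integral>\<^sup>+\<omega>. of_nat (\<Lambda> q (T \<omega>) \<omega>) \<partial>M) \<le> ennreal (lam q) * (\<integral>\<^sup>+\<omega>. ennreal (T \<omega>) \<partial>M)"
proof (rule ennreal_le_epsilon)
  fix e :: real assume e: "0 < e"
  \<comment> \<open>Rounding up costs at most \<open>lam q * h\<close> arrivals in the mean, which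
    is the allowed error \<open>e\<close>.\<close>
  define h where "h = e / lam q"
  have h: "0 < h" and he: "lam q * h = e" using e lam_pos[of q] by (simp_all add: h_def)
  define H where "H k = {\<omega>\<in>space M. real k * h < T \<omega>}" for k :: nat
  have H: "H k \<in> sets (past l (real k * h))" for k
    unfolding H_def using h by (intro stop) simp
  have Hev [measurable]: "H k \<in> events" for k unfolding H_def by measurable
  have [measurable]: "\<Lambda> q (real k * h + h) \<in> measurable M (count_space UNIV)"
    "\<Lambda> q (real k * h) \<in> measurable M (count_space UNIV)" for k
    using h by (auto intro!: Lam_measurable add_nonneg_nonneg)
  let ?N = "\<lambda>\<omega>. nat \<lceil>T \<omega> / h\<rceil>"
  have N_le: "real (?N \<omega>) * h \<le> T \<omega> + h" and N_ge: "T \<omega> \<le> real (?N \<omega>) * h"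
    and H_iff: "real k * h < T \<omega> \<longleftrightarrow> k < ?N \<omega>" for \<omega> k
  proof -
    have c: "real (?N \<omega>) = of_int \<lceil>T \<omega> / h\<rceil>" using T0[of \<omega>] h by simp
    have "T \<omega> / h \<le> real (?N \<omega>)" unfolding c by linarith
    then show "T \<omega> \<le> real (?N \<omega>) * h" using h by (simp add: field_simps)
    have "real (?N \<omega>) \<le> T \<omega> / h + 1" unfolding c by linarith
    then have "real (?N \<omega>) * h \<le> (T \<omega> / h + 1) * h" using h by (intro mult_right_mono) auto
    moreover have "(T \<omega> / h + 1) * h = T \<omega> + h" using h by (simp add: field_simps)
    ultimately show "real (?N \<omega>) * h \<le> T \<omega> + h" by (simp only:)
    have "real k * h < T \<omega> \<longleftrightarrow> real k < T \<omega> / h" using h by (simp add: field_simps)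
    also have "\<dots> \<longleftrightarrow> int k < \<lceil>T \<omega> / h\<rceil>" by (simp add: less_ceiling_iff)
    finally show "real k * h < T \<omega> \<longleftrightarrow> k < ?N \<omega>" by (simp add: zless_nat_eq_int_zless)
  qed
  have "(\<integral>\<^sup>+\<omega>. of_nat (\<Lambda> q (T \<omega>) \<omega>) \<partial>M) \<le>
      (\<integral>\<^sup>+\<omega>. (\<Sum>k. indicator (H k) \<omega> * of_nat (\<Lambda> q (real k * h + h) \<omega> - \<Lambda> q (real k * h) \<omega>)) \<partial>M)"
  proof (rule nn_integral_mono)
    fix \<omega> assume w: "\<omega> \<in> space M"
    have mono: "\<Lambda> q (real k * h) \<omega> \<le> \<Lambda> q (real (Suc k) * h) \<omega>" for k
      using h by (intro Lam_mono[OF w]) (auto simp: distrib_right)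
    have "\<Lambda> q (T \<omega>) \<omega> \<le> \<Lambda> q (real (?N \<omega>) * h) \<omega>"
      by (rule Lam_mono[OF w T0 N_ge])
    also have "\<dots> = (\<Sum>k<?N \<omega>. \<Lambda> q (real (Suc k) * h) \<omega> - \<Lambda> q (real k * h) \<omega>)"
      using telescope_nat[of "\<lambda>k. \<Lambda> q (real k * h) \<omega>" "?N \<omega>", OF mono] Lam_0[OF w] by simp
    finally have "(of_nat (\<Lambda> q (T \<omega>) \<omega>) :: ennreal) \<le>
        of_nat (\<Sum>k<?N \<omega>. \<Lambda> q (real (Suc k) * h) \<omega> - \<Lambda> q (real k * h) \<omega>)"
      by (rule of_nat_mono)
    also have "\<dots> = (\<Sum>k<?N \<omega>. of_nat (\<Lambda> q (real (Suc k) * h) \<omega> - \<Lambda> q (real k * h) \<omega>))"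
      by (rule of_nat_sum)
    also have "\<dots> = (\<Sum>k<?N \<omega>. indicator (H k) \<omega> * of_nat (\<Lambda> q (real k * h + h) \<omega> - \<Lambda> q (real k * h) \<omega>))"
    proof (rule sum.cong[OF refl])
      fix k assume "k \<in> {..<?N \<omega>}"
      then have "\<omega> \<in> H k" using w H_iff[of k \<omega>] by (simp add: H_def)
      moreover have "real (Suc k) * h = real k * h + h" by (simp add: algebra_simps)
      ultimately show "of_nat (\<Lambda> q (real (Suc k) * h) \<omega> - \<Lambda> q (real k * h) \<omega>) =
          (indicator (H k) \<omega> * of_nat (\<Lambda> q (real k * h + h) \<omega> - \<Lambda> q (real k * h) \<omega>) :: ennreal)"
        by simp
    qed
    also have "\<dots> \<le> (\<Sum>k. indicator (H k) \<omega> * of_nat (\<Lambda> q (real k * h + h) \<omega> - \<Lambda> q (real k * h) \<omega>))"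
      by (rule sum_le_suminf) auto
    finally show "of_nat (\<Lambda> q (T \<omega>) \<omega>) \<le>
        (\<Sum>k. indicator (H k) \<omega> * of_nat (\<Lambda> q (real k * h + h) \<omega> - \<Lambda> q (real k * h) \<omega>) :: ennreal)" .
  qed
  also have "\<dots> = (\<Sum>k. \<integral>\<^sup>+\<omega>. indicator (H k) \<omega> * of_nat (\<Lambda> q (real k * h + h) \<omega> - \<Lambda> q (real k * h) \<omega>) \<partial>M)"
    by (rule nn_integral_suminf) measurable
  also have "\<dots> = (\<Sum>k. ennreal (lam q) * (ennreal h * emeasure M (H k)))"
    using h lam_pos[of q] by (intro suminf_cong)
      (subst increment_past_mean[OF _ h H], simp_all add: ennreal_mult ac_simps)
  also have "\<dots> = ennreal (lam q) * (\<Sum>k. \<integral>\<^sup>+\<omega>. ennreal h * indicator (H k) \<omega> \<partial>M)"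
    by (simp add: nn_integral_cmult)
  also have "(\<Sum>k. \<integral>\<^sup>+\<omega>. ennreal h * indicator (H k) \<omega> \<partial>M) = (\<integral>\<^sup>+\<omega>. (\<Sum>k. ennreal h * indicator (H k) \<omega>) \<partial>M)"
    by (rule nn_integral_suminf[symmetric]) measurable
  also have "\<dots> \<le> (\<integral>\<^sup>+\<omega>. ennreal (T \<omega>) + ennreal h \<partial>M)"
  proof (rule nn_integral_mono)
    fix \<omega> assume w: "\<omega> \<in> space M"
    have "(\<Sum>k. ennreal h * indicator (H k) \<omega>) = (\<Sum>k<?N \<omega>. ennreal h * indicator (H k) \<omega>)"
      using H_iff[of _ \<omega>] by (intro suminf_finite) (auto simp: H_def indicator_def)
    also have "\<dots> \<le> (\<Sum>k<?N \<omega>. ennreal h)"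
      by (intro sum_mono) (simp add: indicator_def)
    also have "\<dots> = ennreal (real (?N \<omega>) * h)"
      using h by (simp add: ennreal_mult ennreal_of_nat_eq_real_of_nat)
    also have "\<dots> \<le> ennreal (T \<omega> + h)" using N_le[of \<omega>] by (rule ennreal_leI)
    also have "\<dots> = ennreal (T \<omega>) + ennreal h" using T0[of \<omega>] h by (simp add: ennreal_plus)
    finally show "(\<Sum>k. ennreal h * indicator (H k) \<omega>) \<le> ennreal (T \<omega>) + ennreal h" .
  qed
  also have "\<dots> = (\<integral>\<^sup>+\<omega>. ennreal (T \<omega>) \<partial>M) + ennreal h"
    by (subst nn_integral_add) (simp_all add: emeasure_space_1)
  finally have "(\<integral>\<^sup>+\<omega>. of_nat (\<Lambda> q (T \<omega>) \<omega>) \<partial>M) \<le> ennreal (lam q) * ((\<integral>\<^sup>+\<omega>. ennreal (T \<omega>) \<partial>M) + ennreal h)"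
    by (simp add: mult_left_mono)
  also have "\<dots> = ennreal (lam q) * (\<integral>\<^sup>+\<omega>. ennreal (T \<omega>) \<partial>M) + ennreal e"
    using he h lam_pos[of q] by (simp add: distrib_left flip: ennreal_mult)
  finally show "(\<integral>\<^sup>+\<omega>. of_nat (\<Lambda> q (T \<omega>) \<omega>) \<partial>M) \<le> ennreal (lam q) * (\<integral>\<^sup>+\<omega>. ennreal (T \<omega>) \<partial>M) + ennreal e" .
qed

text \<open>Integer times are enough for an upper bound and make the mean a sum of Poisson
  probabilities. It will bound the period in which the server may idle.\<close>

definition hitting :: "queue \<Rightarrow> nat \<Rightarrow> 'w \<Rightarrow> nat" where
  "hitting q m \<omega> = (LEAST k. m \<le> \<Lambda> q (real k) \<omega>)"

lemma hitting_le_iff: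
  assumes "\<omega> \<in> space M"
  shows "k < hitting q m \<omega> \<longleftrightarrow> \<Lambda> q (real k) \<omega> < m"
proof -
  obtain t where t: "0 \<le> t" "m \<le> \<Lambda> q t \<omega>" using regular_arrivals_unbounded[OF arrivals_regular[OF assms]] by blast
  obtain k' where "t \<le> real k'" using real_arch_simple by blast
  then have "m \<le> \<Lambda> q (real k') \<omega>" using Lam_mono[OF assms t(1), of "real k'" q] t(2) by linarith
  then have hit: "m \<le> \<Lambda> q (real (hitting q m \<omega>)) \<omega>" unfolding hitting_def by (rule LeastI)
  show ?thesis
  proof
    show "\<Lambda> q (real k) \<omega> < m" if "k < hitting q m \<omega>"
      using not_less_Least[OF that[unfolded hitting_def]] by simp
    show "k < hitting q m \<omega>" if "\<Lambda> q (real k) \<omega> < m"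
    proof (rule ccontr)
      assume "\<not> k < hitting q m \<omega>"
      then have "\<Lambda> q (real (hitting q m \<omega>)) \<omega> \<le> \<Lambda> q (real k) \<omega>" by (intro Lam_mono[OF assms]) auto
      then show False using hit that by simp
    qed
  qed
qed

lemma hitting_measurable [measurable]: "hitting q m \<in> measurable M (count_space UNIV)"
proof -
  have [measurable]: "\<Lambda> q (real k) \<in> measurable M (count_space UNIV)" for k by (rule Lam_measurable) simp
  show ?thesis unfolding hitting_def by measurable
qed

lemma hitting_mean_finite: "(\<integral>\<^sup>+\<omega>. of_nat (hitting q m \<omega>) \<partial>M) < \<infinity>"
proof -
  let ?P = "\<lambda>k::nat. prob {\<omega>\<in>space M. \<Lambda> q (real k) \<omega> - \<Lambda> q 0 \<omega> < m}"
  have "(\<integral>\<^sup>+\<omega>. of_nat (hitting q m \<omega>) \<partial>M) = (\<Sum>k. emeasure M {\<omega>\<in>space M. k < hitting q m \<omega>})"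
    by (rule nn_integral_nat_function) measurable
  also have "\<dots> = (\<Sum>k. ennreal (?P k))"
  proof (rule suminf_cong)
    fix k
    have "{\<omega>\<in>space M. k < hitting q m \<omega>} = {\<omega>\<in>space M. \<Lambda> q (real k) \<omega> - \<Lambda> q 0 \<omega> < m}"
      using hitting_le_iff Lam_0 by auto
    then show "emeasure M {\<omega>\<in>space M. k < hitting q m \<omega>} = ennreal (?P k)"
      by (simp add: emeasure_eq_measure)
  qed
  also have "\<dots> = ennreal (\<Sum>k. ?P k)"
    by (rule suminf_ennreal2[OF _ poisson_few_summable[OF arrivals lam_pos]]) simp
  finally show ?thesis by simp
qed

end

subsection \<open>Drift of a visit\<close>

text \<open>The product rule for events says that the law of \<open>X\<close> restricted to
  \<open>E\<close> is a multiple of the law of \<open>Y\<close>; integrating \<open>f\<close>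
  against both gives the claim.\<close>

lemma (in prob_space) nn_integral_factor:
  assumes X [measurable]: "X \<in> measurable M N" and Y [measurable]: "Y \<in> measurable M N"
    and E [measurable]: "E \<in> events"
    and eq: "\<And>C. C \<in> sets N \<Longrightarrow>
      prob (E \<inter> {\<omega>\<in>space M. X \<omega> \<in> C}) = prob E * prob {\<omega>\<in>space M. Y \<omega> \<in> C}"
    and f [measurable]: "f \<in> borel_measurable N"
  shows "(\<integral>\<^sup>+\<omega>. indicator E \<omega> * f (X \<omega>) \<partial>M) = emeasure M E * (\<integral>\<^sup>+\<omega>. f (Y \<omega>) \<partial>M)"
proof -
  have "distr (density M (indicator E)) N X = scale_measure (emeasure M E) (distr M N Y)"
  proof (rule measure_eqI)
    fix C assume "C \<in> sets (distr (density M (indicator E)) N X)"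
    then have C [measurable]: "C \<in> sets N" by simp
    have "emeasure (distr (density M (indicator E)) N X) C =
        emeasure (density M (indicator E)) (X -` C \<inter> space M)"
      by (subst emeasure_distr) simp_all
    also have "\<dots> = (\<integral>\<^sup>+\<omega>. indicator E \<omega> * indicator (X -` C \<inter> space M) \<omega> \<partial>M)"
      by (rule emeasure_density) measurable
    also have "\<dots> = (\<integral>\<^sup>+\<omega>. indicator (E \<inter> {\<omega>\<in>space M. X \<omega> \<in> C}) \<omega> \<partial>M)"
      by (intro nn_integral_cong) (simp add: indicator_def)
    also have "\<dots> = emeasure M (E \<inter> {\<omega>\<in>space M. X \<omega> \<in> C})"
      by (rule nn_integral_indicator) measurable
    also have "\<dots> = emeasure M E * emeasure M {\<omega>\<in>space M. Y \<omega> \<in> C}"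
      unfolding emeasure_eq_measure eq[OF C] by (rule ennreal_mult) simp_all
    also have "{\<omega>\<in>space M. Y \<omega> \<in> C} = Y -` C \<inter> space M" by auto
    finally show "emeasure (distr (density M (indicator E)) N X) C =
        emeasure (scale_measure (emeasure M E) (distr M N Y)) C"
      by (simp add: emeasure_distr)
  qed simp
  then have "(\<integral>\<^sup>+x. f x \<partial>distr (density M (indicator E)) N X) =
      (\<integral>\<^sup>+x. f x \<partial>scale_measure (emeasure M E) (distr M N Y))" by simp
  moreover have "(\<integral>\<^sup>+x. f x \<partial>distr (density M (indicator E)) N X) = (\<integral>\<^sup>+\<omega>. indicator E \<omega> * f (X \<omega>) \<partial>M)"
    by (subst nn_integral_distr, simp, simp, subst nn_integral_density) simp_all
  moreover have "(\<integral>\<^sup>+x. f x \<partial>scale_measure (emeasure M E) (distr M N Y)) = emeasure M E * (\<integral>\<^sup>+\<omega>. f (Y \<omega>) \<partial>M)"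
    by (subst nn_integral_scale_measure, simp, subst nn_integral_distr) simp_all
  ultimately show ?thesis by simp
qed

text \<open>The visit cut off at time \<open>R\<close>, both when it ends later and when it never
  ends. Means stay finite before it is known that visits end.\<close>

definition capped :: "real \<Rightarrow> policy \<Rightarrow> kind \<Rightarrow> content \<Rightarrow> real \<Rightarrow> path \<Rightarrow> real" where
  "capped \<mu> p k n R w =
     (if stop_set \<mu> p k n w \<noteq> {} \<and> duration \<mu> p k n w \<le> R then duration \<mu> p k n w else R)"

lemma capped_nonneg: "0 \<le> R \<Longrightarrow> 0 \<le> capped \<mu> p k n R w"
  and capped_le: "capped \<mu> p k n R w \<le> R"
  by (simp_all add: capped_def duration_nonneg)

text \<open>Expressed through all members of the stop set, so that a visit that never ends needs no
  case of its own.\<close>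

lemma le_capped_iff:
  assumes "w \<in> regular_paths"
  shows "x \<le> capped \<mu> p k n R w \<longleftrightarrow> x \<le> R \<and> (\<forall>e\<in>stop_set \<mu> p k n w. x \<le> e)"
proof
  assume x: "x \<le> capped \<mu> p k n R w"
  have "x \<le> e" if "e \<in> stop_set \<mu> p k n w" for e
  proof (cases "duration \<mu> p k n w \<le> R")
    case True
    moreover have "stop_set \<mu> p k n w \<noteq> {}" using that by blast
    ultimately show ?thesis using x duration_le[OF that] by (simp add: capped_def)
  next
    case False
    then show ?thesis using x duration_le[OF that] capped_le[of \<mu> p k n R w] by linarith
  qed
  then show "x \<le> R \<and> (\<forall>e\<in>stop_set \<mu> p k n w. x \<le> e)"
    using x capped_le[of \<mu> p k n R w] by auto
next
  assume "x \<le> R \<and> (\<forall>e\<in>stop_set \<mu> p k n w. x \<le> e)"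
  then show "x \<le> capped \<mu> p k n R w"
    using duration_mem[OF assms] by (auto simp: capped_def)
qed

lemma capped_measurable [measurable]: "capped \<mu> p k n R \<in> borel_measurable path_space"
proof -
  have [measurable]: "Measurable.pred path_space (\<lambda>w. stop_set \<mu> p k n w \<noteq> {})"
    using stop_set_nonempty_measurable[of \<mu> p k n] by (simp add: pred_def)
  show ?thesis unfolding capped_def by measurable
qed

locale stable_polling = polling_policy M lam \<mu> s \<Lambda> J S p
  for M :: "'w measure" and lam \<mu> s \<Lambda> J S p +
  assumes policy: "p \<in> two_phase_policies"
    and load: "lam Q1 / \<mu> + lam Q2 / \<mu> < 1"
begin

lemma load': "lam i + lam (other i) < \<mu>"
proof -
  have "lam Q1 + lam Q2 < \<mu>" using load mu_pos by (simp add: field_simps)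
  then show ?thesis by (cases i) auto
qed

lemma load_single: "lam i < \<mu>"
  using load'[of i] lam_pos[of "other i"] by linarith

lemma fst_path_0: "\<omega> \<in> space M \<Longrightarrow> fst (path_from 0 l \<omega>) q t = \<Lambda> q t \<omega>"
  by (simp add: fst_path Lam_0)

lemma path_0_measurable [measurable]: "(\<lambda>\<omega>. path_from 0 l \<omega>) \<in> measurable M path_space"
  by (rule path_measurable) simp_all

lemma path_0_regular: "\<omega> \<in> space M \<Longrightarrow> path_from 0 l \<omega> \<in> regular_paths"
  by (rule path_regular) simp_all

lemma U_pos: "\<omega> \<in> space M \<Longrightarrow> 0 < U l v \<omega>"
  using U_regular by (simp add: regular_services_def)

section \<open>Wald's identity for the services of a visit\<close>

lemma driver_visit: "kind_at l = Visit i \<Longrightarrow> driver l v = Service i (l div 4) v"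
  by (rule mod4_cases[of l]) (auto simp: kind_at_def driver_def)

lemma U_visit: "kind_at l = Visit i \<Longrightarrow> U l v = J i (l div 4) v"
  by (rule mod4_cases[of l]) (auto simp: kind_at_def U_def fun_eq_iff)

lemma U_visit_mean:
  assumes "kind_at l = Visit i"
  shows "(\<integral>\<^sup>+\<omega>. ennreal (U l v \<omega>) \<partial>M) = ennreal (1 / \<mu>)"
proof -
  have "AE \<omega> in M. 0 \<le> J i (l div 4) v \<omega>"
    using U_pos[of _ l v] by (auto simp: U_visit[OF assms] intro!: AE_I2 less_imp_le)
  then show ?thesis
    unfolding U_visit[OF assms]
    by (subst nn_integral_eq_integral[OF service_integrable]) (simp_all add: service_mean)
qed

text \<open>Everything except one service time. An event in this sigma-algebra is independent of
  that service time.\<close>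

definition without :: "nat \<Rightarrow> nat \<Rightarrow> 'w measure" where
  "without l v = sigma (space M) (\<Union>x\<in>- {driver l v}. primitive_events M \<Lambda> J S x)"

lemma without_Pow: "(\<Union>x\<in>I. primitive_events M \<Lambda> J S x) \<subseteq> Pow (space M)"
  using subset_trans[OF primitive_events_subset sets.space_closed] by (rule UN_least)

lemma space_without [simp]: "space (without l v) = space M"
  using without_Pow by (simp add: without_def space_measure_of)

lemma sets_without: "sets (without l v) = sigma_sets (space M) (\<Union>x\<in>- {driver l v}. primitive_events M \<Lambda> J S x)"
  using without_Pow by (simp add: without_def sets_measure_of)

lemma Lam_without: "0 \<le> t \<Longrightarrow> \<Lambda> q t \<in> measurable (without l v) (count_space UNIV)"
proof (rule measurableI)
  fix A :: "nat set" assume t: "0 \<le> t"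
  have "\<Lambda> q t -` A \<inter> space M \<in> primitive_events M \<Lambda> J S (Arrivals q)"
    unfolding primitive_events.simps using t by (intro sigma_sets.Basic) blast
  moreover have "Arrivals q \<in> - {driver l v}" using driver_Arrivals[of l v q] by auto
  ultimately show "\<Lambda> q t -` A \<inter> space (without l v) \<in> sets (without l v)"
    unfolding sets_without space_without by (intro sigma_sets.Basic UN_I)
qed simp

lemma U_without: "driver l u \<noteq> driver l v \<Longrightarrow> U l u \<in> borel_measurable (without l v)"
proof (rule measurableI)
  fix A :: "real set" assume n: "driver l u \<noteq> driver l v" and A: "A \<in> sets borel"
  have "U l u -` A \<inter> space M \<in> primitive_events M \<Lambda> J S (driver l u)"
    unfolding primitive_events_driver using A by blast
  then show "U l u -` A \<inter> space (without l v) \<in> sets (without l v)"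
    unfolding sets_without space_without using n by (intro sigma_sets.Basic UN_I[of "driver l u"]) auto
qed simp

lemma service_factor:
  assumes k: "kind_at l = Visit i" and H: "H \<in> sets (without l v)"
  shows "(\<integral>\<^sup>+\<omega>. indicator H \<omega> * ennreal (U l v \<omega>) \<partial>M) = emeasure M H * ennreal (1 / \<mu>)"
proof -
  have Hev: "H \<in> events"
    using H primitive_events_subset unfolding sets_without
    by (rule subsetD[OF sets.sigma_sets_subset[OF UN_least], rotated])
  have "(\<integral>\<^sup>+\<omega>. indicator H \<omega> * ennreal (U l v \<omega>) \<partial>M) = emeasure M H * (\<integral>\<^sup>+\<omega>. ennreal (U l v \<omega>) \<partial>M)"
  proof (rule nn_integral_factor[where N = borel and X = "U l v" and Y = "U l v" and f = ennreal])
    fix C :: "real set" assume C: "C \<in> sets borel"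
    define I where "I b = (if b then - {driver l v} else {driver l v})" for b
    have "disjoint_family_on I UNIV" by (auto simp: disjoint_family_on_def I_def)
    then have ind: "indep_sets (\<lambda>j. sigma_sets (space M) (\<Union>x\<in>I j. primitive_events M \<Lambda> J S x)) UNIV"
      by (rule indep_blocks)
    define A where "A b = (if b then H else U l v -` C \<inter> space M)" for b
    have "U l v -` C \<inter> space M \<in> primitive_events M \<Lambda> J S (driver l v)"
      unfolding primitive_events_driver using C by blast
    then have "prob (\<Inter>b\<in>UNIV. A b) = (\<Prod>b\<in>UNIV. prob (A b))"
      using H by (intro indep_setsD[OF ind]) (auto simp: A_def I_def sets_without)
    then have "prob (H \<inter> (U l v -` C \<inter> space M)) = prob H * prob (U l v -` C \<inter> space M)"
      by (simp add: UNIV_bool A_def Int_commute mult.commute)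
    moreover have "U l v -` C \<inter> space M = {\<omega>\<in>space M. U l v \<omega> \<in> C}" by auto
    ultimately show "prob (H \<inter> {\<omega>\<in>space M. U l v \<omega> \<in> C}) = prob H * prob {\<omega>\<in>space M. U l v \<omega> \<in> C}" by simp
  qed (use Hev in simp_all)
  then show ?thesis using U_visit_mean[OF k] by simp
qed

definition served :: "nat \<Rightarrow> queue \<Rightarrow> content \<Rightarrow> real \<Rightarrow> 'w \<Rightarrow> nat" where
  "served l i n R \<omega> = departures (fst (path_from 0 l \<omega>) i) (snd (path_from 0 l \<omega>)) 0 (n i)
     (capped \<mu> p (Visit i) n R (path_from 0 l \<omega>))"

lemma served_le_iff:
  assumes w: "\<omega> \<in> space M" and R: "0 \<le> R"
  shows "v \<le> served l i n R \<omega> \<longleftrightarrow>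
    completion (fst (path_from 0 l \<omega>) i) (snd (path_from 0 l \<omega>)) 0 (n i) v \<le> capped \<mu> p (Visit i) n R (path_from 0 l \<omega>)"
  unfolding served_def
  using less_departures_iff[OF regular_pathsD(1)[OF path_0_regular[OF w]] regular_pathsD(2)[OF path_0_regular[OF w]]
      capped_nonneg[OF R]] .

text \<open>Service times from \<open>v\<close> on are replaced by 1, which removes service
  \<open>v\<close> from the path and keeps the partial sums divergent.\<close>

definition truncated_path :: "nat \<Rightarrow> nat \<Rightarrow> 'w \<Rightarrow> path" where
  "truncated_path l v \<omega> = (fst (path_from 0 l \<omega>), \<lambda>u. if u < v then U l u \<omega> else 1)"

lemma truncated_regular:
  assumes w: "\<omega> \<in> space M"
  shows "truncated_path l v \<omega> \<in> regular_paths"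
proof -
  let ?J = "\<lambda>u. if u < v then U l u \<omega> else 1"
  have "\<exists>k. x < sum ?J {..<k}" for x
  proof -
    obtain m :: nat where m: "x < real m" using reals_Archimedean2 by blast
    have "real m = sum ?J {v..<v + m}" by simp
    also have "\<dots> \<le> sum ?J {..<v + m}"
      using U_pos[OF w, of l] by (intro sum_mono2) (auto intro: less_imp_le)
    finally show ?thesis using m by (intro exI[of _ "v + m"]) linarith
  qed
  then have "regular_services ?J" using U_pos[OF w, of l] by (simp add: regular_services_def)
  then show ?thesis
    using regular_pathsD(1)[OF path_0_regular[OF w, of l]] by (simp add: truncated_path_def regular_paths_def)
qed

text \<open>That the first \<open>v\<close> services are completed before the visit is stopped
  depends only on service times numbered below \<open>v\<close>. The truncated path therefore gives
  the same event, and it never looks at service \<open>v\<close>.\<close>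

lemma served_without:
  assumes k: "kind_at l = Visit i" and R: "0 \<le> R"
  shows "{\<omega>\<in>space M. v \<le> served l i n R \<omega>} \<in> sets (without l v)"
proof -
  have meas: "truncated_path l v \<in> measurable (without l v) path_space"
  proof (rule measurable_path_space)
    fix q and t :: real assume t: "0 \<le> t"
    have [measurable]: "\<Lambda> q t \<in> measurable (without l v) (count_space UNIV)" "\<Lambda> q 0 \<in> measurable (without l v) (count_space UNIV)"
      using t by (auto intro: Lam_without)
    have "(\<lambda>\<omega>. \<Lambda> q t \<omega> - \<Lambda> q 0 \<omega>) \<in> measurable (without l v) (count_space UNIV)" by measurable
    then show "(\<lambda>\<omega>. fst (truncated_path l v \<omega>) q t) \<in> measurable (without l v) (count_space UNIV)"
      by (simp add: truncated_path_def fst_path)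
  next
    fix u
    show "(\<lambda>\<omega>. snd (truncated_path l v \<omega>) u) \<in> borel_measurable (without l v)"
    proof (cases "u < v")
      case True
      then have "driver l u \<noteq> driver l v" by (simp add: driver_visit[OF k])
      then show ?thesis using U_without True by (simp add: truncated_path_def)
    qed (simp add: truncated_path_def)
  qed (simp add: truncated_regular)
  let ?c = "\<lambda>w. completion (fst w i) (snd w) 0 (n i) v"
  let ?C = "{w\<in>space path_space. ?c w \<le> capped \<mu> p (Visit i) n R w}"
  have "?C \<in> sets path_space" by measurable
  from measurable_sets[OF meas this]
  have "{\<omega>\<in>space M. ?c (truncated_path l v \<omega>) \<le> capped \<mu> p (Visit i) n R (truncated_path l v \<omega>)} \<in> sets (without l v)"
    using truncated_regular by (simp add: vimage_def Int_def conj_commute cong: conj_cong)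
  moreover have "v \<le> served l i n R \<omega> \<longleftrightarrow> ?c (truncated_path l v \<omega>) \<le> capped \<mu> p (Visit i) n R (truncated_path l v \<omega>)"
    if w: "\<omega> \<in> space M" for \<omega>
  proof -
    let ?w = "path_from 0 l \<omega>" and ?w' = "truncated_path l v \<omega>"
    note reg = path_0_regular[OF w, of l] and reg' = truncated_regular[OF w, of l v]
    have A: "fst ?w = fst ?w'" by (simp add: truncated_path_def)
    have eq: "snd ?w u = snd ?w' u" if "u < v" for u using that by (simp add: truncated_path_def snd_path)
    have c: "?c ?w = ?c ?w'"
      using completion_cong_services[of v "snd ?w" "snd ?w'"] eq A by simp
    \<comment> \<open>The two paths may stop at different epochs, but they agree on whether the
      first \<open>v\<close> completions come before every possible stop.\<close>
    have st: "(\<forall>e\<in>stop_set \<mu> p (Visit i) n ?w. ?c ?w \<le> e) \<longleftrightarrow> (\<forall>e\<in>stop_set \<mu> p (Visit i) n ?w'. ?c ?w' \<le> e)"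
    proof
      assume a: "\<forall>e\<in>stop_set \<mu> p (Visit i) n ?w. ?c ?w \<le> e"
      show "\<forall>e\<in>stop_set \<mu> p (Visit i) n ?w'. ?c ?w' \<le> e"
      proof
        fix e assume e: "e \<in> stop_set \<mu> p (Visit i) n ?w'"
        show "?c ?w' \<le> e"
          by (rule completion_stop_cong_services[OF reg reg' A eq bspec[OF a] e])
      qed
    next
      assume a: "\<forall>e\<in>stop_set \<mu> p (Visit i) n ?w'. ?c ?w' \<le> e"
      show "\<forall>e\<in>stop_set \<mu> p (Visit i) n ?w. ?c ?w \<le> e"
      proof
        fix e assume e: "e \<in> stop_set \<mu> p (Visit i) n ?w"
        show "?c ?w \<le> e"
          by (rule completion_stop_cong_services[OF reg' reg A[symmetric] eq[symmetric] bspec[OF a] e])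
      qed
    qed
    show ?thesis
      unfolding served_le_iff[OF w R] le_capped_iff[OF reg] le_capped_iff[OF reg'] using c st by simp
  qed
  then have "{\<omega>\<in>space M. v \<le> served l i n R \<omega>} =
      {\<omega>\<in>space M. ?c (truncated_path l v \<omega>) \<le> capped \<mu> p (Visit i) n R (truncated_path l v \<omega>)}"
    by blast
  ultimately show ?thesis by (simp only:)
qed

lemma without_events: "sets (without l v) \<subseteq> events"
  unfolding sets_without using primitive_events_subset by (intro sets.sigma_sets_subset UN_least)

lemma served_measurable:
  assumes k: "kind_at l = Visit i" and R: "0 \<le> R"
  shows "served l i n R \<in> measurable M (count_space UNIV)"
proof (rule measurable_countableI)
  fix v
  have "{\<omega>\<in>space M. served l i n R \<omega> = v} =
      {\<omega>\<in>space M. v \<le> served l i n R \<omega>} - {\<omega>\<in>space M. Suc v \<le> served l i n R \<omega>}" by auto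
  also have "\<dots> \<in> events"
    using served_without[OF k R] without_events by (intro sets.Diff) blast+
  finally show "{\<omega>\<in>space M. served l i n R \<omega> = v} \<in> events" .
qed

text \<open>The number of services started is a stopping time for the service times.\<close>

lemma wald:
  assumes k: "kind_at l = Visit i" and R: "0 \<le> R"
  shows "(\<integral>\<^sup>+\<omega>. (\<Sum>v\<le>served l i n R \<omega>. ennreal (U l v \<omega>)) \<partial>M) =
    ennreal (1 / \<mu>) * (\<integral>\<^sup>+\<omega>. of_nat (Suc (served l i n R \<omega>)) \<partial>M)"
proof -
  let ?H = "\<lambda>v. {\<omega>\<in>space M. v \<le> served l i n R \<omega>}"
  have H [measurable]: "?H v \<in> events" for v using served_without[OF k R] without_events by blast
  note [measurable] = served_measurable[OF k R]
  have "(\<integral>\<^sup>+\<omega>. (\<Sum>v\<le>served l i n R \<omega>. ennreal (U l v \<omega>)) \<partial>M) =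
      (\<integral>\<^sup>+\<omega>. (\<Sum>v. indicator (?H v) \<omega> * ennreal (U l v \<omega>)) \<partial>M)"
  proof (rule nn_integral_cong)
    fix \<omega> assume w: "\<omega> \<in> space M"
    have "(\<Sum>v. indicator (?H v) \<omega> * ennreal (U l v \<omega>)) =
        (\<Sum>v\<le>served l i n R \<omega>. indicator (?H v) \<omega> * ennreal (U l v \<omega>))"
      by (rule suminf_finite) auto
    also have "\<dots> = (\<Sum>v\<le>served l i n R \<omega>. ennreal (U l v \<omega>))"
      using w by (intro sum.cong) auto
    finally show "(\<Sum>v\<le>served l i n R \<omega>. ennreal (U l v \<omega>)) = (\<Sum>v. indicator (?H v) \<omega> * ennreal (U l v \<omega>))" ..
  qed
  also have "\<dots> = (\<Sum>v. \<integral>\<^sup>+\<omega>. indicator (?H v) \<omega> * ennreal (U l v \<omega>) \<partial>M)"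
    by (rule nn_integral_suminf) measurable
  \<comment> \<open>Each event \<open>?H v\<close> is free of service \<open>v\<close>, so every
    term of the series factorizes.\<close>
  also have "\<dots> = (\<Sum>v. ennreal (1 / \<mu>) * emeasure M (?H v))"
    by (intro suminf_cong) (subst service_factor[OF k served_without[OF k R]], rule mult.commute)
  also have "\<dots> = ennreal (1 / \<mu>) * (\<Sum>v. emeasure M {\<omega>\<in>space M. v < Suc (served l i n R \<omega>)})"
    by (simp add: less_Suc_eq_le)
  also have "(\<Sum>v. emeasure M {\<omega>\<in>space M. v < Suc (served l i n R \<omega>)}) =
      (\<integral>\<^sup>+\<omega>. of_nat (Suc (served l i n R \<omega>)) \<partial>M)"
    by (rule nn_integral_nat_function[symmetric]) measurable
  finally show ?thesis .
qed

end

section \<open>Mean balance of one visit\<close>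

context stable_polling
begin

text \<open>The mean time after which the arrivals to the other queue alone have lifted it to the
  threshold of the beginning phase; from then on an empty own queue ends the visit.\<close>

definition idle_bound :: "queue \<Rightarrow> real" where
  "idle_bound i = enn2real (\<integral>\<^sup>+\<omega>. of_nat (hitting (other i) (nat \<lceil>- (\<mu> * beta p i Beginning)\<rceil>) \<omega>) \<partial>M)"

text \<open>Conserved by the fluid model of a busy visit to queue \<open>i\<close>: the own queue
  falls at rate \<open>\<mu> - lam i\<close> while the other one grows at rate
  \<open>lam (other i)\<close>.\<close>

definition weight :: "queue \<Rightarrow> content \<Rightarrow> real" where
  "weight i y = real (y (other i)) + lam (other i) / (\<mu> - lam i) * real (y i)"

text \<open>At most \<open>\<mu> * idle_bound i\<close> services are lost through idling in the
  mean, and one more for the service interrupted at the end; the ratio converts them into units of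
  the weight.\<close>

definition drift :: "queue \<Rightarrow> real" where
  "drift i = lam (other i) / (\<mu> - lam i) * (\<mu> * idle_bound i + 1)"

lemma ratio_nonneg: "0 \<le> lam (other i) / (\<mu> - lam i)"
  using lam_pos[of "other i"] load_single[of i] by simp

lemma idle_bound_nonneg: "0 \<le> idle_bound i"
  by (simp add: idle_bound_def)

lemma weight_nonneg: "0 \<le> weight i y"
  unfolding weight_def by (intro add_nonneg_nonneg mult_nonneg_nonneg ratio_nonneg of_nat_0_le_iff)

lemma weight_ennreal:
  "0 \<le> r \<Longrightarrow> ennreal (real a + r * real b) = of_nat a + ennreal r * of_nat b"
  by (simp add: ennreal_plus ennreal_mult ennreal_of_nat_eq_real_of_nat)

lemma adapted_time_0: "adapted_time l (\<lambda>_. 0) (space M)"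
  using sets.top[of "past l _"] by (simp add: adapted_time_def)

lemma capped_adapted:
  assumes k: "kind_at l = Visit i" and u: "0 \<le> u"
  shows "{\<omega>\<in>space M. u < capped \<mu> p (Visit i) n R (path_from 0 l \<omega>)} \<in> sets (past (Suc l) u)"
proof (cases "u < R")
  case True
  let ?X = "space M \<inter> {\<omega>\<in>space M. path_from 0 l \<omega> \<in> next_paths l n UNIV \<and>
      0 + duration \<mu> p (kind_at l) n (path_from 0 l \<omega>) \<le> u}"
  have X: "?X \<in> sets (past (Suc l) u)"
    by (rule adapted_step[OF adapted_time_0 order_refl u])
  have "{\<omega>\<in>space M. u < capped \<mu> p (Visit i) n R (path_from 0 l \<omega>)} = space (past (Suc l) u) - ?X"
    using True path_0_regular by (auto simp: capped_def next_paths_def stopping_paths_def k split: if_splits)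
  also have "\<dots> \<in> sets (past (Suc l) u)" using X by (rule sets.compl_sets)
  finally show ?thesis .
next
  case False
  then have "\<not> u < capped \<mu> p (Visit i) n R w" for w
    using capped_le[of \<mu> p "Visit i" n R w] by linarith
  then have "{\<omega>\<in>space M. u < capped \<mu> p (Visit i) n R (path_from 0 l \<omega>)} = {}" by blast
  then show ?thesis by (simp only: sets.empty_sets)
qed

text \<open>Balance of means over the capped visit of mean length \<open>t\<close>. Arrivals number
  at most \<open>lam q * t\<close>, and by Wald's identity services number at least
  \<open>\<mu> * t\<close> up to a constant. As the own queue cannot become negative,
  \<open>t\<close> is bounded independently of the cap \<open>R\<close>; in the weight
  \<open>t\<close> cancels.\<close>

lemma visit_capped:
  fixes n :: content and l :: nat and i :: queue and R :: real
  assumes k: "kind_at l = Visit i" and R: "0 \<le> R"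
  defines "T \<equiv> \<lambda>\<omega>. capped \<mu> p (Visit i) n R (path_from 0 l \<omega>)"
  shows "(\<integral>\<^sup>+\<omega>. ennreal (T \<omega>) \<partial>M) \<le> ennreal ((real (n i) + \<mu> * idle_bound i + 1) / (\<mu> - lam i))"
    and "(\<integral>\<^sup>+\<omega>. ennreal (weight i (content_at (Visit i) n (path_from 0 l \<omega>) (T \<omega>))) \<partial>M) \<le>
      ennreal (weight i n + drift i)"
proof -
  let ?j = "other i"
  let ?m = "nat \<lceil>- (\<mu> * beta p i Beginning)\<rceil>"
  have T_meas [measurable]: "T \<in> borel_measurable M" unfolding T_def by measurable
  have T0: "0 \<le> T \<omega>" for \<omega> unfolding T_def by (rule capped_nonneg[OF R])
  have T_adapted: "{\<omega>\<in>space M. u < T \<omega>} \<in> sets (past (Suc l) u)" if "0 \<le> u" for u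
    unfolding T_def by (rule capped_adapted[OF k that])
  note Lam_T [measurable] = Lam_compose_measurable[OF T_meas T0]
  note served_meas [measurable] = served_measurable[OF k R, of n]
  define Y where "Y \<omega> = content_at (Visit i) n (path_from 0 l \<omega>) (T \<omega>)" for \<omega>
  have Yj: "Y \<omega> ?j = n ?j + \<Lambda> ?j (T \<omega>) \<omega>" and
    Yi: "Y \<omega> i + served l i n R \<omega> = n i + \<Lambda> i (T \<omega>) \<omega>" if w: "\<omega> \<in> space M" for \<omega>
  proof -
    note reg = path_0_regular[OF w, of l]
    show "Y \<omega> ?j = n ?j + \<Lambda> ?j (T \<omega>) \<omega>"
      by (simp add: Y_def content_at_Visit[OF reg] fst_path_0[OF w])
    have "served l i n R \<omega> \<le> n i + \<Lambda> i (T \<omega>) \<omega>"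
      using departures_le[OF regular_pathsD(1)[OF reg, of i] regular_pathsD(2)[OF reg] T0, of "n i" \<omega>]
      by (simp add: served_def T_def fst_path_0[OF w])
    then show "Y \<omega> i + served l i n R \<omega> = n i + \<Lambda> i (T \<omega>) \<omega>"
      by (simp add: Y_def content_at_Visit[OF reg] fst_path_0[OF w] served_def T_def)
  qed
  have Y_meas: "(\<lambda>\<omega>. Y \<omega> q) \<in> measurable M (count_space UNIV)" for q
  proof -
    have "(\<lambda>w. content_at (Visit i) n w (capped \<mu> p (Visit i) n R w)) \<in> measurable path_space (count_space UNIV)"
      by (rule content_at_compose_measurable) (simp_all add: capped_nonneg[OF R])
    from measurable_compose[OF measurable_compose[OF path_0_measurable this], of "\<lambda>y. y q"]
    show ?thesis by (simp add: Y_def T_def)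
  qed
  note [measurable] = Y_meas
  have \<kappa>: "(\<integral>\<^sup>+\<omega>. of_nat (hitting ?j ?m \<omega>) \<partial>M) = ennreal (idle_bound i)"
    using hitting_mean_finite[of ?j ?m] by (simp add: idle_bound_def)
  have T_fin: "(\<integral>\<^sup>+\<omega>. ennreal (T \<omega>) \<partial>M) \<le> ennreal R"
  proof -
    have "(\<integral>\<^sup>+\<omega>. ennreal (T \<omega>) \<partial>M) \<le> (\<integral>\<^sup>+\<omega>. ennreal R \<partial>M)"
      unfolding T_def by (intro nn_integral_mono ennreal_leI capped_le)
    then show ?thesis by (simp add: emeasure_space_1)
  qed
  \<comment> \<open>The cap makes this mean finite, and with it the means below, so that the balance
    equations can be subtracted.\<close>
  obtain t where t: "0 \<le> t" "(\<integral>\<^sup>+\<omega>. ennreal (T \<omega>) \<partial>M) = ennreal t"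
    using T_fin by (cases "\<integral>\<^sup>+\<omega>. ennreal (T \<omega>) \<partial>M" rule: ennreal_cases) (auto simp: top_unique)
  have Lam_le: "(\<integral>\<^sup>+\<omega>. of_nat (\<Lambda> q (T \<omega>) \<omega>) \<partial>M) \<le> ennreal (lam q * t)" for q
    using Lam_stopped_le[OF T_meas T0 T_adapted] lam_pos[of q] t by (simp add: ennreal_mult)
  have "\<exists>x. 0 \<le> x \<and> x \<le> lam q * t \<and> (\<integral>\<^sup>+\<omega>. of_nat (\<Lambda> q (T \<omega>) \<omega>) \<partial>M) = ennreal x" for q
    using Lam_le[of q] lam_pos[of q] t(1)
    by (cases "\<integral>\<^sup>+\<omega>. of_nat (\<Lambda> q (T \<omega>) \<omega>) \<partial>M" rule: ennreal_cases) (auto simp: top_unique)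
  then obtain L where L: "\<And>q. 0 \<le> L q" "\<And>q. L q \<le> lam q * t"
    "\<And>q. (\<integral>\<^sup>+\<omega>. of_nat (\<Lambda> q (T \<omega>) \<omega>) \<partial>M) = ennreal (L q)" by metis
  have sum_i: "(\<integral>\<^sup>+\<omega>. of_nat (Y \<omega> i) \<partial>M) + (\<integral>\<^sup>+\<omega>. of_nat (served l i n R \<omega>) \<partial>M) = ennreal (real (n i) + L i)"
  proof -
    have "(\<integral>\<^sup>+\<omega>. of_nat (Y \<omega> i) \<partial>M) + (\<integral>\<^sup>+\<omega>. of_nat (served l i n R \<omega>) \<partial>M) =
        (\<integral>\<^sup>+\<omega>. of_nat (Y \<omega> i) + of_nat (served l i n R \<omega>) \<partial>M)"
      by (rule nn_integral_add[symmetric]) measurable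
    also have "\<dots> = (\<integral>\<^sup>+\<omega>. of_nat (n i) + of_nat (\<Lambda> i (T \<omega>) \<omega>) \<partial>M)"
      by (intro nn_integral_cong) (simp only: Yi flip: of_nat_add)
    also have "\<dots> = of_nat (n i) + (\<integral>\<^sup>+\<omega>. of_nat (\<Lambda> i (T \<omega>) \<omega>) \<partial>M)"
      by (subst nn_integral_add) (simp_all add: emeasure_space_1)
    finally show ?thesis using L(1,3)[of i] by (simp add: ennreal_plus ennreal_of_nat_eq_real_of_nat)
  qed
  obtain c g where cg: "0 \<le> c" "0 \<le> g" "c + g = real (n i) + L i"
    "(\<integral>\<^sup>+\<omega>. of_nat (Y \<omega> i) \<partial>M) = ennreal c" "(\<integral>\<^sup>+\<omega>. of_nat (served l i n R \<omega>) \<partial>M) = ennreal g"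
  proof -
    have "(\<integral>\<^sup>+\<omega>. of_nat (Y \<omega> i) \<partial>M) \<noteq> top" "(\<integral>\<^sup>+\<omega>. of_nat (served l i n R \<omega>) \<partial>M) \<noteq> top"
      using sum_i by auto
    then obtain c g where "0 \<le> c" "0 \<le> g" "(\<integral>\<^sup>+\<omega>. of_nat (Y \<omega> i) \<partial>M) = ennreal c"
      "(\<integral>\<^sup>+\<omega>. of_nat (served l i n R \<omega>) \<partial>M) = ennreal g"
      by (metis ennreal_cases)
    moreover from this have "c + g = real (n i) + L i"
      using sum_i L(1)[of i] by (simp flip: ennreal_plus)
    ultimately show thesis using that by blast
  qed
  have Yj_mean: "(\<integral>\<^sup>+\<omega>. of_nat (Y \<omega> ?j) \<partial>M) = ennreal (real (n ?j) + L ?j)"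
  proof -
    have "(\<integral>\<^sup>+\<omega>. of_nat (Y \<omega> ?j) \<partial>M) = (\<integral>\<^sup>+\<omega>. of_nat (n ?j) + of_nat (\<Lambda> ?j (T \<omega>) \<omega>) \<partial>M)"
      by (intro nn_integral_cong) (simp only: Yj of_nat_add)
    also have "\<dots> = of_nat (n ?j) + (\<integral>\<^sup>+\<omega>. of_nat (\<Lambda> ?j (T \<omega>) \<omega>) \<partial>M)"
      by (subst nn_integral_add) (simp_all add: emeasure_space_1)
    finally show ?thesis using L(1,3)[of ?j] by (simp add: ennreal_plus ennreal_of_nat_eq_real_of_nat)
  qed
  \<comment> \<open>\<open>visit_time_le\<close> in the mean: the idle part is bounded by the
    hitting time of the threshold, and Wald's identity evaluates the services. The summand 1 is the
    service in progress.\<close>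
  have time: "t \<le> idle_bound i + (1 / \<mu>) * (g + 1)"
  proof -
    have "ennreal t \<le> (\<integral>\<^sup>+\<omega>. of_nat (hitting ?j ?m \<omega>) + (\<Sum>v\<le>served l i n R \<omega>. ennreal (U l v \<omega>)) \<partial>M)"
      unfolding t(2)[symmetric]
    proof (rule nn_integral_mono)
      fix \<omega> assume w: "\<omega> \<in> space M"
      note reg = path_0_regular[OF w, of l]
      have "T \<omega> \<le> real (hitting ?j ?m \<omega>) + sum (snd (path_from 0 l \<omega>)) {..served l i n R \<omega>}"
        unfolding served_def T_def
      proof (rule visit_time_le[OF reg policy mu_pos])
        fix u assume u: "real (hitting ?j ?m \<omega>) \<le> u"
        have m: "- (\<mu> * beta p i Beginning) \<le> real ?m" by linarith
        have "\<not> \<Lambda> ?j (real (hitting ?j ?m \<omega>)) \<omega> < ?m"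
          using hitting_le_iff[OF w, of "hitting ?j ?m \<omega>" ?j ?m] by blast
        then have "?m \<le> \<Lambda> ?j (real (hitting ?j ?m \<omega>)) \<omega>" by (simp only: not_less)
        also have "\<dots> \<le> \<Lambda> ?j u \<omega>" using u by (intro Lam_mono[OF w]) auto
        finally have "?m \<le> \<Lambda> ?j u \<omega>" .
        then have "real ?m \<le> real (n ?j + \<Lambda> ?j u \<omega>)" by (simp only: of_nat_le_iff trans_le_add2)
        then show "- (\<mu> * beta p i Beginning) \<le> real (n ?j + fst (path_from 0 l \<omega>) ?j u)"
          unfolding fst_path_0[OF w] using m by linarith
      next
        fix e assume "e \<in> stop_set \<mu> p (Visit i) n (path_from 0 l \<omega>)"
        then show "capped \<mu> p (Visit i) n R (path_from 0 l \<omega>) \<le> e"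
          using le_capped_iff[OF reg, of _ \<mu> p "Visit i" n R] by blast
      qed (simp_all add: capped_nonneg[OF R])
      then have "ennreal (T \<omega>) \<le> ennreal (real (hitting ?j ?m \<omega>) + (\<Sum>v\<le>served l i n R \<omega>. U l v \<omega>))"
        by (simp add: snd_path ennreal_leI)
      also have "\<dots> = of_nat (hitting ?j ?m \<omega>) + (\<Sum>v\<le>served l i n R \<omega>. ennreal (U l v \<omega>))"
      proof -
        have U0: "0 \<le> U l v \<omega>" for v using U_pos[OF w, of l v] by (rule less_imp_le)
        then have "0 \<le> (\<Sum>v\<le>served l i n R \<omega>. U l v \<omega>)" by (intro sum_nonneg)
        moreover have "(\<Sum>v\<le>served l i n R \<omega>. ennreal (U l v \<omega>)) = ennreal (\<Sum>v\<le>served l i n R \<omega>. U l v \<omega>)"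
          using U0 by (intro sum_ennreal)
        ultimately show ?thesis
          by (simp only: ennreal_plus[OF of_nat_0_le_iff] ennreal_of_nat_eq_real_of_nat)
      qed
      finally show "ennreal (T \<omega>) \<le> of_nat (hitting ?j ?m \<omega>) + (\<Sum>v\<le>served l i n R \<omega>. ennreal (U l v \<omega>))" .
    qed
    also have "\<dots> = (\<integral>\<^sup>+\<omega>. of_nat (hitting ?j ?m \<omega>) \<partial>M) + (\<integral>\<^sup>+\<omega>. (\<Sum>v\<le>served l i n R \<omega>. ennreal (U l v \<omega>)) \<partial>M)"
    proof (rule nn_integral_add)
      show "(\<lambda>\<omega>. \<Sum>v\<le>served l i n R \<omega>. ennreal (U l v \<omega>)) \<in> borel_measurable M"
        by (rule measurable_compose_countable[OF _ served_meas, where f = "\<lambda>d \<omega>. \<Sum>v\<le>d. ennreal (U l v \<omega>)"]) measurable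
    qed measurable
    also have "\<dots> = ennreal (idle_bound i) + ennreal (1 / \<mu>) * ((\<integral>\<^sup>+\<omega>. of_nat (served l i n R \<omega>) \<partial>M) + 1)"
      unfolding \<kappa> wald[OF k R] by (simp add: nn_integral_add emeasure_space_1 add.commute)
    also have "\<dots> = ennreal (idle_bound i + (1 / \<mu>) * (g + 1))"
    proof -
      have "ennreal g + 1 = ennreal (g + 1)" using cg(2) by (simp add: ennreal_plus)
      then have "ennreal (1 / \<mu>) * (ennreal g + 1) = ennreal ((1 / \<mu>) * (g + 1))"
        using mu_pos cg(2) ennreal_mult[of "1 / \<mu>" "g + 1"] by (simp only:) simp
      then show ?thesis
        unfolding cg(5) using mu_pos cg(2) idle_bound_nonneg[of i] by (simp add: ennreal_plus)
    qed
    finally show ?thesis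
      by (subst (asm) ennreal_le_iff) (use mu_pos cg(2) idle_bound_nonneg[of i] in simp_all)
  qed
  have g_ge: "\<mu> * t \<le> \<mu> * idle_bound i + g + 1"
  proof -
    have "\<mu> * t \<le> \<mu> * (idle_bound i + (1 / \<mu>) * (g + 1))" using time mu_pos by (intro mult_left_mono) auto
    also have "\<dots> = \<mu> * idle_bound i + g + 1" using mu_pos by (simp add: field_simps)
    finally show ?thesis .
  qed
  have c_le: "c \<le> real (n i) + \<mu> * idle_bound i + 1 - (\<mu> - lam i) * t"
    using cg(3) L(2)[of i] g_ge by (simp add: algebra_simps)
  have pos: "0 < \<mu> - lam i" using load_single[of i] by simp
  have "(\<mu> - lam i) * t \<le> real (n i) + \<mu> * idle_bound i + 1" using c_le cg(1) by linarith
  then have "t \<le> (real (n i) + \<mu> * idle_bound i + 1) / (\<mu> - lam i)"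
    using pos by (simp add: pos_le_divide_eq mult.commute)
  then show "(\<integral>\<^sup>+\<omega>. ennreal (T \<omega>) \<partial>M) \<le> ennreal ((real (n i) + \<mu> * idle_bound i + 1) / (\<mu> - lam i))"
    unfolding t(2) by (rule ennreal_leI)
  let ?r = "lam ?j / (\<mu> - lam i)"
  have "(\<integral>\<^sup>+\<omega>. ennreal (weight i (Y \<omega>)) \<partial>M) = (\<integral>\<^sup>+\<omega>. of_nat (Y \<omega> ?j) + ennreal ?r * of_nat (Y \<omega> i) \<partial>M)"
    unfolding weight_def by (intro nn_integral_cong weight_ennreal ratio_nonneg)
  also have "\<dots> = (\<integral>\<^sup>+\<omega>. of_nat (Y \<omega> ?j) \<partial>M) + ennreal ?r * (\<integral>\<^sup>+\<omega>. of_nat (Y \<omega> i) \<partial>M)"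
    by (subst nn_integral_add) (simp_all add: nn_integral_cmult)
  also have "\<dots> = ennreal (real (n ?j) + L ?j) + ennreal (?r * c)"
    unfolding Yj_mean cg(4) using cg(1) ratio_nonneg[of i] by (simp only: ennreal_mult)
  also have "\<dots> = ennreal (real (n ?j) + L ?j + ?r * c)"
    by (rule ennreal_plus[OF add_nonneg_nonneg[OF of_nat_0_le_iff L(1)]
          mult_nonneg_nonneg[OF ratio_nonneg cg(1)], symmetric])
  also have "\<dots> \<le> ennreal (weight i n + drift i)"
  proof (rule ennreal_leI)
    have "?r * c \<le> ?r * (real (n i) + \<mu> * idle_bound i + 1 - (\<mu> - lam i) * t)"
      using c_le ratio_nonneg[of i] by (rule mult_left_mono)
    \<comment> \<open>The ratio \<open>?r\<close> is such that the weighted loss of the own queue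
      cancels the arrivals \<open>lam ?j * t\<close> to the other queue.\<close>
    also have "\<dots> = ?r * real (n i) + drift i - lam ?j * t"
    proof -
      have alg: "r * (x + y + 1 - z) = r * x + r * (y + 1) - r * z" for r x y z :: real
        by (simp add: algebra_simps)
      have "?r * ((\<mu> - lam i) * t) = lam ?j * t" using pos by simp
      then show ?thesis unfolding alg drift_def by (simp only:)
    qed
    finally show "real (n ?j) + L ?j + ?r * c \<le> weight i n + drift i"
      using L(2)[of ?j] by (simp add: weight_def)
  qed
  finally show "(\<integral>\<^sup>+\<omega>. ennreal (weight i (content_at (Visit i) n (path_from 0 l \<omega>) (T \<omega>))) \<partial>M) \<le>
      ennreal (weight i n + drift i)" unfolding Y_def .
qed

text \<open>A visit that never ends contributes the full cap to the mean of its capped length, which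
  stays bounded as the cap grows.\<close>

lemma visit_stops:
  assumes k: "kind_at l = Visit i"
  shows "AE \<omega> in M. path_from 0 l \<omega> \<in> stopping_paths l n"
proof -
  let ?N = "{\<omega>\<in>space M. path_from 0 l \<omega> \<notin> stopping_paths l n}"
  define b where "b = (real (n i) + \<mu> * idle_bound i + 1) / (\<mu> - lam i)"
  have b: "0 \<le> b"
    using idle_bound_nonneg[of i] mu_pos load_single[of i] by (simp add: b_def)
  have N [measurable]: "?N \<in> events"
  proof -
    have "{\<omega>\<in>space M. path_from 0 l \<omega> \<in> stopping_paths l n} \<in> events"
      by (rule path_event[OF _ _ stopping_paths_sets]) simp_all
    moreover have "?N = space M - {\<omega>\<in>space M. path_from 0 l \<omega> \<in> stopping_paths l n}" by blast
    ultimately show ?thesis by (simp only: sets.compl_sets)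
  qed
  have le: "real m * prob ?N \<le> b" for m :: nat
  proof -
    have "ennreal (real m * prob ?N) = (\<integral>\<^sup>+\<omega>. ennreal (real m) * indicator ?N \<omega> \<partial>M)"
      by (simp add: nn_integral_cmult emeasure_eq_measure ennreal_mult)
    also have "\<dots> \<le> (\<integral>\<^sup>+\<omega>. ennreal (capped \<mu> p (Visit i) n (real m) (path_from 0 l \<omega>)) \<partial>M)"
    proof (rule nn_integral_mono)
      fix \<omega> assume w: "\<omega> \<in> space M"
      show "ennreal (real m) * indicator ?N \<omega> \<le> ennreal (capped \<mu> p (Visit i) n (real m) (path_from 0 l \<omega>))"
      proof (cases "\<omega> \<in> ?N")
        case True
        then have "stop_set \<mu> p (Visit i) n (path_from 0 l \<omega>) = {}"
          using path_0_regular[OF w, of l] by (simp add: stopping_paths_def k)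
        then show ?thesis using True by (simp add: capped_def)
      qed simp
    qed
    also have "\<dots> \<le> ennreal b" unfolding b_def by (rule visit_capped(1)[OF k]) simp
    finally show ?thesis using b by simp
  qed
  have "prob ?N = 0"
  proof (rule ccontr)
    assume "prob ?N \<noteq> 0"
    then have "0 < prob ?N" by (simp add: zero_less_measure_iff)
    then obtain m :: nat where "b < real m * prob ?N" using reals_Archimedean3 by blast
    then show False using le[of m] by simp
  qed
  then have "AE \<omega> in M. \<omega> \<notin> ?N" using N by (subst (asm) prob_eq_0) auto
  then show ?thesis by (rule AE_mp) (rule AE_I2, simp)
qed

text \<open>Removal of the cap by Fatou's lemma: almost surely the visit ends, and for large caps
  the capped contents are the true ones.\<close>

lemma visit_weight:
  assumes k: "kind_at l = Visit i"
  shows "(\<integral>\<^sup>+\<omega>. ennreal (weight i (outcome \<mu> p (Visit i) n (path_from 0 l \<omega>))) \<partial>M) \<le> ennreal (weight i n + drift i)"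
proof -
  let ?c = "\<lambda>m \<omega>. content_at (Visit i) n (path_from 0 l \<omega>) (capped \<mu> p (Visit i) n (real m) (path_from 0 l \<omega>))"
  have meas: "?c m \<in> measurable M (count_space UNIV)" for m :: nat
    by (rule measurable_compose[OF path_0_measurable content_at_compose_measurable]) (simp_all add: capped_nonneg)
  have "AE \<omega> in M. ennreal (weight i (outcome \<mu> p (Visit i) n (path_from 0 l \<omega>))) \<le>
      liminf (\<lambda>m. ennreal (weight i (?c m \<omega>)))"
    using visit_stops[OF k, of n]
  proof (rule AE_mp, intro AE_I2 impI)
    fix \<omega> assume w: "\<omega> \<in> space M" and st: "path_from 0 l \<omega> \<in> stopping_paths l n"
    obtain N :: nat where N: "duration \<mu> p (Visit i) n (path_from 0 l \<omega>) \<le> real N" using real_arch_simple by blast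
    have "?c m \<omega> = outcome \<mu> p (Visit i) n (path_from 0 l \<omega>)" if "m \<ge> N" for m
    proof -
      have "duration \<mu> p (Visit i) n (path_from 0 l \<omega>) \<le> real m" using N that by linarith
      then show ?thesis using st by (simp add: outcome_def capped_def stopping_paths_def k)
    qed
    then have "eventually (\<lambda>m. ennreal (weight i (?c m \<omega>)) =
        ennreal (weight i (outcome \<mu> p (Visit i) n (path_from 0 l \<omega>)))) sequentially"
      unfolding eventually_sequentially by (intro exI[of _ N]) simp
    then have "(\<lambda>m. ennreal (weight i (?c m \<omega>))) \<longlonglongrightarrow> ennreal (weight i (outcome \<mu> p (Visit i) n (path_from 0 l \<omega>)))"
      by (rule tendsto_eventually)
    then show "ennreal (weight i (outcome \<mu> p (Visit i) n (path_from 0 l \<omega>))) \<le>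
      liminf (\<lambda>m. ennreal (weight i (?c m \<omega>)))"
      by (subst lim_imp_Liminf) auto
  qed
  then have "(\<integral>\<^sup>+\<omega>. ennreal (weight i (outcome \<mu> p (Visit i) n (path_from 0 l \<omega>))) \<partial>M) \<le>
      (\<integral>\<^sup>+\<omega>. liminf (\<lambda>m. ennreal (weight i (?c m \<omega>))) \<partial>M)"
    by (rule nn_integral_mono_AE)
  also have "\<dots> \<le> liminf (\<lambda>m. \<integral>\<^sup>+\<omega>. ennreal (weight i (?c m \<omega>)) \<partial>M)"
    by (rule nn_integral_liminf) (rule measurable_compose[OF meas], simp)
  also have "\<dots> \<le> liminf (\<lambda>m::nat. ennreal (weight i n + drift i))"
    by (intro Liminf_mono always_eventually allI visit_capped(2)[OF k]) simp
  also have "\<dots> = ennreal (weight i n + drift i)" by (simp add: Liminf_const)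
  finally show ?thesis .
qed

lemma drift_nonneg: "0 \<le> drift i"
  unfolding drift_def using idle_bound_nonneg[of i] mu_pos
  by (intro mult_nonneg_nonneg ratio_nonneg add_nonneg_nonneg) auto

section \<open>Switching steps\<close>

definition travel_mean :: real where
  "travel_mean = max (s Q1) (s Q2)"

lemma U_travel:
  assumes "kind_at l = Travel"
  shows "\<exists>i. U l v = S i (l div 4)"
  using assms by (rule_tac mod4_cases[of l]) (auto simp: kind_at_def U_def fun_eq_iff split: if_splits)

lemma travel_duration_mean:
  assumes k: "kind_at l = Travel"
  shows "(\<integral>\<^sup>+\<omega>. ennreal (U l 0 \<omega>) \<partial>M) \<le> ennreal travel_mean"
proof -
  obtain i where i: "U l 0 = S i (l div 4)" using U_travel[OF k] by blast
  have "AE \<omega> in M. 0 \<le> S i (l div 4) \<omega>"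
    using switching_regular by (auto intro!: AE_I2 less_imp_le)
  then have "(\<integral>\<^sup>+\<omega>. ennreal (U l 0 \<omega>) \<partial>M) = ennreal (s i)"
    unfolding i by (subst nn_integral_eq_integral[OF switching_integrable]) (simp_all add: switching_mean)
  also have "s i \<le> travel_mean" by (cases i) (simp_all add: travel_mean_def)
  then have "ennreal (s i) \<le> ennreal travel_mean" by (rule ennreal_leI)
  finally show ?thesis .
qed

lemma travel_outcome:
  assumes w: "\<omega> \<in> space M"
  shows "outcome \<mu> p Travel n (path_from 0 l \<omega>) q = n q + \<Lambda> q (U l 0 \<omega>) \<omega>"
  unfolding outcome_def duration_Travel(1)[OF path_0_regular[OF w]] content_at_Travel[OF path_0_regular[OF w]]
  by (simp add: snd_path fst_path_0[OF w])

lemma travel_stops: "kind_at l = Travel \<Longrightarrow> \<omega> \<in> space M \<Longrightarrow> path_from 0 l \<omega> \<in> stopping_paths l n"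
  using duration_Travel(2)[OF path_0_regular] path_0_regular by (simp add: stopping_paths_def)

lemma path_stops: "AE \<omega> in M. path_from 0 l \<omega> \<in> stopping_paths l n"
proof (cases "kind_at l")
  case (Visit i)
  then show ?thesis by (rule visit_stops)
qed (simp add: travel_stops)

lemma driver_positive:
  "{\<omega>\<in>space M. a < U l 0 \<omega> \<and> U l 0 \<omega> \<le> b} \<in> sets (past (Suc l) u)"
proof -
  have [measurable]: "U l 0 \<in> borel_measurable (past (Suc l) u)" by (rule U_past) simp
  have "{\<omega>\<in>space (past (Suc l) u). a < U l 0 \<omega> \<and> U l 0 \<omega> \<le> b} \<in> sets (past (Suc l) u)" by measurable
  then show ?thesis by simp
qed

lemma travel_arrivals_mean:
  assumes k: "kind_at l = Travel"
  shows "(\<integral>\<^sup>+\<omega>. of_nat (\<Lambda> q (U l 0 \<omega>) \<omega>) \<partial>M) \<le> ennreal (lam q * travel_mean)"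
proof -
  \<comment> \<open>The switching time is a stopping time for the past of the next step, in which it
    is known from the start. The maximum with 0 provides nonnegativity outside the sample space as
    well.\<close>
  let ?T = "\<lambda>\<omega>. max 0 (U l 0 \<omega>)"
  have eq: "?T \<omega> = U l 0 \<omega>" if "\<omega> \<in> space M" for \<omega> using U_pos[OF that, of l 0] by simp
  have "(\<integral>\<^sup>+\<omega>. of_nat (\<Lambda> q (?T \<omega>) \<omega>) \<partial>M) \<le> ennreal (lam q) * (\<integral>\<^sup>+\<omega>. ennreal (?T \<omega>) \<partial>M)"
  proof (rule Lam_stopped_le)
    fix u :: real assume "0 \<le> u"
    have [measurable]: "U l 0 \<in> borel_measurable (past (Suc l) u)" by (rule U_past) simp
    have "{\<omega>\<in>space (past (Suc l) u). u < ?T \<omega>} \<in> sets (past (Suc l) u)" by measurable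
    then show "{\<omega>\<in>space M. u < ?T \<omega>} \<in> sets (past (Suc l) u)" by simp
  qed simp_all
  also have "(\<integral>\<^sup>+\<omega>. ennreal (?T \<omega>) \<partial>M) = (\<integral>\<^sup>+\<omega>. ennreal (U l 0 \<omega>) \<partial>M)"
    using eq by (intro nn_integral_cong) simp
  also have "ennreal (lam q) * \<dots> \<le> ennreal (lam q) * ennreal travel_mean"
    by (intro mult_left_mono travel_duration_mean[OF k]) simp
  also have "\<dots> = ennreal (lam q * travel_mean)"
    using lam_pos[of q] by (simp add: ennreal_mult')
  finally show ?thesis using eq by (simp cong: nn_integral_cong)
qed

lemma increment_positive:
  assumes u: "0 \<le> u" and h: "0 < h"
  shows "0 < prob {\<omega>\<in>space M. \<Lambda> q (u + h) \<omega> - \<Lambda> q u \<omega> = m}"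
proof -
  have [measurable]: "\<Lambda> q (u + h) \<in> measurable M (count_space UNIV)" "\<Lambda> q u \<in> measurable M (count_space UNIV)"
    using Lam_measurable u h by auto
  have "{\<omega>\<in>space M. \<Lambda> q (u + h) \<omega> - \<Lambda> q u \<omega> = m} = (\<lambda>\<omega>. \<Lambda> q (u + h) \<omega> - \<Lambda> q u \<omega>) -` {m} \<inter> space M" by auto
  then have "prob {\<omega>\<in>space M. \<Lambda> q (u + h) \<omega> - \<Lambda> q u \<omega> = m} =
      measure (distr M (count_space UNIV) (\<lambda>\<omega>. \<Lambda> q (u + h) \<omega> - \<Lambda> q u \<omega>)) {m}"
    by (simp add: measure_distr)
  also have "\<dots> = pmf (poisson_pmf (lam q * h)) m"
    using poisson_process_increment[OF arrivals, of u "u + h" q] u h by (simp add: measure_pmf_single)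
  finally show ?thesis using lam_pos[of q] h by simp
qed

text \<open>With positive probability the switching time falls between two positive bounds
  \<open>a\<close> and \<open>b\<close>, exactly \<open>g\<close> customers arrive by time
  \<open>a\<close>, and none between \<open>a\<close> and \<open>b\<close>; these events are
  independent.\<close>

lemma travel_positive:
  assumes k: "kind_at l = Travel"
  shows "0 < prob {\<omega>\<in>space M. outcome \<mu> p Travel n (path_from 0 l \<omega>) = (\<lambda>q. n q + g q)}"
proof -
  have "\<exists>a b. 0 < a \<and> a < b \<and> 0 < prob {\<omega>\<in>space M. a < U l 0 \<omega> \<and> U l 0 \<omega> \<le> b}"
  proof (rule ccontr)
    assume none: "\<not> ?thesis"
    \<comment> \<open>These intervals exhaust the positive reals, so a positive switching time
      charges one of them.\<close>
    let ?A = "\<lambda>m::nat. {\<omega>\<in>space M. 1 / real (Suc m) < U l 0 \<omega> \<and> U l 0 \<omega> \<le> real (Suc (Suc m))}"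
    have ab: "0 < 1 / real (Suc m)" "1 / real (Suc m) < real (Suc (Suc m))" for m
    proof -
      show "0 < 1 / real (Suc m)" by simp
      have "1 / real (Suc m) \<le> 1" by simp
      moreover have "1 < real (Suc (Suc m))" by simp
      ultimately show "1 / real (Suc m) < real (Suc (Suc m))" by linarith
    qed
    have A0: "prob (?A m) = 0" for m
    proof (rule ccontr)
      assume "prob (?A m) \<noteq> 0"
      then have "0 < prob (?A m)" by (rule zero_less_measure_iff[THEN iffD2])
      then show False using none ab[of m] by blast
    qed
    have "AE \<omega> in M. \<omega> \<notin> ?A m" for m
      using A0[of m] by (subst (asm) prob_eq_0) auto
    then have "AE \<omega> in M. \<forall>m. \<omega> \<notin> ?A m" unfolding AE_all_countable by blast
    then have "AE \<omega> in M. False"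
    proof (rule AE_mp, intro AE_I2 impI)
      fix \<omega> assume w: "\<omega> \<in> space M" and nA: "\<forall>m. \<omega> \<notin> ?A m"
      obtain m1 :: nat where m1: "1 / real (Suc m1) < U l 0 \<omega>" using nat_approx_posE[OF U_pos[OF w]] by blast
      obtain m2 :: nat where m2: "U l 0 \<omega> \<le> real m2" using real_arch_simple by blast
      have "1 / real (Suc (max m1 m2)) \<le> 1 / real (Suc m1)" by (simp add: frac_le)
      then have "1 / real (Suc (max m1 m2)) < U l 0 \<omega>" using m1 by linarith
      moreover have "U l 0 \<omega> \<le> real (Suc (Suc (max m1 m2)))" using m2 by simp
      ultimately have "\<omega> \<in> ?A (max m1 m2)" using w by blast
      then show False using nA by blast
    qed
    then show False by simp
  qed
  then obtain a b where ab: "0 < a" "a < b" and pos: "0 < prob {\<omega>\<in>space M. a < U l 0 \<omega> \<and> U l 0 \<omega> \<le> b}" by blast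
  let ?H = "{\<omega>\<in>space M. a < U l 0 \<omega> \<and> U l 0 \<omega> \<le> b}"
  let ?C1 = "cylinder {a} (\<lambda>q _. {g q}) {} (\<lambda>_. UNIV)"
  let ?C2 = "cylinder {b - a} (\<lambda>_ _. {0}) {} (\<lambda>_. UNIV)"
  \<comment> \<open>Paths of step \<open>Suc l\<close> are used, because the past of that step
    contains the switching time of step \<open>l\<close>.\<close>
  let ?E1 = "{\<omega>\<in>space M. path_from 0 (Suc l) \<omega> \<in> ?C1}"
  let ?E2 = "\<lambda>t. {\<omega>\<in>space M. path_from t (Suc l) \<omega> \<in> ?C2}"
  have C1: "?C1 \<in> cylinders" using ab by (intro cylindersI) auto
  have C2: "?C2 \<in> cylinders" using ab by (intro cylindersI) auto
  have E1_iff: "\<omega> \<in> ?E1 \<longleftrightarrow> (\<forall>q. \<Lambda> q a \<omega> = g q)" if w: "\<omega> \<in> space M" for \<omega>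
    using w path_0_regular[OF w, of "Suc l"] by (simp add: cylinder_def fst_path_0)
  have E1: "?H \<inter> ?E1 \<in> sets (past (Suc l) a)"
  proof -
    have [measurable]: "\<Lambda> q a \<in> measurable (past (Suc l) a) (count_space UNIV)" for q
      using ab by (intro Lam_past) auto
    have "{\<omega>\<in>space (past (Suc l) a). \<Lambda> Q1 a \<omega> = g Q1 \<and> \<Lambda> Q2 a \<omega> = g Q2} \<in> sets (past (Suc l) a)"
      by measurable
    moreover have "?E1 = {\<omega>\<in>space (past (Suc l) a). \<Lambda> Q1 a \<omega> = g Q1 \<and> \<Lambda> Q2 a \<omega> = g Q2}"
      using E1_iff by (auto simp: all_queue)
    ultimately show ?thesis using driver_positive[of a l b a] by (simp only: sets.Int)
  qed
  have "prob (?H \<inter> ?E1) = prob ?H * prob ?E1"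
    by (rule past_future_cylinder[OF order_refl driver_positive C1])
  moreover have "prob (?H \<inter> ?E1 \<inter> ?E2 a) = prob (?H \<inter> ?E1) * prob (?E2 0)"
    by (rule past_future_cylinder[OF _ E1 C2]) (use ab in simp)
  moreover have "0 < prob ?E1"
    using prob_path_cylinder[of 0 "{a}" "{}" "\<lambda>_. UNIV" "Suc l" "\<lambda>q _. {g q}"] ab
      increment_positive[of 0 a Q1 "g Q1"] increment_positive[of 0 a Q2 "g Q2"] by (simp add: prob_space)
  moreover have "0 < prob (?E2 0)"
    using prob_path_cylinder[of 0 "{b - a}" "{}" "\<lambda>_. UNIV" "Suc l" "\<lambda>_ _. {0}"] ab
      increment_positive[of 0 "b - a" Q1 0] increment_positive[of 0 "b - a" Q2 0] by (simp add: prob_space)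
  ultimately have "0 < prob (?H \<inter> ?E1 \<inter> ?E2 a)" using pos by simp
  also have "\<dots> \<le> prob {\<omega>\<in>space M. outcome \<mu> p Travel n (path_from 0 l \<omega>) = (\<lambda>q. n q + g q)}"
  proof (rule finite_measure_mono)
    show "?H \<inter> ?E1 \<inter> ?E2 a \<subseteq> {\<omega>\<in>space M. outcome \<mu> p Travel n (path_from 0 l \<omega>) = (\<lambda>q. n q + g q)}"
    proof
      fix \<omega> assume "\<omega> \<in> ?H \<inter> ?E1 \<inter> ?E2 a"
      then have w: "\<omega> \<in> space M" and h: "a < U l 0 \<omega>" "U l 0 \<omega> \<le> b"
        and e1: "\<omega> \<in> ?E1" and e2: "path_from a (Suc l) \<omega> \<in> ?C2" by simp_all
      have "\<Lambda> q (U l 0 \<omega>) \<omega> = g q" for q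
      proof -
        have "\<Lambda> q a \<omega> = g q" using e1 E1_iff[OF w] by blast
        moreover have "\<Lambda> q b \<omega> - \<Lambda> q a \<omega> = 0" using e2 by (simp add: cylinder_def fst_path)
        moreover have "\<Lambda> q a \<omega> \<le> \<Lambda> q (U l 0 \<omega>) \<omega>" "\<Lambda> q (U l 0 \<omega>) \<omega> \<le> \<Lambda> q b \<omega>"
          using ab h by (auto intro!: Lam_mono[OF w])
        ultimately show ?thesis by linarith
      qed
      then show "\<omega> \<in> {\<omega>\<in>space M. outcome \<mu> p Travel n (path_from 0 l \<omega>) = (\<lambda>q. n q + g q)}"
        using w by (simp add: fun_eq_iff travel_outcome[OF w])
    qed
    have "(\<lambda>\<omega>. outcome \<mu> p Travel n (path_from 0 l \<omega>)) \<in> measurable M (count_space UNIV)"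
      by (rule measurable_compose[OF path_0_measurable outcome_measurable])
    from measurable_sets[OF this, of "{\<lambda>q. n q + g q}"]
    show "{\<omega>\<in>space M. outcome \<mu> p Travel n (path_from 0 l \<omega>) = (\<lambda>q. n q + g q)} \<in> events"
      by (simp add: vimage_def Int_def conj_commute)
  qed
  finally show ?thesis .
qed

end

subsection \<open>The chain of the regular model\<close>

lemma (in prob_space) nn_integral_countable_partition:
  fixes c :: "'a \<Rightarrow> 'b::countable"
  assumes c [measurable]: "c \<in> measurable M (count_space UNIV)" and g [measurable]: "g \<in> borel_measurable M"
  shows "(\<integral>\<^sup>+\<omega>. g \<omega> \<partial>M) =
    (\<integral>\<^sup>+n. (\<integral>\<^sup>+\<omega>. indicator {\<omega>\<in>space M. c \<omega> = n} \<omega> * g \<omega> \<partial>M) \<partial>count_space UNIV)"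
proof -
  have "(\<integral>\<^sup>+n. (\<integral>\<^sup>+\<omega>. indicator {\<omega>\<in>space M. c \<omega> = n} \<omega> * g \<omega> \<partial>M) \<partial>count_space UNIV) =
      (\<integral>\<^sup>+\<omega>. (\<integral>\<^sup>+n. indicator {\<omega>\<in>space M. c \<omega> = n} \<omega> * g \<omega> \<partial>count_space UNIV) \<partial>M)"
    by (rule nn_integral_count_space_nn_integral[symmetric]) (auto intro: countableI_type)
  also have "\<dots> = (\<integral>\<^sup>+\<omega>. g \<omega> \<partial>M)"
  proof (rule nn_integral_cong)
    fix \<omega> assume w: "\<omega> \<in> space M"
    have "(\<integral>\<^sup>+n. indicator {\<omega>\<in>space M. c \<omega> = n} \<omega> * g \<omega> \<partial>count_space UNIV) =
        (\<integral>\<^sup>+n. g \<omega> * indicator {c \<omega>} n \<partial>count_space UNIV)"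
      using w by (intro nn_integral_cong) (auto simp: indicator_def)
    then show "(\<integral>\<^sup>+n. indicator {\<omega>\<in>space M. c \<omega> = n} \<omega> * g \<omega> \<partial>count_space UNIV) = g \<omega>"
      by (simp add: emeasure_count_space_finite)
  qed
  finally show ?thesis ..
qed

text \<open>The affine map preserves every upper bound that is at least its fixed point.\<close>

lemma affine_contraction_bounded:
  fixes x :: "nat \<Rightarrow> real"
  assumes "\<And>k. x (Suc k) \<le> \<theta> * x k + c" "0 \<le> \<theta>" "\<theta> < 1"
  shows "x k \<le> max (x 0) (c / (1 - \<theta>))"
proof (induction k)
  case (Suc k)
  let ?m = "max (x 0) (c / (1 - \<theta>))"
  have "c \<le> (1 - \<theta>) * ?m"
  proof -
    have "c / (1 - \<theta>) \<le> ?m" by simp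
    then have "c \<le> ?m * (1 - \<theta>)" using assms(3) by (subst (asm) pos_divide_le_eq) auto
    then show ?thesis by (simp only: mult.commute)
  qed
  moreover have "\<theta> * x k \<le> \<theta> * ?m" using Suc assms(2) by (rule mult_left_mono)
  moreover have "\<theta> * ?m + (1 - \<theta>) * ?m = ?m" by (simp add: algebra_simps)
  ultimately show ?case using assms(1)[of k] by linarith
qed simp

text \<open>
  The drift of the two visits and the switching curves \<open>N\<^sub>i = A\<^sub>i N\<^sub>j\<close> combine to an affine
  contraction; its factor is below one exactly because
  \<open>(1 - A\<^sub>1 A\<^sub>2) (1 - R\<^sub>1 R\<^sub>2) > 0\<close>.
\<close>

lemma alternating_contraction:
  fixes x y :: "nat \<Rightarrow> real"
  assumes nonneg: "0 \<le> A1" "0 \<le> A2" "0 \<le> R1" "0 \<le> R2" and A: "A1 * A2 < 1" and R: "R1 * R2 < 1"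
    and xy: "\<And>k. (1 + R2 * A2) * y k \<le> (A1 + R2) * x k + c"
    and yx: "\<And>k. (1 + R1 * A1) * x (Suc k) \<le> (A2 + R1) * y k + d"
  shows "\<exists>B. \<forall>k. x k \<le> B \<and> y k \<le> B"
proof -
  let ?p = "1 + R2 * A2" and ?q = "1 + R1 * A1"
  have p: "0 < ?p" and q: "0 < ?q" using nonneg by (simp_all add: add_pos_nonneg)
  define \<theta> where "\<theta> = (A2 + R1) * (A1 + R2) / (?q * ?p)"
  have pq: "0 < ?q * ?p" using p q by simp
  \<comment> \<open>Expanded, this product is the denominator of \<theta> minus its
    numerator.\<close>
  have "0 < (1 - A1 * A2) * (1 - R1 * R2)" using A R by simp
  then have "(A2 + R1) * (A1 + R2) < ?q * ?p" by (simp add: algebra_simps)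
  then have \<theta>1: "\<theta> < 1" unfolding \<theta>_def using pq by (simp only: pos_divide_less_eq mult_1)
  have \<theta>0: "0 \<le> \<theta>" unfolding \<theta>_def using nonneg pq by (intro divide_nonneg_pos mult_nonneg_nonneg) auto
  have y: "y k \<le> ((A1 + R2) * x k + c) / ?p" for k
    using xy[of k] p by (simp only: pos_le_divide_eq mult.commute)
  have step: "x (Suc k) \<le> \<theta> * x k + ((A2 + R1) * (c / ?p) + d) / ?q" for k
  proof -
    have "?q * x (Suc k) \<le> (A2 + R1) * (((A1 + R2) * x k + c) / ?p) + d"
      using yx[of k] mult_left_mono[OF y[of k], of "A2 + R1"] nonneg by linarith
    then have "x (Suc k) \<le> ((A2 + R1) * (((A1 + R2) * x k + c) / ?p) + d) / ?q"
      using q by (simp only: pos_le_divide_eq mult.commute)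
    also have "\<dots> = \<theta> * x k + ((A2 + R1) * (c / ?p) + d) / ?q"
    proof -
      have "(a * ((b * u + c) / P) + d) / Q = a * b / (Q * P) * u + (a * (c / P) + d) / Q" for a b u P Q
        by (simp add: add_divide_distrib distrib_left mult.assoc mult.commute)
      then show ?thesis unfolding \<theta>_def .
    qed
    finally show ?thesis .
  qed
  define Bx where "Bx = max (x 0) (((A2 + R1) * (c / ?p) + d) / ?q / (1 - \<theta>))"
  have x: "x k \<le> Bx" for k
    unfolding Bx_def by (rule affine_contraction_bounded[where x = x, OF step \<theta>0 \<theta>1])
  have "y k \<le> ((A1 + R2) * Bx + c) / ?p" for k
  proof -
    have "(A1 + R2) * x k \<le> (A1 + R2) * Bx" using x[of k] nonneg by (intro mult_left_mono) auto
    then have "((A1 + R2) * x k + c) / ?p \<le> ((A1 + R2) * Bx + c) / ?p"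
      using p by (intro divide_right_mono) auto
    then show ?thesis using y[of k] by linarith
  qed
  then show ?thesis using x by (meson max.coboundedI1 max.coboundedI2)
qed

lemma kind_at_mod: "kind_at (l mod 4) = kind_at l"
  by (simp add: kind_at_def)

context stable_polling
begin

lemma stopping_paths_mod: "stopping_paths (l mod 4) n = stopping_paths l n"
  by (simp add: stopping_paths_def kind_at_mod)

definition full :: "content \<Rightarrow> nat \<Rightarrow> 'w set" where
  "full z l = {\<omega>\<in>space M. \<forall>j<l. \<omega> \<in> step_ends z j}"

lemma full_history: "full z l \<in> history z l"
proof (induction l)
  case 0
  then show ?case using history_0 by (simp add: full_def)
next
  case (Suc l)
  have "full z (Suc l) = full z l \<inter> step_ends z l"
    by (auto simp: full_def less_Suc_eq)
  then show ?case using history_step[OF Suc] by simp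
qed

lemma path_law_stopping: "path_law l (stopping_paths l n) = 1"
proof -
  have "AE \<omega> in M. path_from 0 (l mod 4) \<omega> \<in> stopping_paths l n"
    using path_stops[of "l mod 4" n] by (simp add: stopping_paths_mod)
  then show ?thesis
    unfolding path_law_def by (subst prob_Collect_eq_1) (simp_all add: path_event[OF _ _ stopping_paths_sets])
qed

text \<open>Given the contents, the next path has the law \<open>path_law\<close> by the strong
  Markov property, and under that law the step ends almost surely. The countably many contents are
  then joined.\<close>

lemma AE_step_ends:
  assumes E: "E \<in> history z l"
  shows "AE \<omega> in M. \<omega> \<in> E \<longrightarrow> \<omega> \<in> step_ends z l"
proof -
  have "AE \<omega> in M. \<not> (\<omega> \<in> E \<inter> {\<omega>\<in>space M. cust z l \<omega> = n} \<and> \<omega> \<notin> step_ends z l)" for n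
  proof -
    let ?E = "E \<inter> {\<omega>\<in>space M. cust z l \<omega> = n}"
    let ?P = "{\<omega>\<in>space M. path_from (clock z l \<omega>) l \<omega> \<in> stopping_paths l n}"
    have E': "?E \<in> events" by (rule adapted_time_event[OF history_adapted[OF E]])
    have P: "?P \<in> events" by (rule path_event[OF clock_measurable clock_nonneg stopping_paths_sets])
    have "prob (?E \<inter> ?P) = prob ?E"
      using history_markov[OF E stopping_paths_sets, of n l n] by (simp add: path_law_stopping)
    moreover have "prob (?E - ?P) = prob ?E - prob (?E \<inter> ?P)"
      using E' P by (rule finite_measure_Diff')
    ultimately have "prob (?E - ?P) = 0" by simp
    then have "AE \<omega> in M. \<omega> \<notin> ?E - ?P" using E' P by (subst (asm) prob_eq_0) auto
    then show ?thesis by (rule AE_mp) (rule AE_I2, auto simp: step_ends_def)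
  qed
  then have "AE \<omega> in M. \<forall>n. \<not> (\<omega> \<in> E \<inter> {\<omega>\<in>space M. cust z l \<omega> = n} \<and> \<omega> \<notin> step_ends z l)"
    unfolding AE_all_countable by blast
  then show ?thesis by (rule AE_mp) (rule AE_I2, auto)
qed

lemma AE_full: "AE \<omega> in M. \<omega> \<in> full z l"
proof (induction l)
  case 0
  show ?case by (rule AE_I2) (simp add: full_def)
next
  case (Suc l)
  show ?case
    using Suc AE_step_ends[OF full_history[of z l]]
    by eventually_elim (auto simp: full_def less_Suc_eq)
qed

lemma AE_all_steps: "AE \<omega> in M. \<forall>l. \<omega> \<in> step_ends z l"
proof -
  have "AE \<omega> in M. \<omega> \<in> step_ends z l" for l
    using AE_full[of z "Suc l"] by eventually_elim (simp add: full_def)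
  then show ?thesis unfolding AE_all_countable by blast
qed

text \<open>The iterated transition kernel: the probability that the next \<open>m\<close> steps
  lead through \<open>D 1\<close>, \<open>D 2\<close> and so on from contents \<open>n\<close>. It
  depends on the past only through \<open>n\<close> and on \<open>l\<close> only modulo 4.\<close>

primrec path_prob :: "nat \<Rightarrow> nat \<Rightarrow> (nat \<Rightarrow> content set) \<Rightarrow> content \<Rightarrow> ennreal" where
  "path_prob l 0 D n = 1"
| "path_prob l (Suc m) D n = (\<integral>\<^sup>+y. indicator (D 1) y * (ennreal (path_law l (next_paths l n {y})) *
     path_prob (Suc l) m (\<lambda>j. D (Suc j)) y) \<partial>count_space UNIV)"

lemma cust_all_event: "{\<omega>\<in>space M. \<forall>j\<in>{1..m}. cust z (l + j) \<omega> \<in> D j} \<in> events"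
  by (intro sets.sets_Collect_finite_All) auto

text \<open>Induction over the remaining steps, with the event \<open>E\<close> varying:
  \<open>E\<close> together with a completed step and its new contents is a history event of the
  next step, so the induction hypothesis applies to it.\<close>

lemma markov_path:
  assumes "E \<in> history z l" "\<And>\<omega>. \<omega> \<in> E \<Longrightarrow> cust z l \<omega> = n"
  shows "emeasure M (E \<inter> {\<omega>\<in>space M. \<forall>j\<in>{1..m}. cust z (l + j) \<omega> \<in> D j}) = emeasure M E * path_prob l m D n"
  using assms
proof (induction m arbitrary: E l D n)
  case 0
  have "E \<subseteq> space M" using history_subset[OF 0(1)] .
  then show ?case by (simp add: Int_absorb2)
next
  case (Suc m)
  note E = Suc.prems(1)
  let ?F = "\<lambda>y. E \<inter> step_ends z l \<inter> {\<omega>\<in>space M. cust z (Suc l) \<omega> \<in> {y}}"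
  let ?A = "\<lambda>y. ?F y \<inter> {\<omega>\<in>space M. \<forall>j\<in>{1..m}. cust z (Suc l + j) \<omega> \<in> D (Suc j)}"
  have F: "?F y \<in> history z (Suc l)" for y by (rule history_cust[OF history_step[OF E]])
  have F_emeasure: "emeasure M (?F y) = emeasure M E * ennreal (path_law l (next_paths l n {y}))" for y
  proof -
    have En: "E \<inter> {\<omega>\<in>space M. cust z l \<omega> = n} = E" using Suc.prems(2) history_subset[OF E] by blast
    have "?F y = E \<inter> {\<omega>\<in>space M. cust z l \<omega> = n} \<inter> {\<omega>\<in>space M. path_from (clock z l \<omega>) l \<omega> \<in> next_paths l n {y}}"
      using Suc.prems(2) by (auto simp: step_ends_def next_paths_def cust_Suc)
    then have "prob (?F y) = prob E * path_law l (next_paths l n {y})"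
      using history_markov[OF E next_paths_sets, of n l n "{y}"] En by simp
    then show ?thesis by (simp add: emeasure_eq_measure ennreal_mult path_law_def)
  qed
  have A: "?A y \<in> events" for y by (rule sets.Int[OF history_event[OF F] cust_all_event])
  have IH: "emeasure M (?A y) = emeasure M (?F y) * path_prob (Suc l) m (\<lambda>j. D (Suc j)) y" for y
    by (rule Suc.IH[OF F]) simp
  have Icc: "{1..Suc m} = insert 1 (Suc ` {1..m})"
    by (auto simp: image_Suc_atLeastAtMost)
  have eq: "(E \<inter> step_ends z l) \<inter> {\<omega>\<in>space M. \<forall>j\<in>{1..Suc m}. cust z (l + j) \<omega> \<in> D j} = (\<Union>y\<in>D 1. ?A y)"
  proof -
    have iff: "(\<forall>j\<in>{1..Suc m}. P j) \<longleftrightarrow> P 1 \<and> (\<forall>j\<in>{1..m}. P (Suc j))" for P :: "nat \<Rightarrow> bool"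
      unfolding Icc by blast
    have mem: "\<omega> \<in> ?A y \<longleftrightarrow> \<omega> \<in> E \<inter> step_ends z l \<and> \<omega> \<in> space M \<and> cust z (l + 1) \<omega> = y \<and>
        (\<forall>j\<in>{1..m}. cust z (l + Suc j) \<omega> \<in> D (Suc j))" for \<omega> y
      by (simp del: atLeastAtMost_iff add: conj_ac)
    have gen: "(\<exists>y\<in>X. a \<and> b \<and> c = y \<and> d) \<longleftrightarrow> c \<in> X \<and> a \<and> b \<and> d" for X a b d and c :: content
      by blast
    show ?thesis
    proof (rule set_eqI)
      fix \<omega>
      have R: "\<omega> \<in> (\<Union>y\<in>D 1. ?A y) \<longleftrightarrow> cust z (l + 1) \<omega> \<in> D 1 \<and> \<omega> \<in> E \<inter> step_ends z l \<and> \<omega> \<in> space M \<and>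
        (\<forall>j\<in>{1..m}. cust z (l + Suc j) \<omega> \<in> D (Suc j))"
        unfolding UN_iff mem by (rule gen)
      show "\<omega> \<in> (E \<inter> step_ends z l) \<inter> {\<omega>\<in>space M. \<forall>j\<in>{1..Suc m}. cust z (l + j) \<omega> \<in> D j} \<longleftrightarrow>
        \<omega> \<in> (\<Union>y\<in>D 1. ?A y)"
        unfolding R Int_iff mem_Collect_eq iff by (simp only: conj_ac)
    qed
  qed
  \<comment> \<open>Outcomes in which step \<open>l\<close> never ends are discarded as a null set
    first, since only a completed step keeps the event in the history.\<close>
  have "emeasure M (E \<inter> {\<omega>\<in>space M. \<forall>j\<in>{1..Suc m}. cust z (l + j) \<omega> \<in> D j}) =
      emeasure M ((E \<inter> step_ends z l) \<inter> {\<omega>\<in>space M. \<forall>j\<in>{1..Suc m}. cust z (l + j) \<omega> \<in> D j})"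
  proof (rule emeasure_eq_AE)
    show "AE \<omega> in M. (\<omega> \<in> E \<inter> {\<omega>\<in>space M. \<forall>j\<in>{1..Suc m}. cust z (l + j) \<omega> \<in> D j}) =
        (\<omega> \<in> (E \<inter> step_ends z l) \<inter> {\<omega>\<in>space M. \<forall>j\<in>{1..Suc m}. cust z (l + j) \<omega> \<in> D j})"
      using AE_step_ends[OF E] by eventually_elim (simp only: Int_iff, blast)
    show "E \<inter> {\<omega>\<in>space M. \<forall>j\<in>{1..Suc m}. cust z (l + j) \<omega> \<in> D j} \<in> events"
      by (intro sets.Int history_event[OF E] cust_all_event)
    show "(E \<inter> step_ends z l) \<inter> {\<omega>\<in>space M. \<forall>j\<in>{1..Suc m}. cust z (l + j) \<omega> \<in> D j} \<in> events"
      by (intro sets.Int[of "E \<inter> step_ends z l"] history_event[OF history_step[OF E]] cust_all_event)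
  qed
  also have "\<dots> = (\<integral>\<^sup>+y. emeasure M (?A y) \<partial>count_space (D 1))"
    unfolding eq
  proof (rule emeasure_UN_countable)
    show "disjoint_family_on ?A (D 1)" unfolding disjoint_family_on_def by blast
    show "countable (D 1)" by (rule countableI_type)
  qed (rule A)
  also have "\<dots> = (\<integral>\<^sup>+y. emeasure M (?A y) * indicator (D 1) y \<partial>count_space UNIV)"
    by (rule nn_integral_count_space_indicator) (simp add: NO_MATCH_def)
  also have "\<dots> = (\<integral>\<^sup>+y. emeasure M E * (indicator (D 1) y * (ennreal (path_law l (next_paths l n {y})) *
     path_prob (Suc l) m (\<lambda>j. D (Suc j)) y)) \<partial>count_space UNIV)"
    unfolding IH F_emeasure by (intro nn_integral_cong) (simp only: ac_simps)
  also have "\<dots> = emeasure M E * path_prob l (Suc m) D n"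
    by (simp add: nn_integral_cmult)
  finally show ?case .
qed

lemma path_prob_mod: "path_prob (l + 4) m D n = path_prob l m D n"
proof (induction m arbitrary: l D n)
  case (Suc m)
  have "path_law (l + 4) C = path_law l C" for C by (simp add: path_law_def)
  moreover have "next_paths (l + 4) n D = next_paths l n D" for D
    by (simp add: next_paths_def stopping_paths_def kind_at_def)
  moreover have "path_prob (Suc (l + 4)) m (\<lambda>j. D (Suc j)) y = path_prob (Suc l) m (\<lambda>j. D (Suc j)) y" for y
    using Suc[of "Suc l"] by simp
  ultimately show ?case by simp
qed simp

lemma path_prob_cycle: "path_prob (4 * k) m D n = path_prob 0 m D n"
proof (induction k)
  case (Suc k)
  then show ?case using path_prob_mod[of "4 * k"] by (simp add: add.commute)
qed simp

text \<open>The chain seen once per cycle is homogeneous because the kernels repeat with period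
  four.\<close>

lemma cycle_markov:
  "prob {\<omega>\<in>space M. cust x (4 * k) \<omega> = z \<and> (\<forall>j\<in>{1..m}. cust x (4 * (k + j)) \<omega> \<in> D j)} =
   prob {\<omega>\<in>space M. cust x (4 * k) \<omega> = z} * prob {\<omega>\<in>space M. \<forall>j\<in>{1..m}. cust z (4 * j) \<omega> \<in> D j}"
proof -
  \<comment> \<open>All steps are tracked, but only those that begin a cycle are
    constrained.\<close>
  define D' where "D' j = (if 4 dvd j then D (j div 4) else UNIV)" for j
  have D': "(\<forall>j\<in>{1..4 * m}. f (4 * k + j) \<in> D' j) \<longleftrightarrow> (\<forall>j\<in>{1..m}. f (4 * (k + j)) \<in> D j)" for f k
  proof
    assume l: "\<forall>j\<in>{1..4 * m}. f (4 * k + j) \<in> D' j"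
    show "\<forall>j\<in>{1..m}. f (4 * (k + j)) \<in> D j"
    proof
      fix j assume "j \<in> {1..m}"
      then have "f (4 * k + 4 * j) \<in> D' (4 * j)" using l by auto
      then show "f (4 * (k + j)) \<in> D j" by (simp add: D'_def distrib_left)
    qed
  next
    assume r: "\<forall>j\<in>{1..m}. f (4 * (k + j)) \<in> D j"
    show "\<forall>j\<in>{1..4 * m}. f (4 * k + j) \<in> D' j"
    proof
      fix j assume j: "j \<in> {1..4 * m}"
      show "f (4 * k + j) \<in> D' j"
      proof (cases "4 dvd j")
        case True
        then obtain i where "j = 4 * i" by blast
        moreover from this have "i \<in> {1..m}" using j by auto
        ultimately show ?thesis using r by (auto simp: D'_def distrib_left)
      qed (simp add: D'_def)
    qed
  qed
  have main: "prob {\<omega>\<in>space M. cust x (4 * k) \<omega> = z \<and> (\<forall>j\<in>{1..m}. cust x (4 * (k + j)) \<omega> \<in> D j)} =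
      enn2real (emeasure M {\<omega>\<in>space M. cust x (4 * k) \<omega> = z} * path_prob 0 (4 * m) D' z)" for x k
  proof -
    let ?E = "full x (4 * k) \<inter> {\<omega>\<in>space M. cust x (4 * k) \<omega> \<in> {z}}"
    let ?A = "{\<omega>\<in>space M. \<forall>j\<in>{1..4 * m}. cust x (4 * k + j) \<omega> \<in> D' j}"
    have E: "?E \<in> history x (4 * k)" by (rule history_cust[OF full_history])
    have "emeasure M (?E \<inter> ?A) = emeasure M ?E * path_prob (4 * k) (4 * m) D' z"
      by (rule markov_path[OF E]) simp
    moreover have "emeasure M ?E = emeasure M {\<omega>\<in>space M. cust x (4 * k) \<omega> = z}"
    proof (rule emeasure_eq_AE)
      show "AE \<omega> in M. (\<omega> \<in> ?E) = (\<omega> \<in> {\<omega>\<in>space M. cust x (4 * k) \<omega> = z})"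
        using AE_full[of x "4 * k"] by eventually_elim auto
    qed (use history_event[OF E] in simp_all)
    moreover have "emeasure M (?E \<inter> ?A) =
        emeasure M {\<omega>\<in>space M. cust x (4 * k) \<omega> = z \<and> (\<forall>j\<in>{1..m}. cust x (4 * (k + j)) \<omega> \<in> D j)}"
    proof (rule emeasure_eq_AE)
      show "AE \<omega> in M. (\<omega> \<in> ?E \<inter> ?A) =
          (\<omega> \<in> {\<omega>\<in>space M. cust x (4 * k) \<omega> = z \<and> (\<forall>j\<in>{1..m}. cust x (4 * (k + j)) \<omega> \<in> D j)})"
        using AE_full[of x "4 * k"]
      proof (rule AE_mp, intro AE_I2 impI)
        fix \<omega> assume "\<omega> \<in> space M" "\<omega> \<in> full x (4 * k)"
        then show "(\<omega> \<in> ?E \<inter> ?A) =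
          (\<omega> \<in> {\<omega>\<in>space M. cust x (4 * k) \<omega> = z \<and> (\<forall>j\<in>{1..m}. cust x (4 * (k + j)) \<omega> \<in> D j)})"
          using D'[of "\<lambda>l. cust x l \<omega>" k] by (simp only: Int_iff mem_Collect_eq singleton_iff) blast
      qed
      show "?E \<inter> ?A \<in> events" by (rule sets.Int[OF history_event[OF E] cust_all_event])
      show "{\<omega>\<in>space M. cust x (4 * k) \<omega> = z \<and> (\<forall>j\<in>{1..m}. cust x (4 * (k + j)) \<omega> \<in> D j)} \<in> events"
        by (intro sets.sets_Collect_conj sets.sets_Collect_finite_All) auto
    qed
    ultimately show ?thesis by (simp add: path_prob_cycle measure_def)
  qed
  \<comment> \<open>The case \<open>k = 0\<close> with start \<open>z\<close>: the second factor of
    the claim is evaluated by the same kernel.\<close>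
  have "{\<omega>\<in>space M. cust z (4 * 0) \<omega> = z} = space M" by simp
  then have "prob {\<omega>\<in>space M. \<forall>j\<in>{1..m}. cust z (4 * j) \<omega> \<in> D j} = enn2real (path_prob 0 (4 * m) D' z)"
    using main[of z 0] by (simp add: emeasure_space_1)
  then show ?thesis unfolding main[of x k] by (simp add: measure_def enn2real_mult)
qed

end

subsection \<open>Moment bounds and positive recurrence of the regular model\<close>

context stable_polling
begin

definition step_mean :: "nat \<Rightarrow> (content \<Rightarrow> ennreal) \<Rightarrow> content \<Rightarrow> ennreal" where
  "step_mean l f n = (\<integral>\<^sup>+\<omega>. f (outcome \<mu> p (kind_at l) n (path_from 0 (l mod 4) \<omega>)) \<partial>M)"

text \<open>The one-step kernel in integrated form: the strong Markov property on each value of the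
  current contents, summed over the countably many values.\<close>

lemma step_integral:
  "(\<integral>\<^sup>+\<omega>. f (cust z (Suc l) \<omega>) \<partial>M) = (\<integral>\<^sup>+\<omega>. step_mean l f (cust z l \<omega>) \<partial>M)"
proof -
  let ?I = "\<lambda>n. {\<omega>\<in>space M. cust z l \<omega> = n}"
  have inner: "(\<integral>\<^sup>+\<omega>. indicator (?I n) \<omega> * f (cust z (Suc l) \<omega>) \<partial>M) =
      (\<integral>\<^sup>+\<omega>. indicator (?I n) \<omega> * step_mean l f (cust z l \<omega>) \<partial>M)" for n
  proof -
    let ?E = "full z l \<inter> ?I n"
    have E: "?E \<in> events" by (rule adapted_time_event[OF history_adapted[OF full_history]])
    have AE_E: "AE \<omega> in M. indicator ?E \<omega> = (indicator (?I n) \<omega> :: ennreal)"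
      using AE_full[of z l] by eventually_elim (simp add: indicator_def)
    have "(\<integral>\<^sup>+\<omega>. indicator (?I n) \<omega> * f (cust z (Suc l) \<omega>) \<partial>M) =
        (\<integral>\<^sup>+\<omega>. indicator ?E \<omega> * f (outcome \<mu> p (kind_at l) n (path_from (clock z l \<omega>) l \<omega>)) \<partial>M)"
      by (rule nn_integral_cong_AE) (use AE_E in eventually_elim, auto simp: indicator_def cust_Suc)
    also have "\<dots> = emeasure M ?E * step_mean l f n"
      unfolding step_mean_def
    proof (rule nn_integral_factor[where f = "\<lambda>w. f (outcome \<mu> p (kind_at l) n w)" and N = path_space])
      show "(\<lambda>\<omega>. path_from (clock z l \<omega>) l \<omega>) \<in> measurable M path_space"
        by (rule path_measurable[OF clock_measurable clock_nonneg])
      show "(\<lambda>w. f (outcome \<mu> p (kind_at l) n w)) \<in> borel_measurable path_space"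
        by (rule measurable_compose[OF outcome_measurable]) simp
      fix C assume "C \<in> sets path_space"
      then show "prob (?E \<inter> {\<omega>\<in>space M. path_from (clock z l \<omega>) l \<omega> \<in> C}) =
          prob ?E * prob {\<omega>\<in>space M. path_from 0 (l mod 4) \<omega> \<in> C}"
        using history_markov[OF full_history, of C z l n] by (simp add: path_law_def)
    qed (use E path_0_measurable in simp_all)
    also have "\<dots> = (\<integral>\<^sup>+\<omega>. step_mean l f n * indicator ?E \<omega> \<partial>M)"
      using E by (simp add: nn_integral_cmult_indicator mult.commute)
    also have "\<dots> = (\<integral>\<^sup>+\<omega>. indicator (?I n) \<omega> * step_mean l f (cust z l \<omega>) \<partial>M)"
      by (rule nn_integral_cong_AE) (use AE_E in eventually_elim, auto simp: indicator_def)
    finally show ?thesis .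
  qed
  have m: "(\<lambda>\<omega>. g (cust z j \<omega>)) \<in> borel_measurable M" for g :: "content \<Rightarrow> ennreal" and j
    by (rule measurable_compose[OF cust_measurable]) simp
  show ?thesis
    unfolding nn_integral_countable_partition[OF cust_measurable[of z l] m[of f "Suc l"]]
      nn_integral_countable_partition[OF cust_measurable[of z l] m[of "step_mean l f" l]] inner ..
qed

lemma weight_step:
  assumes k: "kind_at l = Visit i"
  shows "(\<integral>\<^sup>+\<omega>. ennreal (weight i (cust z (Suc l) \<omega>)) \<partial>M) \<le>
    (\<integral>\<^sup>+\<omega>. ennreal (weight i (cust z l \<omega>)) \<partial>M) + ennreal (drift i)"
proof -
  have "(\<integral>\<^sup>+\<omega>. ennreal (weight i (cust z (Suc l) \<omega>)) \<partial>M) =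
      (\<integral>\<^sup>+\<omega>. step_mean l (\<lambda>n. ennreal (weight i n)) (cust z l \<omega>) \<partial>M)" by (rule step_integral)
  also have "\<dots> \<le> (\<integral>\<^sup>+\<omega>. ennreal (weight i (cust z l \<omega>)) + ennreal (drift i) \<partial>M)"
  proof (rule nn_integral_mono)
    fix \<omega>
    have "kind_at (l mod 4) = Visit i" using k by (simp add: kind_at_mod)
    from visit_weight[OF this, of "cust z l \<omega>"]
    show "step_mean l (\<lambda>n. ennreal (weight i n)) (cust z l \<omega>) \<le> ennreal (weight i (cust z l \<omega>)) + ennreal (drift i)"
      by (simp add: step_mean_def k ennreal_plus weight_nonneg drift_nonneg)
  qed
  also have "\<dots> = (\<integral>\<^sup>+\<omega>. ennreal (weight i (cust z l \<omega>)) \<partial>M) + ennreal (drift i)"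
    by (subst nn_integral_add) (simp_all add: emeasure_space_1 measurable_compose[OF cust_measurable])
  finally show ?thesis .
qed

lemma travel_mean_nonneg: "0 \<le> travel_mean"
proof -
  have "0 \<le> expectation (S Q1 0)" using switching_regular by (intro integral_nonneg_AE AE_I2 less_imp_le)
  then show ?thesis by (simp add: travel_mean_def switching_mean)
qed

lemma travel_step:
  assumes k: "kind_at l = Travel"
  shows "(\<integral>\<^sup>+\<omega>. of_nat (cust z (Suc l) \<omega> q) \<partial>M) \<le>
    (\<integral>\<^sup>+\<omega>. of_nat (cust z l \<omega> q) \<partial>M) + ennreal (lam q * travel_mean)"
proof -
  have k': "kind_at (l mod 4) = Travel" using k by (simp add: kind_at_mod)
  have [measurable]: "(\<lambda>\<omega>. cust z l \<omega> q) \<in> measurable M (count_space UNIV)"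
    by (rule measurable_compose[OF cust_measurable]) simp
  have [measurable]: "(\<lambda>\<omega>. \<Lambda> q (U (l mod 4) 0 \<omega>) \<omega>) \<in> measurable M (count_space UNIV)"
    by (rule Lam_compose_measurable) (simp_all add: less_imp_le[OF U_pos])
  have "(\<integral>\<^sup>+\<omega>. of_nat (cust z (Suc l) \<omega> q) \<partial>M) = (\<integral>\<^sup>+\<omega>. step_mean l (\<lambda>n. of_nat (n q)) (cust z l \<omega>) \<partial>M)"
    by (rule step_integral)
  also have "\<dots> \<le> (\<integral>\<^sup>+\<omega>. of_nat (cust z l \<omega> q) + ennreal (lam q * travel_mean) \<partial>M)"
  proof (rule nn_integral_mono)
    fix \<omega>
    have "step_mean l (\<lambda>n. of_nat (n q)) (cust z l \<omega>) =
        (\<integral>\<^sup>+\<omega>'. of_nat (cust z l \<omega> q) + of_nat (\<Lambda> q (U (l mod 4) 0 \<omega>') \<omega>') \<partial>M)"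
      unfolding step_mean_def k by (intro nn_integral_cong) (simp only: travel_outcome of_nat_add)
    also have "\<dots> = of_nat (cust z l \<omega> q) + (\<integral>\<^sup>+\<omega>'. of_nat (\<Lambda> q (U (l mod 4) 0 \<omega>') \<omega>') \<partial>M)"
      by (subst nn_integral_add) (simp_all add: emeasure_space_1)
    also have "\<dots> \<le> of_nat (cust z l \<omega> q) + ennreal (lam q * travel_mean)"
      by (intro add_left_mono travel_arrivals_mean k')
    finally show "step_mean l (\<lambda>n. of_nat (n q)) (cust z l \<omega>) \<le> of_nat (cust z l \<omega> q) + ennreal (lam q * travel_mean)" .
  qed
  also have "\<dots> = (\<integral>\<^sup>+\<omega>. of_nat (cust z l \<omega> q) \<partial>M) + ennreal (lam q * travel_mean)"
    by (subst nn_integral_add) (simp_all add: emeasure_space_1 measurable_compose[OF cust_measurable])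
  finally show ?thesis .
qed

definition cust_mean :: "content \<Rightarrow> nat \<Rightarrow> queue \<Rightarrow> real" where
  "cust_mean z l q = enn2real (\<integral>\<^sup>+\<omega>. of_nat (cust z l \<omega> q) \<partial>M)"

lemma ratio_pos: "0 < lam (other i) / (\<mu> - lam i)"
  using lam_pos[of "other i"] load_single[of i] by simp

lemma weight_integral:
  "(\<integral>\<^sup>+\<omega>. ennreal (weight i (cust z l \<omega>)) \<partial>M) = (\<integral>\<^sup>+\<omega>. of_nat (cust z l \<omega> (other i)) \<partial>M) +
     ennreal (lam (other i) / (\<mu> - lam i)) * (\<integral>\<^sup>+\<omega>. of_nat (cust z l \<omega> i) \<partial>M)"
proof -
  have m [measurable]: "(\<lambda>\<omega>. cust z l \<omega> q) \<in> measurable M (count_space UNIV)" for q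
    by (rule measurable_compose[OF cust_measurable]) simp
  have "(\<integral>\<^sup>+\<omega>. ennreal (weight i (cust z l \<omega>)) \<partial>M) = (\<integral>\<^sup>+\<omega>. of_nat (cust z l \<omega> (other i)) +
     ennreal (lam (other i) / (\<mu> - lam i)) * of_nat (cust z l \<omega> i) \<partial>M)"
    unfolding weight_def by (intro nn_integral_cong weight_ennreal ratio_nonneg)
  then show ?thesis by (simp add: nn_integral_add nn_integral_cmult)
qed

text \<open>No uniform bound yet: the means are finite at every step by induction. After a visit the
  mean of the own queue is recovered from the weight because its coefficient is strictly
  positive.\<close>

lemma cust_integrable: "(\<integral>\<^sup>+\<omega>. of_nat (cust z l \<omega> q) \<partial>M) = ennreal (cust_mean z l q)"
proof -
  have "\<forall>q. (\<integral>\<^sup>+\<omega>. of_nat (cust z l \<omega> q) \<partial>M) < top"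
  proof (induction l)
    case 0
    show ?case by (simp add: emeasure_space_1 of_nat_less_top)
  next
    case (Suc l)
    show ?case
    proof (cases "kind_at l")
      case (Visit i)
      have "(\<integral>\<^sup>+\<omega>. ennreal (weight i (cust z l \<omega>)) \<partial>M) < top"
        unfolding weight_integral using Suc by (simp add: ennreal_mult_less_top)
      then have "(\<integral>\<^sup>+\<omega>. ennreal (weight i (cust z (Suc l) \<omega>)) \<partial>M) < top"
        using le_less_trans[OF weight_step[OF Visit, of z]] by simp
      then have fin: "(\<integral>\<^sup>+\<omega>. of_nat (cust z (Suc l) \<omega> (other i)) \<partial>M) < top"
        "ennreal (lam (other i) / (\<mu> - lam i)) * (\<integral>\<^sup>+\<omega>. of_nat (cust z (Suc l) \<omega> i) \<partial>M) < top"
        unfolding weight_integral by simp_all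
      have "ennreal (lam (other i) / (\<mu> - lam i)) \<noteq> 0"
        using ratio_pos[of i] by (simp only: ennreal_eq_0_iff not_le)
      then have "(\<integral>\<^sup>+\<omega>. of_nat (cust z (Suc l) \<omega> i) \<partial>M) < top"
        using fin(2) by (auto simp: ennreal_mult_less_top)
      then show ?thesis using fin(1) queue_cases_other[of _ i] by metis
    next
      case Travel
      show ?thesis
      proof
        fix q
        have "(\<integral>\<^sup>+\<omega>. of_nat (cust z l \<omega> q) \<partial>M) + ennreal (lam q * travel_mean) < top" using Suc by simp
        then show "(\<integral>\<^sup>+\<omega>. of_nat (cust z (Suc l) \<omega> q) \<partial>M) < top"
          by (rule le_less_trans[OF travel_step[OF Travel]])
      qed
    qed
  qed
  then show ?thesis by (simp add: cust_mean_def)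
qed

lemma cust_mean_nonneg: "0 \<le> cust_mean z l q"
  by (simp add: cust_mean_def)

lemma cust_mean_visit:
  assumes k: "kind_at l = Visit i"
  shows "cust_mean z (Suc l) (other i) + lam (other i) / (\<mu> - lam i) * cust_mean z (Suc l) i \<le>
    cust_mean z l (other i) + lam (other i) / (\<mu> - lam i) * cust_mean z l i + drift i"
proof -
  let ?w = "\<lambda>l. cust_mean z l (other i) + lam (other i) / (\<mu> - lam i) * cust_mean z l i"
  have w0: "0 \<le> ?w l" for l
    by (intro add_nonneg_nonneg mult_nonneg_nonneg cust_mean_nonneg ratio_nonneg)
  have "(\<integral>\<^sup>+\<omega>. ennreal (weight i (cust z l \<omega>)) \<partial>M) = ennreal (?w l)" for l
    unfolding weight_integral cust_integrable ennreal_mult[OF ratio_nonneg cust_mean_nonneg, symmetric]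
    by (rule ennreal_plus[OF cust_mean_nonneg mult_nonneg_nonneg[OF ratio_nonneg cust_mean_nonneg], symmetric])
  then have "ennreal (?w (Suc l)) \<le> ennreal (?w l) + ennreal (drift i)"
    using weight_step[OF k, of z] by simp
  also have "\<dots> = ennreal (?w l + drift i)" by (rule ennreal_plus[OF w0 drift_nonneg, symmetric])
  finally show ?thesis by (subst (asm) ennreal_le_iff) (intro add_nonneg_nonneg w0 drift_nonneg)
qed

lemma cust_mean_travel:
  assumes k: "kind_at l = Travel"
  shows "cust_mean z (Suc l) q \<le> cust_mean z l q + lam q * travel_mean"
proof -
  have t: "0 \<le> lam q * travel_mean" using lam_pos[of q] travel_mean_nonneg by simp
  have "ennreal (cust_mean z (Suc l) q) \<le> ennreal (cust_mean z l q) + ennreal (lam q * travel_mean)"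
    using travel_step[OF k, of z q] by (simp only: cust_integrable)
  also have "\<dots> = ennreal (cust_mean z l q + lam q * travel_mean)"
    by (rule ennreal_plus[OF cust_mean_nonneg t, symmetric])
  finally show ?thesis
    by (subst (asm) ennreal_le_iff) (intro add_nonneg_nonneg cust_mean_nonneg t)
qed

lemma cust_expectation:
  "integrable M (\<lambda>\<omega>. real (cust z l \<omega> q))" "expectation (\<lambda>\<omega>. real (cust z l \<omega> q)) = cust_mean z l q"
proof -
  have [measurable]: "(\<lambda>\<omega>. cust z l \<omega> q) \<in> measurable M (count_space UNIV)"
    by (rule measurable_compose[OF cust_measurable]) simp
  have eq: "(\<integral>\<^sup>+\<omega>. ennreal (real (cust z l \<omega> q)) \<partial>M) = ennreal (cust_mean z l q)"
    using cust_integrable[of z l q] by (simp add: ennreal_of_nat_eq_real_of_nat)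
  show "integrable M (\<lambda>\<omega>. real (cust z l \<omega> q))"
    by (rule integrableI_nonneg) (simp_all add: eq)
  show "expectation (\<lambda>\<omega>. real (cust z l \<omega> q)) = cust_mean z l q"
    by (subst integral_eq_nn_integral) (simp_all add: eq cust_mean_nonneg)
qed

text \<open>The residual is affine in the contents. A bound on its mean therefore ties the two mean
  contents at a departure together, up to a constant, as \<open>- alpha p i Concluding\<close> to
  1.\<close>

lemma residual_mean:
  "expectation (\<lambda>\<omega>. Pi_C \<mu> p i (cust z l \<omega>)) =
     cust_mean z l i + alpha p i Concluding * cust_mean z l (other i) + \<mu> * beta p i Concluding"
  unfolding Pi_C_def using cust_expectation(1)[of z l] by (simp add: cust_expectation(2) prob_space)

lemma kind_at_cycle:
  "kind_at (4 * k) = Visit Q1" "kind_at (4 * k + 1) = Travel" "kind_at (4 * k + 2) = Visit Q2"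
  "kind_at (4 * k + 3) = Travel"
proof -
  have "(4 * k) mod 4 = 0" "(4 * k + 1) mod 4 = 1" "(4 * k + 2) mod 4 = 2" "(4 * k + 3) mod 4 = 3"
    by presburger+
  then show "kind_at (4 * k) = Visit Q1" "kind_at (4 * k + 1) = Travel" "kind_at (4 * k + 2) = Visit Q2"
    "kind_at (4 * k + 3) = Travel"
    unfolding kind_at_def by simp_all
qed

lemma cust_mean_bounded:
  assumes product: "alpha p Q1 Concluding * alpha p Q2 Concluding < 1"
    and residuals: "\<And>i. \<exists>K. \<forall>k. \<bar>expectation (\<lambda>\<omega>. Pi_C \<mu> p i (cust z (4 * k + (if i = Q1 then 1 else 3)) \<omega>))\<bar> \<le> K"
  shows "\<exists>B. \<forall>k. cust_mean z (4 * k) Q1 + cust_mean z (4 * k) Q2 \<le> B"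
proof -
  let ?a = "cust_mean z"
  define A1 where "A1 = - alpha p Q1 Concluding"
  define A2 where "A2 = - alpha p Q2 Concluding"
  define R1 where "R1 = lam Q2 / (\<mu> - lam Q1)"
  define R2 where "R2 = lam Q1 / (\<mu> - lam Q2)"
  define t1 where "t1 = lam Q1 * travel_mean"
  define t2 where "t2 = lam Q2 * travel_mean"
  have nonneg: "0 \<le> A1" "0 \<le> A2" "0 \<le> R1" "0 \<le> R2"
    using policy ratio_nonneg[of Q1] ratio_nonneg[of Q2]
    by (simp_all add: A1_def A2_def R1_def R2_def two_phase_policies_def)
  \<comment> \<open>The total load being below one makes each ratio less than one.\<close>
  have R: "R1 * R2 < 1"
  proof -
    have "lam Q2 < \<mu> - lam Q1" "lam Q1 < \<mu> - lam Q2" using load'[of Q1] by simp_all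
    then have "R1 < 1" "R2 < 1"
      using load_single[of Q1] load_single[of Q2] by (simp_all add: R1_def R2_def)
    then have "R1 * R2 \<le> R1 * 1" "R1 < 1" using mult_left_mono[of R2 1 R1] nonneg by simp_all
    then show ?thesis by simp
  qed
  obtain K1 where K1: "\<And>k. \<bar>expectation (\<lambda>\<omega>. Pi_C \<mu> p Q1 (cust z (4 * k + 1) \<omega>))\<bar> \<le> K1"
    using residuals[of Q1] by auto
  obtain K2 where K2: "\<And>k. \<bar>expectation (\<lambda>\<omega>. Pi_C \<mu> p Q2 (cust z (4 * k + 3) \<omega>))\<bar> \<le> K2"
    using residuals[of Q2] by auto
  define b1 where "b1 = \<bar>\<mu> * beta p Q1 Concluding\<bar>"
  define b2 where "b2 = \<bar>\<mu> * beta p Q2 Concluding\<bar>"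
  have r1: "\<bar>?a (4 * k + 1) Q1 - A1 * ?a (4 * k + 1) Q2\<bar> \<le> K1 + b1" for k
  proof -
    have "\<bar>?a (4 * k + 1) Q1 - A1 * ?a (4 * k + 1) Q2 + \<mu> * beta p Q1 Concluding\<bar> \<le> K1"
      using K1[of k] unfolding residual_mean A1_def by simp
    then show ?thesis unfolding b1_def by linarith
  qed
  have r2: "\<bar>?a (4 * k + 3) Q2 - A2 * ?a (4 * k + 3) Q1\<bar> \<le> K2 + b2" for k
  proof -
    have "\<bar>?a (4 * k + 3) Q2 - A2 * ?a (4 * k + 3) Q1 + \<mu> * beta p Q2 Concluding\<bar> \<le> K2"
      using K2[of k] unfolding residual_mean A2_def by simp
    then show ?thesis unfolding b2_def by linarith
  qed
  \<comment> \<open>At each departure only the queue not just served is recorded; the residual bound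
    determines the other one up to a constant.\<close>
  define x where "x k = ?a (4 * k + 1) Q2" for k
  define y where "y k = ?a (4 * k + 3) Q1" for k
  have s1: "Suc (4 * k + 1) = 4 * k + 2" "Suc (4 * k + 2) = 4 * k + 3" "Suc (4 * k + 3) = 4 * Suc k"
    "Suc (4 * Suc k) = 4 * Suc k + 1" for k :: nat by simp_all
  have travel1: "?a (4 * k + 2) Q1 \<le> ?a (4 * k + 1) Q1 + t1" "?a (4 * k + 2) Q2 \<le> ?a (4 * k + 1) Q2 + t2" for k
    using cust_mean_travel[OF kind_at_cycle(2), of z k] unfolding s1 t1_def t2_def by blast+
  have travel2: "?a (4 * Suc k) Q1 \<le> ?a (4 * k + 3) Q1 + t1" "?a (4 * Suc k) Q2 \<le> ?a (4 * k + 3) Q2 + t2" for k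
    using cust_mean_travel[OF kind_at_cycle(4), of z k] unfolding s1 t1_def t2_def by blast+
  \<comment> \<open>The drift inequality of the visit to \<open>Q2\<close>. The residual bound at
    its end replaces the mean of \<open>Q2\<close> by \<open>A2 * y k\<close>, the one at the
    preceding departure replaces the mean of \<open>Q1\<close> by \<open>A1 * x k\<close>. The
    constant collects residuals, arrivals while switching and the drift.\<close>
  have xy: "(1 + R2 * A2) * y k \<le> (A1 + R2) * x k + (K1 + b1 + t1 + R2 * (t2 + K2 + b2) + drift Q2)" for k
  proof -
    have "?a (4 * k + 3) Q1 + R2 * ?a (4 * k + 3) Q2 \<le> ?a (4 * k + 2) Q1 + R2 * ?a (4 * k + 2) Q2 + drift Q2"
      using cust_mean_visit[OF kind_at_cycle(3), of z k] unfolding s1 R2_def by simp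
    moreover have "R2 * (A2 * y k - (K2 + b2)) \<le> R2 * ?a (4 * k + 3) Q2"
      using r2[of k] nonneg by (intro mult_left_mono) (auto simp: y_def)
    moreover have "R2 * ?a (4 * k + 2) Q2 \<le> R2 * (x k + t2)"
      using travel1(2)[of k] nonneg by (intro mult_left_mono) (auto simp: x_def)
    moreover have "?a (4 * k + 1) Q1 \<le> A1 * x k + (K1 + b1)" using r1[of k] by (simp add: x_def)
    ultimately show ?thesis using travel1(1)[of k] by (simp add: y_def algebra_simps)
  qed
  have yx: "(1 + R1 * A1) * x (Suc k) \<le> (A2 + R1) * y k + (K2 + b2 + t2 + R1 * (t1 + K1 + b1) + drift Q1)" for k
  proof -
    have "?a (4 * Suc k + 1) Q2 + R1 * ?a (4 * Suc k + 1) Q1 \<le> ?a (4 * Suc k) Q2 + R1 * ?a (4 * Suc k) Q1 + drift Q1"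
      using cust_mean_visit[OF kind_at_cycle(1)[of "Suc k"], of z] unfolding s1 R1_def other.simps .
    moreover have "R1 * (A1 * x (Suc k) - (K1 + b1)) \<le> R1 * ?a (4 * Suc k + 1) Q1"
      using r1[of "Suc k"] nonneg by (intro mult_left_mono) (auto simp: x_def)
    moreover have "R1 * ?a (4 * Suc k) Q1 \<le> R1 * (y k + t1)"
      using travel2(1)[of k] nonneg by (intro mult_left_mono) (auto simp: y_def)
    moreover have "?a (4 * k + 3) Q2 \<le> A2 * y k + (K2 + b2)" using r2[of k] by (simp add: y_def)
    moreover have "x (Suc k) = ?a (4 * Suc k + 1) Q2" by (simp add: x_def)
    ultimately have "x (Suc k) + R1 * (A1 * x (Suc k) - (K1 + b1)) \<le>
        A2 * y k + (K2 + b2) + t2 + R1 * (y k + t1) + drift Q1"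
      using travel2(2)[of k] by linarith
    then show ?thesis by (simp add: algebra_simps)
  qed
  have A: "A1 * A2 < 1" using product by (simp add: A1_def A2_def)
  obtain B where B: "\<And>k. x k \<le> B \<and> y k \<le> B"
    using alternating_contraction[where x = x and y = y, OF nonneg A R xy yx] by blast
  \<comment> \<open>From the departure of the previous cycle back to the start of a cycle; cycle 0
    has no predecessor and enters through the maximum.\<close>
  have "?a (4 * k) Q1 + ?a (4 * k) Q2 \<le>
      max (?a 0 Q1 + ?a 0 Q2) (B + t1 + A2 * B + K2 + b2 + t2)" for k
  proof (cases k)
    case (Suc k')
    have "A2 * y k' \<le> A2 * B" using B[of k'] nonneg by (intro mult_left_mono) auto
    then have "?a (4 * Suc k') Q1 + ?a (4 * Suc k') Q2 \<le> B + t1 + A2 * B + K2 + b2 + t2"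
    proof -
      have "y k' \<le> B" using B by blast
      moreover have "?a (4 * k' + 3) Q2 \<le> A2 * y k' + (K2 + b2)" using r2[of k'] unfolding y_def by linarith
      moreover have "?a (4 * Suc k') Q1 \<le> y k' + t1" using travel2(1)[of k'] unfolding y_def .
      ultimately show ?thesis using travel2(2)[of k'] \<open>A2 * y k' \<le> A2 * B\<close> by linarith
    qed
    then show ?thesis unfolding Suc by (rule max.coboundedI2)
  qed simp
  then show ?thesis by blast
qed

section \<open>Tightness and a common successor\<close>

lemma finite_content_le: "finite {n :: content. n Q1 + n Q2 \<le> L}"
proof (rule finite_imageD)
  show "finite ((\<lambda>n. (n Q1, n Q2)) ` {n :: content. n Q1 + n Q2 \<le> L})"
    by (rule finite_subset[of _ "{..L} \<times> {..L}"]) auto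
  show "inj_on (\<lambda>n. (n Q1, n Q2)) {n :: content. n Q1 + n Q2 \<le> L}"
    by (auto simp: inj_on_def fun_eq_iff all_queue)
qed

text \<open>Markov's inequality for the total contents, which exceed a given level only outside a
  finite set of states.\<close>

lemma cycle_tight:
  assumes bound: "\<And>k. cust_mean z (4 * k) Q1 + cust_mean z (4 * k) Q2 \<le> B" and d: "0 < d"
  shows "\<exists>F. finite F \<and> (\<forall>k. prob {\<omega>\<in>space M. cust z (4 * k) \<omega> \<notin> F} \<le> d)"
proof -
  have "0 \<le> B" using bound[of 0] cust_mean_nonneg[of z 0 Q1] cust_mean_nonneg[of z 0 Q2] by simp
  obtain L :: nat where L: "B / d < real L" using reals_Archimedean2 by blast
  have L0: "0 < real L" using L \<open>0 \<le> B\<close> d by (meson divide_nonneg_pos le_less_trans)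
  let ?F = "{n :: content. n Q1 + n Q2 \<le> L}"
  have "prob {\<omega>\<in>space M. cust z (4 * k) \<omega> \<notin> ?F} \<le> d" for k
  proof -
    let ?f = "\<lambda>\<omega>. real (cust z (4 * k) \<omega> Q1) + real (cust z (4 * k) \<omega> Q2)"
    have int: "integrable M ?f" by (intro Bochner_Integration.integrable_add cust_expectation)
    have ev: "{\<omega>\<in>space M. cust z (4 * k) \<omega> \<notin> ?F} \<in> events"
      using measurable_sets[OF cust_measurable[of z "4 * k"], of "- ?F"] by (simp add: vimage_def Int_def conj_commute)
    have "real L * prob {\<omega>\<in>space M. cust z (4 * k) \<omega> \<notin> ?F} =
        expectation (\<lambda>\<omega>. real L * indicator {\<omega>\<in>space M. cust z (4 * k) \<omega> \<notin> ?F} \<omega>)"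
      using ev by (simp add: Int_absorb2 subset_eq)
    also have "\<dots> \<le> expectation ?f"
    proof (rule integral_mono[OF _ int])
      have "integrable M (indicat_real {\<omega>\<in>space M. cust z (4 * k) \<omega> \<notin> ?F})"
        using ev by (intro integrable_real_indicator) (simp_all add: emeasure_eq_measure)
      then show "integrable M (\<lambda>\<omega>. real L * indicator {\<omega>\<in>space M. cust z (4 * k) \<omega> \<notin> ?F} \<omega>)"
        by (rule integrable_mult_right)
    qed (auto simp: indicator_def)
    also have "\<dots> \<le> B"
      using bound[of k] by (simp add: cust_expectation)
    finally have "prob {\<omega>\<in>space M. cust z (4 * k) \<omega> \<notin> ?F} \<le> B / real L"
      using L0 by (simp add: pos_le_divide_eq mult.commute)
    also have "\<dots> \<le> d" using L L0 d by (simp add: pos_divide_le_eq pos_divide_less_eq mult.commute less_imp_le)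
    finally show ?thesis .
  qed
  then show ?thesis using finite_content_le[of L] by blast
qed

text \<open>Some contents \<open>y\<close> have positive probability before the last switching of
  the first cycle, and the arrivals during that switching can add anything to them.\<close>

lemma cycle_reaches:
  "\<exists>y. \<forall>w. (\<forall>q. y q \<le> w q) \<longrightarrow> 0 < prob {\<omega>\<in>space M. cust z 4 \<omega> = w}"
proof -
  let ?E = "\<lambda>y. full z 3 \<inter> {\<omega>\<in>space M. cust z 3 \<omega> = y}"
  have ev: "?E y \<in> events" for y by (rule adapted_time_event[OF history_adapted[OF full_history]])
  \<comment> \<open>Countably many contents share the total mass one.\<close>
  have "\<exists>y. 0 < prob (?E y)"
  proof (rule ccontr)
    assume "\<not> ?thesis"
    then have "prob (?E y) = 0" for y by (metis zero_less_measure_iff)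
    then have "AE \<omega> in M. \<omega> \<notin> ?E y" for y using ev by (subst (asm) prob_eq_0) auto
    then have "AE \<omega> in M. \<forall>y. \<omega> \<notin> ?E y" unfolding AE_all_countable by blast
    then have "AE \<omega> in M. \<omega> \<notin> full z 3"
      by (rule AE_mp) (intro AE_I2 impI, blast)
    then have "AE \<omega> in M. False"
      using AE_full[of z 3] by eventually_elim blast
    then show False by simp
  qed
  then obtain y where y: "0 < prob (?E y)" by blast
  have "0 < prob {\<omega>\<in>space M. cust z 4 \<omega> = w}" if w: "\<And>q. y q \<le> w q" for w
  proof -
    have k: "kind_at 3 = Travel" by (simp add: kind_at_def)
    have "path_law 3 (next_paths 3 y {w}) = prob {\<omega>\<in>space M. outcome \<mu> p Travel y (path_from 0 3 \<omega>) = (\<lambda>q. y q + (w q - y q))}"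
    proof -
      have "(\<lambda>q. y q + (w q - y q)) = w" using w by auto
      moreover have mem: "path_from 0 3 \<omega> \<in> next_paths 3 y {w} \<longleftrightarrow> outcome \<mu> p Travel y (path_from 0 3 \<omega>) = w"
        if "\<omega> \<in> space M" for \<omega>
        using travel_stops[OF k that, of y] by (simp add: next_paths_def k)
      have "{\<omega>\<in>space M. path_from 0 (3 mod 4) \<omega> \<in> next_paths 3 y {w}} =
          {\<omega>\<in>space M. outcome \<mu> p Travel y (path_from 0 3 \<omega>) = w}"
        using mem by (simp cong: conj_cong)
      ultimately show ?thesis unfolding path_law_def by simp
    qed
    then have "0 < path_law 3 (next_paths 3 y {w})" using travel_positive[OF k, of y "\<lambda>q. w q - y q"] by simp
    then have "0 < prob (?E y) * path_law 3 (next_paths 3 y {w})" using y by simp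
    also have "\<dots> = prob (?E y \<inter> {\<omega>\<in>space M. path_from (clock z 3 \<omega>) 3 \<omega> \<in> next_paths 3 y {w}})"
      using history_markov[OF full_history next_paths_sets, of z 3 y 3 y "{w}"] by simp
    also have "\<dots> \<le> prob {\<omega>\<in>space M. cust z 4 \<omega> = w}"
    proof (rule finite_measure_mono)
      have "cust z 4 \<omega> = outcome \<mu> p (kind_at 3) (cust z 3 \<omega>) (path_from (clock z 3 \<omega>) 3 \<omega>)" for \<omega>
        using cust_Suc[of z 3 \<omega>] by simp
      then show "?E y \<inter> {\<omega>\<in>space M. path_from (clock z 3 \<omega>) 3 \<omega> \<in> next_paths 3 y {w}} \<subseteq> {\<omega>\<in>space M. cust z 4 \<omega> = w}"
        by (auto simp: next_paths_def)
    qed simp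
    finally show ?thesis .
  qed
  then show ?thesis by blast
qed

theorem regular_positive_recurrent:
  assumes product: "alpha p Q1 Concluding * alpha p Q2 Concluding < 1"
    and residuals: "\<And>z i. \<exists>K. \<forall>k. \<bar>expectation (\<lambda>\<omega>. Pi_C \<mu> p i (cust z (4 * k + (if i = Q1 then 1 else 3)) \<omega>))\<bar> \<le> K"
  shows "positive_recurrent M UNIV (\<lambda>z k. cust z (4 * k))"
proof -
  interpret chain: markov_family M "\<lambda>z k. cust z (4 * k)"
    by unfold_locales (simp, simp, rule cycle_markov)
  show ?thesis
  proof (rule chain.tight_positive_recurrent)
    fix z :: content and d :: real assume d: "0 < d"
    obtain B where "\<And>k. cust_mean z (4 * k) Q1 + cust_mean z (4 * k) Q2 \<le> B"
      using cust_mean_bounded[OF product residuals, of z] by blast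
    then show "\<exists>F. finite F \<and> (\<forall>k. prob {\<omega>\<in>space M. cust z (4 * k) \<omega> \<notin> F} \<le> d)"
      by (rule cycle_tight[OF _ d])
  next
    fix x x' :: content
    obtain y where y: "\<And>w. (\<And>q. y q \<le> w q) \<Longrightarrow> 0 < prob {\<omega>\<in>space M. cust x 4 \<omega> = w}"
      using cycle_reaches by blast
    obtain y' where y': "\<And>w. (\<And>q. y' q \<le> w q) \<Longrightarrow> 0 < prob {\<omega>\<in>space M. cust x' 4 \<omega> = w}"
      using cycle_reaches by blast
    \<comment> \<open>The componentwise maximum lies above both thresholds, hence both states reach
      it within one cycle.\<close>
    let ?w = "\<lambda>q. max (y q) (y' q)"
    have "0 < chain.trans_prob 1 x ?w" "0 < chain.trans_prob 1 x' ?w"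
      using y[of ?w] y'[of ?w] by (simp_all add: chain.trans_prob_def)
    then show "\<exists>w. chain.accessible x w \<and> chain.accessible x' w"
      unfolding chain.accessible_def by blast
  qed
qed

end

subsection \<open>Identification with the cycles of the model\<close>

context stable_polling
begin

text \<open>Connects the steps seen from their own starting time with the model, where time is
  absolute; it holds on outcomes in which the step ends.\<close>

lemma state_step:
  assumes w: "\<omega> \<in> space M" and st: "\<omega> \<in> step_ends z l"
  shows "kind_at l = Visit i \<Longrightarrow>
      visit \<mu> p (\<lambda>q t. \<Lambda> q t \<omega>) (\<lambda>v. U l v \<omega>) i (state z l \<omega>) = state z (Suc l) \<omega>"
    and "kind_at l = Travel \<Longrightarrow> travel (\<lambda>q t. \<Lambda> q t \<omega>) (U l 0 \<omega>) (state z l \<omega>) = state z (Suc l) \<omega>"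
proof -
  note reg = arrivals_regular[OF w]
  have pf: "path_from (clock z l \<omega>) l \<omega> = (shift_arrivals (\<lambda>q t. \<Lambda> q t \<omega>) (clock z l \<omega>), \<lambda>v. U l v \<omega>)"
    by (simp add: path_from_def)
  have s: "state z l \<omega> = (clock z l \<omega>, cust z l \<omega>)" by (simp add: clock_def cust_def)
  have ne: "stop_set \<mu> p (kind_at l) (cust z l \<omega>) (path_from (clock z l \<omega>) l \<omega>) \<noteq> {}"
    using st by (simp add: step_ends_def stopping_paths_def)
  have Suc: "state z (Suc l) \<omega> = (clock z l \<omega> + duration \<mu> p (kind_at l) (cust z l \<omega>) (path_from (clock z l \<omega>) l \<omega>),
      content_at (kind_at l) (cust z l \<omega>) (path_from (clock z l \<omega>) l \<omega>)
        (duration \<mu> p (kind_at l) (cust z l \<omega>) (path_from (clock z l \<omega>) l \<omega>)))"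
    by (simp add: clock_def cust_def outcome_def)
  show "visit \<mu> p (\<lambda>q t. \<Lambda> q t \<omega>) (\<lambda>v. U l v \<omega>) i (state z l \<omega>) = state z (Suc l) \<omega>" if k: "kind_at l = Visit i"
    unfolding Suc unfolding s pf k
    by (rule visit_shift[OF reg U_regular[OF w] clock_nonneg]) (use ne k pf in simp)
  show "travel (\<lambda>q t. \<Lambda> q t \<omega>) (U l 0 \<omega>) (state z l \<omega>) = state z (Suc l) \<omega>" if k: "kind_at l = Travel"
    unfolding Suc unfolding s pf k
    by (rule travel_shift[OF reg U_regular[OF w] clock_nonneg])
qed

lemma U_cycle:
  "U (4 * k) v = J Q1 k v" "U (4 * k + 1) v = S Q1 k" "U (4 * k + 2) v = J Q2 k v" "U (4 * k + 3) v = S Q2 k"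
proof -
  have "(4 * k) mod 4 = 0" "(4 * k + 1) mod 4 = 1" "(4 * k + 2) mod 4 = 2" "(4 * k + 3) mod 4 = 3"
    "(4 * k) div 4 = k" "(4 * k + 1) div 4 = k" "(4 * k + 2) div 4 = k" "(4 * k + 3) div 4 = k"
    by presburger+
  then show "U (4 * k) v = J Q1 k v" "U (4 * k + 1) v = S Q1 k" "U (4 * k + 2) v = J Q2 k v" "U (4 * k + 3) v = S Q2 k"
    unfolding U_def fun_eq_iff by simp_all
qed

lemma cycle_state:
  assumes w: "\<omega> \<in> space M" and st: "\<And>l. \<omega> \<in> step_ends z l"
  defines "A \<equiv> \<lambda>q t. \<Lambda> q t \<omega>" and "Js \<equiv> \<lambda>i k v. J i k v \<omega>" and "Ss \<equiv> \<lambda>i k. S i k \<omega>"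
  shows "cycle_start \<mu> p A Js Ss z k = state z (4 * k) \<omega>"
    and "departure_state \<mu> p A Js Ss z k Q1 = state z (4 * k + 1) \<omega>"
    and "departure_state \<mu> p A Js Ss z k Q2 = state z (4 * k + 3) \<omega>"
proof -
  have n: "Suc (4 * k) = 4 * k + 1" "Suc (4 * k + 1) = 4 * k + 2" "Suc (4 * k + 2) = 4 * k + 3"
    "Suc (4 * k + 3) = 4 * Suc k" for k :: nat
    by simp_all
  have 1: "visit \<mu> p A (Js Q1 k) Q1 (state z (4 * k) \<omega>) = state z (4 * k + 1) \<omega>" for k
    using state_step(1)[OF w st kind_at_cycle(1), of k] by (simp only: U_cycle A_def Js_def n)
  have 2: "travel A (Ss Q1 k) (state z (4 * k + 1) \<omega>) = state z (4 * k + 2) \<omega>" for k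
    using state_step(2)[OF w st kind_at_cycle(2), of k] by (simp only: U_cycle A_def Ss_def n)
  have 3: "visit \<mu> p A (Js Q2 k) Q2 (state z (4 * k + 2) \<omega>) = state z (4 * k + 3) \<omega>" for k
    using state_step(1)[OF w st kind_at_cycle(3), of k] by (simp only: U_cycle A_def Js_def n)
  have 4: "travel A (Ss Q2 k) (state z (4 * k + 3) \<omega>) = state z (4 * Suc k) \<omega>" for k
    using state_step(2)[OF w st kind_at_cycle(4), of k] by (simp only: U_cycle A_def Ss_def n)
  show cyc: "cycle_start \<mu> p A Js Ss z k = state z (4 * k) \<omega>"
    by (induction k) (simp, simp only: cycle_start.simps 1 2 3 4)
  show "departure_state \<mu> p A Js Ss z k Q1 = state z (4 * k + 1) \<omega>"
    by (simp only: departure_state.simps cyc 1)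
  show "departure_state \<mu> p A Js Ss z k Q2 = state z (4 * k + 3) \<omega>"
    by (simp only: departure_state.simps cyc 1 2 3)
qed

end

subsection \<open>Almost sure regularity\<close>

text \<open>The natural numbers are discrete, so convergence from the right is eventual
  equality.\<close>

lemma continuous_nat_right_constant:
  fixes a :: "real \<Rightarrow> nat"
  assumes "continuous (at_right t) a"
  shows "\<exists>e>0. \<forall>u\<in>{t..t + e}. a u = a t"
proof -
  have "(a \<longlongrightarrow> a t) (at_right t)" using assms by (simp add: continuous_within)
  then have "eventually (\<lambda>u. a u \<in> {a t}) (at_right t)" by (rule topological_tendstoD[OF _ Topological_Spaces.open_discrete]) simp
  then obtain b where "t < b" "\<forall>u>t. u < b \<longrightarrow> a u \<in> {a t}"
    unfolding eventually_at_right_field by blast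
  then have b: "t < b" "\<And>u. t < u \<Longrightarrow> u < b \<Longrightarrow> a u = a t" by simp_all
  have c: "a u = a t" if "u \<in> {t..t + (b - t) / 2}" for u
  proof (cases "u = t")
    case False
    then have "t < u" "u \<le> t + (b - t) / 2" using that by auto
    moreover have "t + (b - t) / 2 < b" using b(1) by (simp add: field_simps)
    ultimately show ?thesis by (intro b(2)) simp_all
  qed simp
  have "0 < (b - t) / 2" using b(1) by simp
  then show ?thesis using c by blast
qed

context polling_system
begin

text \<open>Unboundedness is the one property not part of the definition of a Poisson process; it
  follows since the probability of fewer than \<open>m\<close> arrivals vanishes as time
  grows.\<close>

lemma AE_regular_arrivals: "AE \<omega> in M. regular_arrivals (\<lambda>t. \<Lambda> i t \<omega>)"
proof -
  have [measurable]: "\<Lambda> i (real k) \<in> measurable M (count_space UNIV)" "\<Lambda> i 0 \<in> measurable M (count_space UNIV)" for k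
    using poisson_process_measurable[OF arrivals] by auto
  have raw: "AE \<omega> in M. \<Lambda> i 0 \<omega> = 0 \<and> mono_on {0..} (\<lambda>t. \<Lambda> i t \<omega>) \<and>
      (\<forall>t\<ge>0. continuous (at_right t) (\<lambda>u. \<Lambda> i u \<omega>))"
    using arrivals[of i] by (simp add: poisson_process_def)
  have "AE \<omega> in M. \<exists>k. m \<le> \<Lambda> i (real k) \<omega> - \<Lambda> i 0 \<omega>" for m
  proof -
    let ?A = "{\<omega>\<in>space M. \<forall>k. \<Lambda> i (real k) \<omega> - \<Lambda> i 0 \<omega> < m}"
    let ?p = "\<lambda>k::nat. prob {\<omega>\<in>space M. \<Lambda> i (real k) \<omega> - \<Lambda> i 0 \<omega> < m}"
    have "?p \<longlonglongrightarrow> 0" by (rule summable_LIMSEQ_zero[OF poisson_few_summable[OF arrivals lam_pos]])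
    moreover have "prob ?A \<le> ?p k" for k by (intro finite_measure_mono) auto
    ultimately have "prob ?A \<le> 0" by (intro LIMSEQ_le_const) auto
    then have "prob ?A = 0" by (simp add: measure_le_0_iff)
    then have "AE \<omega> in M. \<omega> \<notin> ?A" by (subst (asm) prob_eq_0) auto
    then show ?thesis by (rule AE_mp) (rule AE_I2, auto simp: not_less)
  qed
  then have "AE \<omega> in M. \<forall>m. \<exists>k. m \<le> \<Lambda> i (real k) \<omega> - \<Lambda> i 0 \<omega>"
    unfolding AE_all_countable by blast
  with raw show ?thesis
  proof eventually_elim
    case (elim \<omega>)
    have "\<exists>t\<ge>0. m \<le> \<Lambda> i t \<omega>" for m
    proof -
      obtain k where "m \<le> \<Lambda> i (real k) \<omega> - \<Lambda> i 0 \<omega>" using elim by blast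
      then show ?thesis by (intro exI[of _ "real k"]) simp
    qed
    moreover have "\<exists>e>0. \<forall>u\<in>{t..t + e}. \<Lambda> i u \<omega> = \<Lambda> i t \<omega>" if "0 \<le> t" for t
      using elim that by (intro continuous_nat_right_constant) blast
    ultimately show ?case using elim unfolding regular_arrivals_def by blast
  qed
qed

text \<open>Independent copies of a positive variable exceed some fixed \<open>c > 0\<close>
  infinitely often, so their sum diverges.\<close>

lemma AE_regular_services: "AE \<omega> in M. regular_services (\<lambda>v. J i k v \<omega>)"
proof -
  have m [measurable]: "J q k v \<in> borel_measurable M" for q k v using service_integrable by blast
  let ?F = "\<lambda>c. measure (distr M borel (J i 0 0)) {..c}"
  have F: "?F c = prob {\<omega>\<in>space M. J i 0 0 \<omega> \<le> c}" for c
    by (subst measure_distr) (auto intro!: arg_cong[where f = prob])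
  have "\<exists>c>0. ?F c < 1"
  proof (rule ccontr)
    assume none: "\<not> ?thesis"
    have "AE \<omega> in M. J i 0 0 \<omega> \<le> 1 / real (Suc n)" for n
    proof -
      have "\<not> ?F (1 / real (Suc n)) < 1" using none by (metis of_nat_0_less_iff zero_less_Suc zero_less_divide_1_iff)
      then have "prob {\<omega>\<in>space M. J i 0 0 \<omega> \<le> 1 / real (Suc n)} = 1"
        unfolding F using prob_le_1 by (meson antisym not_less)
      then show ?thesis by (subst (asm) prob_Collect_eq_1) auto
    qed
    then have "AE \<omega> in M. \<forall>n. J i 0 0 \<omega> \<le> 1 / real (Suc n)" unfolding AE_all_countable by blast
    then have "AE \<omega> in M. False"
      using service_pos[of i 0 0]
    proof eventually_elim
      case (elim \<omega>)
      obtain n where "1 / real (Suc n) < J i 0 0 \<omega>" using nat_approx_posE elim(2) by blast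
      then show False using elim(1) by (meson not_less)
    qed
    then show False by simp
  qed
  then obtain c where c: "0 < c" "?F c < 1" by blast
  have "AE \<omega> in M. \<exists>v\<ge>a. c < J i k v \<omega>" for a
  proof -
    let ?A = "{\<omega>\<in>space M. \<forall>v\<in>{a..}. J i k v \<omega> \<le> c}"
    \<comment> \<open>By independence, a run of \<open>n\<close> service times at most
      \<open>c\<close> has probability \<open>?F c ^ n\<close>, whatever its starting index
      \<open>a\<close>.\<close>
    have "(\<lambda>n. ?F c ^ n) \<longlonglongrightarrow> 0" using c(2) by (intro LIMSEQ_realpow_zero) simp_all
    moreover have "prob ?A \<le> ?F c ^ n" for n
    proof -
      have "prob ?A \<le> prob {\<omega>\<in>space M. \<forall>v\<in>{a..<a + n}. J i k v \<omega> \<in> {..c}}"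
        by (intro finite_measure_mono) auto
      also have "\<dots> = ?F c ^ n"
        using prob_services[of "{a..<a + n}" "\<lambda>_. {..c}" i k] by simp
      finally show ?thesis .
    qed
    ultimately have "prob ?A \<le> 0" by (intro LIMSEQ_le_const) auto
    then have "prob ?A = 0" by (simp add: measure_le_0_iff)
    then have "AE \<omega> in M. \<omega> \<notin> ?A" by (subst (asm) prob_eq_0) auto
    then show ?thesis by (rule AE_mp) (rule AE_I2, auto simp: not_le)
  qed
  then have "AE \<omega> in M. \<forall>a. \<exists>v\<ge>a. c < J i k v \<omega>" unfolding AE_all_countable by blast
  moreover have "AE \<omega> in M. \<forall>v. 0 < J i k v \<omega>" unfolding AE_all_countable using service_pos by blast
  ultimately show ?thesis
  proof eventually_elim
    case (elim \<omega>)
    have "\<exists>v. real m * c \<le> (\<Sum>u<v. J i k u \<omega>)" for m :: nat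
    proof (induction m)
      case (Suc m)
      then obtain v where v: "real m * c \<le> (\<Sum>u<v. J i k u \<omega>)" by blast
      obtain v' where v': "v' \<ge> v" "c < J i k v' \<omega>" using elim(1) by blast
      have "(\<Sum>u<v. J i k u \<omega>) \<le> (\<Sum>u<v'. J i k u \<omega>)"
        using v'(1) elim(2) by (intro sum_mono2) (auto intro: less_imp_le)
      then have "real (Suc m) * c \<le> (\<Sum>u<Suc v'. J i k u \<omega>)"
        using v v'(2) by (simp add: distrib_right)
      then show ?case by blast
    qed (intro exI[of _ 0], simp)
    then have "\<exists>v. x < (\<Sum>u<v. J i k u \<omega>)" for x
      using reals_Archimedean3[OF c(1)] by (meson less_le_trans)
    then show ?case using elim(2) by (simp add: regular_services_def)
  qed
qed

lemma AE_regular: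
  "AE \<omega> in M. (\<forall>i. regular_arrivals (\<lambda>t. \<Lambda> i t \<omega>)) \<and> (\<forall>i k. regular_services (\<lambda>v. J i k v \<omega>)) \<and> (\<forall>i k. 0 < S i k \<omega>)"
proof -
  have "AE \<omega> in M. \<forall>i. regular_arrivals (\<lambda>t. \<Lambda> i t \<omega>)" unfolding AE_all_countable using AE_regular_arrivals by blast
  moreover have "AE \<omega> in M. \<forall>i k. regular_services (\<lambda>v. J i k v \<omega>)" unfolding AE_all_countable using AE_regular_services by blast
  moreover have "AE \<omega> in M. \<forall>i k. 0 < S i k \<omega>" unfolding AE_all_countable using switching_pos by blast
  ultimately show ?thesis by (intro AE_conjI)
qed

end

lemma (in prob_space) indep_sets_pullback:
  assumes f: "f \<in> measurable M M" "distr M M f = M" and E: "indep_sets E I"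
  shows "indep_sets (\<lambda>i. {f -` A \<inter> space M | A. A \<in> E i}) I"
proof (rule indep_setsI)
  have Eev: "A \<in> events" if "A \<in> E i" "i \<in> I" for A i using E that by (auto simp: indep_sets_def)
  have P: "prob (f -` A \<inter> space M) = prob A" if "A \<in> events" for A
    using measure_distr[OF f(1) that] by (simp add: f(2))
  show "{f -` A \<inter> space M | A. A \<in> E i} \<subseteq> events" if "i \<in> I" for i
    using Eev[OF _ that] measurable_sets[OF f(1)] by blast
  fix A K assume K: "K \<noteq> {}" "K \<subseteq> I" "finite K" "\<forall>j\<in>K. A j \<in> {f -` A \<inter> space M | A. A \<in> E j}"
  then have "\<forall>j\<in>K. \<exists>B. B \<in> E j \<and> A j = f -` B \<inter> space M" by blast
  then obtain B where B: "\<And>j. j \<in> K \<Longrightarrow> B j \<in> E j" "\<And>j. j \<in> K \<Longrightarrow> A j = f -` B j \<inter> space M" by metis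
  have Bev: "B j \<in> events" if "j \<in> K" for j using Eev[OF B(1)[OF that]] K(2) that by blast
  have "(\<Inter>j\<in>K. A j) = f -` (\<Inter>j\<in>K. B j) \<inter> space M" using B(2) K(1) by auto
  then have "prob (\<Inter>j\<in>K. A j) = prob (\<Inter>j\<in>K. B j)"
    using P[OF sets.finite_INT[OF K(3,1) Bev]] by simp
  also have "\<dots> = (\<Prod>j\<in>K. prob (B j))" using B(1) K by (intro indep_setsD[OF E]) auto
  also have "\<dots> = (\<Prod>j\<in>K. prob (A j))"
    using B(2) P[OF Bev] by (intro prod.cong) simp_all
  finally show "prob (\<Inter>j\<in>K. A j) = (\<Prod>j\<in>K. prob (A j))" .
qed

text \<open>Moving the sample point instead of modifying each process separately changes all
  primitives at once; their joint law survives because \<open>f\<close> preserves the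
  measure.\<close>

lemma (in polling_system) polling_system_pullback:
  assumes f: "f \<in> measurable M M" "distr M M f = M" and f_AE: "AE \<omega> in M. f \<omega> = \<omega>"
  shows "polling_system M lam \<mu> s (\<lambda>i t \<omega>. \<Lambda> i t (f \<omega>)) (\<lambda>i k v \<omega>. J i k v (f \<omega>)) (\<lambda>i k \<omega>. S i k (f \<omega>))"
proof -
  have distr_f: "distr M N (\<lambda>\<omega>. X (f \<omega>)) = distr M N X" if "X \<in> measurable M N" for X N
    using distr_distr[OF that f(1)] f(2) by (simp add: comp_def)
  have int: "integrable M (\<lambda>\<omega>. X (f \<omega>)) \<and> expectation (\<lambda>\<omega>. X (f \<omega>)) = expectation X"
    if X: "integrable M X" for X :: "'w \<Rightarrow> real"
  proof -
    have m: "X \<in> borel_measurable M" using X by blast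
    have "integrable (distr M M f) X" using X f(2) by simp
    then have "integrable M (\<lambda>\<omega>. X (f \<omega>))" using integrable_distr_eq[OF f(1) m] by simp
    moreover have "integral\<^sup>L (distr M M f) X = expectation (\<lambda>\<omega>. X (f \<omega>))" by (rule integral_distr[OF f(1) m])
    ultimately show ?thesis using f(2) by simp
  qed
  have fs: "f \<in> space M \<rightarrow> space M" using f(1) by (rule measurable_space[THEN funcsetI])
  have pre: "(\<lambda>\<omega>. X (f \<omega>)) -` B \<inter> space M = f -` (X -` B \<inter> space M) \<inter> space M" for X :: "'w \<Rightarrow> 'z" and B
    using fs by auto
  have pois: "poisson_process M (lam i) (\<lambda>t \<omega>. \<Lambda> i t (f \<omega>))" for i
    unfolding poisson_process_def
  proof (intro conjI allI impI)
    show "(\<lambda>\<omega>. \<Lambda> i t (f \<omega>)) \<in> measurable M (count_space UNIV)" if "0 \<le> t" for t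
      by (rule measurable_compose[OF f(1) poisson_process_measurable[OF arrivals that]])
    have "AE \<omega> in M. \<Lambda> i 0 \<omega> = 0 \<and> mono_on {0..} (\<lambda>t. \<Lambda> i t \<omega>) \<and>
        (\<forall>t\<ge>0. continuous (at_right t) (\<lambda>u. \<Lambda> i u \<omega>))"
      using arrivals[of i] by (simp add: poisson_process_def)
    then show "AE \<omega> in M. \<Lambda> i 0 (f \<omega>) = 0 \<and> mono_on {0..} (\<lambda>t. \<Lambda> i t (f \<omega>)) \<and>
        (\<forall>t\<ge>0. continuous (at_right t) (\<lambda>u. \<Lambda> i u (f \<omega>)))"
      using f_AE by eventually_elim simp
  next
    fix u t :: real assume ut: "0 \<le> u \<and> u < t"
    then have [measurable]: "\<Lambda> i t \<in> measurable M (count_space UNIV)" "\<Lambda> i u \<in> measurable M (count_space UNIV)"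
      using poisson_process_measurable[OF arrivals] by auto
    have "(\<lambda>\<omega>. \<Lambda> i t \<omega> - \<Lambda> i u \<omega>) \<in> measurable M (count_space UNIV)" by measurable
    from distr_f[OF this] show "distr M (count_space UNIV) (\<lambda>\<omega>. \<Lambda> i t (f \<omega>) - \<Lambda> i u (f \<omega>)) =
        measure_pmf (poisson_pmf (lam i * (t - u)))"
      using poisson_process_increment[OF arrivals, of u t i] ut by simp
  next
    fix \<tau> :: "nat \<Rightarrow> real" and m assume \<tau>: "0 \<le> \<tau> 0 \<and> mono \<tau>"
    let ?X = "\<lambda>l \<omega>. \<Lambda> i (\<tau> (Suc l)) \<omega> - \<Lambda> i (\<tau> l) \<omega>"
    have "indep_vars (\<lambda>_. count_space UNIV) ?X {..<m}"
      using poisson_process_indep[OF arrivals] \<tau> by blast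
    then have rv: "\<And>l. l \<in> {..<m} \<Longrightarrow> random_variable (count_space UNIV) (?X l)"
      and ind: "indep_sets (\<lambda>l. {?X l -` A \<inter> space M | A. A \<in> sets (count_space UNIV)}) {..<m}"
      unfolding indep_vars_def2 by auto
    have "{(\<lambda>\<omega>. ?X l (f \<omega>)) -` A \<inter> space M | A. A \<in> sets (count_space UNIV)} =
        {f -` A \<inter> space M | A. A \<in> {?X l -` A \<inter> space M | A. A \<in> sets (count_space UNIV)}}" for l
      unfolding pre[of "?X l"] by blast
    then have "indep_sets (\<lambda>l. {(\<lambda>\<omega>. ?X l (f \<omega>)) -` A \<inter> space M | A. A \<in> sets (count_space UNIV)}) {..<m}"
      using indep_sets_pullback[OF f ind] by (simp only:)
    moreover have "random_variable (count_space UNIV) (\<lambda>\<omega>. ?X l (f \<omega>))" if "l \<in> {..<m}" for l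
      by (rule measurable_compose[OF f(1) rv[OF that]])
    ultimately show "indep_vars (\<lambda>_. count_space UNIV) (\<lambda>l \<omega>. \<Lambda> i (\<tau> (Suc l)) (f \<omega>) - \<Lambda> i (\<tau> l) (f \<omega>)) {..<m}"
      unfolding indep_vars_def2 by blast
  qed
  \<comment> \<open>The events of each primitive become preimages under \<open>f\<close>; for
    arrivals because preimages commute with generating a sigma-algebra.\<close>
  have prim: "primitive_events M (\<lambda>i t \<omega>. \<Lambda> i t (f \<omega>)) (\<lambda>i k v \<omega>. J i k v (f \<omega>)) (\<lambda>i k \<omega>. S i k (f \<omega>)) x =
      {f -` A \<inter> space M | A. A \<in> primitive_events M \<Lambda> J S x}" for x
  proof (cases x)
    case (Arrivals i)
    have "{f -` A \<inter> space M | A. A \<in> sigma_sets (space M) {\<Lambda> i t -` B \<inter> space M | t B. 0 \<le> t}} =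
        sigma_sets (space M) {f -` A \<inter> space M | A. A \<in> {\<Lambda> i t -` B \<inter> space M | t B. 0 \<le> t}}"
      by (rule sigma_sets_vimage_commute[OF fs])
    also have "{f -` A \<inter> space M | A. A \<in> {\<Lambda> i t -` B \<inter> space M | t B. 0 \<le> t}} =
        {(\<lambda>\<omega>. \<Lambda> i t (f \<omega>)) -` B \<inter> space M | t B. 0 \<le> t}"
      unfolding pre by blast
    finally show ?thesis unfolding Arrivals primitive_events.simps by (rule sym)
  next
    case (Service i k v)
    show ?thesis unfolding Service primitive_events.simps pre by blast
  next
    case (Switching i k)
    show ?thesis unfolding Switching primitive_events.simps pre by blast
  qed
  have Jm: "J i k v \<in> borel_measurable M" for i k v using service_integrable by blast
  have Sm: "S i k \<in> borel_measurable M" for i k using switching_integrable by blast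
  show ?thesis
  proof (unfold_locales)
    show "AE \<omega> in M. 0 < J i k v (f \<omega>)" for i k v
      using service_pos[of i k v] f_AE by eventually_elim simp
    show "AE \<omega> in M. 0 < S i k (f \<omega>)" for i k
      using switching_pos[of i k] f_AE by eventually_elim simp
    show "distr M borel (\<lambda>\<omega>. J i k v (f \<omega>)) = distr M borel (\<lambda>\<omega>. J i 0 0 (f \<omega>))" for i k v
      unfolding distr_f[OF Jm] by (rule service_ident)
    show "distr M borel (\<lambda>\<omega>. S i k (f \<omega>)) = distr M borel (\<lambda>\<omega>. S i 0 (f \<omega>))" for i k
      unfolding distr_f[OF Sm] by (rule switching_ident)
    show "indep_sets (primitive_events M (\<lambda>i t \<omega>. \<Lambda> i t (f \<omega>)) (\<lambda>i k v \<omega>. J i k v (f \<omega>)) (\<lambda>i k \<omega>. S i k (f \<omega>))) UNIV"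
      unfolding prim by (rule indep_sets_pullback[OF f primitives_indep])
  qed (use int service_integrable switching_integrable service_mean switching_mean lam_pos mu_pos pois in auto)
qed

text \<open>A null set covers the irregular outcomes, and \<open>f\<close> sends it to one fixed
  regular outcome, which exists because the null set is not the whole space.\<close>

lemma (in polling_system) ex_regular_version:
  "\<exists>f. (AE \<omega> in M. f \<omega> = \<omega>) \<and>
     regular_polling M lam \<mu> s (\<lambda>i t \<omega>. \<Lambda> i t (f \<omega>)) (\<lambda>i k v \<omega>. J i k v (f \<omega>)) (\<lambda>i k \<omega>. S i k (f \<omega>))"
proof -
  let ?good = "\<lambda>\<omega>. (\<forall>i. regular_arrivals (\<lambda>t. \<Lambda> i t \<omega>)) \<and> (\<forall>i k. regular_services (\<lambda>v. J i k v \<omega>)) \<and> (\<forall>i k. 0 < S i k \<omega>)"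
  obtain N where N: "{\<omega>\<in>space M. \<not> ?good \<omega>} \<subseteq> N" "emeasure M N = 0" "N \<in> events"
    using AE_E[OF AE_regular] by blast
  have "emeasure M N \<noteq> emeasure M (space M)" using N(2) by (simp add: emeasure_space_1)
  then obtain \<omega>0 where \<omega>0: "\<omega>0 \<in> space M" "\<omega>0 \<notin> N" using sets.sets_into_space[OF N(3)] by (metis subsetI subset_antisym)
  define f where "f \<omega> = (if \<omega> \<in> N then \<omega>0 else \<omega>)" for \<omega>
  have f_meas: "f \<in> measurable M M"
    unfolding f_def using N(3) \<omega>0(1) by measurable
  have f_AE: "AE \<omega> in M. f \<omega> = \<omega>"
    using AE_not_in[OF null_setsI[OF N(2,3)]] by eventually_elim (simp add: f_def)
  have "distr M M f = distr M M (\<lambda>\<omega>. \<omega>)" by (rule distr_cong_AE) (use f_AE f_meas in auto)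
  then have f_distr: "distr M M f = M" by simp
  interpret P: polling_system M lam \<mu> s "\<lambda>i t \<omega>. \<Lambda> i t (f \<omega>)" "\<lambda>i k v \<omega>. J i k v (f \<omega>)" "\<lambda>i k \<omega>. S i k (f \<omega>)"
    by (rule polling_system_pullback[OF f_meas f_distr f_AE])
  have good: "?good (f \<omega>)" if "\<omega> \<in> space M" for \<omega>
    using that N(1) \<omega>0 by (cases "\<omega> \<in> N") (auto simp: f_def)
  have "regular_polling M lam \<mu> s (\<lambda>i t \<omega>. \<Lambda> i t (f \<omega>)) (\<lambda>i k v \<omega>. J i k v (f \<omega>)) (\<lambda>i k \<omega>. S i k (f \<omega>))"
    by unfold_locales (use good in blast)+
  then show ?thesis using f_AE by blast
qed

subsection \<open>Positive recurrence of the Palm chain\<close>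

text \<open>Only the almost sure agreement of entire trajectories enters, so \<open>Y\<close> itself
  may fail to be measurable, as the Palm chain may on irregular paths.\<close>

lemma positive_recurrent_image:
  assumes inj: "inj \<phi>" and Y: "\<And>z. AE \<omega> in M. \<forall>k. Y (\<phi> z) k \<omega> = \<phi> (X z k \<omega>)"
    and X: "positive_recurrent M UNIV X"
  shows "positive_recurrent M (range \<phi>) Y"
proof -
  obtain R where R: "R \<noteq> {}" "\<And>x k. x \<in> R \<Longrightarrow> AE \<omega> in M. X x k \<omega> \<in> R"
      "\<And>x y. x \<in> R \<Longrightarrow> y \<in> R \<Longrightarrow> \<exists>k. \<not> (AE \<omega> in M. X x k \<omega> \<noteq> y)"
      "\<And>x. x \<in> R \<Longrightarrow> (\<integral>\<^sup>+ \<omega>. return_time X x \<omega> \<partial>M) < \<infinity>"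
      "\<And>x. AE \<omega> in M. \<exists>k. X x k \<omega> \<in> R"
    using X unfolding positive_recurrent_def by (elim exE conjE) simp
  show ?thesis
    unfolding positive_recurrent_def
  proof (intro exI[of _ "\<phi> ` R"] conjI ballI allI)
    fix x k assume "x \<in> \<phi> ` R"
    then obtain z where z: "x = \<phi> z" "z \<in> R" by blast
    show "AE \<omega> in M. Y x k \<omega> \<in> \<phi> ` R"
      using R(2)[OF z(2), of k] Y[of z] unfolding z(1) by eventually_elim simp
  next
    fix x y assume "x \<in> \<phi> ` R" "y \<in> \<phi> ` R"
    then obtain z u where z: "x = \<phi> z" "z \<in> R" and u: "y = \<phi> u" "u \<in> R" by blast
    obtain k where k: "\<not> (AE \<omega> in M. X z k \<omega> \<noteq> u)" using R(3)[OF z(2) u(2)] by blast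
    have "\<not> (AE \<omega> in M. Y x k \<omega> \<noteq> y)"
    proof
      assume "AE \<omega> in M. Y x k \<omega> \<noteq> y"
      then have "AE \<omega> in M. X z k \<omega> \<noteq> u"
        using Y[of z] unfolding z(1) u(1) by eventually_elim metis
      with k show False by (rule notE)
    qed
    then show "\<exists>k. \<not> (AE \<omega> in M. Y x k \<omega> \<noteq> y)" ..
  next
    fix x assume "x \<in> \<phi> ` R"
    then obtain z where z: "x = \<phi> z" "z \<in> R" by blast
    have "AE \<omega> in M. return_time Y x \<omega> = return_time X z \<omega>"
      using Y[of z]
    proof eventually_elim
      case (elim \<omega>)
      then have "Y x k \<omega> = x \<longleftrightarrow> X z k \<omega> = z" for k using inj by (simp add: z(1) inj_eq)
      then show ?case unfolding return_time_def by simp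
    qed
    then have "(\<integral>\<^sup>+ \<omega>. return_time Y x \<omega> \<partial>M) = (\<integral>\<^sup>+ \<omega>. return_time X z \<omega> \<partial>M)"
      by (rule nn_integral_cong_AE)
    then show "(\<integral>\<^sup>+ \<omega>. return_time Y x \<omega> \<partial>M) < \<infinity>" using R(4)[OF z(2)] by simp
  next
    fix x assume "x \<in> range \<phi>"
    then obtain z where z: "x = \<phi> z" by blast
    show "AE \<omega> in M. \<exists>k. Y x k \<omega> \<in> \<phi> ` R"
      using R(5)[of z] Y[of z] unfolding z
    proof eventually_elim
      case (elim \<omega>)
      then obtain k where "X z k \<omega> \<in> R" by blast
      then have "Y (\<phi> z) k \<omega> \<in> \<phi> ` R" using elim(2) by simp
      then show ?case ..
    qed
  qed (use R(1) in \<open>simp_all add: image_mono\<close>)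
qed

lemma inj_normalized: "\<mu> > 0 \<Longrightarrow> inj (normalized \<mu>)"
proof (rule injI)
  fix n m :: content assume "\<mu> > 0" "normalized \<mu> n = normalized \<mu> m"
  then have "n Q1 = m Q1" "n Q2 = m Q2" by (simp_all add: normalized_def)
  then have "n q = m q" for q by (cases q) simp_all
  then show "n = m" by (rule ext)
qed

lemma range_normalized: "range (normalized \<mu>) = state_space \<mu>"
proof (intro equalityI subsetI)
  fix x assume "x \<in> state_space \<mu>"
  then obtain z1 z2 :: nat where "x = (real z1 / \<mu>, real z2 / \<mu>)" by (auto simp: state_space_def)
  then have "x = normalized \<mu> (case_queue z1 z2)" by (simp add: normalized_def)
  then show "x \<in> range (normalized \<mu>)" by simp
qed (auto simp: normalized_def state_space_def)

theorem theorem1: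
  fixes M :: "'w measure"
    and lam s :: "queue \<Rightarrow> real"
    and \<mu> :: real
    and p :: policy
    and \<Lambda> :: "queue \<Rightarrow> real \<Rightarrow> 'w \<Rightarrow> nat"
    and J :: "queue \<Rightarrow> nat \<Rightarrow> nat \<Rightarrow> 'w \<Rightarrow> real"
    and S :: "queue \<Rightarrow> nat \<Rightarrow> 'w \<Rightarrow> real"
  assumes "polling_system M lam \<mu> s \<Lambda> J S"
    and "p \<in> two_phase_policies"
    and "\<forall>x\<in>state_space \<mu>. \<forall>i. \<exists>K. \<forall>k. integrable M (residual \<mu> p \<Lambda> J S x i k) \<and>
           \<bar>\<integral>\<omega>. residual \<mu> p \<Lambda> J S x i k \<omega> \<partial>M\<bar> \<le> K"
    and "lam Q1 / \<mu> + lam Q2 / \<mu> < 1"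
    and "alpha p Q1 Concluding * alpha p Q2 Concluding < 1"
  shows "positive_recurrent M (state_space \<mu>) (palm_chain \<mu> p \<Lambda> J S)"
proof -
  interpret polling_system M lam \<mu> s \<Lambda> J S by fact
  obtain f where f: "AE \<omega> in M. f \<omega> = \<omega>"
    and reg: "regular_polling M lam \<mu> s (\<lambda>i t \<omega>. \<Lambda> i t (f \<omega>)) (\<lambda>i k v \<omega>. J i k v (f \<omega>)) (\<lambda>i k \<omega>. S i k (f \<omega>))"
    using ex_regular_version by (elim exE conjE)
  interpret R: stable_polling M lam \<mu> s "\<lambda>i t \<omega>. \<Lambda> i t (f \<omega>)" "\<lambda>i k v \<omega>. J i k v (f \<omega>)" "\<lambda>i k \<omega>. S i k (f \<omega>)" p
    by (intro stable_polling.intro polling_policy.intro stable_polling_axioms.intro reg assms(2,4))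
  note inv_normalized = inv_f_f[OF inj_normalized[OF mu_pos]]
  \<comment> \<open>Almost surely \<open>f\<close> fixes the sample point and all steps end; there
    the chain of the regular version is the chain of the model.\<close>
  have cycle: "AE \<omega> in M. \<forall>k. palm_chain \<mu> p \<Lambda> J S (normalized \<mu> z) k \<omega> = normalized \<mu> (R.cust z (4 * k) \<omega>)" for z
    using R.AE_all_steps[of z] f AE_space
  proof eventually_elim
    case (elim \<omega>)
    have "cycle_start \<mu> p (\<lambda>i t. \<Lambda> i t \<omega>) (\<lambda>i k v. J i k v \<omega>) (\<lambda>i k. S i k \<omega>) z k = R.state z (4 * k) \<omega>" for k
      using R.cycle_state(1)[OF elim(3), of z k] elim(1,2) by simp
    then show ?case by (simp add: palm_chain_def inv_normalized R.cust_def)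
  qed
  have dep: "AE \<omega> in M. residual \<mu> p \<Lambda> J S (normalized \<mu> z) i k \<omega> =
      Pi_C \<mu> p i (R.cust z (4 * k + (if i = Q1 then 1 else 3)) \<omega>)" for z i k
    using R.AE_all_steps[of z] f AE_space
  proof eventually_elim
    case (elim \<omega>)
    have "departure_state \<mu> p (\<lambda>i t. \<Lambda> i t \<omega>) (\<lambda>i k v. J i k v \<omega>) (\<lambda>i k. S i k \<omega>) z k i =
        R.state z (4 * k + (if i = Q1 then 1 else 3)) \<omega>"
    proof (cases i)
      case Q1
      then show ?thesis using R.cycle_state(2)[OF elim(3), of z k] elim(1,2) by simp
    next
      case Q2
      then show ?thesis using R.cycle_state(3)[OF elim(3), of z k] elim(1,2) by simp
    qed
    then show ?case by (simp only: residual_def inv_normalized R.cust_def)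
  qed
  have "positive_recurrent M UNIV (\<lambda>z k. R.cust z (4 * k))"
  proof (rule R.regular_positive_recurrent[OF assms(5)])
    fix z i
    have "normalized \<mu> z \<in> state_space \<mu>" by (simp flip: range_normalized)
    from assms(3)[rule_format, OF this, of i]
    obtain K where "\<forall>k. integrable M (residual \<mu> p \<Lambda> J S (normalized \<mu> z) i k) \<and>
        \<bar>expectation (residual \<mu> p \<Lambda> J S (normalized \<mu> z) i k)\<bar> \<le> K" ..
    then have K: "integrable M (residual \<mu> p \<Lambda> J S (normalized \<mu> z) i k)"
        "\<bar>expectation (residual \<mu> p \<Lambda> J S (normalized \<mu> z) i k)\<bar> \<le> K" for k by simp_all
    \<comment> \<open>The hypothesis on mean residuals passes to the regular version. Measurability
      of the original residuals comes from their assumed integrability.\<close>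
    have eq: "expectation (residual \<mu> p \<Lambda> J S (normalized \<mu> z) i k) =
        expectation (\<lambda>\<omega>. Pi_C \<mu> p i (R.cust z (4 * k + (if i = Q1 then 1 else 3)) \<omega>))" for k
    proof (rule integral_cong_AE)
      show "residual \<mu> p \<Lambda> J S (normalized \<mu> z) i k \<in> borel_measurable M" using K(1) by (rule borel_measurable_integrable)
      show "(\<lambda>\<omega>. Pi_C \<mu> p i (R.cust z (4 * k + (if i = Q1 then 1 else 3)) \<omega>)) \<in> borel_measurable M"
        by (rule measurable_compose[OF conjunct2[OF R.state_measurable]]) simp
    qed (rule dep)
    show "\<exists>K. \<forall>k. \<bar>expectation (\<lambda>\<omega>. Pi_C \<mu> p i (R.cust z (4 * k + (if i = Q1 then 1 else 3)) \<omega>))\<bar> \<le> K"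
    proof (intro exI[of _ K] allI)
      show "\<bar>expectation (\<lambda>\<omega>. Pi_C \<mu> p i (R.cust z (4 * k + (if i = Q1 then 1 else 3)) \<omega>))\<bar> \<le> K" for k
        using K(2)[of k] unfolding eq .
    qed
  qed
  from positive_recurrent_image[OF inj_normalized[OF mu_pos] cycle this] show ?thesis
    unfolding range_normalized .
qed

end
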